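(* Let $\mathcal X,\mathcal Y,\mathcal S_1,\mathcal S_2$ be finite alphabets, let $p(y|x,s_1,s_2)$ be a memoryless channel with states $(S_{1,i},S_{2,i})$ i.i.d. $\sim p(s_1,s_2)$, where $S_1$ is the encoder's side information (ESI) and $S_2$ is the decoder's side information (DSI), and let $R'\ge 0$. Let $C_1(R')$, $C_2(R')$, $C_{2C}(R')$ be the operational capacities of Cases 1, 2 and 2$_C$ (defined in the context). Then the following hold. (Case 1: encoder has the ESI; decoder has the DSI and a rate-$R'$ description of the ESI.) $$C_1(R')=\max\; I(U;Y,S_2|V_1)-I(U;S_1|V_1),$$ where the maximum is over all $p(v_1|s_1)\,p(u|s_1,v_1)\,p(x|u,s_1,v_1)$ such that $R'\ge I(V_1;S_1)-I(V_1;Y,S_2)$. (Case 2: encoder has the ESI and a rate-$R'$ description of the DSI; decoder has the DSI.) $$C_2^{lb}(R')\le C_2(R')\le C_2^{ub1}(R')\quad\text{and}\quad C_2(R')\le C_2^{ub2}(R'),$$ where each of $C_2^{lb}(R'),C_2^{ub1}(R'),C_2^{ub2}(R')$ is the maximum of $$I(U;Y,S_2|V_2)-I(U;S_1|V_2)$$ subject to $R'\ge I(V_2;S_2|S_1)$, the maximum being taken - for $C_2^{lb}$ over all $p(v_2|s_2)\,p(u|s_1,v_2)\,p(x|u,s_1,v_2)$; - for $C_2^{ub1}$ over all $p(v_2|s_1,s_2)\,p(u|s_1,v_2)\,p(x|u,s_1,v_2)$; - for $C_2^{ub2}$ over all $p(v_2|s_2)\,p(u|s_1,s_2,v_2)\,p(x|u,s_1,v_2)$.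 (Case 2$_C$: as Case 2, but the ESI is known to the encoder causally.) $$C_{2C}(R')=\max\; I(U;Y,S_2|V_2),$$ where the maximum is over all $p(v_2|s_2)\,p(u|v_2)\,p(x|u,s_1,v_2)$ such that $R'\ge I(V_2;S_2)$. In every case $U$ and $V_j$ ($j\in\{1,2\}$) are auxiliary random variables with finite alphabets of bounded cardinality, and the joint law of $(S_1,S_2,V_j,U,X,Y)$ is the product of $p(s_1,s_2)$, the listed conditional distributions, and $p(y|x,s_1,s_2)$.
   Context: Notation: $x^n=(x_1,\dots,x_n)$; $I(\cdot;\cdot)$ is mutual information (logarithms to base 2). Channel: the state pairs $(S_{1,i},S_{2,i})$, $i=1,2,\dots$, are i.i.d. $\sim p(s_1,s_2)$ on $\mathcal S_1\times\mathcal S_2$, and the channel is memoryless: $p(y_i|x^i,s_1^i,s_2^i,y^{i-1})=p(y_i|x_i,s_{1,i},s_{2,i})$. The message $W$ is uniform on $\{1,\dots,2^{nR}\}$ and independent of the states. Codes. An $(n,2^{nR},2^{nR'})$ code consists of a side-information encoder $f_v$, a channel encoder $f$ and a decoder $g$: - Case 1: $f_v:\mathcal S_1^n\to\{1,\dots,2^{nR'}\}$; $f:\{1,\dots,2^{nR}\}\times\mathcal S_1^n\times\{1,\dots,2^{nR'}\}\to\mathcal X^n$; $g:\mathcal Y^n\times\mathcal S_2^n\times\{1,\dots,2^{nR'}\}\to\{1,\dots,2^{nR}\}$. - Case 2: $f_v:\mathcal S_2^n\to\{1,\dots,2^{nR'}\}$; $f:\{1,\dots,2^{nR}\}\times\mathcal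 S_1^n\times\{1,\dots,2^{nR'}\}\to\mathcal X^n$; $g:\mathcal Y^n\times\mathcal S_2^n\times\{1,\dots,2^{nR'}\}\to\{1,\dots,2^{nR}\}$. - Case 2$_C$: $f_v$ and $g$ as in Case 2, and the channel encoder is a family $f_i:\{1,\dots,2^{nR}\}\times\mathcal S_1^i\times\{1,\dots,2^{nR'}\}\to\mathcal X$, $i=1,\dots,n$ (at time $i$ only $S_1^i$ is used). In each case the output of $f_v$ (applied to $S_1^n$ in Case 1, to $S_2^n$ in Cases 2 and 2$_C$) is supplied to both $f$ and $g$; $X^n$ is the output of $f$ and $\hat W$ is the output of $g$. The average probability of error is $P_e^{(n)}=2^{-nR}\sum_{w=1}^{2^{nR}}\Pr\{\hat W\ne W\,|\,W=w\}$. A pair $(R,R')$ is achievable if there is a sequence of $(n,2^{nR},2^{nR'})$ codes with $P_e^{(n)}\to0$ as $n\to\infty$. The capacity $C(R')$ of a case is the supremum of all $R$ such that $(R,R')$ is achievable. *)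

theory Defs
  imports "HOL-Probability.Probability"
begin

section \<open>Codes and operational capacities\<close>

text \<open>
  The state law is \<open>p :: ('s1 \<times> 's2) pmf\<close> and the channel law is \<open>ch x s1 s2 :: 'y pmf\<close>. A block
  of length \<open>n\<close> is a function on \<^typ>\<open>nat\<close> of which only the positions \<open>0, \<dots>, n - 1\<close> are relevant:
  the random blocks below are constant (the default of \<^const>\<open>Pi_pmf\<close>) at all other positions.
\<close>

text \<open>The set \<open>{1, \<dots>, 2\<^sup>n\<^sup>R}\<close>, read as the integers \<open>m\<close> with \<open>1 \<le> m \<le> 2\<^sup>n\<^sup>R\<close> when \<open>2\<^sup>n\<^sup>R\<close> is no integer.\<close>

definition index_set :: "nat \<Rightarrow> real \<Rightarrow> nat set" where
  "index_set n R = {m. 1 \<le> m \<and> real m \<le> 2 powr (real n * R)}"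

text \<open>
  The joint law of the message, the states and the channel output. The side information encoder
  is given here as a function \<open>d\<close> of both state sequences; in each of the cases below it is
  applied to only one of them.
\<close>

definition block_law ::
  "nat \<Rightarrow> nat set \<Rightarrow> ('s1 \<times> 's2) pmf \<Rightarrow> ('x \<Rightarrow> 's1 \<Rightarrow> 's2 \<Rightarrow> 'y pmf) \<Rightarrow>
   ((nat \<Rightarrow> 's1) \<Rightarrow> (nat \<Rightarrow> 's2) \<Rightarrow> nat) \<Rightarrow> (nat \<Rightarrow> (nat \<Rightarrow> 's1) \<Rightarrow> nat \<Rightarrow> (nat \<Rightarrow> 'x)) \<Rightarrow>
   (nat \<times> (nat \<Rightarrow> 's1) \<times> (nat \<Rightarrow> 's2) \<times> (nat \<Rightarrow> 'y)) pmf" where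
  "block_law n M p ch d f = do {
     w \<leftarrow> pmf_of_set M;
     s \<leftarrow> Pi_pmf {..<n} undefined (\<lambda>_. p);
     let s1 = (\<lambda>i. fst (s i));
     let s2 = (\<lambda>i. snd (s i));
     let x = f w s1 (d s1 s2);
     y \<leftarrow> Pi_pmf {..<n} undefined (\<lambda>i. ch (x i) (s1 i) (s2 i));
     return_pmf (w, s1, s2, y)
   }"

definition error_prob ::
  "nat \<Rightarrow> nat set \<Rightarrow> ('s1 \<times> 's2) pmf \<Rightarrow> ('x \<Rightarrow> 's1 \<Rightarrow> 's2 \<Rightarrow> 'y pmf) \<Rightarrow>
   ((nat \<Rightarrow> 's1) \<Rightarrow> (nat \<Rightarrow> 's2) \<Rightarrow> nat) \<Rightarrow> (nat \<Rightarrow> (nat \<Rightarrow> 's1) \<Rightarrow> nat \<Rightarrow> (nat \<Rightarrow> 'x)) \<Rightarrow>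
   ((nat \<Rightarrow> 'y) \<Rightarrow> (nat \<Rightarrow> 's2) \<Rightarrow> nat \<Rightarrow> nat) \<Rightarrow> real" where
  "error_prob n M p ch d f g =
     (\<Sum>w\<in>M. \<P>(\<omega> in measure_pmf (block_law n M p ch d f).
        (case \<omega> of (w', s1, s2, y) \<Rightarrow> g y s2 (d s1 s2) \<noteq> w') \<bar> fst \<omega> = w)) / real (card M)"

definition achievable1 ::
  "('s1 \<times> 's2) pmf \<Rightarrow> ('x \<Rightarrow> 's1 \<Rightarrow> 's2 \<Rightarrow> 'y pmf) \<Rightarrow> real \<Rightarrow> real \<Rightarrow> bool" where
  "achievable1 p ch R R' \<longleftrightarrow> 0 \<le> R \<and>
     (\<exists>(fv :: nat \<Rightarrow> (nat \<Rightarrow> 's1) \<Rightarrow> nat)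
       (f :: nat \<Rightarrow> nat \<Rightarrow> (nat \<Rightarrow> 's1) \<Rightarrow> nat \<Rightarrow> (nat \<Rightarrow> 'x))
       (g :: nat \<Rightarrow> (nat \<Rightarrow> 'y) \<Rightarrow> (nat \<Rightarrow> 's2) \<Rightarrow> nat \<Rightarrow> nat).
        (\<forall>n s. fv n s \<in> index_set n R') \<and>
        (\<forall>n y s t. g n y s t \<in> index_set n R) \<and>
        (\<lambda>n. error_prob n (index_set n R) p ch (\<lambda>s1 s2. fv n s1) (f n) (g n)) \<longlonglongrightarrow> 0)"

definition achievable2 ::
  "('s1 \<times> 's2) pmf \<Rightarrow> ('x \<Rightarrow> 's1 \<Rightarrow> 's2 \<Rightarrow> 'y pmf) \<Rightarrow> real \<Rightarrow> real \<Rightarrow> bool" where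
  "achievable2 p ch R R' \<longleftrightarrow> 0 \<le> R \<and>
     (\<exists>(fv :: nat \<Rightarrow> (nat \<Rightarrow> 's2) \<Rightarrow> nat)
       (f :: nat \<Rightarrow> nat \<Rightarrow> (nat \<Rightarrow> 's1) \<Rightarrow> nat \<Rightarrow> (nat \<Rightarrow> 'x))
       (g :: nat \<Rightarrow> (nat \<Rightarrow> 'y) \<Rightarrow> (nat \<Rightarrow> 's2) \<Rightarrow> nat \<Rightarrow> nat).
        (\<forall>n s. fv n s \<in> index_set n R') \<and>
        (\<forall>n y s t. g n y s t \<in> index_set n R) \<and>
        (\<lambda>n. error_prob n (index_set n R) p ch (\<lambda>s1 s2. fv n s2) (f n) (g n)) \<longlonglongrightarrow> 0)"

text \<open>
  With positions starting at \<open>0\<close>, causality means that the input at position \<open>i\<close> depends on the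
  first kind of state at positions \<open>0, \<dots>, i\<close>, the present one included; \<^const>\<open>restrict\<close> hides
  all later positions.
\<close>

definition achievable2C ::
  "('s1 \<times> 's2) pmf \<Rightarrow> ('x \<Rightarrow> 's1 \<Rightarrow> 's2 \<Rightarrow> 'y pmf) \<Rightarrow> real \<Rightarrow> real \<Rightarrow> bool" where
  "achievable2C p ch R R' \<longleftrightarrow> 0 \<le> R \<and>
     (\<exists>(fv :: nat \<Rightarrow> (nat \<Rightarrow> 's2) \<Rightarrow> nat)
       (f :: nat \<Rightarrow> nat \<Rightarrow> nat \<Rightarrow> (nat \<Rightarrow> 's1) \<Rightarrow> nat \<Rightarrow> 'x)
       (g :: nat \<Rightarrow> (nat \<Rightarrow> 'y) \<Rightarrow> (nat \<Rightarrow> 's2) \<Rightarrow> nat \<Rightarrow> nat).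
        (\<forall>n s. fv n s \<in> index_set n R') \<and>
        (\<forall>n y s t. g n y s t \<in> index_set n R) \<and>
        (\<lambda>n. error_prob n (index_set n R) p ch (\<lambda>s1 s2. fv n s2)
               (\<lambda>w s1 t i. f n i w (restrict s1 {..i}) t) (g n)) \<longlonglongrightarrow> 0)"

text \<open>
  For finite alphabets and nonnegative \<open>R'\<close> the sets below contain \<open>0\<close> and are bounded, so that the
  real-valued \<^const>\<open>Sup\<close> is a genuine supremum.
\<close>

definition capacity1 :: "('s1 \<times> 's2) pmf \<Rightarrow> ('x \<Rightarrow> 's1 \<Rightarrow> 's2 \<Rightarrow> 'y pmf) \<Rightarrow> real \<Rightarrow> real" where
  "capacity1 p ch R' = Sup {R. achievable1 p ch R R'}"

definition capacity2 :: "('s1 \<times> 's2) pmf \<Rightarrow> ('x \<Rightarrow> 's1 \<Rightarrow> 's2 \<Rightarrow> 'y pmf) \<Rightarrow> real \<Rightarrow> real" where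
  "capacity2 p ch R' = Sup {R. achievable2 p ch R R'}"

definition capacity2C :: "('s1 \<times> 's2) pmf \<Rightarrow> ('x \<Rightarrow> 's1 \<Rightarrow> 's2 \<Rightarrow> 'y pmf) \<Rightarrow> real \<Rightarrow> real" where
  "capacity2C p ch R' = Sup {R. achievable2C p ch R R'}"


section \<open>Single-letter expressions\<close>

text \<open>
  Mutual information in bits of random variables on a discrete probability space. The codomains
  carry the full counting measure, so that every function is measurable.
\<close>

definition mi :: "'a pmf \<Rightarrow> ('a \<Rightarrow> 'b) \<Rightarrow> ('a \<Rightarrow> 'c) \<Rightarrow> real" where
  "mi P A B =
     prob_space.mutual_information (measure_pmf P) 2 (count_space UNIV) (count_space UNIV) A B"

text \<open>\<open>cmi P A B C\<close> is \<open>I(A; B | C)\<close>.\<close>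

definition cmi :: "'a pmf \<Rightarrow> ('a \<Rightarrow> 'b) \<Rightarrow> ('a \<Rightarrow> 'c) \<Rightarrow> ('a \<Rightarrow> 'd) \<Rightarrow> real" where
  "cmi P A B C =
     prob_space.conditional_mutual_information (measure_pmf P) 2
       (count_space UNIV) (count_space UNIV) (count_space UNIV) A B C"

text \<open>
  Auxiliary variables take values in \<open>{..<k}\<close> (enforced in the sets of laws below). The conditional laws are \<open>qv s1 s2\<close> for \<open>V\<close>,
  \<open>qu s1 s2 v\<close> for \<open>U\<close> and \<open>qx u s1 v\<close> for \<open>X\<close>.
\<close>

type_synonym ('s1, 's2, 'x, 'y) outcome = "'s1 \<times> 's2 \<times> nat \<times> nat \<times> 'x \<times> 'y"

definition joint_law ::
  "('s1 \<times> 's2) pmf \<Rightarrow> ('x \<Rightarrow> 's1 \<Rightarrow> 's2 \<Rightarrow> 'y pmf) \<Rightarrow> ('s1 \<Rightarrow> 's2 \<Rightarrow> nat pmf) \<Rightarrow>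
   ('s1 \<Rightarrow> 's2 \<Rightarrow> nat \<Rightarrow> nat pmf) \<Rightarrow> (nat \<Rightarrow> 's1 \<Rightarrow> nat \<Rightarrow> 'x pmf) \<Rightarrow>
   ('s1, 's2, 'x, 'y) outcome pmf" where
  "joint_law p ch qv qu qx = do {
     (s1, s2) \<leftarrow> p;
     v \<leftarrow> qv s1 s2;
     u \<leftarrow> qu s1 s2 v;
     x \<leftarrow> qx u s1 v;
     y \<leftarrow> ch x s1 s2;
     return_pmf (s1, s2, v, u, x, y)
   }"

definition rv_S1 :: "('s1, 's2, 'x, 'y) outcome \<Rightarrow> 's1" where
  "rv_S1 = (\<lambda>(s1, s2, v, u, x, y). s1)"

definition rv_S2 :: "('s1, 's2, 'x, 'y) outcome \<Rightarrow> 's2" where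
  "rv_S2 = (\<lambda>(s1, s2, v, u, x, y). s2)"

definition rv_V :: "('s1, 's2, 'x, 'y) outcome \<Rightarrow> nat" where
  "rv_V = (\<lambda>(s1, s2, v, u, x, y). v)"

definition rv_U :: "('s1, 's2, 'x, 'y) outcome \<Rightarrow> nat" where
  "rv_U = (\<lambda>(s1, s2, v, u, x, y). u)"

definition rv_YS2 :: "('s1, 's2, 'x, 'y) outcome \<Rightarrow> 'y \<times> 's2" where
  "rv_YS2 = (\<lambda>(s1, s2, v, u, x, y). (y, s2))"

definition rate :: "('s1, 's2, 'x, 'y) outcome pmf \<Rightarrow> real" where
  "rate P = cmi P rv_U rv_YS2 rv_V - cmi P rv_U rv_S1 rv_V"

definition laws1 ::
  "nat \<Rightarrow> ('s1 \<times> 's2) pmf \<Rightarrow> ('x \<Rightarrow> 's1 \<Rightarrow> 's2 \<Rightarrow> 'y pmf) \<Rightarrow> ('s1, 's2, 'x, 'y) outcome pmf set" where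
  "laws1 k p ch =
     {joint_law p ch (\<lambda>s1 s2. qv s1) (\<lambda>s1 s2 v. qu s1 v) qx | qv qu qx.
        (\<forall>s1. set_pmf (qv s1) \<subseteq> {..<k}) \<and> (\<forall>s1 v. set_pmf (qu s1 v) \<subseteq> {..<k})}"

definition values1 ::
  "nat \<Rightarrow> ('s1 \<times> 's2) pmf \<Rightarrow> ('x \<Rightarrow> 's1 \<Rightarrow> 's2 \<Rightarrow> 'y pmf) \<Rightarrow> real \<Rightarrow> real set" where
  "values1 k p ch R' = rate ` {P \<in> laws1 k p ch. R' \<ge> mi P rv_V rv_S1 - mi P rv_V rv_YS2}"

definition laws2_lb ::
  "nat \<Rightarrow> ('s1 \<times> 's2) pmf \<Rightarrow> ('x \<Rightarrow> 's1 \<Rightarrow> 's2 \<Rightarrow> 'y pmf) \<Rightarrow> ('s1, 's2, 'x, 'y) outcome pmf set" where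
  "laws2_lb k p ch =
     {joint_law p ch (\<lambda>s1 s2. qv s2) (\<lambda>s1 s2 v. qu s1 v) qx | qv qu qx.
        (\<forall>s2. set_pmf (qv s2) \<subseteq> {..<k}) \<and> (\<forall>s1 v. set_pmf (qu s1 v) \<subseteq> {..<k})}"

definition laws2_ub1 ::
  "nat \<Rightarrow> ('s1 \<times> 's2) pmf \<Rightarrow> ('x \<Rightarrow> 's1 \<Rightarrow> 's2 \<Rightarrow> 'y pmf) \<Rightarrow> ('s1, 's2, 'x, 'y) outcome pmf set" where
  "laws2_ub1 k p ch =
     {joint_law p ch qv (\<lambda>s1 s2 v. qu s1 v) qx | qv qu qx.
        (\<forall>s1 s2. set_pmf (qv s1 s2) \<subseteq> {..<k}) \<and> (\<forall>s1 v. set_pmf (qu s1 v) \<subseteq> {..<k})}"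

definition laws2_ub2 ::
  "nat \<Rightarrow> ('s1 \<times> 's2) pmf \<Rightarrow> ('x \<Rightarrow> 's1 \<Rightarrow> 's2 \<Rightarrow> 'y pmf) \<Rightarrow> ('s1, 's2, 'x, 'y) outcome pmf set" where
  "laws2_ub2 k p ch =
     {joint_law p ch (\<lambda>s1 s2. qv s2) qu qx | qv qu qx.
        (\<forall>s2. set_pmf (qv s2) \<subseteq> {..<k}) \<and> (\<forall>s1 s2 v. set_pmf (qu s1 s2 v) \<subseteq> {..<k})}"

definition values2 :: "('s1, 's2, 'x, 'y) outcome pmf set \<Rightarrow> real \<Rightarrow> real set" where
  "values2 L R' = rate ` {P \<in> L. R' \<ge> cmi P rv_V rv_S2 rv_S1}"

definition laws2C ::
  "nat \<Rightarrow> ('s1 \<times> 's2) pmf \<Rightarrow> ('x \<Rightarrow> 's1 \<Rightarrow> 's2 \<Rightarrow> 'y pmf) \<Rightarrow> ('s1, 's2, 'x, 'y) outcome pmf set" where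
  "laws2C k p ch =
     {joint_law p ch (\<lambda>s1 s2. qv s2) (\<lambda>s1 s2 v. qu v) qx | qv qu qx.
        (\<forall>s2. set_pmf (qv s2) \<subseteq> {..<k}) \<and> (\<forall>v. set_pmf (qu v) \<subseteq> {..<k})}"

definition values2C ::
  "nat \<Rightarrow> ('s1 \<times> 's2) pmf \<Rightarrow> ('x \<Rightarrow> 's1 \<Rightarrow> 's2 \<Rightarrow> 'y pmf) \<Rightarrow> real \<Rightarrow> real set" where
  "values2C k p ch R' =
     (\<lambda>P. cmi P rv_U rv_YS2 rv_V) ` {P \<in> laws2C k p ch. R' \<ge> mi P rv_V rv_S2}"

definition is_maximum :: "real \<Rightarrow> real set \<Rightarrow> bool" where
  "is_maximum m A \<longleftrightarrow> m \<in> A \<and> (\<forall>a\<in>A. a \<le> m)"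

end

theory Submission
  imports Defs
begin

text \<open>
  Converse: Fano's inequality bounds the rate by \<open>I(W;Y\<^sup>n,S\<^sub>2\<^sup>n,T)\<close>, with \<open>T\<close> the description. Telescoping the entropies of
  \<open>(T, Y\<^sup>i\<^sup>-\<^sup>1, S\<^sub>2\<^sup>i\<^sup>-\<^sup>1, S\<^sub>1\<^sub>i \<dots> S\<^sub>1\<^sub>n)\<close> over \<open>i\<close>, as in the Csiszar sum identity, splits the bound into single letters; time sharing
  and a Caratheodory argument reduce these to one letter with alphabets of bounded size, on which the maxima are
  attained by compactness.

  Achievability: a random function \<open>\<phi>\<close> selects from every law \<open>P\<close> a winner \<open>\<phi> P\<close> with law \<open>P\<close>, by a race of
  exponential clocks common to all laws, such that the winners of \<open>P\<close> and \<open>Q\<close> differ at \<open>a\<close> with probability at most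
  \<open>P a / (P a + Q a)\<close>. The description is the winner of the law of \<open>(V\<^sup>n, T)\<close> with \<open>T\<close> uniform, and is guessed as
  the winner of a posterior law with \<open>T\<close> known; the codeword is the winner of the law of \<open>(U\<^sup>n, W)\<close> with \<open>W\<close> known, and is
  decoded as the winner of a posterior law with \<open>W\<close> uniform. The error is thus bounded by likelihood ratios, whose logarithms
  have means equal to the mutual information expressions, and a Chernoff bound applies. A constraint that holds with
  equality is made strict by time sharing if \<open>R' > 0\<close>. If \<open>R' = 0\<close>, then in Case 1 \<open>V\<close> can be absorbed into \<open>U\<close>, and in the
  other cases the law of the description is known to everybody, so that all winners agree.
\<close>

section \<open>Entropy\<close>

text \<open>Every mutual information is rewritten as a combination of entropies \<open>ent\<close>,
  which see only the partition that a variable induces. So whole blocks may serve as auxiliary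
  variables and be relabelled later. In the converse of Case 2 the obstacle is the past output: if
  it belongs to \<open>V\<close>, then \<open>V\<close> depends on \<open>S1\<close> as well as on
  \<open>S2\<close>; if it belongs to \<open>U\<close>, then \<open>U\<close> depends on
  \<open>S2\<close> too. Each choice gives one upper bound, and causality removes the conflict. In
  achievability the races take the place of typicality, and the uniform index acts as a bin: a party
  who knows it has its likelihood ratio divided by about 2^(n R'). The Chernoff bound needs a
  strictly negative mean, so equality in the constraint is a case of its own. At
  \<open>R' = 0\<close> time sharing gains nothing, because the trivial law has constraint value 0
  as well; there a vanishing divergence forces the guessing law to be the true one. Once the clocks
  are fixed, winners are deterministic functions of the laws, which turns the random scheme into a
  code.\<close>

definition pr :: "'a pmf \<Rightarrow> ('a \<Rightarrow> 'b) \<Rightarrow> 'a \<Rightarrow> real" where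
  "pr P f \<omega> = measure_pmf.prob P {\<omega>'. f \<omega>' = f \<omega>}"

text \<open>Taken as a mean over the sample space, entropy depends only on the partition that
  \<open>f\<close> induces, so \<open>f\<close> may take values in any type, also in functions on
  \<open>nat\<close>.\<close>

definition ent :: "'a pmf \<Rightarrow> ('a \<Rightarrow> 'b) \<Rightarrow> real" where
  "ent P f = measure_pmf.expectation P (\<lambda>\<omega>. - log 2 (pr P f \<omega>))"

lemma pr_pmf_map: "pr P f \<omega> = pmf (map_pmf f P) (f \<omega>)"
  by (simp add: pr_def pmf_map vimage_def)

lemma pr_map: "pr (map_pmf g P) f (g \<omega>) = pr P (\<lambda>\<omega>. f (g \<omega>)) \<omega>"
  by (simp add: pr_def vimage_def)

lemma pr_pos: "\<omega> \<in> set_pmf P \<Longrightarrow> 0 < pr P f \<omega>"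
  unfolding pr_def by (intro measure_pmf_posI) auto

lemma pr_le_1: "pr P f \<omega> \<le> 1"
  by (simp add: pr_def)

lemma pr_cong:
  assumes "\<And>\<omega>'. \<omega>' \<in> set_pmf P \<Longrightarrow> f \<omega>' = f \<omega> \<longleftrightarrow> g \<omega>' = g \<omega>"
  shows "pr P f \<omega> = pr P g \<omega>"
  unfolding pr_def by (intro measure_prob_cong_0) (use assms in \<open>auto simp: set_pmf_iff\<close>)

lemma pr_mono:
  assumes "\<And>\<omega>'. f \<omega>' = f \<omega> \<Longrightarrow> g \<omega>' = g \<omega>"
  shows "pr P f \<omega> \<le> pr P g \<omega>"
  unfolding pr_def by (intro measure_pmf.finite_measure_mono) (auto intro: assms)

lemma expectation_sum:
  fixes h :: "'a \<Rightarrow> real"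
  assumes "finite A" "set_pmf P \<subseteq> A"
  shows "measure_pmf.expectation P h = (\<Sum>\<omega>\<in>A. pmf P \<omega> * h \<omega>)"
  using assms by (subst integral_measure_pmf_real[where A=A]) (auto simp: mult.commute)

lemma ent_map: "ent (map_pmf g P) f = ent P (\<lambda>\<omega>. f (g \<omega>))"
  unfolding ent_def by (simp add: pr_map)

lemma expectation_cong_pmf:
  fixes f :: "'a \<Rightarrow> real"
  assumes "\<And>\<omega>. \<omega> \<in> set_pmf P \<Longrightarrow> f \<omega> = g \<omega>"
  shows "measure_pmf.expectation P f = measure_pmf.expectation P g"
  by (intro integral_cong_AE) (auto simp: AE_measure_pmf_iff assms)

lemma expectation_mono_pmf:
  fixes f :: "'a \<Rightarrow> real"
  assumes "finite (set_pmf P)" "\<And>\<omega>. \<omega> \<in> set_pmf P \<Longrightarrow> f \<omega> \<le> g \<omega>"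
  shows "measure_pmf.expectation P f \<le> measure_pmf.expectation P g"
  by (intro integral_mono_AE) (auto simp: AE_measure_pmf_iff assms integrable_measure_pmf_finite)

lemma ent_cong:
  assumes "\<And>\<omega> \<omega>'. \<omega> \<in> set_pmf P \<Longrightarrow> \<omega>' \<in> set_pmf P \<Longrightarrow> f \<omega>' = f \<omega> \<longleftrightarrow> g \<omega>' = g \<omega>"
  shows "ent P f = ent P g"
  unfolding ent_def
proof (rule expectation_cong_pmf)
  fix \<omega> assume "\<omega> \<in> set_pmf P"
  then have "pr P f \<omega> = pr P g \<omega>" by (intro pr_cong assms)
  then show "- log 2 (pr P f \<omega>) = - log 2 (pr P g \<omega>)" by simp
qed

lemma ent_law_cong: "map_pmf f P = map_pmf g Q \<Longrightarrow> ent P f = ent Q g"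
  using ent_map[of f P id] ent_map[of g Q id] by simp

lemma ent_mono:
  assumes "finite (set_pmf P)" "\<And>\<omega> \<omega>'. f \<omega>' = f \<omega> \<Longrightarrow> g \<omega>' = g \<omega>"
  shows "ent P g \<le> ent P f"
  unfolding ent_def
proof (rule expectation_mono_pmf[OF assms(1)])
  fix \<omega> assume "\<omega> \<in> set_pmf P"
  then have "0 < pr P f \<omega>" "pr P f \<omega> \<le> pr P g \<omega>"
    using assms by (auto intro: pr_pos pr_mono)
  then show "- log 2 (pr P g \<omega>) \<le> - log 2 (pr P f \<omega>)" by simp
qed

lemma ent_nonneg: "0 \<le> ent P f"
  unfolding ent_def
proof (intro integral_nonneg_AE AE_pmfI)
  fix \<omega> assume "\<omega> \<in> set_pmf P"
  then show "0 \<le> - log 2 (pr P f \<omega>)" using pr_pos[of \<omega> P f] pr_le_1[of P f \<omega>] by simp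
qed

lemma ent_const: "(\<And>\<omega>. \<omega> \<in> set_pmf P \<Longrightarrow> f \<omega> = c) \<Longrightarrow> ent P f = 0"
proof -
  assume a: "\<And>\<omega>. \<omega> \<in> set_pmf P \<Longrightarrow> f \<omega> = c"
  have "ent P f = ent P (\<lambda>_. c)" by (rule ent_cong) (simp add: a)
  also have "\<dots> = 0" by (simp add: ent_def pr_def)
  finally show ?thesis .
qed

text \<open>The inequality \<open>ln r \<le> r - 1\<close> bounds the mean of \<open>- ln r\<close>
  below by the mean of \<open>1 - r\<close>. This is the source of submodularity, of Fano's
  inequality and, through the case of equality, of the treatment of description rate zero.\<close>

lemma gibbs:
  assumes fin: "finite (set_pmf P)" and pos: "\<And>\<omega>. \<omega> \<in> set_pmf P \<Longrightarrow> 0 < r \<omega>"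
    and le: "measure_pmf.expectation P r \<le> 1"
  shows "0 \<le> measure_pmf.expectation P (\<lambda>\<omega>. - log 2 (r \<omega>))"
    and "measure_pmf.expectation P (\<lambda>\<omega>. - log 2 (r \<omega>)) = 0 \<Longrightarrow> \<omega> \<in> set_pmf P \<Longrightarrow> r \<omega> = 1"
proof -
  note int = integrable_measure_pmf_finite[OF fin]
  have ln: "measure_pmf.expectation P (\<lambda>\<omega>. - log 2 (r \<omega>)) =
      measure_pmf.expectation P (\<lambda>\<omega>. - ln (r \<omega>)) / ln 2"
    by (simp add: log_def)
  have "0 \<le> measure_pmf.expectation P (\<lambda>\<omega>. 1 - r \<omega>)"
    using le by (simp add: int)
  also have *: "\<dots> \<le> measure_pmf.expectation P (\<lambda>\<omega>. - ln (r \<omega>))"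
    using ln_le_minus_one[OF pos] by (intro expectation_mono_pmf fin) force
  finally show "0 \<le> measure_pmf.expectation P (\<lambda>\<omega>. - log 2 (r \<omega>))"
    unfolding ln by (rule divide_nonneg_pos) simp
  assume z: "measure_pmf.expectation P (\<lambda>\<omega>. - log 2 (r \<omega>)) = 0" and w: "\<omega> \<in> set_pmf P"
  \<comment> \<open>\<open>?h\<close> is nonnegative and has mean at most zero, so it vanishes on
    the support; \<open>ln r = r - 1\<close> holds only at \<open>r = 1\<close>.\<close>
  let ?h = "\<lambda>\<omega>. r \<omega> - 1 - ln (r \<omega>)"
  have "measure_pmf.expectation P ?h \<le> 0"
    using z le ln by (simp add: int)
  moreover have h: "0 \<le> ?h \<omega>" if "\<omega> \<in> set_pmf P" for \<omega>
    using ln_le_minus_one[OF pos[OF that]] by simp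
  ultimately have "(\<Sum>\<omega>\<in>set_pmf P. pmf P \<omega> * ?h \<omega>) = 0"
    using expectation_sum[OF fin order_refl, of ?h] sum_nonneg[of "set_pmf P" "\<lambda>\<omega>. pmf P \<omega> * ?h \<omega>"]
    by (auto intro!: mult_nonneg_nonneg)
  then have "pmf P \<omega> * ?h \<omega> = 0"
    using w h fin by (subst (asm) sum_nonneg_eq_0_iff) auto
  then have "ln (r \<omega>) = r \<omega> - 1" using w by (simp add: set_pmf_iff)
  then show "r \<omega> = 1" using pos[OF w] ln_eq_minus_one by blast
qed

lemma pr_sum_fiber:
  assumes fin: "finite (set_pmf P)" "finite T" "g ` set_pmf P \<subseteq> T"
  shows "(\<Sum>t\<in>T. pmf (map_pmf (\<lambda>\<omega>. (g \<omega>, f \<omega>)) P) (t, c)) = pmf (map_pmf f P) c"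
proof -
  have "(\<Sum>t\<in>T. pmf (map_pmf (\<lambda>\<omega>. (g \<omega>, f \<omega>)) P) (t, c)) =
      (\<Sum>t\<in>T. measure_pmf.prob P {\<omega>. g \<omega> = t \<and> f \<omega> = c})"
    by (simp add: pmf_map vimage_def)
  also have "\<dots> = measure_pmf.prob P (\<Union>t\<in>T. {\<omega>. g \<omega> = t \<and> f \<omega> = c})"
    by (intro measure_pmf.finite_measure_finite_Union[symmetric] fin) (auto simp: disjoint_family_on_def)
  also have "\<dots> = measure_pmf.prob P {\<omega>. f \<omega> = c}"
    using fin(3) by (intro measure_prob_cong_0) (auto simp: pmf_eq_0_set_pmf image_subset_iff)
  finally show ?thesis by (simp add: pmf_map vimage_def)
qed

text \<open>This is I(A;B|C) \<ge> 0, obtained from \<open>gibbs\<close> with the ratio of p(a,c)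
  p(b,c) to p(a,b,c) p(c).\<close>

lemma ent_submodular:
  assumes fin: "finite (set_pmf P)"
  shows "ent P (\<lambda>\<omega>. (A \<omega>, B \<omega>, C \<omega>)) + ent P C \<le> ent P (\<lambda>\<omega>. (A \<omega>, C \<omega>)) + ent P (\<lambda>\<omega>. (B \<omega>, C \<omega>))"
proof -
  let ?S = "set_pmf P"
  define pa where "pa a c = pmf (map_pmf (\<lambda>\<omega>. (A \<omega>, C \<omega>)) P) (a, c)" for a c
  define pb where "pb b c = pmf (map_pmf (\<lambda>\<omega>. (B \<omega>, C \<omega>)) P) (b, c)" for b c
  define pc where "pc c = pmf (map_pmf C P) c" for c
  define pabc where "pabc a b c = pmf (map_pmf (\<lambda>\<omega>. (A \<omega>, B \<omega>, C \<omega>)) P) (a, b, c)" for a b c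
  define r where "r \<omega> = pr P (\<lambda>\<omega>. (A \<omega>, C \<omega>)) \<omega> * pr P (\<lambda>\<omega>. (B \<omega>, C \<omega>)) \<omega> /
    (pr P (\<lambda>\<omega>. (A \<omega>, B \<omega>, C \<omega>)) \<omega> * pr P C \<omega>)" for \<omega>
  have r_eq: "r \<omega> = pa (A \<omega>) (C \<omega>) * pb (B \<omega>) (C \<omega>) / (pabc (A \<omega>) (B \<omega>) (C \<omega>) * pc (C \<omega>))" for \<omega>
    by (simp add: r_def pr_pmf_map pa_def pb_def pc_def pabc_def)
  have pos: "0 < r \<omega>" if "\<omega> \<in> ?S" for \<omega>
    using that by (auto simp: r_def intro!: divide_pos_pos mult_pos_pos pr_pos)
  have "measure_pmf.expectation P r = measure_pmf.expectation (map_pmf (\<lambda>\<omega>. (A \<omega>, B \<omega>, C \<omega>)) P)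
     (\<lambda>(a, b, c). pa a c * pb b c / (pabc a b c * pc c))"
    by (simp add: r_eq[abs_def])
  also have "\<dots> = (\<Sum>(a, b, c)\<in>A`?S \<times> B`?S \<times> C`?S. pabc a b c * (pa a c * pb b c / (pabc a b c * pc c)))"
    using fin by (subst expectation_sum[where A = "A`?S \<times> B`?S \<times> C`?S"])
      (auto simp: pabc_def split_def)
  \<comment> \<open>A triple of probability zero contributes 0 on the left, by the convention for
    division by zero, and a nonnegative amount on the right; all other terms agree.\<close>
  also have "\<dots> \<le> (\<Sum>(a, b, c)\<in>A`?S \<times> B`?S \<times> C`?S. pa a c * pb b c / pc c)"
    by (intro sum_mono) (auto simp: pa_def pb_def pabc_def pc_def)
  also have "\<dots> = (\<Sum>a\<in>A`?S. \<Sum>b\<in>B`?S. \<Sum>c\<in>C`?S. pa a c * pb b c / pc c)"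
    by (simp add: sum.cartesian_product split_def)
  also have "\<dots> = (\<Sum>c\<in>C`?S. \<Sum>a\<in>A`?S. \<Sum>b\<in>B`?S. pa a c * pb b c / pc c)"
    by (subst (2) sum.swap, subst sum.swap) (rule refl)
  also have "\<dots> = (\<Sum>c\<in>C`?S. (\<Sum>a\<in>A`?S. pa a c) * (\<Sum>b\<in>B`?S. pb b c) / pc c)"
    by (simp add: sum_product sum_divide_distrib)
  also have "\<dots> = (\<Sum>c\<in>C`?S. pc c)"
    unfolding pa_def pb_def pc_def using fin by (subst (1 2) pr_sum_fiber) auto
  also have "\<dots> = 1"
    unfolding pc_def using fin by (intro sum_pmf_eq_1) auto
  finally have "measure_pmf.expectation P r \<le> 1" .
  then have "0 \<le> measure_pmf.expectation P (\<lambda>\<omega>. - log 2 (r \<omega>))"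
    by (intro gibbs fin pos)
  also have "\<dots> = measure_pmf.expectation P (\<lambda>\<omega>. - log 2 (pr P (\<lambda>\<omega>. (A \<omega>, C \<omega>)) \<omega>)
      - log 2 (pr P (\<lambda>\<omega>. (B \<omega>, C \<omega>)) \<omega>) + log 2 (pr P (\<lambda>\<omega>. (A \<omega>, B \<omega>, C \<omega>)) \<omega>) + log 2 (pr P C \<omega>))"
  proof (intro expectation_cong_pmf)
    fix \<omega> assume "\<omega> \<in> ?S"
    note p = pr_pos[OF this, of "\<lambda>\<omega>. (A \<omega>, C \<omega>)"] pr_pos[OF this, of "\<lambda>\<omega>. (B \<omega>, C \<omega>)"]
       pr_pos[OF this, of "\<lambda>\<omega>. (A \<omega>, B \<omega>, C \<omega>)"] pr_pos[OF this, of C]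
    show "- log 2 (r \<omega>) = - log 2 (pr P (\<lambda>\<omega>. (A \<omega>, C \<omega>)) \<omega>)
      - log 2 (pr P (\<lambda>\<omega>. (B \<omega>, C \<omega>)) \<omega>) + log 2 (pr P (\<lambda>\<omega>. (A \<omega>, B \<omega>, C \<omega>)) \<omega>) + log 2 (pr P C \<omega>)"
      using p by (simp add: r_def log_divide log_mult)
  qed
  also have "\<dots> = ent P (\<lambda>\<omega>. (A \<omega>, C \<omega>)) + ent P (\<lambda>\<omega>. (B \<omega>, C \<omega>)) - ent P (\<lambda>\<omega>. (A \<omega>, B \<omega>, C \<omega>)) - ent P C"
    unfolding ent_def by (simp add: integrable_measure_pmf_finite[OF fin])
  finally show ?thesis by simp
qed

text \<open>Conditional independence of \<open>A\<close> and \<open>B\<close> given \<open>C\<close>, multiplied out so that values of \<open>C\<close> of probability zero need no care.\<close>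

definition cind :: "'a pmf \<Rightarrow> ('a \<Rightarrow> 'b) \<Rightarrow> ('a \<Rightarrow> 'c) \<Rightarrow> ('a \<Rightarrow> 'd) \<Rightarrow> bool" where
  "cind P A B C \<longleftrightarrow> (\<forall>Sa Sb c.
     measure_pmf.prob P {\<omega>. A \<omega> \<in> Sa \<and> B \<omega> \<in> Sb \<and> C \<omega> = c} * measure_pmf.prob P {\<omega>. C \<omega> = c} =
     measure_pmf.prob P {\<omega>. A \<omega> \<in> Sa \<and> C \<omega> = c} * measure_pmf.prob P {\<omega>. B \<omega> \<in> Sb \<and> C \<omega> = c})"

lemma cindD:
  "cind P A B C \<Longrightarrow>
     measure_pmf.prob P {\<omega>. A \<omega> \<in> Sa \<and> B \<omega> \<in> Sb \<and> C \<omega> = c} * measure_pmf.prob P {\<omega>. C \<omega> = c} =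
     measure_pmf.prob P {\<omega>. A \<omega> \<in> Sa \<and> C \<omega> = c} * measure_pmf.prob P {\<omega>. B \<omega> \<in> Sb \<and> C \<omega> = c}"
  unfolding cind_def by blast

text \<open>Take two independent copies that agree in \<open>C\<close> and let \<open>m\<close>
  splice \<open>A\<close> of the first with \<open>B\<close> of the second. The splice is an
  involution on pairs of copies and keeps their joint probability, so the two products in the
  definition of \<open>cind\<close> collect the same mass.\<close>

lemma cind_swap:
  assumes fin: "finite (set_pmf P)"
    and m: "\<And>\<omega> \<omega>'. \<omega> \<in> set_pmf P \<Longrightarrow> \<omega>' \<in> set_pmf P \<Longrightarrow> C \<omega> = C \<omega>' \<Longrightarrow>
      A (m \<omega> \<omega>') = A \<omega> \<and> B (m \<omega> \<omega>') = B \<omega>' \<and> C (m \<omega> \<omega>') = C \<omega> \<and> m (m \<omega> \<omega>') (m \<omega>' \<omega>) = \<omega> \<and>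
      pmf P (m \<omega> \<omega>') * pmf P (m \<omega>' \<omega>) = pmf P \<omega> * pmf P \<omega>'"
  shows "cind P A B C"
  unfolding cind_def
proof (intro allI)
  fix Sa Sb c
  let ?S = "set_pmf P"
  have meas: "measure_pmf.prob P {\<omega>. Q \<omega>} = (\<Sum>\<omega>\<in>{\<omega>\<in>?S. Q \<omega>}. pmf P \<omega>)" for Q
  proof -
    have "measure_pmf.prob P {\<omega>. Q \<omega>} = measure_pmf.prob P {\<omega>\<in>?S. Q \<omega>}"
      by (intro measure_prob_cong_0) (auto simp: pmf_eq_0_set_pmf)
    then show ?thesis using fin by (simp add: measure_measure_pmf_finite)
  qed
  \<comment> \<open>The product of the two spliced probabilities equals a nonzero product, so
    neither factor vanishes and the splice stays in the support.\<close>
  have clo: "m \<omega> \<omega>' \<in> ?S \<and> m \<omega>' \<omega> \<in> ?S" if "\<omega> \<in> ?S" "\<omega>' \<in> ?S" "C \<omega> = C \<omega>'" for \<omega> \<omega>'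
  proof -
    have "pmf P (m \<omega> \<omega>') * pmf P (m \<omega>' \<omega>) \<noteq> 0"
      using m[OF that] that by (simp add: set_pmf_iff)
    then show ?thesis by (auto simp: set_pmf_iff)
  qed
  have "measure_pmf.prob P {\<omega>. A \<omega> \<in> Sa \<and> B \<omega> \<in> Sb \<and> C \<omega> = c} * measure_pmf.prob P {\<omega>. C \<omega> = c} =
      (\<Sum>(\<omega>, \<omega>')\<in>{\<omega>\<in>?S. A \<omega> \<in> Sa \<and> B \<omega> \<in> Sb \<and> C \<omega> = c} \<times> {\<omega>\<in>?S. C \<omega> = c}. pmf P \<omega> * pmf P \<omega>')"
    by (simp add: meas sum_product sum.cartesian_product)
  also have "\<dots> = (\<Sum>(\<omega>, \<omega>')\<in>{\<omega>\<in>?S. A \<omega> \<in> Sa \<and> C \<omega> = c} \<times> {\<omega>\<in>?S. B \<omega> \<in> Sb \<and> C \<omega> = c}. pmf P \<omega> * pmf P \<omega>')"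
    by (rule sum.reindex_bij_witness[where i="\<lambda>(\<omega>, \<omega>'). (m \<omega> \<omega>', m \<omega>' \<omega>)" and j="\<lambda>(\<omega>, \<omega>'). (m \<omega> \<omega>', m \<omega>' \<omega>)"])
      (use m clo in \<open>auto\<close>)
  also have "\<dots> = measure_pmf.prob P {\<omega>. A \<omega> \<in> Sa \<and> C \<omega> = c} * measure_pmf.prob P {\<omega>. B \<omega> \<in> Sb \<and> C \<omega> = c}"
    by (simp add: meas sum_product sum.cartesian_product)
  finally show "measure_pmf.prob P {\<omega>. A \<omega> \<in> Sa \<and> B \<omega> \<in> Sb \<and> C \<omega> = c} * measure_pmf.prob P {\<omega>. C \<omega> = c} =
     measure_pmf.prob P {\<omega>. A \<omega> \<in> Sa \<and> C \<omega> = c} * measure_pmf.prob P {\<omega>. B \<omega> \<in> Sb \<and> C \<omega> = c}" .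
qed

text \<open>Conditional independence survives passing to functions of \<open>A\<close> and
  \<open>C\<close> and of \<open>B\<close> and \<open>C\<close>, and also enlarging the condition by
  a function \<open>k\<close> of \<open>A\<close>. All independences needed for single letters are
  drawn in this way from a few independences between blocks.\<close>

lemma cind_derive:
  assumes ci: "cind P A B C"
    and A': "\<And>\<omega>. A' \<omega> = fa (A \<omega>) (C \<omega>)" and B': "\<And>\<omega>. B' \<omega> = fb (B \<omega>) (C \<omega>)"
    and C': "\<And>\<omega> \<omega>'. C' \<omega> = C' \<omega>' \<longleftrightarrow> k (A \<omega>) (C \<omega>) = k (A \<omega>') (C \<omega>') \<and> C \<omega> = C \<omega>'"
  shows "cind P A' B' C'"
  unfolding cind_def
proof (intro allI)
  fix Sa Sb c'
  show "measure_pmf.prob P {\<omega>. A' \<omega> \<in> Sa \<and> B' \<omega> \<in> Sb \<and> C' \<omega> = c'} * measure_pmf.prob P {\<omega>. C' \<omega> = c'} =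
     measure_pmf.prob P {\<omega>. A' \<omega> \<in> Sa \<and> C' \<omega> = c'} * measure_pmf.prob P {\<omega>. B' \<omega> \<in> Sb \<and> C' \<omega> = c'}"
  proof (cases "\<exists>\<omega>0. C' \<omega>0 = c'")
    case True
    then obtain \<omega>0 where w0: "c' = C' \<omega>0" by auto
    define c where "c = C \<omega>0"
    define u where "u = k (A \<omega>0) c"
    have iff: "C' \<omega> = c' \<longleftrightarrow> k (A \<omega>) c = u \<and> C \<omega> = c" for \<omega>
      unfolding w0 C' u_def c_def by auto
    define Sk where "Sk = {a. k a c = u}"
    define Sa' where "Sa' = {a. fa a c \<in> Sa}"
    define Sb' where "Sb' = {b. fb b c \<in> Sb}"
    have e: "{\<omega>. A' \<omega> \<in> Sa \<and> B' \<omega> \<in> Sb \<and> C' \<omega> = c'} = {\<omega>. A \<omega> \<in> Sa' \<inter> Sk \<and> B \<omega> \<in> Sb' \<and> C \<omega> = c}"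
      "{\<omega>. C' \<omega> = c'} = {\<omega>. A \<omega> \<in> Sk \<and> C \<omega> = c}"
      "{\<omega>. A' \<omega> \<in> Sa \<and> C' \<omega> = c'} = {\<omega>. A \<omega> \<in> Sa' \<inter> Sk \<and> C \<omega> = c}"
      "{\<omega>. B' \<omega> \<in> Sb \<and> C' \<omega> = c'} = {\<omega>. A \<omega> \<in> Sk \<and> B \<omega> \<in> Sb' \<and> C \<omega> = c}"
      unfolding iff A' B' Sk_def Sa'_def Sb'_def by auto
    note d1 = cindD[OF ci, of "Sa' \<inter> Sk" Sb' c] and d2 = cindD[OF ci, of Sk Sb' c]
    let ?z = "measure_pmf.prob P {\<omega>. C \<omega> = c}"
    show ?thesis
    \<comment> \<open>The two instances of the independence are combined by cancelling
      \<open>?z\<close>; where it vanishes, both sides vanish.\<close>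
    proof (cases "?z = 0")
      case True
      have "measure_pmf.prob P {\<omega>. A \<omega> \<in> Sk \<and> C \<omega> = c} \<le> ?z"
        "measure_pmf.prob P {\<omega>. A \<omega> \<in> Sk \<and> B \<omega> \<in> Sb' \<and> C \<omega> = c} \<le> ?z"
        by (auto intro!: measure_pmf.finite_measure_mono)
      then have "measure_pmf.prob P {\<omega>. A \<omega> \<in> Sk \<and> C \<omega> = c} = 0"
        "measure_pmf.prob P {\<omega>. A \<omega> \<in> Sk \<and> B \<omega> \<in> Sb' \<and> C \<omega> = c} = 0"
        using True by (auto intro!: antisym)
      then show ?thesis unfolding e by simp
    next
      case False
      have alg: "(x * k) * z = (a * w) * z" if "x * z = a * b" "w * z = k * b" for x z a b w k :: real
      proof -
        have "(x * k) * z = (x * z) * k" by simp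
        also have "\<dots> = a * (k * b)" by (simp add: that(1))
        also have "\<dots> = (a * w) * z" by (simp add: that(2)[symmetric])
        finally show ?thesis .
      qed
      from d1 d2 have "(measure_pmf.prob P {\<omega>. A \<omega> \<in> Sa' \<inter> Sk \<and> B \<omega> \<in> Sb' \<and> C \<omega> = c} * measure_pmf.prob P {\<omega>. A \<omega> \<in> Sk \<and> C \<omega> = c}) * ?z =
        (measure_pmf.prob P {\<omega>. A \<omega> \<in> Sa' \<inter> Sk \<and> C \<omega> = c} * measure_pmf.prob P {\<omega>. A \<omega> \<in> Sk \<and> B \<omega> \<in> Sb' \<and> C \<omega> = c}) * ?z"
        by (rule alg)
      then show ?thesis using False unfolding e by simp
    qed
  qed (simp)
qed

lemma cind_determined:
  assumes "\<And>\<omega> \<omega>'. C \<omega> = C \<omega>' \<Longrightarrow> B \<omega> = B \<omega>'"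
  shows "cind P A B C" "cind P B A C"
proof -
  have "measure_pmf.prob P {\<omega>. A \<omega> \<in> Sa \<and> B \<omega> \<in> Sb \<and> C \<omega> = c} * measure_pmf.prob P {\<omega>. C \<omega> = c} =
     measure_pmf.prob P {\<omega>. A \<omega> \<in> Sa \<and> C \<omega> = c} * measure_pmf.prob P {\<omega>. B \<omega> \<in> Sb \<and> C \<omega> = c}" for Sa Sb c
  proof (cases "\<exists>\<omega>0. C \<omega>0 = c \<and> B \<omega>0 \<in> Sb")
    case True
    then have b: "\<And>\<omega>. C \<omega> = c \<Longrightarrow> B \<omega> \<in> Sb" using assms by metis
    then have "{\<omega>. A \<omega> \<in> Sa \<and> B \<omega> \<in> Sb \<and> C \<omega> = c} = {\<omega>. A \<omega> \<in> Sa \<and> C \<omega> = c}"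
      "{\<omega>. B \<omega> \<in> Sb \<and> C \<omega> = c} = {\<omega>. C \<omega> = c}" by auto
    then show ?thesis by simp
  next
    case False
    then have "{\<omega>. A \<omega> \<in> Sa \<and> B \<omega> \<in> Sb \<and> C \<omega> = c} = {}" "{\<omega>. B \<omega> \<in> Sb \<and> C \<omega> = c} = {}" by auto
    then show ?thesis by (simp only: measure_empty mult_zero_left mult_zero_right)
  qed
  then show ci: "cind P A B C" unfolding cind_def by blast
  have "measure_pmf.prob P {\<omega>. B \<omega> \<in> Sb \<and> A \<omega> \<in> Sa \<and> C \<omega> = c} = measure_pmf.prob P {\<omega>. A \<omega> \<in> Sa \<and> B \<omega> \<in> Sb \<and> C \<omega> = c}" for Sa Sb c
    by (intro arg_cong[where f="measure_pmf.prob P"]) auto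
  then show "cind P B A C"
    using cindD[OF ci] unfolding cind_def by (simp add: mult.commute)
qed

text \<open>The case of equality in \<open>ent_submodular\<close>: the four probabilities multiply
  out at every outcome of the support, hence their logarithms add up.\<close>

lemma ent_cind:
  assumes fin: "finite (set_pmf P)" and ci: "cind P A B C"
  shows "ent P (\<lambda>\<omega>. (A \<omega>, B \<omega>, C \<omega>)) + ent P C = ent P (\<lambda>\<omega>. (A \<omega>, C \<omega>)) + ent P (\<lambda>\<omega>. (B \<omega>, C \<omega>))"
proof -
  have "ent P (\<lambda>\<omega>. (A \<omega>, B \<omega>, C \<omega>)) + ent P C =
    measure_pmf.expectation P (\<lambda>\<omega>. - log 2 (pr P (\<lambda>\<omega>. (A \<omega>, B \<omega>, C \<omega>)) \<omega>) + - log 2 (pr P C \<omega>))"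
    unfolding ent_def by (subst Bochner_Integration.integral_add) (auto intro!: integrable_measure_pmf_finite fin)
  also have "\<dots> = measure_pmf.expectation P (\<lambda>\<omega>. - log 2 (pr P (\<lambda>\<omega>. (A \<omega>, C \<omega>)) \<omega>) + - log 2 (pr P (\<lambda>\<omega>. (B \<omega>, C \<omega>)) \<omega>))"
  proof (intro expectation_cong_pmf)
    fix \<omega> assume "\<omega> \<in> set_pmf P"
    note p = pr_pos[OF this, of "\<lambda>\<omega>. (A \<omega>, C \<omega>)"] pr_pos[OF this, of "\<lambda>\<omega>. (B \<omega>, C \<omega>)"]
       pr_pos[OF this, of "\<lambda>\<omega>. (A \<omega>, B \<omega>, C \<omega>)"] pr_pos[OF this, of C]
    have "pr P (\<lambda>\<omega>. (A \<omega>, B \<omega>, C \<omega>)) \<omega> * pr P C \<omega> = pr P (\<lambda>\<omega>. (A \<omega>, C \<omega>)) \<omega> * pr P (\<lambda>\<omega>. (B \<omega>, C \<omega>)) \<omega>"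
      using cindD[OF ci, of "{A \<omega>}" "{B \<omega>}" "C \<omega>"] unfolding pr_def by simp
    then have "log 2 (pr P (\<lambda>\<omega>. (A \<omega>, B \<omega>, C \<omega>)) \<omega> * pr P C \<omega>) =
        log 2 (pr P (\<lambda>\<omega>. (A \<omega>, C \<omega>)) \<omega> * pr P (\<lambda>\<omega>. (B \<omega>, C \<omega>)) \<omega>)" by simp
    then show "- log 2 (pr P (\<lambda>\<omega>. (A \<omega>, B \<omega>, C \<omega>)) \<omega>) + - log 2 (pr P C \<omega>) =
       - log 2 (pr P (\<lambda>\<omega>. (A \<omega>, C \<omega>)) \<omega>) + - log 2 (pr P (\<lambda>\<omega>. (B \<omega>, C \<omega>)) \<omega>)"
      using p by (simp add: log_mult)
  qed
  also have "\<dots> = ent P (\<lambda>\<omega>. (A \<omega>, C \<omega>)) + ent P (\<lambda>\<omega>. (B \<omega>, C \<omega>))"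
    unfolding ent_def by (subst Bochner_Integration.integral_add) (auto intro!: integrable_measure_pmf_finite fin)
  finally show ?thesis .
qed

lemma ent_subadd:
  assumes fin: "finite (set_pmf P)"
  shows "ent P (\<lambda>\<omega>. (A \<omega>, B \<omega>)) \<le> ent P A + ent P B"
proof -
  have "ent P (\<lambda>\<omega>. (A \<omega>, B \<omega>, ())) + ent P (\<lambda>_. ()) \<le> ent P (\<lambda>\<omega>. (A \<omega>, ())) + ent P (\<lambda>\<omega>. (B \<omega>, ()))"
    by (rule ent_submodular[OF fin])
  moreover have "ent P (\<lambda>\<omega>. (A \<omega>, B \<omega>, ())) = ent P (\<lambda>\<omega>. (A \<omega>, B \<omega>))" "ent P (\<lambda>\<omega>. (A \<omega>, ())) = ent P A"
    "ent P (\<lambda>\<omega>. (B \<omega>, ())) = ent P B" "ent P (\<lambda>_. ()) = 0"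
    by (auto intro: ent_cong ent_const)
  ultimately show ?thesis by simp
qed

text \<open>An instance of \<open>gibbs\<close> with the uniform law on \<open>T\<close> as
  reference.\<close>

lemma ent_le_log_card:
  assumes fin: "finite (set_pmf P)" and T: "finite T" "f ` set_pmf P \<subseteq> T"
  shows "ent P f \<le> log 2 (card T)"
proof -
  have ne: "T \<noteq> {}" using T set_pmf_not_empty[of P] by auto
  then have c: "0 < real (card T)" using T by (simp add: card_gt_0_iff)
  let ?r = "\<lambda>\<omega>. 1 / (card T * pr P f \<omega>)"
  have "measure_pmf.expectation P ?r = measure_pmf.expectation (map_pmf f P) (\<lambda>a. 1 / (card T * pmf (map_pmf f P) a))"
    by (simp add: pr_pmf_map)
  also have "\<dots> = (\<Sum>a\<in>T. pmf (map_pmf f P) a * (1 / (card T * pmf (map_pmf f P) a)))"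
    using T by (intro expectation_sum) auto
  also have "\<dots> \<le> (\<Sum>a\<in>T. 1 / card T)" by (intro sum_mono) (auto)
  also have "\<dots> = 1" using c by simp
  finally have "0 \<le> measure_pmf.expectation P (\<lambda>\<omega>. - log 2 (?r \<omega>))"
    using c by (intro gibbs(1) fin) (auto intro!: divide_pos_pos mult_pos_pos pr_pos)
  also have "\<dots> = measure_pmf.expectation P (\<lambda>\<omega>. log 2 (card T) - (- log 2 (pr P f \<omega>)))"
  proof (intro expectation_cong_pmf)
    fix \<omega> assume "\<omega> \<in> set_pmf P"
    then show "- log 2 (?r \<omega>) = log 2 (card T) - (- log 2 (pr P f \<omega>))"
      using c pr_pos[of \<omega> P f] by (simp add: log_divide log_mult)
  qed
  also have "\<dots> = log 2 (card T) - ent P f"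
    unfolding ent_def by (subst Bochner_Integration.integral_diff) (auto intro!: integrable_measure_pmf_finite fin)
  finally show ?thesis by simp
qed

section \<open>Mutual information as a combination of entropies\<close>

lemma measurable_distributed_pmf:
  fixes A :: "'a \<Rightarrow> 'b"
  shows "distributed (measure_pmf P) (count_space UNIV) A (\<lambda>a. ennreal (pmf (map_pmf A P) a))"
  unfolding distributed_def
  by (auto simp: measure_pmf_eq_density[symmetric] map_pmf_rep_eq[symmetric])

text \<open>Over countable types the product of two counting measures is again a counting measure,
  so the joint pmf is a density of the pair and the information integral is a mean of differences of
  logarithms.\<close>

lemma mutual_information_ent:
  fixes A :: "'a \<Rightarrow> 'b :: countable" and B :: "'a \<Rightarrow> 'c :: countable"
  assumes fin: "finite (set_pmf P)"
  shows "mi P A B = ent P A + ent P B - ent P (\<lambda>\<omega>. (A \<omega>, B \<omega>))"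
proof -
  interpret information_space "measure_pmf P" 2
    by standard simp
  let ?pa = "pmf (map_pmf A P)" and ?pb = "pmf (map_pmf B P)" and ?pab = "pmf (map_pmf (\<lambda>\<omega>. (A \<omega>, B \<omega>)) P)"
  have cs: "count_space (UNIV :: 'b set) \<Otimes>\<^sub>M count_space (UNIV :: 'c set) = count_space UNIV"
    by (simp add: pair_measure_countable)
  let ?f = "\<lambda>x. ?pab x * log 2 (?pab x / (?pa (fst x) * ?pb (snd x)))"
  have "mi P A B = integral\<^sup>L (count_space UNIV \<Otimes>\<^sub>M count_space UNIV) ?f"
    unfolding mi_def
  proof (rule mutual_information_distr)
    show "sigma_finite_measure (count_space (UNIV :: 'b set))" "sigma_finite_measure (count_space (UNIV :: 'c set))"
      by (auto intro: sigma_finite_measure_count_space)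
  qed (auto simp: measurable_distributed_pmf cs)
  also have "\<dots> = integral\<^sup>L (measure_pmf (map_pmf (\<lambda>\<omega>. (A \<omega>, B \<omega>)) P)) (\<lambda>x. log 2 (?pab x / (?pa (fst x) * ?pb (snd x))))"
    unfolding cs measure_pmf_eq_density[of "map_pmf (\<lambda>\<omega>. (A \<omega>, B \<omega>)) P"]
    by (subst integral_density) auto
  also have "\<dots> = measure_pmf.expectation P (\<lambda>\<omega>. log 2 (pr P (\<lambda>\<omega>. (A \<omega>, B \<omega>)) \<omega> / (pr P A \<omega> * pr P B \<omega>)))"
    by (simp add: pr_pmf_map)
  also have "\<dots> = measure_pmf.expectation P (\<lambda>\<omega>. - log 2 (pr P A \<omega>) + - log 2 (pr P B \<omega>) - (- log 2 (pr P (\<lambda>\<omega>. (A \<omega>, B \<omega>)) \<omega>)))"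
  proof (intro expectation_cong_pmf)
    fix \<omega> assume "\<omega> \<in> set_pmf P"
    note p = pr_pos[OF this, of "\<lambda>\<omega>. (A \<omega>, B \<omega>)"] pr_pos[OF this, of A] pr_pos[OF this, of B]
    then show "log 2 (pr P (\<lambda>\<omega>. (A \<omega>, B \<omega>)) \<omega> / (pr P A \<omega> * pr P B \<omega>)) =
       - log 2 (pr P A \<omega>) + - log 2 (pr P B \<omega>) - (- log 2 (pr P (\<lambda>\<omega>. (A \<omega>, B \<omega>)) \<omega>))"
      by (simp add: log_divide log_mult)
  qed
  also have "\<dots> = ent P A + ent P B - ent P (\<lambda>\<omega>. (A \<omega>, B \<omega>))"
    unfolding ent_def by (simp add: integrable_measure_pmf_finite[OF fin])
  finally show ?thesis .
qed

lemma cmi_ent: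
  fixes A :: "'a \<Rightarrow> 'b :: countable" and B :: "'a \<Rightarrow> 'c :: countable" and C :: "'a \<Rightarrow> 'd :: countable"
  assumes fin: "finite (set_pmf P)"
  shows "cmi P A B C = ent P (\<lambda>\<omega>. (A \<omega>, C \<omega>)) + ent P (\<lambda>\<omega>. (B \<omega>, C \<omega>)) - ent P (\<lambda>\<omega>. (A \<omega>, B \<omega>, C \<omega>)) - ent P C"
proof -
  interpret information_space "measure_pmf P" 2
    by standard simp
  have "cmi P A B C = mi P A (\<lambda>\<omega>. (B \<omega>, C \<omega>)) - mi P A C"
    unfolding cmi_def mi_def prob_space.conditional_mutual_information_def[OF prob_space_measure_pmf] by (simp add: pair_measure_countable)
  then show ?thesis by (simp add: mutual_information_ent[OF fin])
qed

section \<open>Single-letter laws\<close>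

text \<open>The mean of the vectors lies in their convex hull, hence is a convex combination of at
  most one more vector than the dimension. Multiplying its coefficients by the number of vectors
  gives weights that reproduce the sum. The weights are not normalized; where normalization matters
  it is made to follow from the coordinates of \<open>a\<close>.\<close>

lemma conic_caratheodory:
  fixes a :: "'i \<Rightarrow> 'e::euclidean_space"
  assumes "finite A"
  shows "\<exists>\<sigma>. (\<forall>i. 0 \<le> (\<sigma> i :: real)) \<and> card {i\<in>A. \<sigma> i \<noteq> 0} \<le> DIM('e) + 1 \<and>
    (\<Sum>i\<in>A. \<sigma> i *\<^sub>R a i) = (\<Sum>i\<in>A. a i)"
proof (cases "A = {}")
  case False
  define N where "N = real (card A)"
  have N: "N > 0" using False assms by (simp add: N_def card_gt_0_iff)
  have "(\<Sum>i\<in>A. (1 / N) *\<^sub>R a i) \<in> convex hull (a ` A)"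
    using assms N by (intro convex_sum) (auto simp: N_def hull_inc)
  then obtain S where S: "finite S" "S \<subseteq> a ` A" "card S \<le> DIM('e) + 1"
    and in_S: "(\<Sum>i\<in>A. (1 / N) *\<^sub>R a i) \<in> convex hull S"
    using caratheodory[of "a ` A"] by auto
  from in_S obtain u where u: "\<And>x. x \<in> S \<Longrightarrow> 0 \<le> u x" "(\<Sum>x\<in>S. u x *\<^sub>R x) = (\<Sum>i\<in>A. (1 / N) *\<^sub>R a i)"
    using convex_hull_finite[OF S(1)] by auto
  \<comment> \<open>Different indices may carry the same vector; one index is chosen for each vector
    of \<open>S\<close>.\<close>
  obtain C where C: "C \<subseteq> A" "inj_on a C" "S = a ` C"
    using S(2) by (auto simp: subset_image_inj)
  define \<sigma> where "\<sigma> i = (if i \<in> C then N * u (a i) else 0)" for i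
  have "(\<Sum>i\<in>A. \<sigma> i *\<^sub>R a i) = (\<Sum>i\<in>C. \<sigma> i *\<^sub>R a i)"
    using C assms by (intro sum.mono_neutral_right) (auto simp: \<sigma>_def)
  also have "\<dots> = N *\<^sub>R (\<Sum>i\<in>C. u (a i) *\<^sub>R a i)"
    by (auto simp: \<sigma>_def scaleR_sum_right intro!: sum.cong)
  also have "(\<Sum>i\<in>C. u (a i) *\<^sub>R a i) = (\<Sum>x\<in>S. u x *\<^sub>R x)"
    using C by (simp add: sum.reindex)
  also have "N *\<^sub>R \<dots> = (\<Sum>i\<in>A. a i)"
    using N by (simp add: u scaleR_sum_right)
  finally have "(\<Sum>i\<in>A. \<sigma> i *\<^sub>R a i) = (\<Sum>i\<in>A. a i)" .
  moreover have "\<forall>i. 0 \<le> \<sigma> i" using N u C by (auto simp: \<sigma>_def)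
  moreover have "card {i\<in>A. \<sigma> i \<noteq> 0} \<le> card C"
    using C assms by (intro card_mono) (auto simp: \<sigma>_def intro: finite_subset)
  moreover have "card C = card S" using C by (simp add: card_image)
  ultimately show ?thesis using S(3) by (intro exI[of _ \<sigma>]) auto
qed auto

text \<open>The law \<^const>\<open>joint_law\<close> with auxiliary variables of arbitrary types: the converse uses whole
  sequences and time sharing uses pairs as auxiliary variables, before they are relabelled by numbers.\<close>

definition aux_law :: "('s1 \<times> 's2) pmf \<Rightarrow> ('x \<Rightarrow> 's1 \<Rightarrow> 's2 \<Rightarrow> 'y pmf) \<Rightarrow> ('s1 \<Rightarrow> 's2 \<Rightarrow> 'v pmf) \<Rightarrow>
   ('s1 \<Rightarrow> 's2 \<Rightarrow> 'v \<Rightarrow> 'u pmf) \<Rightarrow> ('u \<Rightarrow> 's1 \<Rightarrow> 'v \<Rightarrow> 'x pmf) \<Rightarrow> ('s1 \<times> 's2 \<times> 'v \<times> 'u \<times> 'x \<times> 'y) pmf" where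
  "aux_law p ch qv qu qx = do {
     (s1, s2) \<leftarrow> p;
     v \<leftarrow> qv s1 s2;
     u \<leftarrow> qu s1 s2 v;
     x \<leftarrow> qx u s1 v;
     y \<leftarrow> ch x s1 s2;
     return_pmf (s1, s2, v, u, x, y)
   }"

lemma joint_law_aux_law: "joint_law p ch qv qu qx = aux_law p ch qv qu qx"
  unfolding joint_law_def aux_law_def ..

text \<open>\<open>I(U;Y,S\<^sub>2|V) - I(U;S\<^sub>1|V)\<close>, \<open>I(V;S\<^sub>1) - I(V;Y,S\<^sub>2)\<close>, \<open>I(V;S\<^sub>2|S\<^sub>1)\<close> and \<open>I(V;S\<^sub>2)\<close> as combinations of
  entropies.\<close>

definition eRate :: "('s1 \<times> 's2 \<times> 'v \<times> 'u \<times> 'x \<times> 'y) pmf \<Rightarrow> real" where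
  "eRate P = ent P (\<lambda>(s1,s2,v,u,x,y). (y,s2,v)) - ent P (\<lambda>(s1,s2,v,u,x,y). (u,y,s2,v))
     - ent P (\<lambda>(s1,s2,v,u,x,y). (s1,v)) + ent P (\<lambda>(s1,s2,v,u,x,y). (u,s1,v))"

definition eC1 :: "('s1 \<times> 's2 \<times> 'v \<times> 'u \<times> 'x \<times> 'y) pmf \<Rightarrow> real" where
  "eC1 P = ent P (\<lambda>(s1,s2,v,u,x,y). s1) - ent P (\<lambda>(s1,s2,v,u,x,y). (y,s2))
     - ent P (\<lambda>(s1,s2,v,u,x,y). (s1,v)) + ent P (\<lambda>(s1,s2,v,u,x,y). (y,s2,v))"

definition eC2 :: "('s1 \<times> 's2 \<times> 'v \<times> 'u \<times> 'x \<times> 'y) pmf \<Rightarrow> real" where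
  "eC2 P = ent P (\<lambda>(s1,s2,v,u,x,y). (s1,s2)) - ent P (\<lambda>(s1,s2,v,u,x,y). s1)
     - ent P (\<lambda>(s1,s2,v,u,x,y). (s1,s2,v)) + ent P (\<lambda>(s1,s2,v,u,x,y). (s1,v))"

definition eC2C :: "('s1 \<times> 's2 \<times> 'v \<times> 'u \<times> 'x \<times> 'y) pmf \<Rightarrow> real" where
  "eC2C P = ent P (\<lambda>(s1,s2,v,u,x,y). s2)
     - ent P (\<lambda>(s1,s2,v,u,x,y). (s2,v)) + ent P (\<lambda>(s1,s2,v,u,x,y). v)"

text \<open>If the outcome \<open>c\<close> reveals the intermediate value, the mixture has a single
  term. Composite laws record all their intermediate values, so their pmfs become plain
  products.\<close>

lemma pmf_bind_determined:
  assumes "\<And>a' b. a' \<in> set_pmf p \<Longrightarrow> c \<in> set_pmf (k a') \<Longrightarrow> a' = a"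
  shows "pmf (bind_pmf p k) c = pmf p a * pmf (k a) c"
proof -
  have "pmf (bind_pmf p k) c = measure_pmf.expectation p (\<lambda>a'. pmf (k a') c)"
    by (rule pmf_bind)
  also have "\<dots> = (\<Sum>a'\<in>{a}. pmf p a' *\<^sub>R pmf (k a') c)"
    by (rule integral_measure_pmf) (use assms in \<open>auto simp: set_pmf_iff\<close>)
  finally show ?thesis by simp
qed

lemma pmf_aux_law: "pmf (aux_law p ch qv qu qx) (s1, s2, v, u, x, y) =
  pmf p (s1, s2) * pmf (qv s1 s2) v * pmf (qu s1 s2 v) u * pmf (qx u s1 v) x * pmf (ch x s1 s2) y"
  unfolding aux_law_def split_def
  by (subst pmf_bind_determined[where a="(s1,s2)"], force,
      subst pmf_bind_determined[where a="v"], force,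
      subst pmf_bind_determined[where a="u"], force,
      subst pmf_bind_determined[where a="x"], force,
      subst pmf_bind_determined[where a="y"], force) simp

lemma map_aux_law:
  "map_pmf h (aux_law p ch qv qu qx) = do {
     (s1, s2) \<leftarrow> p;
     v \<leftarrow> qv s1 s2;
     u \<leftarrow> qu s1 s2 v;
     x \<leftarrow> qx u s1 v;
     y \<leftarrow> ch x s1 s2;
     return_pmf (h (s1, s2, v, u, x, y))
   }"
  unfolding aux_law_def by (simp add: map_bind_pmf split_def)

lemma finite_set_aux_law:
  fixes p :: "('s1::finite \<times> 's2::finite) pmf" and ch :: "'x::finite \<Rightarrow> 's1 \<Rightarrow> 's2 \<Rightarrow> 'y::finite pmf"
  assumes "\<And>s1 s2. finite (set_pmf (qv s1 s2))" "\<And>s1 s2 v. finite (set_pmf (qu s1 s2 v))"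
  shows "finite (set_pmf (aux_law p ch qv qu qx))"
  unfolding aux_law_def by (auto simp: split_def intro!: finite_UN_I assms)

lemma map_aux_law_S: "map_pmf (\<lambda>(s1,s2,v,u,x,y). (s1,s2)) (aux_law p ch qv qu qx) = p"
  unfolding map_aux_law by (simp add: split_def bind_return_pmf')

lemma ent_aux_law_S: "ent (aux_law p ch qv qu qx) (\<lambda>(s1,s2,v,u,x,y). f s1 s2) = ent p (\<lambda>(s1,s2). f s1 s2)"
  by (subst (2) map_aux_law_S[symmetric, of p ch qv qu qx]) (simp add: ent_map split_def)

text \<open>The chain rule for a mixture: if the observation \<open>G\<close> shows the index
  \<open>q\<close> in addition to \<open>F\<close>, its entropy is that of the index plus the mean
  entropy of \<open>F\<close> within the components.\<close>

lemma ent_pair_bind: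
  assumes fin: "finite (set_pmf L)" "\<And>q. q \<in> set_pmf L \<Longrightarrow> finite (set_pmf (Q q))"
    and G: "\<And>q q' \<omega> \<omega>'. G (h q \<omega>) = G (h q' \<omega>') \<longleftrightarrow> q = q' \<and> F q \<omega> = F q' \<omega>'"
  shows "ent (bind_pmf L (\<lambda>q. map_pmf (h q) (Q q))) G =
    ent L id + measure_pmf.expectation L (\<lambda>q. ent (Q q) (F q))"
proof -
  let ?M = "bind_pmf L (\<lambda>q. map_pmf (Pair q) (Q q))"
  have finM: "finite (set_pmf ?M)" using fin by auto
  have "ent (bind_pmf L (\<lambda>q. map_pmf (h q) (Q q))) G = ent (map_pmf (\<lambda>(q, \<omega>). h q \<omega>) ?M) G"
    by (simp add: map_bind_pmf map_pmf_comp)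
  also have "\<dots> = measure_pmf.expectation ?M (\<lambda>x. - log 2 (pr ?M (\<lambda>(q, \<omega>). G (h q \<omega>)) x))"
    unfolding ent_map by (simp add: ent_def split_def)
  also have "\<dots> = measure_pmf.expectation L (\<lambda>q. measure_pmf.expectation (map_pmf (Pair q) (Q q))
      (\<lambda>x. - log 2 (pr ?M (\<lambda>(q, \<omega>). G (h q \<omega>)) x)))"
    using fin by (subst pmf_expectation_bind[where A="set_pmf L"]) (auto simp: expectation_sum[of "set_pmf L"] sum_negf)
  also have "\<dots> = measure_pmf.expectation L (\<lambda>q. measure_pmf.expectation (Q q)
      (\<lambda>\<omega>. - log 2 (pmf L q) + - log 2 (pr (Q q) (F q) \<omega>)))"
  proof (intro expectation_cong_pmf)
    fix q assume q: "q \<in> set_pmf L"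
    have "measure_pmf.expectation (map_pmf (Pair q) (Q q)) (\<lambda>x. - log 2 (pr ?M (\<lambda>(q, \<omega>). G (h q \<omega>)) x)) =
      measure_pmf.expectation (Q q) (\<lambda>\<omega>. - log 2 (pr ?M (\<lambda>(q, \<omega>). G (h q \<omega>)) (q, \<omega>)))" by simp
    also have "\<dots> = measure_pmf.expectation (Q q) (\<lambda>\<omega>. - log 2 (pmf L q) + - log 2 (pr (Q q) (F q) \<omega>))"
    proof (intro expectation_cong_pmf)
      fix \<omega> assume w: "\<omega> \<in> set_pmf (Q q)"
      have "pr ?M (\<lambda>(q, \<omega>). G (h q \<omega>)) (q, \<omega>) = measure ?M {(q', \<omega>'). q' = q \<and> F q \<omega>' = F q \<omega>}"
        unfolding pr_def by (intro arg_cong[where f="measure ?M"]) (auto simp: G)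
      also have "\<dots> = pmf (map_pmf (\<lambda>(q', \<omega>'). q' = q \<and> F q \<omega>' = F q \<omega>) ?M) True"
        by (simp add: pmf_map vimage_def split_def)
      also have "map_pmf (\<lambda>(q', \<omega>'). q' = q \<and> F q \<omega>' = F q \<omega>) ?M =
          bind_pmf L (\<lambda>q'. map_pmf (\<lambda>\<omega>'. q' = q \<and> F q \<omega>' = F q \<omega>) (Q q'))"
        by (simp add: map_bind_pmf map_pmf_comp)
      also have "pmf \<dots> True = pmf L q * pmf (map_pmf (\<lambda>\<omega>'. q = q \<and> F q \<omega>' = F q \<omega>) (Q q)) True"
        by (rule pmf_bind_determined) auto
      also have "\<dots> = pmf L q * pr (Q q) (F q) \<omega>"
        by (simp add: pr_def pmf_map vimage_def)
      finally show "- log 2 (pr ?M (\<lambda>(q, \<omega>). G (h q \<omega>)) (q, \<omega>)) = - log 2 (pmf L q) + - log 2 (pr (Q q) (F q) \<omega>)"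
        using q pr_pos[OF w, of "F q"] by (simp add: log_mult set_pmf_iff)
    qed
    finally show "measure_pmf.expectation (map_pmf (Pair q) (Q q)) (\<lambda>x. - log 2 (pr ?M (\<lambda>(q, \<omega>). G (h q \<omega>)) x)) =
       measure_pmf.expectation (Q q) (\<lambda>\<omega>. - log 2 (pmf L q) + - log 2 (pr (Q q) (F q) \<omega>))" .
  qed
  also have "\<dots> = measure_pmf.expectation L (\<lambda>q. - log 2 (pmf L q) + ent (Q q) (F q))"
  proof (intro expectation_cong_pmf)
    fix q assume q: "q \<in> set_pmf L"
    show "measure_pmf.expectation (Q q) (\<lambda>\<omega>. - log 2 (pmf L q) + - log 2 (pr (Q q) (F q) \<omega>)) = - log 2 (pmf L q) + ent (Q q) (F q)"
      unfolding ent_def by (subst Bochner_Integration.integral_add) (auto intro!: integrable_measure_pmf_finite fin q)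
  qed
  also have "\<dots> = ent L id + measure_pmf.expectation L (\<lambda>q. ent (Q q) (F q))"
    by (subst Bochner_Integration.integral_add)
      (auto intro!: integrable_measure_pmf_finite fin simp: ent_def pr_def measure_pmf_single)
  finally show ?thesis .
qed

text \<open>Concavity of entropy: keeping the index gives equality in the chain rule, and by
  subadditivity hiding it costs at most the entropy of the index.\<close>

lemma ent_bind_concave:
  assumes fin: "finite (set_pmf L)" "\<And>q. q \<in> set_pmf L \<Longrightarrow> finite (set_pmf (Q q))"
    and G: "\<And>q \<omega>. G (h q \<omega>) = F \<omega>"
  shows "measure_pmf.expectation L (\<lambda>q. ent (Q q) F) \<le> ent (bind_pmf L (\<lambda>q. map_pmf (h q) (Q q))) G"
proof -
  let ?M = "bind_pmf L (\<lambda>q. map_pmf (Pair q) (Q q))"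
  have finM: "finite (set_pmf ?M)" using fin by auto
  have "ent L id + measure_pmf.expectation L (\<lambda>q. ent (Q q) F) = ent ?M (\<lambda>x. (fst x, F (snd x)))"
    using fin by (intro ent_pair_bind[symmetric]) auto
  also have "\<dots> \<le> ent ?M fst + ent ?M (\<lambda>x. F (snd x))"
    by (rule ent_subadd[OF finM])
  also have "ent ?M fst = ent L id"
    by (rule ent_law_cong) (simp add: map_bind_pmf map_pmf_comp bind_return_pmf')
  also have "ent ?M (\<lambda>x. F (snd x)) = ent (bind_pmf L (\<lambda>q. map_pmf (h q) (Q q))) G"
    by (rule ent_law_cong) (simp add: map_bind_pmf map_pmf_comp G)
  finally show ?thesis by simp
qed

text \<open>The time sharing index is drawn independently of the states and stored as the first
  component of \<open>V\<close>. The mixed law is then again a product of kernels, and the kernels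
  of \<open>U\<close> and \<open>X\<close> read the index from \<open>V\<close>.\<close>

definition mix_v where "mix_v L qv = (\<lambda>s1 s2. bind_pmf L (\<lambda>q. map_pmf (Pair q) (qv q s1 s2)))"
definition mix_u where "mix_u qu = (\<lambda>s1 s2 w. qu (fst w) s1 s2 (snd w))"
definition mix_x where "mix_x qx = (\<lambda>u s1 w. qx (fst w) u s1 (snd w))"

lemma aux_law_mix:
  "aux_law p ch (mix_v L qv) (mix_u qu) (mix_x qx) =
   bind_pmf L (\<lambda>q. map_pmf (\<lambda>(s1,s2,v,u,x,y). (s1,s2,(q,v),u,x,y)) (aux_law p ch (qv q) (qu q) (qx q)))"
  unfolding map_aux_law unfolding aux_law_def mix_v_def mix_u_def mix_x_def
  by (subst bind_commute_pmf) (simp add: split_def bind_assoc_pmf bind_map_pmf)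

text \<open>Every entropy that involves \<open>V\<close> shows the index, so \<open>ent L id\<close>
  cancels and the mean remains; entropies of the states alone are the same for all components. Only
  the entropy of (Y,S2) without \<open>V\<close>, which occurs in \<open>eC1\<close>, hides the
  index. It is concave and enters with a minus sign, which gives an inequality in the useful
  direction.\<close>

lemma time_sharing:
  fixes p :: "('s1::finite \<times> 's2::finite) pmf" and ch :: "'x::finite \<Rightarrow> 's1 \<Rightarrow> 's2 \<Rightarrow> 'y::finite pmf"
    and L :: "'q pmf" and qv :: "'q \<Rightarrow> 's1 \<Rightarrow> 's2 \<Rightarrow> 'v pmf" and qu :: "'q \<Rightarrow> 's1 \<Rightarrow> 's2 \<Rightarrow> 'v \<Rightarrow> 'u pmf"
    and qx :: "'q \<Rightarrow> 'u \<Rightarrow> 's1 \<Rightarrow> 'v \<Rightarrow> 'x pmf"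
  assumes fin: "finite (set_pmf L)" "\<And>q s1 s2. finite (set_pmf (qv q s1 s2))" "\<And>q s1 s2 v. finite (set_pmf (qu q s1 s2 v))"
  defines "P \<equiv> aux_law p ch (mix_v L qv) (mix_u qu) (mix_x qx)" and "Q \<equiv> \<lambda>q. aux_law p ch (qv q) (qu q) (qx q)"
  shows "eRate P = measure_pmf.expectation L (\<lambda>q. eRate (Q q))"
    and "eC1 P \<le> measure_pmf.expectation L (\<lambda>q. eC1 (Q q))"
    and "eC2 P = measure_pmf.expectation L (\<lambda>q. eC2 (Q q))"
    and "eC2C P = measure_pmf.expectation L (\<lambda>q. eC2C (Q q))"
proof -
  have finQ: "finite (set_pmf (Q q))" for q unfolding Q_def by (intro finite_set_aux_law fin)
  note int = integrable_measure_pmf_finite[OF fin(1)]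
  let ?h = "\<lambda>q (s1,s2,v,u,x,y). (s1,s2,(q,v),u,x,y)"
  have P: "P = bind_pmf L (\<lambda>q. map_pmf (?h q) (Q q))"
    unfolding P_def Q_def by (rule aux_law_mix)
  have e: "ent P (\<lambda>(s1,s2,v,u,x,y). f s1 s2 (snd v) u x y (fst v)) =
      ent L id + measure_pmf.expectation L (\<lambda>q. ent (Q q) (\<lambda>(s1,s2,v,u,x,y). F s1 s2 v u x y))"
    if f: "\<And>s1 s2 v u x y q s1' s2' v' u' x' y' q'. f s1 s2 v u x y q = f s1' s2' v' u' x' y' q' \<longleftrightarrow>
      q = q' \<and> F s1 s2 v u x y = F s1' s2' v' u' x' y'"
    for f :: "'s1 \<Rightarrow> 's2 \<Rightarrow> 'v \<Rightarrow> 'u \<Rightarrow> 'x \<Rightarrow> 'y \<Rightarrow> 'q \<Rightarrow> 'f" and F :: "'s1 \<Rightarrow> 's2 \<Rightarrow> 'v \<Rightarrow> 'u \<Rightarrow> 'x \<Rightarrow> 'y \<Rightarrow> 'g"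
    unfolding P by (rule ent_pair_bind) (auto simp: fin finQ split_def f)
  have c: "measure_pmf.expectation L (\<lambda>q. ent (Q q) (\<lambda>(s1,s2,v,u,x,y). (y,s2))) \<le> ent P (\<lambda>(s1,s2,v,u,x,y). (y,s2))"
    unfolding P by (rule ent_bind_concave) (auto simp: fin finQ)
  have s: "ent (Q q) (\<lambda>(s1,s2,v,u,x,y). f s1 s2) = ent P (\<lambda>(s1,s2,v,u,x,y). f s1 s2)" for q and f :: "'s1 \<Rightarrow> 's2 \<Rightarrow> 'e"
    unfolding P_def Q_def by (simp add: ent_aux_law_S)
  have [simp]: "ent P (\<lambda>(s1,s2,v,u,x,y). (y,s2,v)) = ent L id + measure_pmf.expectation L (\<lambda>q. ent (Q q) (\<lambda>(s1,s2,v,u,x,y). (y,s2,v)))"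
    using e[of "\<lambda>s1 s2 v u x y q. (y,s2,(q,v))" "\<lambda>s1 s2 v u x y. (y,s2,v)"] by auto
  have [simp]: "ent P (\<lambda>(s1,s2,v,u,x,y). (u,y,s2,v)) = ent L id + measure_pmf.expectation L (\<lambda>q. ent (Q q) (\<lambda>(s1,s2,v,u,x,y). (u,y,s2,v)))"
    using e[of "\<lambda>s1 s2 v u x y q. (u,y,s2,(q,v))" "\<lambda>s1 s2 v u x y. (u,y,s2,v)"] by auto
  have [simp]: "ent P (\<lambda>(s1,s2,v,u,x,y). (s1,v)) = ent L id + measure_pmf.expectation L (\<lambda>q. ent (Q q) (\<lambda>(s1,s2,v,u,x,y). (s1,v)))"
    using e[of "\<lambda>s1 s2 v u x y q. (s1,(q,v))" "\<lambda>s1 s2 v u x y. (s1,v)"] by auto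
  have [simp]: "ent P (\<lambda>(s1,s2,v,u,x,y). (u,s1,v)) = ent L id + measure_pmf.expectation L (\<lambda>q. ent (Q q) (\<lambda>(s1,s2,v,u,x,y). (u,s1,v)))"
    using e[of "\<lambda>s1 s2 v u x y q. (u,s1,(q,v))" "\<lambda>s1 s2 v u x y. (u,s1,v)"] by auto
  have [simp]: "ent P (\<lambda>(s1,s2,v,u,x,y). (s1,s2,v)) = ent L id + measure_pmf.expectation L (\<lambda>q. ent (Q q) (\<lambda>(s1,s2,v,u,x,y). (s1,s2,v)))"
    using e[of "\<lambda>s1 s2 v u x y q. (s1,s2,(q,v))" "\<lambda>s1 s2 v u x y. (s1,s2,v)"] by auto
  have [simp]: "ent P (\<lambda>(s1,s2,v,u,x,y). (s2,v)) = ent L id + measure_pmf.expectation L (\<lambda>q. ent (Q q) (\<lambda>(s1,s2,v,u,x,y). (s2,v)))"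
    using e[of "\<lambda>s1 s2 v u x y q. (s2,(q,v))" "\<lambda>s1 s2 v u x y. (s2,v)"] by auto
  have [simp]: "ent P (\<lambda>(s1,s2,v,u,x,y). v) = ent L id + measure_pmf.expectation L (\<lambda>q. ent (Q q) (\<lambda>(s1,s2,v,u,x,y). v))"
    using e[of "\<lambda>s1 s2 v u x y q. (q,v)" "\<lambda>s1 s2 v u x y. v"] by auto
  show "eRate P = measure_pmf.expectation L (\<lambda>q. eRate (Q q))"
    unfolding eRate_def by (simp add: int)
  show "eC1 P \<le> measure_pmf.expectation L (\<lambda>q. eC1 (Q q))"
    unfolding eC1_def using c by (simp add: int s)
  show "eC2 P = measure_pmf.expectation L (\<lambda>q. eC2 (Q q))"
    unfolding eC2_def by (simp add: int s)
  show "eC2C P = measure_pmf.expectation L (\<lambda>q. eC2C (Q q))"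
    unfolding eC2C_def by (simp add: int s)
qed


lemma set_aux_law_subset:
  assumes "\<And>s1 s2. set_pmf (qv s1 s2) \<subseteq> A" "\<And>s1 s2 v. v \<in> A \<Longrightarrow> set_pmf (qu s1 s2 v) \<subseteq> B v"
    and "(s1, s2, v, u, x, y) \<in> set_pmf (aux_law p ch qv qu qx)"
  shows "v \<in> A \<and> u \<in> B v"
  using assms(3,1,2) unfolding aux_law_def by (fastforce simp: split_def)

text \<open>In all four functionals \<open>U\<close> occurs only together with \<open>V\<close>. The
  labels of \<open>U\<close> may therefore be chosen separately for each value of \<open>V\<close>,
  which is what the reduction of the alphabet of \<open>U\<close> produces.\<close>

lemma aux_law_relabel:
  fixes p :: "('s1 \<times> 's2) pmf" and ch :: "'x \<Rightarrow> 's1 \<Rightarrow> 's2 \<Rightarrow> 'y pmf"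
    and qv :: "'s1 \<Rightarrow> 's2 \<Rightarrow> 'v pmf" and qu :: "'s1 \<Rightarrow> 's2 \<Rightarrow> 'v \<Rightarrow> 'u pmf"
    and qx :: "'u \<Rightarrow> 's1 \<Rightarrow> 'v \<Rightarrow> 'x pmf"
    and \<pi> :: "'v \<Rightarrow> 'v2" and \<tau> :: "'v \<Rightarrow> 'u \<Rightarrow> 'u2"
  assumes inj: "inj_on \<pi> A" "\<And>v. v \<in> A \<Longrightarrow> inj_on (\<tau> v) (B v)"
    and supp: "\<And>s1 s2. set_pmf (qv s1 s2) \<subseteq> A" "\<And>s1 s2 v. v \<in> A \<Longrightarrow> set_pmf (qu s1 s2 v) \<subseteq> B v"
  defines "\<pi>' \<equiv> inv_into A \<pi>"
  defines "P \<equiv> aux_law p ch qv qu qx"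
    and "P' \<equiv> aux_law p ch (\<lambda>s1 s2. map_pmf \<pi> (qv s1 s2)) (\<lambda>s1 s2 w. map_pmf (\<tau> (\<pi>' w)) (qu s1 s2 (\<pi>' w)))
      (\<lambda>u' s1 w. qx (inv_into (B (\<pi>' w)) (\<tau> (\<pi>' w)) u') s1 (\<pi>' w))"
  shows "eRate P' = eRate P" "eC1 P' = eC1 P" "eC2 P' = eC2 P" "eC2C P' = eC2C P"
proof -
  let ?h = "\<lambda>(s1,s2,v,u,x,y). (s1,s2,\<pi> v,\<tau> v u,x,y)"
  have eq: "P' = map_pmf ?h P"
    unfolding P'_def P_def map_aux_law unfolding aux_law_def bind_map_pmf split_def
  proof (intro bind_pmf_cong refl)
    fix s v assume "s \<in> set_pmf p" and v: "v \<in> set_pmf (qv (fst s) (snd s))"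
    then have vA: "v \<in> A" using supp(1) by auto
    then have [simp]: "\<pi>' (\<pi> v) = v" using inj by (simp add: \<pi>'_def)
    show "qu (fst s) (snd s) (\<pi>' (\<pi> v)) = qu (fst s) (snd s) v" by simp
    fix u assume "u \<in> set_pmf (qu (fst s) (snd s) v)"
    then have uB: "u \<in> B v" using supp(2)[OF vA] by auto
    then have [simp]: "inv_into (B v) (\<tau> v) (\<tau> v u) = u" using inj(2)[OF vA] by simp
    show "qx (inv_into (B (\<pi>' (\<pi> v))) (\<tau> (\<pi>' (\<pi> v))) (\<tau> (\<pi>' (\<pi> v)) u)) (fst s) (\<pi>' (\<pi> v)) = qx u (fst s) v"
      by simp
    show "return_pmf (fst s, snd s, \<pi> v, \<tau> (\<pi>' (\<pi> v)) u, xa, ya) =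
       return_pmf
            (fst (fst s, snd s, v, u, xa, ya), fst (snd (fst s, snd s, v, u, xa, ya)),
             \<pi> (fst (snd (snd (fst s, snd s, v, u, xa, ya)))),
             \<tau> (fst (snd (snd (fst s, snd s, v, u, xa, ya))))
              (fst (snd (snd (snd (fst s, snd s, v, u, xa, ya))))),
             fst (snd (snd (snd (snd (fst s, snd s, v, u, xa, ya))))),
             snd (snd (snd (snd (snd (fst s, snd s, v, u, xa, ya))))))" for xa ya
      by simp
  qed
  have d: "v \<in> A" "u \<in> B v" if "(s1, s2, v, u, x, y) \<in> set_pmf P" for s1 s2 v u x y
    using set_aux_law_subset[of qv A qu B s1 s2 v u x y p ch qx, OF supp] that unfolding P_def by auto
  have i: "\<pi> v = \<pi> v' \<longleftrightarrow> v = v'" if "(s1, s2, v, u, x, y) \<in> set_pmf P" "(s1', s2', v', u', x', y') \<in> set_pmf P"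
    for s1 s2 v u x y s1' s2' v' u' x' y'
    using d[OF that(1)] d[OF that(2)] inj(1) by (auto dest: inj_onD)
  have j: "\<tau> v u = \<tau> v u' \<longleftrightarrow> u = u'" if "(s1, s2, v, u, x, y) \<in> set_pmf P" "(s1', s2', v, u', x', y') \<in> set_pmf P"
    for s1 s2 v u x y s1' s2' u' x' y'
    using d[OF that(1)] d[OF that(2)] inj(2) by (auto dest: inj_onD)
  note [simp] = eq ent_map split_def
  have e: "ent P' (\<lambda>(s1,s2,v,u,x,y). (y,s2,v)) = ent P (\<lambda>(s1,s2,v,u,x,y). (y,s2,v))"
    "ent P' (\<lambda>(s1,s2,v,u,x,y). (u,y,s2,v)) = ent P (\<lambda>(s1,s2,v,u,x,y). (u,y,s2,v))"
    "ent P' (\<lambda>(s1,s2,v,u,x,y). (s1,v)) = ent P (\<lambda>(s1,s2,v,u,x,y). (s1,v))"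
    "ent P' (\<lambda>(s1,s2,v,u,x,y). (u,s1,v)) = ent P (\<lambda>(s1,s2,v,u,x,y). (u,s1,v))"
    "ent P' (\<lambda>(s1,s2,v,u,x,y). (s1,s2,v)) = ent P (\<lambda>(s1,s2,v,u,x,y). (s1,s2,v))"
    "ent P' (\<lambda>(s1,s2,v,u,x,y). (s2,v)) = ent P (\<lambda>(s1,s2,v,u,x,y). (s2,v))"
    "ent P' (\<lambda>(s1,s2,v,u,x,y). v) = ent P (\<lambda>(s1,s2,v,u,x,y). v)"
    by (simp, intro ent_cong, clarsimp, metis i j)+
  have e': "ent P' (\<lambda>(s1,s2,v,u,x,y). s1) = ent P (\<lambda>(s1,s2,v,u,x,y). s1)"
    "ent P' (\<lambda>(s1,s2,v,u,x,y). s2) = ent P (\<lambda>(s1,s2,v,u,x,y). s2)"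
    "ent P' (\<lambda>(s1,s2,v,u,x,y). (s1,s2)) = ent P (\<lambda>(s1,s2,v,u,x,y). (s1,s2))"
    "ent P' (\<lambda>(s1,s2,v,u,x,y). (y,s2)) = ent P (\<lambda>(s1,s2,v,u,x,y). (y,s2))"
    by simp_all
  show "eRate P' = eRate P" "eC1 P' = eC1 P" "eC2 P' = eC2 P" "eC2C P' = eC2C P"
    unfolding eRate_def eC1_def eC2_def eC2C_def e e' by (rule refl)+
qed

section \<open>Reduction of the alphabets by reweighting\<close>

lemma pr_sum:
  assumes "finite S" "set_pmf P \<subseteq> S"
  shows "pr P F \<omega> = (\<Sum>\<omega>'\<in>{\<omega>'\<in>S. F \<omega>' = F \<omega>}. pmf P \<omega>')"
proof -
  have "pr P F \<omega> = measure_pmf.prob P {\<omega>'\<in>S. F \<omega>' = F \<omega>}"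
    unfolding pr_def using assms by (intro measure_prob_cong_0) (auto simp: pmf_eq_0_set_pmf)
  then show ?thesis using assms(1) by (simp add: measure_measure_pmf_finite)
qed

text \<open>A factor that depends only on \<open>g\<close> leaves the conditional laws given
  \<open>g\<close> alone. If \<open>F\<close> and \<open>F'\<close> both determine \<open>g\<close>,
  the factor cancels in the ratio of their probabilities, so the difference of the two entropies is
  linear in the factor although each entropy is not.\<close>

lemma
  assumes fin: "finite (set_pmf P)" and rw: "\<And>\<omega>. pmf P' \<omega> = r (g \<omega>) * pmf P \<omega>"
  shows pr_reweight: "(\<And>\<omega> \<omega>'. F \<omega> = F \<omega>' \<Longrightarrow> g \<omega> = g \<omega>') \<Longrightarrow> pr P' F \<omega> = r (g \<omega>) * pr P F \<omega>"
    and ent_diff_reweight: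
    "(\<And>\<omega> \<omega>'. F \<omega> = F \<omega>' \<Longrightarrow> g \<omega> = g \<omega>') \<Longrightarrow> (\<And>\<omega> \<omega>'. F' \<omega> = F' \<omega>' \<Longrightarrow> g \<omega> = g \<omega>') \<Longrightarrow>
      ent P' F - ent P' F' =
      (\<Sum>\<omega>\<in>set_pmf P. r (g \<omega>) * (pmf P \<omega> * (log 2 (pr P F' \<omega>) - log 2 (pr P F \<omega>))))"
proof -
  have sub: "set_pmf P' \<subseteq> set_pmf P" by (auto simp: set_pmf_iff rw)
  show pr: "pr P' F \<omega> = r (g \<omega>) * pr P F \<omega>" if F: "\<And>\<omega> \<omega>'. F \<omega> = F \<omega>' \<Longrightarrow> g \<omega> = g \<omega>'" for F :: "'a \<Rightarrow> 'f" and \<omega>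
  proof -
    have "pr P' F \<omega> = (\<Sum>\<omega>'\<in>{\<omega>'\<in>set_pmf P. F \<omega>' = F \<omega>}. r (g \<omega>) * pmf P \<omega>')"
      unfolding pr_sum[OF fin sub] by (intro sum.cong refl) (auto simp: rw dest: F)
    also have "\<dots> = r (g \<omega>) * pr P F \<omega>"
      by (simp add: pr_sum[OF fin order_refl] sum_distrib_left)
    finally show ?thesis .
  qed
  assume F: "\<And>\<omega> \<omega>'. F \<omega> = F \<omega>' \<Longrightarrow> g \<omega> = g \<omega>'" and F': "\<And>\<omega> \<omega>'. F' \<omega> = F' \<omega>' \<Longrightarrow> g \<omega> = g \<omega>'"
  have pr': "pr P' F' \<omega> = r (g \<omega>) * pr P F' \<omega>" for \<omega>
  proof -
    have "pr P' F' \<omega> = (\<Sum>\<omega>'\<in>{\<omega>'\<in>set_pmf P. F' \<omega>' = F' \<omega>}. r (g \<omega>) * pmf P \<omega>')"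
      unfolding pr_sum[OF fin sub] by (intro sum.cong refl) (auto simp: rw dest: F')
    also have "\<dots> = r (g \<omega>) * pr P F' \<omega>"
      by (simp add: pr_sum[OF fin order_refl] sum_distrib_left)
    finally show ?thesis .
  qed
  have "ent P' F - ent P' F' = (\<Sum>\<omega>\<in>set_pmf P. pmf P' \<omega> * (log 2 (pr P' F' \<omega>) - log 2 (pr P' F \<omega>)))"
    unfolding ent_def expectation_sum[OF fin sub]
    by (simp add: sum_subtractf[symmetric] algebra_simps sum_negf)
  also have "\<dots> = (\<Sum>\<omega>\<in>set_pmf P. r (g \<omega>) * (pmf P \<omega> * (log 2 (pr P F' \<omega>) - log 2 (pr P F \<omega>))))"
  proof (intro sum.cong refl)
    fix \<omega> assume w: "\<omega> \<in> set_pmf P"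
    show "pmf P' \<omega> * (log 2 (pr P' F' \<omega>) - log 2 (pr P' F \<omega>)) =
       r (g \<omega>) * (pmf P \<omega> * (log 2 (pr P F' \<omega>) - log 2 (pr P F \<omega>)))"
    proof (cases "r (g \<omega>) = 0")
      case False
      have "0 \<le> r (g \<omega>) * pmf P \<omega>" using rw[of \<omega>] pmf_nonneg[of P' \<omega>] by simp
      then have "0 < r (g \<omega>)" using w False by (auto simp: zero_le_mult_iff set_pmf_iff)
      then show ?thesis
        using pr_pos[OF w, of F] pr_pos[OF w, of F'] by (simp add: rw pr[OF F] pr' log_mult)
    qed (simp add: rw)
  qed
  finally show "ent P' F - ent P' F' =
      (\<Sum>\<omega>\<in>set_pmf P. r (g \<omega>) * (pmf P \<omega> * (log 2 (pr P F' \<omega>) - log 2 (pr P F \<omega>))))" .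
qed

definition reweight :: "('a \<Rightarrow> real) \<Rightarrow> 'a pmf \<Rightarrow> 'a pmf" where
  "reweight r q = embed_pmf (\<lambda>a. r a * pmf q a)"

lemma pmf_reweight:
  assumes "finite A" "set_pmf q \<subseteq> A" "\<And>a. 0 \<le> r a" "(\<Sum>a\<in>A. r a * pmf q a) = 1"
  shows "pmf (reweight r q) a = r a * pmf q a"
  unfolding reweight_def
proof (rule pmf_embed_pmf)
  have "(\<integral>\<^sup>+ a. ennreal (r a * pmf q a) \<partial>count_space UNIV) = (\<Sum>a\<in>A. ennreal (r a * pmf q a))"
    using assms by (intro nn_integral_count_space') (auto simp: set_pmf_iff)
  also have "\<dots> = ennreal (\<Sum>a\<in>A. r a * pmf q a)"
    using assms by (intro sum_ennreal) auto
  finally show "(\<integral>\<^sup>+ a. ennreal (r a * pmf q a) \<partial>count_space UNIV) = 1"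
    by (simp add: assms)
qed (auto simp: assms)

lemma pmf_bind_finite:
  assumes "finite A" "set_pmf p \<subseteq> A"
  shows "pmf (bind_pmf p k) c = (\<Sum>a\<in>A. pmf p a * pmf (k a) c)"
  unfolding pmf_bind by (rule expectation_sum[OF assms])


text \<open>Reweighting the values of \<open>U\<close>, for each value of \<open>V\<close>, such that the law of \<open>(S\<^sub>1,S\<^sub>2,X)\<close> given \<open>V\<close> is kept
  changes the conditional entropies given \<open>U\<close> linearly, so that conic Caratheodory bounds the number of values.\<close>

lemma reduce_u:
  fixes p :: "('s1::finite \<times> 's2::finite) pmf" and ch :: "'x::finite \<Rightarrow> 's1 \<Rightarrow> 's2 \<Rightarrow> 'y::finite pmf"
    and qv :: "'s1 \<Rightarrow> 's2 \<Rightarrow> 'v pmf" and qu :: "'s1 \<Rightarrow> 's2 \<Rightarrow> 'v \<Rightarrow> 'u pmf"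
    and qx :: "'u \<Rightarrow> 's1 \<Rightarrow> 'v \<Rightarrow> 'x pmf"
  assumes finv: "\<And>s1 s2. finite (set_pmf (qv s1 s2))" and finu: "\<And>s1 s2 v. finite (set_pmf (qu s1 s2 v))"
  shows "\<exists>qu'. (\<forall>s1 s2 t1 t2 v. qu s1 s2 v = qu t1 t2 v \<longrightarrow> qu' s1 s2 v = qu' t1 t2 v) \<and>
    (\<forall>v. \<exists>B. finite B \<and> card B \<le> DIM((real ^ ('s1 \<times> 's2 \<times> 'x)) \<times> real) + 1 \<and> (\<forall>s1 s2. set_pmf (qu' s1 s2 v) \<subseteq> B)) \<and>
    eRate (aux_law p ch qv qu' qx) = eRate (aux_law p ch qv qu qx) \<and>
    eC1 (aux_law p ch qv qu' qx) = eC1 (aux_law p ch qv qu qx) \<and>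
    eC2 (aux_law p ch qv qu' qx) = eC2 (aux_law p ch qv qu qx) \<and>
    eC2C (aux_law p ch qv qu' qx) = eC2C (aux_law p ch qv qu qx)"
proof -
  define P where "P = aux_law p ch qv qu qx"
  have finP: "finite (set_pmf P)" unfolding P_def by (intro finite_set_aux_law finv finu)
  define A where "A = (\<Union>s1 s2. set_pmf (qv s1 s2))"
  define B where "B v = (\<Union>s1 s2. set_pmf (qu s1 s2 v))" for v
  have finA: "finite A" and finB: "finite (B v)" for v by (auto simp: A_def B_def finv finu)
  have subA: "set_pmf (qv s1 s2) \<subseteq> A" and subB: "set_pmf (qu s1 s2 v) \<subseteq> B v" for s1 s2 v
    by (auto simp: A_def B_def)
  define FY where "FY = (\<lambda>(s1::'s1,s2::'s2,v::'v,u::'u,x::'x,y::'y). (u,y,s2,v))"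
  define FS where "FS = (\<lambda>(s1::'s1,s2::'s2,v::'v,u::'u,x::'x,y::'y). (u,s1,v))"
  define gvu where "gvu = (\<lambda>(s1::'s1,s2::'s2,v::'v,u::'u,x::'x,y::'y). (v,u))"
  have gvuF: "FS \<omega> = FS \<omega>' \<Longrightarrow> gvu \<omega> = gvu \<omega>'" "FY \<omega> = FY \<omega>' \<Longrightarrow> gvu \<omega> = gvu \<omega>'" for \<omega> \<omega>'
    by (auto simp: FS_def FY_def gvu_def split_def)
  define D where "D \<omega> = pmf P \<omega> * (log 2 (pr P FY \<omega>) - log 2 (pr P FS \<omega>))" for \<omega>
  define G where "G w = (\<Sum>\<omega>\<in>{\<omega>\<in>set_pmf P. gvu \<omega> = w}. D \<omega>)" for w
  \<comment> \<open>The first component keeps, for each pair of states, the law of X given this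
    \<open>v\<close>; the second keeps the share of \<open>v\<close> in the entropy difference of
    \<open>FS\<close> and \<open>FY\<close>, the only place where \<open>U\<close> enters a
    functional.\<close>
  define a :: "'v \<Rightarrow> 'u \<Rightarrow> (real ^ ('s1 \<times> 's2 \<times> 'x)) \<times> real" where
    "a v u = ((\<chi> i. case i of (s1, s2, x) \<Rightarrow> pmf (qu s1 s2 v) u * pmf (qx u s1 v) x), G (v, u))" for v u
  have "\<forall>v. \<exists>\<sigma>. (\<forall>i. 0 \<le> (\<sigma> i :: real)) \<and> card {i\<in>B v. \<sigma> i \<noteq> 0} \<le> DIM((real ^ ('s1 \<times> 's2 \<times> 'x)) \<times> real) + 1 \<and>
    (\<Sum>i\<in>B v. \<sigma> i *\<^sub>R a v i) = (\<Sum>i\<in>B v. a v i)"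
    by (intro allI conic_caratheodory finB)
  from choice[OF this] obtain \<rho> where \<rho>: "\<And>v u. 0 \<le> (\<rho> v u :: real)"
    "\<And>v. card {u\<in>B v. \<rho> v u \<noteq> 0} \<le> DIM((real ^ ('s1 \<times> 's2 \<times> 'x)) \<times> real) + 1"
    "\<And>v. (\<Sum>u\<in>B v. \<rho> v u *\<^sub>R a v u) = (\<Sum>u\<in>B v. a v u)"
    by blast
  have \<rho>x: "(\<Sum>u\<in>B v. \<rho> v u * (pmf (qu s1 s2 v) u * pmf (qx u s1 v) x)) = (\<Sum>u\<in>B v. pmf (qu s1 s2 v) u * pmf (qx u s1 v) x)"
    for v s1 s2 x
    using arg_cong[OF \<rho>(3)[of v], of "\<lambda>z. fst z $ (s1, s2, x)"]
    by (simp add: fst_sum a_def)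
  have \<rho>G: "(\<Sum>u\<in>B v. \<rho> v u * G (v, u)) = (\<Sum>u\<in>B v. G (v, u))" for v
    using arg_cong[OF \<rho>(3)[of v], of snd] by (simp add: snd_sum a_def)
  \<comment> \<open>Normalization needs no coordinate of its own: it follows by summing the
    preserved coordinates over \<open>x\<close>.\<close>
  have \<rho>1: "(\<Sum>u\<in>B v. \<rho> v u * pmf (qu s1 s2 v) u) = 1" for v s1 s2
  proof -
    have "(\<Sum>u\<in>B v. \<rho> v u * pmf (qu s1 s2 v) u) = (\<Sum>u\<in>B v. \<rho> v u * pmf (qu s1 s2 v) u * (\<Sum>x\<in>UNIV. pmf (qx u s1 v) x))"
      by (simp add: sum_pmf_eq_1)
    also have "\<dots> = (\<Sum>x\<in>UNIV. \<Sum>u\<in>B v. \<rho> v u * (pmf (qu s1 s2 v) u * pmf (qx u s1 v) x))"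
      unfolding sum_distrib_left by (subst sum.swap) (simp add: mult.assoc)
    also have "\<dots> = (\<Sum>x\<in>UNIV. \<Sum>u\<in>B v. pmf (qu s1 s2 v) u * pmf (qx u s1 v) x)"
      by (simp add: \<rho>x)
    also have "\<dots> = (\<Sum>u\<in>B v. pmf (qu s1 s2 v) u * (\<Sum>x\<in>UNIV. pmf (qx u s1 v) x))"
      unfolding sum_distrib_left by (subst sum.swap) simp
    also have "\<dots> = 1" by (simp add: sum_pmf_eq_1 finB subB)
    finally show ?thesis .
  qed
  define qu' where "qu' s1 s2 v = reweight (\<rho> v) (qu s1 s2 v)" for s1 s2 v
  have pmf_qu': "pmf (qu' s1 s2 v) u = \<rho> v u * pmf (qu s1 s2 v) u" for s1 s2 v u
    unfolding qu'_def by (intro pmf_reweight[OF finB subB] \<rho> \<rho>1)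
  define P' where "P' = aux_law p ch qv qu' qx"
  have rw: "pmf P' \<omega> = (case gvu \<omega> of (v, u) \<Rightarrow> \<rho> v u) * pmf P \<omega>" for \<omega>
    by (cases \<omega>) (simp add: P'_def P_def pmf_aux_law pmf_qu' gvu_def)
  have sub': "set_pmf (qu' s1 s2 v) \<subseteq> {u\<in>B v. \<rho> v u \<noteq> 0}" for s1 s2 v
    using subB[of s1 s2 v] by (auto simp: set_pmf_iff pmf_qu')
  \<comment> \<open>The law of X given the states and \<open>v\<close> is unchanged, and with it
    every entropy that does not involve \<open>U\<close>.\<close>
  have bx: "bind_pmf (qu' s1 s2 v) (\<lambda>u. qx u s1 v) = bind_pmf (qu s1 s2 v) (\<lambda>u. qx u s1 v)" for s1 s2 v
    using sub'[of s1 s2 v] \<rho>x[of v s1 s2] subB[of s1 s2 v]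
    by (intro pmf_eqI) (subst (1 2) pmf_bind_finite[OF finB[of v]], auto simp: pmf_qu' mult.assoc)
  have bx': "bind_pmf (qu' s1 s2 v) (\<lambda>u. bind_pmf (qx u s1 v) k) = bind_pmf (qu s1 s2 v) (\<lambda>u. bind_pmf (qx u s1 v) k)"
    for s1 s2 v and k :: "'x \<Rightarrow> 'f pmf"
    using bx[of s1 s2 v] by (simp add: bind_assoc_pmf[symmetric])
  have law: "map_pmf (\<lambda>(s1,s2,v,u,x,y). f s1 s2 v x y) P' = map_pmf (\<lambda>(s1,s2,v,u,x,y). f s1 s2 v x y) P" for f :: "_ \<Rightarrow> _ \<Rightarrow> _ \<Rightarrow> _ \<Rightarrow> _ \<Rightarrow> 'f"
    unfolding P'_def P_def map_aux_law split_def
    by (simp add: bx')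
  have law': "ent P' (\<lambda>(s1,s2,v,u,x,y). f s1 s2 v x y) = ent P (\<lambda>(s1,s2,v,u,x,y). f s1 s2 v x y)" for f :: "_ \<Rightarrow> _ \<Rightarrow> _ \<Rightarrow> _ \<Rightarrow> _ \<Rightarrow> 'f"
    by (rule ent_law_cong[OF law])
  have img: "gvu ` set_pmf P \<subseteq> Sigma A B"
    by (fastforce simp: P_def gvu_def dest: set_aux_law_subset[of qv A qu B, OF subA subB])
  have grp: "(\<Sum>\<omega>\<in>set_pmf P. r (gvu \<omega>) * D \<omega>) = (\<Sum>v\<in>A. \<Sum>u\<in>B v. r (v, u) * G (v, u))" for r :: "'v \<times> 'u \<Rightarrow> real"
  proof -
    have "(\<Sum>\<omega>\<in>set_pmf P. r (gvu \<omega>) * D \<omega>) = (\<Sum>w\<in>Sigma A B. \<Sum>\<omega>\<in>{\<omega>\<in>set_pmf P. gvu \<omega> = w}. r (gvu \<omega>) * D \<omega>)"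
      using finP img finA finB by (intro sum.group[symmetric]) auto
    also have "\<dots> = (\<Sum>w\<in>Sigma A B. r w * G w)"
      by (intro sum.cong refl) (simp add: G_def sum_distrib_left)
    finally show ?thesis by (simp add: sum.Sigma finA finB split_def)
  qed
  have "ent P' FS - ent P' FY = (\<Sum>\<omega>\<in>set_pmf P. (case gvu \<omega> of (v, u) \<Rightarrow> \<rho> v u) * D \<omega>)"
    unfolding D_def by (rule ent_diff_reweight[OF finP, where r="\<lambda>(v, u). \<rho> v u" and g=gvu]; (erule gvuF | rule rw))
  also have "\<dots> = (\<Sum>v\<in>A. \<Sum>u\<in>B v. G (v, u))"
    using grp[of "\<lambda>(v, u). \<rho> v u"] by (simp add: \<rho>G)
  also have "\<dots> = (\<Sum>\<omega>\<in>set_pmf P. 1 * D \<omega>)"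
    using grp[of "\<lambda>_. 1"] by simp
  also have "\<dots> = ent P FS - ent P FY"
    unfolding D_def by (rule ent_diff_reweight[OF finP, where r="\<lambda>_. 1" and g=gvu, symmetric]) (auto dest: gvuF)
  finally have diff: "ent P' FS - ent P' FY = ent P FS - ent P FY" .
  have "eRate P' = eRate P"
    unfolding eRate_def using diff unfolding FS_def FY_def by (simp add: law')
  moreover have "eC1 P' = eC1 P" "eC2 P' = eC2 P" "eC2C P' = eC2C P"
    unfolding eC1_def eC2_def eC2C_def by (simp_all add: law')
  moreover have "\<forall>v. \<exists>B. finite B \<and> card B \<le> DIM((real ^ ('s1 \<times> 's2 \<times> 'x)) \<times> real) + 1 \<and> (\<forall>s1 s2. set_pmf (qu' s1 s2 v) \<subseteq> B)"
  proof
    fix v show "\<exists>B. finite B \<and> card B \<le> DIM((real ^ ('s1 \<times> 's2 \<times> 'x)) \<times> real) + 1 \<and> (\<forall>s1 s2. set_pmf (qu' s1 s2 v) \<subseteq> B)"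
      using \<rho>(2)[of v] sub'[of _ _ v] finB[of v]
      by (intro exI[of _ "{u\<in>B v. \<rho> v u \<noteq> 0}"] conjI allI) (assumption | rule finite_subset[of _ "B v"] | blast)+
  qed
  moreover have "\<forall>s1 s2 t1 t2 v. qu s1 s2 v = qu t1 t2 v \<longrightarrow> qu' s1 s2 v = qu' t1 t2 v"
    by (auto simp: qu'_def)
  ultimately show ?thesis unfolding P_def P'_def by blast
qed

text \<open>The same reweighting for the values of \<open>V\<close>. What has to be preserved is the
  law of Y given the states, since H(Y,S2) stands alone in \<open>eC1\<close>, and one combination
  of conditional entropies for each of the four functionals. The weight of a value does not depend
  on the states, so state pairs that share a kernel continue to share it.\<close>

lemma reduce_v:
  fixes p :: "('s1::finite \<times> 's2::finite) pmf" and ch :: "'x::finite \<Rightarrow> 's1 \<Rightarrow> 's2 \<Rightarrow> 'y::finite pmf"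
    and qv :: "'s1 \<Rightarrow> 's2 \<Rightarrow> 'v pmf" and qu :: "'s1 \<Rightarrow> 's2 \<Rightarrow> 'v \<Rightarrow> 'u pmf"
    and qx :: "'u \<Rightarrow> 's1 \<Rightarrow> 'v \<Rightarrow> 'x pmf"
  assumes finv: "\<And>s1 s2. finite (set_pmf (qv s1 s2))" and finu: "\<And>s1 s2 v. finite (set_pmf (qu s1 s2 v))"
  shows "\<exists>qv'. (\<forall>s1 s2 t1 t2. qv s1 s2 = qv t1 t2 \<longrightarrow> qv' s1 s2 = qv' t1 t2) \<and>
    (\<exists>A. finite A \<and> card A \<le> DIM((real ^ ('s1 \<times> 's2 \<times> 'y)) \<times> real \<times> real \<times> real \<times> real) + 1 \<and> (\<forall>s1 s2. set_pmf (qv' s1 s2) \<subseteq> A)) \<and>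
    eRate (aux_law p ch qv' qu qx) = eRate (aux_law p ch qv qu qx) \<and>
    eC1 (aux_law p ch qv' qu qx) = eC1 (aux_law p ch qv qu qx) \<and>
    eC2 (aux_law p ch qv' qu qx) = eC2 (aux_law p ch qv qu qx) \<and>
    eC2C (aux_law p ch qv' qu qx) = eC2C (aux_law p ch qv qu qx)"
proof -
  define P where "P = aux_law p ch qv qu qx"
  have finP: "finite (set_pmf P)" unfolding P_def by (intro finite_set_aux_law finv finu)
  define A where "A = (\<Union>s1 s2. set_pmf (qv s1 s2))"
  have finA: "finite A" by (auto simp: A_def finv)
  have subA: "set_pmf (qv s1 s2) \<subseteq> A" for s1 s2
    by (auto simp: A_def)
  let ?\<Omega> = "\<lambda>f (s1::'s1,s2::'s2,v::'v,u::'u,x::'x,y::'y). f s1 s2 v u x y"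
  define FY where "FY = (\<lambda>(s1::'s1,s2::'s2,v::'v,u::'u,x::'x,y::'y). (y,s2,v))"
  define FUY where "FUY = (\<lambda>(s1::'s1,s2::'s2,v::'v,u::'u,x::'x,y::'y). (u,y,s2,v))"
  define FS1 where "FS1 = (\<lambda>(s1::'s1,s2::'s2,v::'v,u::'u,x::'x,y::'y). (s1,v))"
  define FUS1 where "FUS1 = (\<lambda>(s1::'s1,s2::'s2,v::'v,u::'u,x::'x,y::'y). (u,s1,v))"
  define FS12 where "FS12 = (\<lambda>(s1::'s1,s2::'s2,v::'v,u::'u,x::'x,y::'y). (s1,s2,v))"
  define FS2 where "FS2 = (\<lambda>(s1::'s1,s2::'s2,v::'v,u::'u,x::'x,y::'y). (s2,v))"
  define FV where "FV = (\<lambda>(s1::'s1,s2::'s2,v::'v,u::'u,x::'x,y::'y). v)"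
  have FF: "FY \<omega> = FY \<omega>' \<Longrightarrow> FV \<omega> = FV \<omega>'" "FUY \<omega> = FUY \<omega>' \<Longrightarrow> FV \<omega> = FV \<omega>'"
    "FS1 \<omega> = FS1 \<omega>' \<Longrightarrow> FV \<omega> = FV \<omega>'" "FUS1 \<omega> = FUS1 \<omega>' \<Longrightarrow> FV \<omega> = FV \<omega>'"
    "FS12 \<omega> = FS12 \<omega>' \<Longrightarrow> FV \<omega> = FV \<omega>'" "FS2 \<omega> = FS2 \<omega>' \<Longrightarrow> FV \<omega> = FV \<omega>'" for \<omega> \<omega>'
    by (auto simp: FY_def FUY_def FS1_def FUS1_def FS12_def FS2_def FV_def split_def)
  define D1 where "D1 \<omega> = pmf P \<omega> * (log 2 (pr P FUY \<omega>) - log 2 (pr P FY \<omega>))" for \<omega>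
  define D2 where "D2 \<omega> = pmf P \<omega> * (log 2 (pr P FS1 \<omega>) - log 2 (pr P FUS1 \<omega>))" for \<omega>
  define D3 where "D3 \<omega> = pmf P \<omega> * (log 2 (pr P FS1 \<omega>) - log 2 (pr P FY \<omega>))" for \<omega>
  define D4 where "D4 \<omega> = pmf P \<omega> * (log 2 (pr P FS12 \<omega>) - log 2 (pr P FS1 \<omega>))" for \<omega>
  define D5 where "D5 \<omega> = pmf P \<omega> * (log 2 (pr P FS2 \<omega>) - log 2 (pr P FV \<omega>))" for \<omega>
  define G where "G D v = (\<Sum>\<omega>\<in>{\<omega>\<in>set_pmf P. FV \<omega> = v}. D \<omega>)" for D :: "_ \<Rightarrow> real" and v
  define yk where "yk s1 s2 v = bind_pmf (qu s1 s2 v) (\<lambda>u. bind_pmf (qx u s1 v) (\<lambda>x. ch x s1 s2))" for s1 s2 v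
  \<comment> \<open>The four real coordinates belong to \<open>eRate\<close>, \<open>eC1\<close>,
    \<open>eC2\<close> and \<open>eC2C\<close>, in this order; summing the vector coordinates over
    \<open>y\<close> again yields normalization.\<close>
  define a :: "'v \<Rightarrow> (real ^ ('s1 \<times> 's2 \<times> 'y)) \<times> real \<times> real \<times> real \<times> real" where
    "a v = ((\<chi> i. case i of (s1, s2, y) \<Rightarrow> pmf (qv s1 s2) v * pmf (yk s1 s2 v) y), G D1 v + G D2 v, G D3 v, G D4 v, G D5 v)" for v
  obtain \<sigma> where \<sigma>: "\<And>v. 0 \<le> (\<sigma> v :: real)"
    "card {v\<in>A. \<sigma> v \<noteq> 0} \<le> DIM((real ^ ('s1 \<times> 's2 \<times> 'y)) \<times> real \<times> real \<times> real \<times> real) + 1"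
    "(\<Sum>v\<in>A. \<sigma> v *\<^sub>R a v) = (\<Sum>v\<in>A. a v)"
    using conic_caratheodory[OF finA, of a] by blast
  have \<sigma>y: "(\<Sum>v\<in>A. \<sigma> v * (pmf (qv s1 s2) v * pmf (yk s1 s2 v) y)) = (\<Sum>v\<in>A. pmf (qv s1 s2) v * pmf (yk s1 s2 v) y)"
    for s1 s2 y
    using arg_cong[OF \<sigma>(3), of "\<lambda>z. fst z $ (s1, s2, y)"]
    by (simp add: fst_sum a_def)
  have \<sigma>G: "(\<Sum>v\<in>A. \<sigma> v * (G D1 v + G D2 v)) = (\<Sum>v\<in>A. G D1 v + G D2 v)"
    "(\<Sum>v\<in>A. \<sigma> v * G D3 v) = (\<Sum>v\<in>A. G D3 v)"
    "(\<Sum>v\<in>A. \<sigma> v * G D4 v) = (\<Sum>v\<in>A. G D4 v)" "(\<Sum>v\<in>A. \<sigma> v * G D5 v) = (\<Sum>v\<in>A. G D5 v)"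
    using arg_cong[OF \<sigma>(3), of "\<lambda>z. fst (snd z)"] arg_cong[OF \<sigma>(3), of "\<lambda>z. fst (snd (snd z))"]
      arg_cong[OF \<sigma>(3), of "\<lambda>z. fst (snd (snd (snd z)))"] arg_cong[OF \<sigma>(3), of "\<lambda>z. snd (snd (snd (snd z)))"]
    by (simp_all add: fst_sum snd_sum a_def)
  have \<sigma>1: "(\<Sum>v\<in>A. \<sigma> v * pmf (qv s1 s2) v) = 1" for s1 s2
  proof -
    have "(\<Sum>v\<in>A. \<sigma> v * pmf (qv s1 s2) v) = (\<Sum>v\<in>A. \<sigma> v * pmf (qv s1 s2) v * (\<Sum>y\<in>UNIV. pmf (yk s1 s2 v) y))"
      by (simp add: sum_pmf_eq_1)
    also have "\<dots> = (\<Sum>y\<in>UNIV. \<Sum>v\<in>A. \<sigma> v * (pmf (qv s1 s2) v * pmf (yk s1 s2 v) y))"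
      unfolding sum_distrib_left by (subst sum.swap) (simp add: mult.assoc)
    also have "\<dots> = (\<Sum>y\<in>UNIV. \<Sum>v\<in>A. pmf (qv s1 s2) v * pmf (yk s1 s2 v) y)"
      by (simp add: \<sigma>y)
    also have "\<dots> = (\<Sum>v\<in>A. pmf (qv s1 s2) v * (\<Sum>y\<in>UNIV. pmf (yk s1 s2 v) y))"
      unfolding sum_distrib_left by (subst sum.swap) simp
    also have "\<dots> = 1" by (simp add: sum_pmf_eq_1 finA subA)
    finally show ?thesis .
  qed
  define qv' where "qv' s1 s2 = reweight \<sigma> (qv s1 s2)" for s1 s2
  have pmf_qv': "pmf (qv' s1 s2) v = \<sigma> v * pmf (qv s1 s2) v" for s1 s2 v
    unfolding qv'_def by (intro pmf_reweight[OF finA subA] \<sigma> \<sigma>1)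
  define P' where "P' = aux_law p ch qv' qu qx"
  have rw: "pmf P' \<omega> = \<sigma> (FV \<omega>) * pmf P \<omega>" for \<omega>
    by (cases \<omega>) (simp add: P'_def P_def pmf_aux_law pmf_qv' FV_def)
  have sub': "set_pmf (qv' s1 s2) \<subseteq> {v\<in>A. \<sigma> v \<noteq> 0}" for s1 s2
    using subA[of s1 s2] by (auto simp: set_pmf_iff pmf_qv')
  have "bind_pmf (qv' s1 s2) (yk s1 s2) = bind_pmf (qv s1 s2) (yk s1 s2)" for s1 s2
    using sub'[of s1 s2] \<sigma>y[of s1 s2] subA[of s1 s2]
    by (intro pmf_eqI) (subst (1 2) pmf_bind_finite[OF finA], auto simp: pmf_qv' mult.assoc)
  then have by': "bind_pmf (qv' s1 s2) (\<lambda>v. bind_pmf (qu s1 s2 v) (\<lambda>u. bind_pmf (qx u s1 v) (\<lambda>x. bind_pmf (ch x s1 s2) k))) =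
      bind_pmf (qv s1 s2) (\<lambda>v. bind_pmf (qu s1 s2 v) (\<lambda>u. bind_pmf (qx u s1 v) (\<lambda>x. bind_pmf (ch x s1 s2) k)))" for s1 s2 and k :: "'y \<Rightarrow> 'f pmf"
    unfolding yk_def by (simp add: bind_assoc_pmf[symmetric])
  have law: "map_pmf (\<lambda>(s1,s2,v,u,x,y). f s1 s2 y) P' = map_pmf (\<lambda>(s1,s2,v,u,x,y). f s1 s2 y) P" for f :: "_ \<Rightarrow> _ \<Rightarrow> _ \<Rightarrow> 'f"
    unfolding P'_def P_def map_aux_law split_def
    by (simp add: by')
  have law': "ent P' (\<lambda>(s1,s2,v,u,x,y). f s1 s2 y) = ent P (\<lambda>(s1,s2,v,u,x,y). f s1 s2 y)" for f :: "_ \<Rightarrow> _ \<Rightarrow> _ \<Rightarrow> 'f"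
    by (rule ent_law_cong[OF law])
  have img: "FV ` set_pmf P \<subseteq> A"
    using set_aux_law_subset[of qv A qu "\<lambda>_. UNIV", OF subA] unfolding P_def FV_def by auto
  have grp: "(\<Sum>\<omega>\<in>set_pmf P. r (FV \<omega>) * D \<omega>) = (\<Sum>v\<in>A. r v * G D v)" for r :: "'v \<Rightarrow> real" and D
  proof -
    have "(\<Sum>\<omega>\<in>set_pmf P. r (FV \<omega>) * D \<omega>) = (\<Sum>w\<in>A. \<Sum>\<omega>\<in>{\<omega>\<in>set_pmf P. FV \<omega> = w}. r (FV \<omega>) * D \<omega>)"
      using finP img finA by (intro sum.group[symmetric]) auto
    also have "\<dots> = (\<Sum>w\<in>A. r w * G D w)"
      by (intro sum.cong refl) (simp add: G_def sum_distrib_left)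
    finally show ?thesis .
  qed
  have d': "ent P' FY - ent P' FUY = (\<Sum>v\<in>A. \<sigma> v * G D1 v)" "ent P' FUS1 - ent P' FS1 = (\<Sum>v\<in>A. \<sigma> v * G D2 v)"
    "ent P' FY - ent P' FS1 = (\<Sum>v\<in>A. \<sigma> v * G D3 v)"
    "ent P' FS1 - ent P' FS12 = (\<Sum>v\<in>A. \<sigma> v * G D4 v)" "ent P' FV - ent P' FS2 = (\<Sum>v\<in>A. \<sigma> v * G D5 v)"
    unfolding grp[symmetric] D1_def D2_def D3_def D4_def D5_def
    by (rule ent_diff_reweight[OF finP, where r=\<sigma> and g=FV]; (erule FF | assumption | rule rw))+
  have d: "ent P FY - ent P FUY = (\<Sum>v\<in>A. 1 * G D1 v)" "ent P FUS1 - ent P FS1 = (\<Sum>v\<in>A. 1 * G D2 v)"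
    "ent P FY - ent P FS1 = (\<Sum>v\<in>A. 1 * G D3 v)"
    "ent P FS1 - ent P FS12 = (\<Sum>v\<in>A. 1 * G D4 v)" "ent P FV - ent P FS2 = (\<Sum>v\<in>A. 1 * G D5 v)"
    unfolding grp[symmetric] D1_def D2_def D3_def D4_def D5_def
    by (rule ent_diff_reweight[OF finP, where r="\<lambda>_. 1" and g=FV]; (erule FF | assumption | simp))+
  have "ent P' FY - ent P' FUY + (ent P' FUS1 - ent P' FS1) = ent P FY - ent P FUY + (ent P FUS1 - ent P FS1)"
    unfolding d' d using \<sigma>G(1) by (simp add: algebra_simps sum.distrib)
  then have "eRate P' = eRate P"
    unfolding eRate_def FY_def FUY_def FS1_def FUS1_def by simp
  moreover have "ent P' FY - ent P' FS1 = ent P FY - ent P FS1" "ent P' FS1 - ent P' FS12 = ent P FS1 - ent P FS12"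
     "ent P' FV - ent P' FS2 = ent P FV - ent P FS2"
    unfolding d' d using \<sigma>G by simp_all
  then have "eC1 P' = eC1 P" "eC2 P' = eC2 P" "eC2C P' = eC2C P"
    unfolding eC1_def eC2_def eC2C_def FY_def FS1_def FS12_def FV_def FS2_def by (simp_all add: law')
  moreover have "\<exists>A. finite A \<and> card A \<le> DIM((real ^ ('s1 \<times> 's2 \<times> 'y)) \<times> real \<times> real \<times> real \<times> real) + 1 \<and> (\<forall>s1 s2. set_pmf (qv' s1 s2) \<subseteq> A)"
    using \<sigma>(2) sub' finA by (intro exI[of _ "{v\<in>A. \<sigma> v \<noteq> 0}"]) auto
  moreover have "\<forall>s1 s2 t1 t2. qv s1 s2 = qv t1 t2 \<longrightarrow> qv' s1 s2 = qv' t1 t2"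
    by (auto simp: qv'_def)
  ultimately show ?thesis unfolding P_def P'_def by blast
qed

text \<open>\<open>Ev\<close> and \<open>Eu\<close> relate the state pairs which the laws of \<open>V\<close> and \<open>U\<close> may not distinguish. The five families
  of laws in the theorem are five choices of \<open>Ev\<close> and \<open>Eu\<close>, which the reduction of the alphabets respects.\<close>

definition kernel_class :: "('s1 \<times> 's2 \<Rightarrow> 's1 \<times> 's2 \<Rightarrow> bool) \<Rightarrow> ('s1 \<times> 's2 \<Rightarrow> 's1 \<times> 's2 \<Rightarrow> bool) \<Rightarrow>
    ('s1 \<Rightarrow> 's2 \<Rightarrow> 'v pmf) \<Rightarrow> ('s1 \<Rightarrow> 's2 \<Rightarrow> 'v \<Rightarrow> 'u pmf) \<Rightarrow> bool" where
  "kernel_class Ev Eu qv qu \<longleftrightarrow> (\<forall>s1 s2 t1 t2. Ev (s1, s2) (t1, t2) \<longrightarrow> qv s1 s2 = qv t1 t2) \<and>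
     (\<forall>s1 s2 t1 t2 v. Eu (s1, s2) (t1, t2) \<longrightarrow> qu s1 s2 v = qu t1 t2 v)"

lemma inj_to_initial_segment:
  assumes "finite A" "card A \<le> k"
  shows "\<exists>f :: 'a \<Rightarrow> nat. inj_on f A \<and> f ` A \<subseteq> {..<k}"
proof -
  obtain f :: "'a \<Rightarrow> nat" where "bij_betw f A {0..<card A}"
    using ex_bij_betw_finite_nat[OF assms(1)] by auto
  then show ?thesis using assms by (intro exI[of _ f]) (force simp: bij_betw_def)
qed

text \<open>The number \<open>K\<close> comes from two dimensions that depend on the alphabets
  alone, hence it may precede the state law, the channel and the class of kernels. \<open>U\<close>
  is thinned out for each value of \<open>V\<close> before \<open>V\<close> itself is thinned out,
  which leaves the kernels of \<open>U\<close> untouched.\<close>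

lemma cardinality_bound:
  "\<exists>K::nat. 0 < K \<and> (\<forall>(p :: ('s1::finite \<times> 's2::finite) pmf) (ch :: 'x::finite \<Rightarrow> 's1 \<Rightarrow> 's2 \<Rightarrow> 'y::finite pmf)
     (qv :: 's1 \<Rightarrow> 's2 \<Rightarrow> 'v pmf) (qu :: 's1 \<Rightarrow> 's2 \<Rightarrow> 'v \<Rightarrow> 'u pmf) (qx :: 'u \<Rightarrow> 's1 \<Rightarrow> 'v \<Rightarrow> 'x pmf) Ev Eu.
     (\<forall>s1 s2. finite (set_pmf (qv s1 s2))) \<longrightarrow> (\<forall>s1 s2 v. finite (set_pmf (qu s1 s2 v))) \<longrightarrow> kernel_class Ev Eu qv qu \<longrightarrow>
     (\<exists>(qv' :: 's1 \<Rightarrow> 's2 \<Rightarrow> nat pmf) (qu' :: 's1 \<Rightarrow> 's2 \<Rightarrow> nat \<Rightarrow> nat pmf) qx'. kernel_class Ev Eu qv' qu' \<and>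
        (\<forall>s1 s2. set_pmf (qv' s1 s2) \<subseteq> {..<K}) \<and> (\<forall>s1 s2 v. set_pmf (qu' s1 s2 v) \<subseteq> {..<K}) \<and>
        eRate (aux_law p ch qv' qu' qx') = eRate (aux_law p ch qv qu qx) \<and>
        eC1 (aux_law p ch qv' qu' qx') = eC1 (aux_law p ch qv qu qx) \<and>
        eC2 (aux_law p ch qv' qu' qx') = eC2 (aux_law p ch qv qu qx) \<and>
        eC2C (aux_law p ch qv' qu' qx') = eC2C (aux_law p ch qv qu qx)))"
proof -
  define K1 where "K1 = DIM((real ^ ('s1 \<times> 's2 \<times> 'x)) \<times> real) + 1"
  define K2 where "K2 = DIM((real ^ ('s1 \<times> 's2 \<times> 'y)) \<times> real \<times> real \<times> real \<times> real) + 1"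
  define K where "K = max K1 K2"
  have Kpos: "0 < K" by (simp add: K_def K1_def)
  show ?thesis
  proof (intro exI[of _ K] conjI Kpos allI impI)
    fix p :: "('s1 \<times> 's2) pmf" and ch :: "'x \<Rightarrow> 's1 \<Rightarrow> 's2 \<Rightarrow> 'y pmf"
     and qv :: "'s1 \<Rightarrow> 's2 \<Rightarrow> 'v pmf" and qu :: "'s1 \<Rightarrow> 's2 \<Rightarrow> 'v \<Rightarrow> 'u pmf" and qx :: "'u \<Rightarrow> 's1 \<Rightarrow> 'v \<Rightarrow> 'x pmf" and Ev Eu
    assume finv: "\<forall>s1 s2. finite (set_pmf (qv s1 s2))" and finu: "\<forall>s1 s2 v. finite (set_pmf (qu s1 s2 v))" and kc: "kernel_class Ev Eu qv qu"
    obtain qu1 where qu1: "\<And>s1 s2 t1 t2 v. qu s1 s2 v = qu t1 t2 v \<Longrightarrow> qu1 s1 s2 v = qu1 t1 t2 v"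
      "\<And>v. \<exists>B. finite B \<and> card B \<le> K1 \<and> (\<forall>s1 s2. set_pmf (qu1 s1 s2 v) \<subseteq> B)"
      "eRate (aux_law p ch qv qu1 qx) = eRate (aux_law p ch qv qu qx)"
      "eC1 (aux_law p ch qv qu1 qx) = eC1 (aux_law p ch qv qu qx)"
      "eC2 (aux_law p ch qv qu1 qx) = eC2 (aux_law p ch qv qu qx)"
      "eC2C (aux_law p ch qv qu1 qx) = eC2C (aux_law p ch qv qu qx)"
      using reduce_u[of qv qu p ch qx] finv finu unfolding K1_def[symmetric] by blast
    obtain B where B: "\<And>v. finite (B v)" "\<And>v. card (B v) \<le> K1" "\<And>v s1 s2. set_pmf (qu1 s1 s2 v) \<subseteq> B v"
      using choice[of "\<lambda>v B. finite B \<and> card B \<le> K1 \<and> (\<forall>s1 s2. set_pmf (qu1 s1 s2 v) \<subseteq> B)"] qu1(2) by blast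
    have finu1: "finite (set_pmf (qu1 s1 s2 v))" for s1 s2 v
      by (rule finite_subset[OF B(3) B(1)])
    obtain qv1 where qv1a: "\<forall>s1 s2 t1 t2. qv s1 s2 = qv t1 t2 \<longrightarrow> qv1 s1 s2 = qv1 t1 t2"
      and qv1b: "\<exists>A. finite A \<and> card A \<le> K2 \<and> (\<forall>s1 s2. set_pmf (qv1 s1 s2) \<subseteq> A)"
      and qv1c: "eRate (aux_law p ch qv1 qu1 qx) = eRate (aux_law p ch qv qu1 qx)"
      "eC1 (aux_law p ch qv1 qu1 qx) = eC1 (aux_law p ch qv qu1 qx)"
      "eC2 (aux_law p ch qv1 qu1 qx) = eC2 (aux_law p ch qv qu1 qx)"
      "eC2C (aux_law p ch qv1 qu1 qx) = eC2C (aux_law p ch qv qu1 qx)"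
      using reduce_v[of qv qu1 p ch qx, OF finv[rule_format] finu1] unfolding K2_def[symmetric] by (elim exE conjE) (rule that; blast)
    from qv1b obtain A where A: "finite A" "card A \<le> K2" "\<forall>s1 s2. set_pmf (qv1 s1 s2) \<subseteq> A"
      by blast
    note qv1 = qv1a[rule_format] A(1,2) A(3)[rule_format] qv1c
    obtain \<pi> :: "'v \<Rightarrow> nat" where \<pi>: "inj_on \<pi> A" "\<pi> ` A \<subseteq> {..<K}"
      using inj_to_initial_segment[OF qv1(2), of K] qv1(3) unfolding K_def by (meson le_max_iff_disj)
    have "\<forall>v. \<exists>f :: 'u \<Rightarrow> nat. inj_on f (B v) \<and> f ` B v \<subseteq> {..<K}"
      using inj_to_initial_segment[OF B(1)] B(2) unfolding K_def by (meson le_max_iff_disj)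
    from choice[OF this] obtain \<tau> :: "'v \<Rightarrow> 'u \<Rightarrow> nat" where \<tau>: "\<And>v. inj_on (\<tau> v) (B v)" "\<And>v. \<tau> v ` B v \<subseteq> {..<K}"
      by blast
    note R = aux_law_relabel[of \<pi> A \<tau> B qv1 qu1 p ch qx, OF \<pi>(1) \<tau>(1) qv1(4) B(3)]
    let ?\<pi>' = "inv_into A \<pi>"
    show "\<exists>(qv' :: 's1 \<Rightarrow> 's2 \<Rightarrow> nat pmf) (qu' :: 's1 \<Rightarrow> 's2 \<Rightarrow> nat \<Rightarrow> nat pmf) qx'. kernel_class Ev Eu qv' qu' \<and>
        (\<forall>s1 s2. set_pmf (qv' s1 s2) \<subseteq> {..<K}) \<and> (\<forall>s1 s2 v. set_pmf (qu' s1 s2 v) \<subseteq> {..<K}) \<and>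
        eRate (aux_law p ch qv' qu' qx') = eRate (aux_law p ch qv qu qx) \<and>
        eC1 (aux_law p ch qv' qu' qx') = eC1 (aux_law p ch qv qu qx) \<and>
        eC2 (aux_law p ch qv' qu' qx') = eC2 (aux_law p ch qv qu qx) \<and>
        eC2C (aux_law p ch qv' qu' qx') = eC2C (aux_law p ch qv qu qx)"
    proof (intro exI conjI)
      show "eRate (aux_law p ch (\<lambda>s1 s2. map_pmf \<pi> (qv1 s1 s2)) (\<lambda>s1 s2 w. map_pmf (\<tau> (?\<pi>' w)) (qu1 s1 s2 (?\<pi>' w)))
      (\<lambda>u' s1 w. qx (inv_into (B (?\<pi>' w)) (\<tau> (?\<pi>' w)) u') s1 (?\<pi>' w))) = eRate (aux_law p ch qv qu qx)"
       using R(1) qv1(5) qu1(3) by simp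
      show "kernel_class Ev Eu (\<lambda>s1 s2. map_pmf \<pi> (qv1 s1 s2)) (\<lambda>s1 s2 w. map_pmf (\<tau> (?\<pi>' w)) (qu1 s1 s2 (?\<pi>' w)))"
        unfolding kernel_class_def
      proof (intro conjI allI impI)
        fix s1 s2 t1 t2 v assume "Eu (s1, s2) (t1, t2)"
        then have "qu1 s1 s2 (?\<pi>' v) = qu1 t1 t2 (?\<pi>' v)" using kc by (intro qu1(1)) (simp add: kernel_class_def)
        then show "map_pmf (\<tau> (?\<pi>' v)) (qu1 s1 s2 (?\<pi>' v)) = map_pmf (\<tau> (?\<pi>' v)) (qu1 t1 t2 (?\<pi>' v))" by simp
      next
        fix s1 s2 t1 t2 assume "Ev (s1, s2) (t1, t2)"
        then have "qv1 s1 s2 = qv1 t1 t2" using kc by (intro qv1(1)) (simp add: kernel_class_def)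
        then show "map_pmf \<pi> (qv1 s1 s2) = map_pmf \<pi> (qv1 t1 t2)" by simp
      qed
      show "\<forall>s1 s2. set_pmf (map_pmf \<pi> (qv1 s1 s2)) \<subseteq> {..<K}"
        using qv1(4) \<pi>(2) by fastforce
      show "\<forall>s1 s2 v. set_pmf (map_pmf (\<tau> (?\<pi>' v)) (qu1 s1 s2 (?\<pi>' v))) \<subseteq> {..<K}"
        using B(3) \<tau>(2) by fastforce
    qed (use R(2-4) qv1(6-8) qu1(4-6) in simp_all)
  qed
qed

section \<open>Attained maxima\<close>

lemma tendsto_xlogx:
  fixes f :: "nat \<Rightarrow> real"
  assumes f: "f \<longlonglongrightarrow> a" and nn: "\<And>n. 0 \<le> f n"
  shows "(\<lambda>n. f n * log 2 (f n)) \<longlonglongrightarrow> a * log 2 a"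
proof (cases "a = 0")
  case False
  then have "a > 0" using LIMSEQ_le_const[OF f, of 0] nn by force
  then show ?thesis by (intro tendsto_mult f tendsto_log) auto
next
  case True
  \<comment> \<open>At zero the limit needs a bound that tends to 0. The elementary inequality for
    the logarithm, applied to \<open>1 / sqrt x\<close>, provides the square root.\<close>
  have bd: "norm (x * ln x) \<le> 2 * sqrt x" if "0 \<le> x" "x \<le> 1" for x :: real
  proof (cases "x = 0")
    case False
    then have x: "x > 0" using that by simp
    have "ln (1 / sqrt x) \<le> 1 / sqrt x - 1" using x by (intro ln_le_minus_one) simp
    then have "- ln x \<le> 2 / sqrt x" using x by (simp add: ln_div ln_sqrt)
    then have "x * (- ln x) \<le> x * (2 / sqrt x)" using x by (intro mult_left_mono) auto
    also have "\<dots> = 2 * sqrt x" using x by (simp add: field_simps)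
    finally show ?thesis using x that by (simp add: abs_mult)
  qed simp
  have "\<forall>\<^sub>F n in sequentially. f n < 1" using f True by (intro order_tendstoD) auto
  then have ev: "\<forall>\<^sub>F n in sequentially. norm (f n * ln (f n)) \<le> 2 * sqrt (f n)"
    by eventually_elim (use bd nn in auto)
  have "(\<lambda>n. 2 * sqrt (f n)) \<longlonglongrightarrow> 2 * sqrt 0"
    using f True by (intro tendsto_intros) auto
  then have "(\<lambda>n. f n * ln (f n)) \<longlonglongrightarrow> 0"
    using ev by (intro Lim_null_comparison[OF ev]) simp
  then have "(\<lambda>n. f n * ln (f n) / ln 2) \<longlonglongrightarrow> 0 / ln 2"
    by (intro tendsto_divide) auto
  then show ?thesis by (simp add: True log_def)
qed

lemma ent_eq_sum:
  assumes S: "finite S" "set_pmf P \<subseteq> S"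
  shows "ent P F = (\<Sum>a\<in>F ` S. - ((\<Sum>\<omega>\<in>{\<omega>\<in>S. F \<omega> = a}. pmf P \<omega>) * log 2 (\<Sum>\<omega>\<in>{\<omega>\<in>S. F \<omega> = a}. pmf P \<omega>)))"
proof -
  have m: "pmf (map_pmf F P) a = (\<Sum>\<omega>\<in>{\<omega>\<in>S. F \<omega> = a}. pmf P \<omega>)" for a
  proof -
    have "pmf (map_pmf F P) a = measure_pmf.prob P {\<omega>\<in>S. F \<omega> = a}"
      unfolding pmf_map using S by (intro measure_prob_cong_0) (auto simp: pmf_eq_0_set_pmf)
    then show ?thesis using S by (simp add: measure_measure_pmf_finite)
  qed
  have "ent P F = measure_pmf.expectation (map_pmf F P) (\<lambda>a. - log 2 (pmf (map_pmf F P) a))"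
    by (simp add: ent_def pr_pmf_map)
  also have "\<dots> = (\<Sum>a\<in>F ` S. pmf (map_pmf F P) a * - log 2 (pmf (map_pmf F P) a))"
    using S by (intro expectation_sum) auto
  finally show ?thesis by (simp add: m)
qed

lemma tendsto_ent:
  assumes S: "finite S" "\<And>n. set_pmf (P n) \<subseteq> S" "set_pmf Q \<subseteq> S"
    and lim: "\<And>\<omega>. (\<lambda>n. pmf (P n) \<omega>) \<longlonglongrightarrow> pmf Q \<omega>"
  shows "(\<lambda>n. ent (P n) F) \<longlonglongrightarrow> ent Q F"
  unfolding ent_eq_sum[OF S(1,2)] ent_eq_sum[OF S(1,3)]
  by (intro tendsto_sum tendsto_minus tendsto_xlogx lim sum_nonneg) auto

section \<open>Sequential compactness of the families of laws\<close>

lemma finite_family_subseq: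
  fixes x :: "nat \<Rightarrow> 'i \<Rightarrow> real"
  assumes "finite I" "\<And>n i. 0 \<le> x n i \<and> x n i \<le> 1"
  shows "\<exists>r. strict_mono (r :: nat \<Rightarrow> nat) \<and> (\<forall>i\<in>I. convergent (\<lambda>n. x (r n) i))"
  using assms(1)
proof (induction I rule: finite_induct)
  case empty
  show ?case by (intro exI[of _ id]) (simp add: strict_mono_id)
next
  case (insert j I)
  then obtain r where r: "strict_mono (r :: nat \<Rightarrow> nat)" "\<forall>i\<in>I. convergent (\<lambda>n. x (r n) i)" by auto
  have "bounded (range (\<lambda>n. x (r n) j))"
    using assms(2) by (intro boundedI[of _ 1]) auto
  then obtain l r' where r': "strict_mono (r' :: nat \<Rightarrow> nat)" "((\<lambda>n. x (r n) j) \<circ> r') \<longlonglongrightarrow> l"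
    using bounded_imp_convergent_subsequence by blast
  have "convergent (\<lambda>n. x ((r \<circ> r') n) i)" if "i \<in> I" for i
    using convergent_subseq_convergent[OF r(2)[rule_format, OF that] r'(1)] by (simp add: o_def)
  moreover have "convergent (\<lambda>n. x ((r \<circ> r') n) j)"
    using r'(2) by (auto simp: convergent_def o_def)
  ultimately show ?case
    using strict_mono_o[OF r(1) r'(1)] by (intro exI[of _ "r \<circ> r'"]) (auto simp: o_def)
qed

lemma pmf_family_subseq:
  fixes q :: "nat \<Rightarrow> 'j \<Rightarrow> 'a pmf"
  assumes "finite J" "finite A" "\<And>n j. j \<in> J \<Longrightarrow> set_pmf (q n j) \<subseteq> A"
  shows "\<exists>r Q. strict_mono (r :: nat \<Rightarrow> nat) \<and> (\<forall>j\<in>J. set_pmf (Q j) \<subseteq> A \<and> (\<forall>a. (\<lambda>n. pmf (q (r n) j) a) \<longlonglongrightarrow> pmf (Q j) a))"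
proof -
  obtain r where r: "strict_mono (r :: nat \<Rightarrow> nat)" "\<forall>i\<in>J \<times> A. convergent (\<lambda>n. pmf (q (r n) (fst i)) (snd i))"
    using finite_family_subseq[of "J \<times> A" "\<lambda>n i. pmf (q n (fst i)) (snd i)"] assms(1,2)
    by (auto simp: pmf_le_1)
  define l where "l j a = (if a \<in> A then lim (\<lambda>n. pmf (q (r n) j) a) else 0)" for j a
  have l: "(\<lambda>n. pmf (q (r n) j) a) \<longlonglongrightarrow> l j a" if "j \<in> J" for j a
  proof (cases "a \<in> A")
    case True
    then show ?thesis using r(2) that by (auto simp: l_def convergent_LIMSEQ_iff)
  next
    case False
    then have "pmf (q (r n) j) a = 0" for n using assms(3)[OF that] by (auto simp: pmf_eq_0_set_pmf)
    then show ?thesis using False by (simp add: l_def)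
  qed
  have l0: "0 \<le> l j a" if "j \<in> J" for j a
    by (rule LIMSEQ_le_const[OF l[OF that]]) auto
  \<comment> \<open>The common finite support \<open>A\<close> keeps mass from escaping in the
    limit.\<close>
  have l1: "(\<Sum>a\<in>A. l j a) = 1" if "j \<in> J" for j
  proof -
    have "(\<lambda>n. \<Sum>a\<in>A. pmf (q (r n) j) a) \<longlonglongrightarrow> (\<Sum>a\<in>A. l j a)"
      by (intro tendsto_sum l that)
    then have "(\<lambda>n. 1) \<longlonglongrightarrow> (\<Sum>a\<in>A. l j a)"
      using assms that by (simp add: sum_pmf_eq_1)
    then show ?thesis by (simp add: LIMSEQ_const_iff)
  qed
  have pe: "pmf (embed_pmf (l j)) a = l j a" if "j \<in> J" for j a
  proof (rule pmf_embed_pmf)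
    have "(\<integral>\<^sup>+ a. ennreal (l j a) \<partial>count_space UNIV) = (\<Sum>a\<in>A. ennreal (l j a))"
      using assms by (intro nn_integral_count_space') (auto simp: l_def)
    also have "\<dots> = ennreal (\<Sum>a\<in>A. l j a)"
      using l0[OF that] by (intro sum_ennreal) auto
    finally show "(\<integral>\<^sup>+ a. ennreal (l j a) \<partial>count_space UNIV) = 1"
      by (simp add: l1[OF that])
  qed (rule l0[OF that])
  show ?thesis
  proof (intro exI[of _ r] exI[of _ "\<lambda>j. embed_pmf (l j)"] conjI ballI allI r(1))
    fix j assume j: "j \<in> J"
    show "set_pmf (embed_pmf (l j)) \<subseteq> A"
      using pe[OF j] by (auto simp: set_pmf_iff l_def split: if_splits)
    show "(\<lambda>n. pmf (q (r n) j) a) \<longlonglongrightarrow> pmf (embed_pmf (l j)) a" for a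
      using l[OF j] by (simp add: pe[OF j])
  qed
qed

definition class_laws :: "nat \<Rightarrow> ('s1 \<times> 's2 \<Rightarrow> 's1 \<times> 's2 \<Rightarrow> bool) \<Rightarrow> ('s1 \<times> 's2 \<Rightarrow> 's1 \<times> 's2 \<Rightarrow> bool) \<Rightarrow>
    ('s1 \<times> 's2) pmf \<Rightarrow> ('x \<Rightarrow> 's1 \<Rightarrow> 's2 \<Rightarrow> 'y pmf) \<Rightarrow> ('s1 \<times> 's2 \<times> nat \<times> nat \<times> 'x \<times> 'y) pmf set" where
  "class_laws k Ev Eu p ch = {aux_law p ch qv qu qx | qv qu qx. kernel_class Ev Eu qv qu \<and>
     (\<forall>s1 s2. set_pmf (qv s1 s2) \<subseteq> {..<k}) \<and> (\<forall>s1 s2 v. set_pmf (qu s1 s2 v) \<subseteq> {..<k})}"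

abbreviation outcomes :: "nat \<Rightarrow> ('s1::finite \<times> 's2::finite \<times> nat \<times> nat \<times> 'x::finite \<times> 'y::finite) set" where
  "outcomes k \<equiv> UNIV \<times> UNIV \<times> {..<k} \<times> {..<k} \<times> UNIV \<times> UNIV"

lemma set_class_laws: "P \<in> class_laws k Ev Eu p ch \<Longrightarrow> set_pmf P \<subseteq> outcomes k"
proof
  fix \<omega> assume P: "P \<in> class_laws k Ev Eu p ch" and w: "\<omega> \<in> set_pmf P"
  obtain s1 s2 v u x y where e: "\<omega> = (s1, s2, v, u, x, y)" by (cases \<omega>) auto
  obtain qv qu qx where q: "P = aux_law p ch qv qu qx" "\<And>s1 s2. set_pmf (qv s1 s2) \<subseteq> {..<k}"
      "\<And>s1 s2 v. set_pmf (qu s1 s2 v) \<subseteq> {..<k}"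
    using P unfolding class_laws_def by blast
  have "v \<in> {..<k} \<and> u \<in> {..<k}"
    by (rule set_aux_law_subset[of qv "{..<k}" qu "\<lambda>_. {..<k}" s1 s2 v u x y p ch qx]) (use q w e in auto)
  then show "\<omega> \<in> outcomes k" by (simp add: e)
qed

lemma finite_class_laws:
  fixes p :: "('s1::finite \<times> 's2::finite) pmf" and ch :: "'x::finite \<Rightarrow> 's1 \<Rightarrow> 's2 \<Rightarrow> 'y::finite pmf"
  shows "P \<in> class_laws k Ev Eu p ch \<Longrightarrow> finite (set_pmf P)"
  by (rule finite_subset[OF set_class_laws]) auto

text \<open>The limit is taken for the kernels and not for the joint laws. Factorization and the
  equality of kernels on related state pairs are then inherited pointwise, and the joint pmf
  converges as a product of convergent factors.\<close>

lemma class_laws_seq_compact: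
  fixes p :: "('s1::finite \<times> 's2::finite) pmf" and ch :: "'x::finite \<Rightarrow> 's1 \<Rightarrow> 's2 \<Rightarrow> 'y::finite pmf"
  assumes "\<And>n. P n \<in> class_laws k Ev Eu p ch"
  shows "\<exists>r Q. strict_mono (r :: nat \<Rightarrow> nat) \<and> Q \<in> class_laws k Ev Eu p ch \<and> (\<forall>\<omega>. (\<lambda>n. pmf (P (r n)) \<omega>) \<longlonglongrightarrow> pmf Q \<omega>)"
proof -
  let ?ok = "\<lambda>qv qu qx. kernel_class Ev Eu qv qu \<and>
     (\<forall>s1 s2. set_pmf (qv s1 s2) \<subseteq> {..<k}) \<and> (\<forall>s1 s2 v. set_pmf (qu s1 s2 v) \<subseteq> {..<k})"
  have "\<forall>n. \<exists>qv qu qx. P n = aux_law p ch qv qu qx \<and> ?ok qv qu qx"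
    using assms unfolding class_laws_def by blast
  from choice[OF this] obtain qv where "\<forall>n. \<exists>qu qx. P n = aux_law p ch (qv n) qu qx \<and> ?ok (qv n) qu qx" ..
  from choice[OF this] obtain qu where "\<forall>n. \<exists>qx. P n = aux_law p ch (qv n) (qu n) qx \<and> ?ok (qv n) (qu n) qx" ..
  from choice[OF this] obtain qx where h: "\<forall>n. P n = aux_law p ch (qv n) (qu n) (qx n) \<and> ?ok (qv n) (qu n) (qx n)" ..
  have P: "P n = aux_law p ch (qv n) (qu n) (qx n)" and kc: "kernel_class Ev Eu (qv n) (qu n)"
    and sv: "set_pmf (qv n s1 s2) \<subseteq> {..<k}" and su: "set_pmf (qu n s1 s2 v) \<subseteq> {..<k}" for n s1 s2 v
    using h by blast+
  have "\<exists>r Q. strict_mono (r :: nat \<Rightarrow> nat) \<and> (\<forall>j\<in>UNIV. set_pmf (Q j) \<subseteq> {..<k} \<and>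
      (\<forall>a. (\<lambda>n. pmf (qv (r n) (fst j) (snd j)) a) \<longlonglongrightarrow> pmf (Q j) a))"
    by (rule pmf_family_subseq) (use sv in auto)
  then obtain r1 Qv where r1: "strict_mono (r1 :: nat \<Rightarrow> nat)" and Qv: "\<And>j. set_pmf (Qv j) \<subseteq> {..<k}"
     "\<And>j a. (\<lambda>n. pmf (qv (r1 n) (fst j) (snd j)) a) \<longlonglongrightarrow> pmf (Qv j) a"
    by blast
  have "\<exists>r Q. strict_mono (r :: nat \<Rightarrow> nat) \<and> (\<forall>j\<in>UNIV \<times> UNIV \<times> {..<k}. set_pmf (Q j) \<subseteq> {..<k} \<and>
      (\<forall>a. (\<lambda>n. pmf (qu (r1 (r n)) (fst j) (fst (snd j)) (snd (snd j))) a) \<longlonglongrightarrow> pmf (Q j) a))"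
    by (rule pmf_family_subseq) (use su in auto)
  then obtain r2 Qu where r2: "strict_mono (r2 :: nat \<Rightarrow> nat)" and Qu0: "\<forall>j\<in>UNIV \<times> UNIV \<times> {..<k}. set_pmf (Qu j) \<subseteq> {..<k} \<and>
      (\<forall>a. (\<lambda>n. pmf (qu (r1 (r2 n)) (fst j) (fst (snd j)) (snd (snd j))) a) \<longlonglongrightarrow> pmf (Qu j) a)"
    by blast
  have Qu: "set_pmf (Qu (s1, s2, v)) \<subseteq> {..<k}"
     "(\<lambda>n. pmf (qu (r1 (r2 n)) s1 s2 v) a) \<longlonglongrightarrow> pmf (Qu (s1, s2, v)) a" if "v < k" for s1 s2 v a
    using bspec[OF Qu0, of "(s1, s2, v)"] that by auto
  have "\<exists>r Q. strict_mono (r :: nat \<Rightarrow> nat) \<and> (\<forall>j\<in>{..<k} \<times> UNIV \<times> {..<k}. set_pmf (Q j) \<subseteq> UNIV \<and>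
      (\<forall>a. (\<lambda>n. pmf (qx (r1 (r2 (r n))) (fst j) (fst (snd j)) (snd (snd j))) a) \<longlonglongrightarrow> pmf (Q j) a))"
    by (rule pmf_family_subseq) auto
  then obtain r3 Qx where r3: "strict_mono (r3 :: nat \<Rightarrow> nat)" and Qx0:  "\<forall>j\<in>{..<k} \<times> UNIV \<times> {..<k}. 
      (\<forall>a. (\<lambda>n. pmf (qx (r1 (r2 (r3 n))) (fst j) (fst (snd j)) (snd (snd j))) a) \<longlonglongrightarrow> pmf (Qx j) a)"
    by blast
  have Qx: "(\<lambda>n. pmf (qx (r1 (r2 (r3 n))) u s1 v) a) \<longlonglongrightarrow> pmf (Qx (u, s1, v)) a" if "v < k" "u < k" for u s1 v a
    using bspec[OF Qx0, of "(u, s1, v)"] that by auto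
  define r where "r = r1 \<circ> r2 \<circ> r3"
  have r: "strict_mono r" unfolding r_def using r1 r2 r3 by (auto intro: strict_mono_o)
  have lv: "(\<lambda>n. pmf (qv (r n) s1 s2) a) \<longlonglongrightarrow> pmf (Qv (s1, s2)) a" for s1 s2 a
    using LIMSEQ_subseq_LIMSEQ[OF Qv(2)[of "(s1, s2)" a] strict_mono_o[OF r2 r3]] by (simp add: r_def o_def)
  have lu: "(\<lambda>n. pmf (qu (r n) s1 s2 v) a) \<longlonglongrightarrow> pmf (Qu (s1, s2, v)) a" if "v < k" for s1 s2 v a
    using LIMSEQ_subseq_LIMSEQ[OF Qu(2)[OF that] r3] by (simp add: r_def o_def)
  have lx: "(\<lambda>n. pmf (qx (r n) u s1 v) a) \<longlonglongrightarrow> pmf (Qx (u, s1, v)) a" if "v < k" "u < k" for u s1 v a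
    using Qx[OF that] by (simp add: r_def o_def)
  define qv' where "qv' s1 s2 = Qv (s1, s2)" for s1 s2
  \<comment> \<open>The subsequence is controlled only for \<open>v < k\<close>. At all other
    values, which have probability zero, the kernel of the law with number 0 is used; it has the
    required support and class.\<close>
  define qu' where "qu' s1 s2 v = (if v < k then Qu (s1, s2, v) else qu 0 s1 s2 v)" for s1 s2 v
  define qx' where "qx' u s1 v = Qx (u, s1, v)" for u s1 v
  have "kernel_class Ev Eu qv' qu'"
    unfolding kernel_class_def
  proof (intro conjI allI impI)
    fix s1 s2 t1 t2 assume "Ev (s1, s2) (t1, t2)"
    then have "qv n s1 s2 = qv n t1 t2" for n using kc by (auto simp: kernel_class_def)
    then show "qv' s1 s2 = qv' t1 t2"
      unfolding qv'_def using lv[of s1 s2] lv[of t1 t2] by (intro pmf_eqI) (auto intro: LIMSEQ_unique)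
  next
    fix s1 s2 t1 t2 v assume "Eu (s1, s2) (t1, t2)"
    then have "qu n s1 s2 v = qu n t1 t2 v" for n using kc by (auto simp: kernel_class_def)
    then show "qu' s1 s2 v = qu' t1 t2 v"
      unfolding qu'_def using lu[of v s1 s2] lu[of v t1 t2] by (auto intro!: pmf_eqI intro: LIMSEQ_unique)
  qed
  moreover have sv': "set_pmf (qv' s1 s2) \<subseteq> {..<k}" and su': "set_pmf (qu' s1 s2 v) \<subseteq> {..<k}" for s1 s2 v
    using Qv(1) Qu(1) su by (auto simp: qv'_def qu'_def)
  ultimately have Q: "aux_law p ch qv' qu' qx' \<in> class_laws k Ev Eu p ch" unfolding class_laws_def by blast
  have "(\<lambda>n. pmf (P (r n)) \<omega>) \<longlonglongrightarrow> pmf (aux_law p ch qv' qu' qx') \<omega>" for \<omega>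
  proof -
    obtain s1 s2 v u x y where w: "\<omega> = (s1, s2, v, u, x, y)" by (cases \<omega>) auto
    show ?thesis
    proof (cases "v < k \<and> u < k")
      case True
      then show ?thesis unfolding w P pmf_aux_law qv'_def qu'_def qx'_def
        by (auto intro!: tendsto_intros lv lu lx)
    next
      case False
      then have "pmf (qv n s1 s2) v = 0 \<or> pmf (qu n s1 s2 v) u = 0"
        "pmf (qv' s1 s2) v = 0 \<or> pmf (qu' s1 s2 v) u = 0" for n
        using sv[of n s1 s2] su[of n s1 s2 v] sv'[of s1 s2] su'[of s1 s2 v] by (auto simp: pmf_eq_0_set_pmf)
      then have "pmf (P n) \<omega> = 0" "pmf (aux_law p ch qv' qu' qx') \<omega> = 0" for n
        unfolding w P pmf_aux_law by (metis mult_zero_left mult_zero_right)+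
      then show ?thesis by simp
    qed
  qed
  then show ?thesis using r Q by blast
qed

lemma eRate_le:
  fixes P :: "('s1::finite \<times> 's2::finite \<times> nat \<times> nat \<times> 'x::finite \<times> 'y::finite) pmf"
  assumes "set_pmf P \<subseteq> outcomes k"
  shows "eRate P \<le> 2 * log 2 (card (outcomes k :: ('s1 \<times> 's2 \<times> nat \<times> nat \<times> 'x \<times> 'y) set))"
proof -
  let ?S = "outcomes k :: ('s1 \<times> 's2 \<times> nat \<times> nat \<times> 'x \<times> 'y) set"
  have fin: "finite ?S" by auto
  have finP: "finite (set_pmf P)" by (rule finite_subset[OF assms fin])
  have ne: "0 < card (F ` ?S)" for F :: "_ \<Rightarrow> 'f"
    using assms set_pmf_not_empty[of P] fin by (auto simp: card_gt_0_iff)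
  have e: "ent P F \<le> log 2 (card ?S)" for F :: "_ \<Rightarrow> 'f"
  proof -
    have "ent P F \<le> log 2 (card (F ` ?S))"
      using assms by (intro ent_le_log_card finP finite_imageI fin) auto
    also have "\<dots> \<le> log 2 (card ?S)"
      using ne[of F] card_image_le[OF fin, of F] by (intro log_mono of_nat_mono) linarith+
    finally show ?thesis .
  qed
  have "eRate P \<le> ent P (\<lambda>(s1,s2,v,u,x,y). (y,s2,v)) + ent P (\<lambda>(s1,s2,v,u,x,y). (u,s1,v))"
    unfolding eRate_def using ent_nonneg[of P "\<lambda>(s1,s2,v,u,x,y). (u,y,s2,v)"] ent_nonneg[of P "\<lambda>(s1,s2,v,u,x,y). (s1,v)"] by simp
  then show ?thesis using e[of "\<lambda>(s1,s2,v,u,x,y). (y,s2,v)"] e[of "\<lambda>(s1,s2,v,u,x,y). (u,s1,v)"] by simp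
qed

text \<open>The direct method: a maximizing sequence has a convergent subsequence, entropies over a
  fixed finite set of outcomes are continuous, and so both the value and the constraint pass to the
  limit.\<close>

lemma class_laws_maximum:
  fixes p :: "('s1::finite \<times> 's2::finite) pmf" and ch :: "'x::finite \<Rightarrow> 's1 \<Rightarrow> 's2 \<Rightarrow> 'y::finite pmf"
  assumes ne: "P0 \<in> class_laws k Ev Eu p ch" "con P0 \<le> R"
    and con: "con = eC1 \<or> con = eC2 \<or> con = eC2C"
  shows "\<exists>P\<in>class_laws k Ev Eu p ch. con P \<le> (R::real) \<and> (\<forall>Q\<in>class_laws k Ev Eu p ch. con Q \<le> R \<longrightarrow> eRate Q \<le> eRate P)"
proof -
  define F where "F = {P \<in> class_laws k Ev Eu p ch. con P \<le> R}"
  have bdd: "bdd_above (eRate ` F)"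
    unfolding F_def by (rule bdd_aboveI2) (rule eRate_le, rule set_class_laws, blast)
  have neF: "eRate ` F \<noteq> {}" using ne by (auto simp: F_def)
  have "Sup (eRate ` F) \<in> closure (eRate ` F)" by (rule closure_contains_Sup[OF neF bdd])
  then obtain x where x: "\<And>n. x n \<in> eRate ` F" "x \<longlonglongrightarrow> Sup (eRate ` F)"
    unfolding closure_sequential by auto
  have "\<forall>n. \<exists>P. P \<in> F \<and> x n = eRate P" using x(1) by blast
  from choice[OF this] obtain P where P: "\<And>n. P n \<in> F" "\<And>n. x n = eRate (P n)" by blast
  have PG: "P n \<in> class_laws k Ev Eu p ch" "con (P n) \<le> R" for n using P(1)[of n] by (auto simp: F_def)
  obtain r Q where r: "strict_mono (r :: nat \<Rightarrow> nat)" and Q: "Q \<in> class_laws k Ev Eu p ch"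
    and lim: "\<And>\<omega>. (\<lambda>n. pmf (P (r n)) \<omega>) \<longlonglongrightarrow> pmf Q \<omega>"
    using class_laws_seq_compact[of P k Ev Eu p ch] PG(1) by blast
  have te: "(\<lambda>n. ent (P (r n)) F) \<longlonglongrightarrow> ent Q F" for F :: "_ \<Rightarrow> 'f"
    by (rule tendsto_ent[where S="outcomes k", OF _ set_class_laws[OF PG(1)] set_class_laws[OF Q] lim]) auto
  have "(\<lambda>n. eRate (P (r n))) \<longlonglongrightarrow> eRate Q"
    unfolding eRate_def by (intro tendsto_intros te)
  moreover have "(\<lambda>n. eRate (P (r n))) \<longlonglongrightarrow> Sup (eRate ` F)"
    using LIMSEQ_subseq_LIMSEQ[OF x(2) r] by (simp add: P(2) o_def)
  ultimately have eq: "eRate Q = Sup (eRate ` F)" by (rule LIMSEQ_unique)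
  have "(\<lambda>n. con (P (r n))) \<longlonglongrightarrow> con Q"
    using con by (elim disjE; simp only: eC1_def eC2_def eC2C_def) (intro tendsto_intros te)+
  then have "con Q \<le> R" by (rule LIMSEQ_le_const2) (auto intro: PG)
  moreover have "eRate Q' \<le> eRate Q" if "Q' \<in> class_laws k Ev Eu p ch" "con Q' \<le> R" for Q'
    unfolding eq using that by (intro cSup_upper bdd) (auto simp: F_def)
  ultimately show ?thesis using Q by blast
qed

section \<open>Converse\<close>

text \<open>The law of \<open>A\<close> given \<open>C = c\<close>, with a junk value if \<open>C = c\<close> has probability zero.\<close>

definition cond_law :: "'w pmf \<Rightarrow> ('w \<Rightarrow> 'a) \<Rightarrow> ('w \<Rightarrow> 'c) \<Rightarrow> 'c \<Rightarrow> 'a pmf" where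
  "cond_law P A C c = (if c \<in> C ` set_pmf P then map_pmf A (cond_pmf P {\<omega>. C \<omega> = c}) else return_pmf undefined)"

lemma finite_cond_law: "finite (set_pmf P) \<Longrightarrow> finite (set_pmf (cond_law P A C c))"
proof -
  assume fin: "finite (set_pmf P)"
  have "set_pmf (cond_pmf P {\<omega>. C \<omega> = c}) = set_pmf P \<inter> {\<omega>. C \<omega> = c}" if "c \<in> C ` set_pmf P"
    using that by (intro set_cond_pmf) auto
  then show ?thesis using fin by (auto simp: cond_law_def)
qed

lemma pmf_cond_law:
  assumes "c \<in> C ` set_pmf P"
  shows "pmf (cond_law P A C c) a = measure_pmf.prob P {\<omega>. A \<omega> = a \<and> C \<omega> = c} / measure_pmf.prob P {\<omega>. C \<omega> = c}"
proof -
  have ne: "set_pmf P \<inter> {\<omega>. C \<omega> = c} \<noteq> {}" using assms by auto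
  have "pmf (cond_law P A C c) a = measure_pmf.prob (cond_pmf P {\<omega>. C \<omega> = c}) (A -` {a})"
    using assms by (simp add: cond_law_def pmf_map)
  also have "\<dots> = measure_pmf.prob P ({\<omega>. C \<omega> = c} \<inter> A -` {a}) / measure_pmf.prob P {\<omega>. C \<omega> = c}"
  proof -
    have "measure_pmf.prob P {\<omega>. C \<omega> = c} \<noteq> 0" using ne by (simp add: measure_pmf_zero_iff)
    moreover have "measure_pmf (cond_pmf P {\<omega>. C \<omega> = c}) = uniform_measure (measure_pmf P) {\<omega>. C \<omega> = c}"
      by (rule cond_pmf.rep_eq[OF ne])
    ultimately show ?thesis
      by (simp add: measure_uniform_measure emeasure_measure_pmf_not_zero measure_pmf.emeasure_eq_measure)
  qed
  also have "{\<omega>. C \<omega> = c} \<inter> A -` {a} = {\<omega>. A \<omega> = a \<and> C \<omega> = c}" by auto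
  finally show ?thesis .
qed

text \<open>Any pair can be drawn by first drawing \<open>C\<close> and then \<open>A\<close> from
  \<open>cond_law\<close>; the junk value of \<open>cond_law\<close> sits only at values of
  \<open>C\<close> that never occur.\<close>

lemma disintegrate: "map_pmf (\<lambda>\<omega>. (C \<omega>, A \<omega>)) P = bind_pmf (map_pmf C P) (\<lambda>c. map_pmf (Pair c) (cond_law P A C c))"
proof (rule pmf_eqI, clarify)
  fix c a
  have "pmf (bind_pmf (map_pmf C P) (\<lambda>c. map_pmf (Pair c) (cond_law P A C c))) (c, a) =
    pmf (map_pmf C P) c * pmf (map_pmf (Pair c) (cond_law P A C c)) (c, a)"
    by (rule pmf_bind_determined) auto
  also have "pmf (map_pmf (Pair c) (cond_law P A C c)) (c, a) = pmf (cond_law P A C c) a"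
    by (rule pmf_map_inj') (simp add: inj_on_def)
  also have "pmf (map_pmf C P) c * pmf (cond_law P A C c) a = measure_pmf.prob P {\<omega>. A \<omega> = a \<and> C \<omega> = c}"
  proof (cases "c \<in> C ` set_pmf P")
    case True
    then have "measure_pmf.prob P {\<omega>. C \<omega> = c} \<noteq> 0" by (auto simp: measure_pmf_zero_iff)
    then show ?thesis using True by (simp add: pmf_cond_law pmf_map vimage_def)
  next
    case False
    then have "measure_pmf.prob P {\<omega>. A \<omega> = a \<and> C \<omega> = c} = 0" by (auto simp: measure_pmf_zero_iff)
    then show ?thesis using False by (simp add: pmf_map_outside)
  qed
  also have "\<dots> = pmf (map_pmf (\<lambda>\<omega>. (C \<omega>, A \<omega>)) P) (c, a)"
    by (simp add: pmf_map vimage_def conj_commute)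
  finally show "pmf (map_pmf (\<lambda>\<omega>. (C \<omega>, A \<omega>)) P) (c, a) =
    pmf (bind_pmf (map_pmf C P) (\<lambda>c. map_pmf (Pair c) (cond_law P A C c))) (c, a)" by simp
qed

text \<open>Under conditional independence the law of \<open>A\<close> given \<open>(B, C)\<close>
  agrees with the law given \<open>C\<close>, so \<open>A\<close> can be drawn after the pair by a
  kernel that ignores \<open>B\<close>.\<close>

lemma disintegrate_cind:
  assumes ci: "cind P A B C"
  shows "map_pmf (\<lambda>\<omega>. (B \<omega>, C \<omega>, A \<omega>)) P = bind_pmf (map_pmf (\<lambda>\<omega>. (B \<omega>, C \<omega>)) P) (\<lambda>(b, c). map_pmf (\<lambda>a. (b, c, a)) (cond_law P A C c))"
proof -
  have "map_pmf (\<lambda>\<omega>. (B \<omega>, C \<omega>, A \<omega>)) P = map_pmf (\<lambda>((b, c), a). (b, c, a)) (map_pmf (\<lambda>\<omega>. ((B \<omega>, C \<omega>), A \<omega>)) P)"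
    by (simp add: map_pmf_comp)
  also have "\<dots> = bind_pmf (map_pmf (\<lambda>\<omega>. (B \<omega>, C \<omega>)) P) (\<lambda>(b, c). map_pmf (\<lambda>a. (b, c, a)) (cond_law P A (\<lambda>\<omega>. (B \<omega>, C \<omega>)) (b, c)))"
    by (simp add: disintegrate[of "\<lambda>\<omega>. (B \<omega>, C \<omega>)"] map_bind_pmf map_pmf_comp split_def)
  also have "\<dots> = bind_pmf (map_pmf (\<lambda>\<omega>. (B \<omega>, C \<omega>)) P) (\<lambda>(b, c). map_pmf (\<lambda>a. (b, c, a)) (cond_law P A C c))"
  proof (intro bind_pmf_cong refl, clarify)
    fix b c assume bc: "(b, c) \<in> set_pmf (map_pmf (\<lambda>\<omega>. (B \<omega>, C \<omega>)) P)"
    then have s: "(b, c) \<in> (\<lambda>\<omega>. (B \<omega>, C \<omega>)) ` set_pmf P" "c \<in> C ` set_pmf P" by auto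
    have "cond_law P A (\<lambda>\<omega>. (B \<omega>, C \<omega>)) (b, c) = cond_law P A C c"
    proof (rule pmf_eqI)
      fix a
      have nz: "measure_pmf.prob P {\<omega>. B \<omega> = b \<and> C \<omega> = c} \<noteq> 0" "measure_pmf.prob P {\<omega>. C \<omega> = c} \<noteq> 0"
        using s by (auto simp: measure_pmf_zero_iff)
      show "pmf (cond_law P A (\<lambda>\<omega>. (B \<omega>, C \<omega>)) (b, c)) a = pmf (cond_law P A C c) a"
        unfolding pmf_cond_law[OF s(1)] pmf_cond_law[OF s(2)] using cindD[OF ci, of "{a}" "{b}" c] nz by (simp add: field_simps)
    qed
    then show "map_pmf (\<lambda>a. (b, c, a)) (cond_law P A (\<lambda>\<omega>. (B \<omega>, C \<omega>)) (b, c)) = map_pmf (\<lambda>a. (b, c, a)) (cond_law P A C c)" by simp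
  qed
  finally show ?thesis .
qed

text \<open>Three successive disintegrations, with \<open>B\<close> always the pair of states. The
  independences say what each kernel may look at: \<alpha> of the states for \<open>V\<close>,
  \<beta> of the states and \<open>V\<close> for \<open>U\<close>, and \<open>U\<close>, the first
  state and \<open>V\<close> for the input. The output is drawn afresh from the channel.\<close>

lemma kernels_aux_law:
  fixes S :: "'w \<Rightarrow> 's1 \<times> 's2"
  assumes S: "map_pmf S P = p"
    and v: "cind P V S (\<lambda>\<omega>. \<alpha> (S \<omega>))" and u: "cind P U S (\<lambda>\<omega>. (\<beta> (S \<omega>), V \<omega>))"
    and x: "cind P X S (\<lambda>\<omega>. (U \<omega>, fst (S \<omega>), V \<omega>))"
  shows "bind_pmf P (\<lambda>\<omega>. map_pmf (\<lambda>y. (fst (S \<omega>), snd (S \<omega>), V \<omega>, U \<omega>, X \<omega>, y)) (ch (X \<omega>) (fst (S \<omega>)) (snd (S \<omega>)))) =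
    aux_law p ch (\<lambda>s1 s2. cond_law P V (\<lambda>\<omega>. \<alpha> (S \<omega>)) (\<alpha> (s1, s2)))
      (\<lambda>s1 s2 v. cond_law P U (\<lambda>\<omega>. (\<beta> (S \<omega>), V \<omega>)) (\<beta> (s1, s2), v))
      (\<lambda>u s1 v. cond_law P X (\<lambda>\<omega>. (U \<omega>, fst (S \<omega>), V \<omega>)) (u, s1, v))"
proof -
  let ?kv = "\<lambda>s. cond_law P V (\<lambda>\<omega>. \<alpha> (S \<omega>)) (\<alpha> s)" and ?ku = "\<lambda>s v. cond_law P U (\<lambda>\<omega>. (\<beta> (S \<omega>), V \<omega>)) (\<beta> s, v)"
   and ?kx = "\<lambda>u s1 v. cond_law P X (\<lambda>\<omega>. (U \<omega>, fst (S \<omega>), V \<omega>)) (u, s1, v)"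
  have 1: "map_pmf (\<lambda>\<omega>. (S \<omega>, V \<omega>)) P = bind_pmf p (\<lambda>s. map_pmf (Pair s) (?kv s))"
  proof -
    have "map_pmf (\<lambda>\<omega>. (S \<omega>, V \<omega>)) P = map_pmf (\<lambda>(s, c, v). (s, v)) (map_pmf (\<lambda>\<omega>. (S \<omega>, \<alpha> (S \<omega>), V \<omega>)) P)"
      by (simp add: map_pmf_comp)
    then show ?thesis
      unfolding disintegrate_cind[OF v] S[symmetric] by (simp add: map_bind_pmf map_pmf_comp bind_map_pmf)
  qed
  have 2: "map_pmf (\<lambda>\<omega>. (S \<omega>, V \<omega>, U \<omega>)) P = bind_pmf p (\<lambda>s. bind_pmf (?kv s) (\<lambda>v. map_pmf (\<lambda>u. (s, v, u)) (?ku s v)))"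
  proof -
    have "map_pmf (\<lambda>\<omega>. (S \<omega>, V \<omega>, U \<omega>)) P = map_pmf (\<lambda>(s, c, u). (s, snd c, u)) (map_pmf (\<lambda>\<omega>. (S \<omega>, (\<beta> (S \<omega>), V \<omega>), U \<omega>)) P)"
      by (simp add: map_pmf_comp)
    also have "\<dots> = bind_pmf (map_pmf (\<lambda>\<omega>. (S \<omega>, V \<omega>)) P) (\<lambda>(s, v). map_pmf (\<lambda>u. (s, v, u)) (?ku s v))"
      unfolding disintegrate_cind[OF u] by (simp add: map_bind_pmf map_pmf_comp bind_map_pmf)
    finally show ?thesis unfolding 1 by (simp add: bind_assoc_pmf bind_map_pmf)
  qed
  have 3: "map_pmf (\<lambda>\<omega>. (S \<omega>, V \<omega>, U \<omega>, X \<omega>)) P = bind_pmf p (\<lambda>s. bind_pmf (?kv s) (\<lambda>v. bind_pmf (?ku s v) (\<lambda>u. map_pmf (\<lambda>x. (s, v, u, x)) (?kx u (fst s) v))))"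
  proof -
    have "map_pmf (\<lambda>\<omega>. (S \<omega>, V \<omega>, U \<omega>, X \<omega>)) P = map_pmf (\<lambda>(s, (u, s1, v), x). (s, v, u, x)) (map_pmf (\<lambda>\<omega>. (S \<omega>, (U \<omega>, fst (S \<omega>), V \<omega>), X \<omega>)) P)"
      by (simp add: map_pmf_comp)
    also have "\<dots> = bind_pmf (map_pmf (\<lambda>\<omega>. (S \<omega>, V \<omega>, U \<omega>)) P) (\<lambda>(s, v, u). map_pmf (\<lambda>x. (s, v, u, x)) (?kx u (fst s) v))"
      unfolding disintegrate_cind[OF x] by (simp add: map_bind_pmf map_pmf_comp bind_map_pmf)
    finally show ?thesis unfolding 2 by (simp add: bind_assoc_pmf bind_map_pmf)
  qed
  have "bind_pmf P (\<lambda>\<omega>. map_pmf (\<lambda>y. (fst (S \<omega>), snd (S \<omega>), V \<omega>, U \<omega>, X \<omega>, y)) (ch (X \<omega>) (fst (S \<omega>)) (snd (S \<omega>)))) =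
    bind_pmf (map_pmf (\<lambda>\<omega>. (S \<omega>, V \<omega>, U \<omega>, X \<omega>)) P) (\<lambda>(s, v, u, x). map_pmf (\<lambda>y. (fst s, snd s, v, u, x, y)) (ch x (fst s) (snd s)))"
    by (simp add: bind_map_pmf)
  also have "\<dots> = aux_law p ch (\<lambda>s1 s2. ?kv (s1, s2)) (\<lambda>s1 s2 v. ?ku (s1, s2) v) ?kx"
    unfolding 3 aux_law_def by (simp add: bind_assoc_pmf bind_map_pmf split_def map_pmf_def bind_return_pmf)
  finally show ?thesis .
qed

section \<open>Prefixes and suffixes of blocks\<close>

definition lo :: "nat \<Rightarrow> (nat \<Rightarrow> 'a) \<Rightarrow> nat \<Rightarrow> 'a" where "lo i h = restrict h {..<i}"
text \<open>Positions start at 0: \<open>lo i\<close> is the strict past of position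
  \<open>i\<close>, while \<open>hi i\<close> contains position \<open>i\<close>, so the strict
  future is \<open>hi (Suc i)\<close>.\<close>

definition hi :: "nat \<Rightarrow> (nat \<Rightarrow> 'a) \<Rightarrow> nat \<Rightarrow> 'a" where "hi i h = restrict h {i..}"

lemma lo_eq_iff: "lo i h = lo i h' \<longleftrightarrow> (\<forall>j<i. h j = h' j)"
  unfolding lo_def by (auto simp: fun_eq_iff restrict_def)

lemma hi_eq_iff: "hi i h = hi i h' \<longleftrightarrow> (\<forall>j\<ge>i. h j = h' j)"
  unfolding hi_def by (auto simp: fun_eq_iff restrict_def)

lemma lo_Suc_eq_iff: "lo (Suc i) h = lo (Suc i) h' \<longleftrightarrow> lo i h = lo i h' \<and> h i = h' i"
  unfolding lo_eq_iff by (auto simp: less_Suc_eq)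

lemma hi_Suc_eq_iff: "hi i h = hi i h' \<longleftrightarrow> h i = h' i \<and> hi (Suc i) h = hi (Suc i) h'"
  unfolding hi_eq_iff by (metis Suc_leD Suc_leI le_neq_implies_less order_refl)

lemma lo_lo [simp]: "lo i (lo i h) = lo i h"
  by (auto simp: lo_def restrict_def)

lemma set_Pi_pmf_default: fixes n :: nat shows "f \<in> set_pmf (Pi_pmf {..<n} d q) \<Longrightarrow> n \<le> j \<Longrightarrow> f j = d"
  using set_Pi_pmf_subset[OF finite_lessThan, of n d q] by fastforce

lemma Pi_pmf_split_at:
  assumes "i < n"
  shows "map_pmf (\<lambda>y. (lo i y, y i)) (Pi_pmf {..<n} undefined q) = pair_pmf (Pi_pmf {..<i} undefined q) (q i)"
proof -
  have "map_pmf (\<lambda>y. (lo i y, y i)) (Pi_pmf {..<n} undefined q) =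
      map_pmf (\<lambda>y. (lo i y, y i)) (map_pmf (\<lambda>f x. if x \<in> {..<Suc i} then f x else undefined) (Pi_pmf {..<n} undefined q))"
    unfolding map_pmf_comp by (intro map_pmf_cong refl) (auto simp: lo_def restrict_def fun_eq_iff)
  also have "\<dots> = map_pmf (\<lambda>y. (lo i y, y i)) (Pi_pmf {..<Suc i} undefined q)"
    using assms by (subst Pi_pmf_subset[symmetric]) auto
  also have "\<dots> = map_pmf (\<lambda>y. (lo i y, y i)) (map_pmf (\<lambda>(y, f). f(i := y)) (pair_pmf (q i) (Pi_pmf {..<i} undefined q)))"
    unfolding lessThan_Suc by (subst Pi_pmf_insert) auto
  also have "\<dots> = map_pmf (\<lambda>(y, f). (f, y)) (pair_pmf (q i) (Pi_pmf {..<i} undefined q))"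
    unfolding map_pmf_comp
  proof (intro map_pmf_cong refl, clarsimp)
    fix a b assume "b \<in> set_pmf (Pi_pmf {..<i} undefined q)"
    then show "lo i (b(i := a)) = b"
      using set_Pi_pmf_default[of b i undefined q] by (auto simp: lo_def restrict_def fun_eq_iff)
  qed
  finally show ?thesis by (subst pair_commute_pmf)
qed

text \<open>Additivity of entropy over independent letters; \<open>lo n\<close> cuts off the
  constant default positions.\<close>

lemma ent_Pi_pmf:
  fixes q :: "'a::finite pmf"
  shows "ent (Pi_pmf {..<n} d (\<lambda>_. q)) (\<lambda>s. lo n (\<lambda>j. \<phi> (s j))) = real n * ent q \<phi>"
proof -
  let ?P = "Pi_pmf {..<n} d (\<lambda>_. q)"
  have fin: "finite (set_pmf ?P)" by (subst set_Pi_pmf) (auto intro!: finite_PiE_dflt)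
  have pr: "pr ?P (\<lambda>s. lo n (\<lambda>j. \<phi> (s j))) s = (\<Prod>j<n. pr q \<phi> (s j))" for s
  proof -
    have "pr ?P (\<lambda>s. lo n (\<lambda>j. \<phi> (s j))) s = measure_pmf.prob ?P (PiE_dflt {..<n} d (\<lambda>j. {a. \<phi> a = \<phi> (s j)}))"
      unfolding pr_def by (intro measure_prob_cong_0) (auto simp: lo_eq_iff PiE_dflt_def pmf_eq_0_set_pmf set_Pi_pmf)
    then show ?thesis by (simp add: measure_Pi_pmf_PiE_dflt pr_def)
  qed
  have "ent ?P (\<lambda>s. lo n (\<lambda>j. \<phi> (s j))) = measure_pmf.expectation ?P (\<lambda>s. \<Sum>j<n. - log 2 (pr q \<phi> (s j)))"
    unfolding ent_def pr
  proof (intro expectation_cong_pmf)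
    fix s assume "s \<in> set_pmf ?P"
    then have "s j \<in> set_pmf q" if "j < n" for j using that by (auto simp: set_Pi_pmf PiE_dflt_def)
    then have "0 < pr q \<phi> (s j)" if "j < n" for j using that by (intro pr_pos) auto
    then have "ln (\<Prod>j<n. pr q \<phi> (s j)) = (\<Sum>j<n. ln (pr q \<phi> (s j)))"
      by (intro ln_prod) (auto simp: less_imp_neq[THEN not_sym])
    then show "- log 2 (\<Prod>j<n. pr q \<phi> (s j)) = (\<Sum>j<n. - log 2 (pr q \<phi> (s j)))"
      by (simp add: log_def sum_divide_distrib sum_negf)
  qed
  also have "\<dots> = (\<Sum>j<n. measure_pmf.expectation ?P (\<lambda>s. - log 2 (pr q \<phi> (s j))))"
    by (intro Bochner_Integration.integral_sum integrable_measure_pmf_finite fin)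
  also have "\<dots> = (\<Sum>j<n. measure_pmf.expectation (map_pmf (\<lambda>s. s j) ?P) (\<lambda>a. - log 2 (pr q \<phi> a)))"
    by simp
  also have "\<dots> = (\<Sum>j<n. ent q \<phi>)"
    by (intro sum.cong refl) (simp add: Pi_pmf_component ent_def)
  finally show ?thesis by simp
qed

text \<open>\<open>gibbs\<close> against a reference law which, given \<open>Z\<close>, bets on the
  guess \<open>g\<close>: a correct guess costs one bit, a wrong one costs
  \<open>log 2 (card M)\<close> more.\<close>

lemma fano:
  assumes fin: "finite (set_pmf P)" and M: "finite M" "W ` set_pmf P \<subseteq> M"
  shows "ent P (\<lambda>\<omega>. (W \<omega>, Z \<omega>)) - ent P Z \<le> 1 + measure_pmf.prob P {\<omega>. g (Z \<omega>) \<noteq> W \<omega>} * log 2 (card M)"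
proof -
  have ne: "M \<noteq> {}" using M set_pmf_not_empty[of P] by auto
  then have c: "1 \<le> real (card M)" using M by (simp add: Suc_leI card_gt_0_iff)
  \<comment> \<open>Mass one half goes to the guess, the other half is spread evenly over
    \<open>M\<close>; the sum over \<open>M\<close> is at most 1 whether or not the guess lies in
    \<open>M\<close>.\<close>
  define q where "q w z = (if w = g z then 1 / 2 else 1 / (2 * real (card M)))" for w z
  have qpos: "0 < q w z" for w z using c by (simp add: q_def)
  have qsum: "(\<Sum>w\<in>M. q w z) \<le> 1" for z
  proof -
    have "(\<Sum>w\<in>M. q w z) \<le> (\<Sum>w\<in>M. (if w = g z then 1 / 2 else 0) + 1 / (2 * real (card M)))"
      by (intro sum_mono) (auto simp: q_def)
    also have "\<dots> \<le> 1 / 2 + 1 / 2" using c M by (auto simp: sum.distrib)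
    finally show ?thesis by simp
  qed
  let ?r = "\<lambda>\<omega>. q (W \<omega>) (Z \<omega>) * pr P Z \<omega> / pr P (\<lambda>\<omega>. (W \<omega>, Z \<omega>)) \<omega>"
  let ?S = "set_pmf P"
  let ?pz = "pmf (map_pmf Z P)" and ?pwz = "pmf (map_pmf (\<lambda>\<omega>. (W \<omega>, Z \<omega>)) P)"
  have "measure_pmf.expectation P ?r = measure_pmf.expectation (map_pmf (\<lambda>\<omega>. (W \<omega>, Z \<omega>)) P) (\<lambda>(w, z). q w z * ?pz z / ?pwz (w, z))"
    by (simp add: pr_pmf_map)
  also have "\<dots> = (\<Sum>(w, z)\<in>M \<times> Z ` ?S. ?pwz (w, z) * (q w z * ?pz z / ?pwz (w, z)))"
    using fin M by (subst expectation_sum[where A="M \<times> Z ` ?S"]) (auto simp: split_def)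
  also have "\<dots> \<le> (\<Sum>(w, z)\<in>M \<times> Z ` ?S. q w z * ?pz z)"
    using qpos by (intro sum_mono) (auto simp: less_imp_le)
  also have "\<dots> = (\<Sum>z\<in>Z ` ?S. ?pz z * (\<Sum>w\<in>M. q w z))"
    by (subst sum.cartesian_product[symmetric], subst sum.swap) (simp add: sum_distrib_left mult.commute)
  also have "\<dots> \<le> (\<Sum>z\<in>Z ` ?S. ?pz z * 1)"
    using qsum by (intro sum_mono mult_left_mono) auto
  also have "\<dots> = 1" using fin by (simp add: sum_pmf_eq_1)
  finally have "0 \<le> measure_pmf.expectation P (\<lambda>\<omega>. - log 2 (?r \<omega>))"
    by (intro gibbs(1) fin) (auto intro!: divide_pos_pos mult_pos_pos pr_pos qpos)
  also have "\<dots> = measure_pmf.expectation P (\<lambda>\<omega>. - log 2 (q (W \<omega>) (Z \<omega>)) - log 2 (pr P Z \<omega>) + log 2 (pr P (\<lambda>\<omega>. (W \<omega>, Z \<omega>)) \<omega>))"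
  proof (intro expectation_cong_pmf)
    fix \<omega> assume "\<omega> \<in> ?S"
    note p = pr_pos[OF this, of Z] pr_pos[OF this, of "\<lambda>\<omega>. (W \<omega>, Z \<omega>)"] qpos[of "W \<omega>" "Z \<omega>"]
    then show "- log 2 (?r \<omega>) = - log 2 (q (W \<omega>) (Z \<omega>)) - log 2 (pr P Z \<omega>) + log 2 (pr P (\<lambda>\<omega>. (W \<omega>, Z \<omega>)) \<omega>)"
      by (simp add: log_mult log_divide)
  qed
  also have "\<dots> = measure_pmf.expectation P (\<lambda>\<omega>. - log 2 (q (W \<omega>) (Z \<omega>))) + ent P Z - ent P (\<lambda>\<omega>. (W \<omega>, Z \<omega>))"
    unfolding ent_def by (simp add: integrable_measure_pmf_finite[OF fin])
  also have "measure_pmf.expectation P (\<lambda>\<omega>. - log 2 (q (W \<omega>) (Z \<omega>))) =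
      measure_pmf.expectation P (\<lambda>\<omega>. 1 + log 2 (card M) * indicator {\<omega>. g (Z \<omega>) \<noteq> W \<omega>} \<omega>)"
    using c by (intro expectation_cong_pmf) (auto simp: q_def log_divide log_mult indicator_def)
  also have "\<dots> = 1 + measure_pmf.prob P {\<omega>. g (Z \<omega>) \<noteq> W \<omega>} * log 2 (card M)"
    by (simp add: integrable_measure_pmf_finite[OF fin] mult.commute)
  finally show ?thesis by simp
qed

lemma cind_map: "cind (map_pmf g P) A B C \<longleftrightarrow> cind P (\<lambda>\<omega>. A (g \<omega>)) (\<lambda>\<omega>. B (g \<omega>)) (\<lambda>\<omega>. C (g \<omega>))"
  unfolding cind_def by (simp add: vimage_def)

text \<open>\<open>pre i\<close> is the law of the message, the states and the first \<open>i\<close> outputs: the auxiliary variables of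
  position \<open>i\<close> are functions of these, and the conditional independences hold before output \<open>i\<close> is drawn.\<close>

locale block =
  fixes n :: nat and M :: "nat set" and p :: "('s1::finite \<times> 's2::finite) pmf"
    and ch :: "'x::finite \<Rightarrow> 's1 \<Rightarrow> 's2 \<Rightarrow> 'y::finite pmf"
    and xin :: "nat \<Rightarrow> (nat \<Rightarrow> 's1 \<times> 's2) \<Rightarrow> nat \<Rightarrow> 'x" and T :: "(nat \<Rightarrow> 's1 \<times> 's2) \<Rightarrow> nat"
  assumes M: "finite M" "M \<noteq> {}" and n: "0 < n"
begin

definition pre :: "nat \<Rightarrow> (nat \<times> (nat \<Rightarrow> 's1 \<times> 's2) \<times> (nat \<Rightarrow> 'y)) pmf" where
  "pre i = do {
     w \<leftarrow> pmf_of_set M;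
     s \<leftarrow> Pi_pmf {..<n} undefined (\<lambda>_. p);
     y \<leftarrow> Pi_pmf {..<i} undefined (\<lambda>j. ch (xin w s j) (fst (s j)) (snd (s j)));
     return_pmf (w, s, y)
   }"

abbreviation "P \<equiv> pre n"

definition "W = (\<lambda>\<omega> :: nat \<times> (nat \<Rightarrow> 's1 \<times> 's2) \<times> (nat \<Rightarrow> 'y). fst \<omega>)"
definition "St i = (\<lambda>\<omega> :: nat \<times> (nat \<Rightarrow> 's1 \<times> 's2) \<times> (nat \<Rightarrow> 'y). fst (snd \<omega>) i)" for i
definition "S1 = (\<lambda>(\<omega> :: nat \<times> (nat \<Rightarrow> 's1 \<times> 's2) \<times> (nat \<Rightarrow> 'y)) j. fst (fst (snd \<omega>) j))"
definition "S2 = (\<lambda>(\<omega> :: nat \<times> (nat \<Rightarrow> 's1 \<times> 's2) \<times> (nat \<Rightarrow> 'y)) j. snd (fst (snd \<omega>) j))"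
definition "Y = (\<lambda>\<omega> :: nat \<times> (nat \<Rightarrow> 's1 \<times> 's2) \<times> (nat \<Rightarrow> 'y). snd (snd \<omega>))"
definition "D = (\<lambda>\<omega> :: nat \<times> (nat \<Rightarrow> 's1 \<times> 's2) \<times> (nat \<Rightarrow> 'y). T (fst (snd \<omega>)))"
definition "X i = (\<lambda>\<omega> :: nat \<times> (nat \<Rightarrow> 's1 \<times> 's2) \<times> (nat \<Rightarrow> 'y). xin (fst \<omega>) (fst (snd \<omega>)) i)" for i
definition "trunc i = (\<lambda>(\<omega> :: nat \<times> (nat \<Rightarrow> 's1 \<times> 's2) \<times> (nat \<Rightarrow> 'y)). (fst \<omega>, fst (snd \<omega>), lo i (snd (snd \<omega>))))" for i

lemmas rv_defs = W_def St_def S1_def S2_def Y_def D_def X_def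

lemma fst_St: "fst (St i \<omega>) = S1 \<omega> i" and snd_St: "snd (St i \<omega>) = S2 \<omega> i"
  by (auto simp: rv_defs)

lemma rv_trunc [simp]: "W (trunc i \<omega>) = W \<omega>" "St j (trunc i \<omega>) = St j \<omega>" "S1 (trunc i \<omega>) = S1 \<omega>" "S2 (trunc i \<omega>) = S2 \<omega>"
  "D (trunc i \<omega>) = D \<omega>" "X j (trunc i \<omega>) = X j \<omega>" "Y (trunc i \<omega>) = lo i (Y \<omega>)"
  by (auto simp: rv_defs trunc_def)

lemma finite_Pi: "finite (set_pmf (Pi_pmf {..<m} undefined (q :: nat \<Rightarrow> 'a::finite pmf)))"
  by (subst set_Pi_pmf) (auto intro!: finite_PiE_dflt)

lemma finite_pre: "finite (set_pmf (pre i))"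
  unfolding pre_def using M by (auto intro!: finite_UN_I finite_Pi)

lemma set_pre:
  "(w, s, y) \<in> set_pmf (pre i) \<Longrightarrow> w \<in> M \<and> (\<forall>j\<ge>n. s j = undefined) \<and> (\<forall>j\<ge>i. y j = undefined)"
  unfolding pre_def using M by (auto dest: set_Pi_pmf_default)

lemma pmf_pre: "pmf (pre i) (w, s, y) = pmf (pmf_of_set M) w * pmf (Pi_pmf {..<n} undefined (\<lambda>_. p)) s *
   pmf (Pi_pmf {..<i} undefined (\<lambda>j. ch (xin w s j) (fst (s j)) (snd (s j)))) y"
  unfolding pre_def
  by (subst pmf_bind_determined[where a="w"], force,
      subst pmf_bind_determined[where a="s"], force,
      subst pmf_bind_determined[where a="y"], force) simp

lemma map_states: "map_pmf (\<lambda>\<omega>. (W \<omega>, fst (snd \<omega>))) (pre i) = pair_pmf (pmf_of_set M) (Pi_pmf {..<n} undefined (\<lambda>_. p))"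
  unfolding pre_def pair_pmf_def by (simp add: map_bind_pmf W_def)

lemma map_St: "i < n \<Longrightarrow> map_pmf (St i) (pre j) = p"
proof -
  assume i: "i < n"
  have "map_pmf (St i) (pre j) = map_pmf (\<lambda>x. snd x i) (map_pmf (\<lambda>\<omega>. (W \<omega>, fst (snd \<omega>))) (pre j))"
    by (simp add: map_pmf_comp St_def)
  also have "\<dots> = map_pmf (\<lambda>s. s i) (map_pmf snd (pair_pmf (pmf_of_set M) (Pi_pmf {..<n} undefined (\<lambda>_. p))))"
    by (simp add: map_states map_pmf_comp)
  also have "\<dots> = p" using i by (simp add: map_snd_pair_pmf Pi_pmf_component)
  finally show ?thesis .
qed

lemma map_trunc:
  assumes "i < n"
  shows "map_pmf (\<lambda>\<omega>. (trunc i \<omega>, Y \<omega> i)) P = bind_pmf (pre i) (\<lambda>\<omega>. map_pmf (Pair \<omega>) (ch (X i \<omega>) (fst (St i \<omega>)) (snd (St i \<omega>))))"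
proof -
  have "map_pmf (\<lambda>\<omega>. (trunc i \<omega>, Y \<omega> i)) P = do {
     w \<leftarrow> pmf_of_set M;
     s \<leftarrow> Pi_pmf {..<n} undefined (\<lambda>_. p);
     map_pmf (\<lambda>z. ((w, s, fst z), snd z)) (map_pmf (\<lambda>y. (lo i y, y i)) (Pi_pmf {..<n} undefined (\<lambda>j. ch (xin w s j) (fst (s j)) (snd (s j)))))}"
    by (simp add: pre_def map_bind_pmf map_pmf_comp trunc_def Y_def map_pmf_def bind_assoc_pmf bind_return_pmf)
  also have "\<dots> = bind_pmf (pre i) (\<lambda>\<omega>. map_pmf (Pair \<omega>) (ch (X i \<omega>) (fst (St i \<omega>)) (snd (St i \<omega>))))"
    unfolding Pi_pmf_split_at[OF assms]
    by (simp add: pre_def pair_pmf_def map_bind_pmf bind_assoc_pmf bind_return_pmf map_pmf_def X_def St_def)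
  finally show ?thesis .
qed

text \<open>\<open>cind_swap\<close> for splices that act on the states only, with message and
  outputs taken from the first copy. It suffices that the splice keeps the products of
  \<open>p\<close> letter by letter, the default beyond \<open>n\<close>, and the channel law at
  each of the first \<open>i\<close> positions.\<close>

lemma pre_swap:
  fixes mix :: "(nat \<Rightarrow> 's1 \<times> 's2) \<Rightarrow> (nat \<Rightarrow> 's1 \<times> 's2) \<Rightarrow> (nat \<Rightarrow> 's1 \<times> 's2)"
  assumes m: "\<And>w s y w' s' y'. (w, s, y) \<in> set_pmf (pre i) \<Longrightarrow> (w', s', y') \<in> set_pmf (pre i) \<Longrightarrow> C (w, s, y) = C (w', s', y') \<Longrightarrow>
      A (w, mix s s', y) = A (w, s, y) \<and> B (w, mix s s', y) = B (w', s', y') \<and> C (w, mix s s', y) = C (w, s, y) \<and>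
      mix (mix s s') (mix s' s) = s \<and>
      (\<forall>j<n. pmf p (mix s s' j) * pmf p (mix s' s j) = pmf p (s j) * pmf p (s' j)) \<and>
      (\<forall>j\<ge>n. mix s s' j = undefined) \<and>
      (\<forall>j<i. ch (xin w (mix s s') j) (fst (mix s s' j)) (snd (mix s s' j)) = ch (xin w s j) (fst (s j)) (snd (s j)))"
  shows "cind (pre i) A B C"
proof (rule cind_swap[OF finite_pre, where m="\<lambda>(w, s, y) (w', s', y'). (w, mix s s', y)"])
  fix \<omega> \<omega>' assume 0: "\<omega> \<in> set_pmf (pre i)" "\<omega>' \<in> set_pmf (pre i)" "C \<omega> = C \<omega>'"
  obtain w s y where w: "\<omega> = (w, s, y)" by (cases \<omega>)
  obtain w' s' y' where w': "\<omega>' = (w', s', y')" by (cases \<omega>')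
  note a = 0(1)[unfolded w] and b = 0(2)[unfolded w'] and c = 0(3)[unfolded w w']
  note m1 = m[OF a b c] and m2 = m[OF b a c[symmetric]]
  have z: "mix s s' j = undefined" "mix s' s j = undefined" if "j \<ge> n" for j
    using m1 m2 that by blast+
  have "pmf (Pi_pmf {..<n} undefined (\<lambda>_. p)) (mix s s') * pmf (Pi_pmf {..<n} undefined (\<lambda>_. p)) (mix s' s) =
     (\<Prod>j<n. pmf p (mix s s' j) * pmf p (mix s' s j))"
  proof -
    have "pmf (Pi_pmf {..<n} undefined (\<lambda>_. p)) (mix s s') = (\<Prod>j<n. pmf p (mix s s' j))"
      by (rule pmf_Pi') (auto simp: z)
    moreover have "pmf (Pi_pmf {..<n} undefined (\<lambda>_. p)) (mix s' s) = (\<Prod>j<n. pmf p (mix s' s j))"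
      by (rule pmf_Pi') (auto simp: z)
    ultimately show ?thesis by (simp add: prod.distrib)
  qed
  also have "\<dots> = (\<Prod>j<n. pmf p (s j) * pmf p (s' j))" using m1 by (intro prod.cong) auto
  also have "\<dots> = pmf (Pi_pmf {..<n} undefined (\<lambda>_. p)) s * pmf (Pi_pmf {..<n} undefined (\<lambda>_. p)) s'"
  proof -
    have "pmf (Pi_pmf {..<n} undefined (\<lambda>_. p)) s = (\<Prod>j<n. pmf p (s j))"
      by (rule pmf_Pi') (use set_pre[OF a] in auto)
    moreover have "pmf (Pi_pmf {..<n} undefined (\<lambda>_. p)) s' = (\<Prod>j<n. pmf p (s' j))"
      by (rule pmf_Pi') (use set_pre[OF b] in auto)
    ultimately show ?thesis by (simp add: prod.distrib)
  qed
  finally have e: "pmf (Pi_pmf {..<n} undefined (\<lambda>_. p)) (mix s s') * pmf (Pi_pmf {..<n} undefined (\<lambda>_. p)) (mix s' s) =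
     pmf (Pi_pmf {..<n} undefined (\<lambda>_. p)) s * pmf (Pi_pmf {..<n} undefined (\<lambda>_. p)) s'" .
  have k: "Pi_pmf {..<i} undefined (\<lambda>j. ch (xin w (mix s s') j) (fst (mix s s' j)) (snd (mix s s' j))) =
     Pi_pmf {..<i} undefined (\<lambda>j. ch (xin w s j) (fst (s j)) (snd (s j)))"
    "Pi_pmf {..<i} undefined (\<lambda>j. ch (xin w' (mix s' s) j) (fst (mix s' s j)) (snd (mix s' s j))) =
     Pi_pmf {..<i} undefined (\<lambda>j. ch (xin w' s' j) (fst (s' j)) (snd (s' j)))"
    using m1 m2 by (auto intro!: Pi_pmf_cong)
  have alg: "a * x * k * (c * y * l) = a * x' * k * (c * y' * l)" if "x * y = x' * y'" for a x k c y l x' y' :: real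
  proof -
    have "a * x * k * (c * y * l) = a * k * c * l * (x * y)" by (simp add: mult_ac)
    also have "\<dots> = a * x' * k * (c * y' * l)" unfolding that by (simp add: mult_ac)
    finally show ?thesis .
  qed
  have "pmf (pre i) (w, mix s s', y) * pmf (pre i) (w', mix s' s, y') = pmf (pre i) (w, s, y) * pmf (pre i) (w', s', y')"
    unfolding pmf_pre k by (rule alg[OF e])
  then show "A ((\<lambda>(w, s, y) (w', s', y'). (w, mix s s', y)) \<omega> \<omega>') = A \<omega> \<and>
       B ((\<lambda>(w, s, y) (w', s', y'). (w, mix s s', y)) \<omega> \<omega>') = B \<omega>' \<and>
       C ((\<lambda>(w, s, y) (w', s', y'). (w, mix s s', y)) \<omega> \<omega>') = C \<omega> \<and>
       (\<lambda>(w, s, y) (w', s', y'). (w, mix s s', y)) ((\<lambda>(w, s, y) (w', s', y'). (w, mix s s', y)) \<omega> \<omega>')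
        ((\<lambda>(w, s, y) (w', s', y'). (w, mix s s', y)) \<omega>' \<omega>) = \<omega> \<and>
       pmf (pre i) ((\<lambda>(w, s, y) (w', s', y'). (w, mix s s', y)) \<omega> \<omega>') *
       pmf (pre i) ((\<lambda>(w, s, y) (w', s', y'). (w, mix s s', y)) \<omega>' \<omega>) =
       pmf (pre i) \<omega> * pmf (pre i) \<omega>'"
    unfolding w w' using m1 by simp
qed

definition letter_law where
  "letter_law i V U = map_pmf (\<lambda>\<omega>. (S1 \<omega> i, S2 \<omega> i, V \<omega>, U \<omega>, X i \<omega>, Y \<omega> i)) P" for i V U

text \<open>The position is used as a time sharing index, uniform on \<open>{..<n}\<close>, so a
  functional of the mixed law is the mean over the positions. The independences are asked for under
  \<open>pre i\<close>, before output \<open>i\<close> is drawn; this output then comes from the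
  channel as in \<open>aux_law\<close>.\<close>

lemma single_letter:
  fixes V :: "nat \<Rightarrow> (nat \<times> (nat \<Rightarrow> 's1 \<times> 's2) \<times> (nat \<Rightarrow> 'y)) \<Rightarrow> 'v" and U :: "nat \<Rightarrow> (nat \<times> (nat \<Rightarrow> 's1 \<times> 's2) \<times> (nat \<Rightarrow> 'y)) \<Rightarrow> 'u"
  assumes tr: "\<And>i \<omega>. V i (trunc i \<omega>) = V i \<omega>" "\<And>i \<omega>. U i (trunc i \<omega>) = U i \<omega>"
    and ci: "\<And>i. i < n \<Longrightarrow> cind (pre i) (V i) (St i) (\<lambda>\<omega>. \<alpha> (St i \<omega>))"
       "\<And>i. i < n \<Longrightarrow> cind (pre i) (U i) (St i) (\<lambda>\<omega>. (\<beta> (St i \<omega>), V i \<omega>))"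
       "\<And>i. i < n \<Longrightarrow> cind (pre i) (X i) (St i) (\<lambda>\<omega>. (U i \<omega>, S1 \<omega> i, V i \<omega>))"
  shows "\<exists>(qv :: 's1 \<Rightarrow> 's2 \<Rightarrow> (nat \<times> 'v) pmf) (qu :: 's1 \<Rightarrow> 's2 \<Rightarrow> (nat \<times> 'v) \<Rightarrow> 'u pmf) qx.
    (\<forall>s1 s2. finite (set_pmf (qv s1 s2))) \<and> (\<forall>s1 s2 v. finite (set_pmf (qu s1 s2 v))) \<and>
    kernel_class (\<lambda>s t. \<alpha> s = \<alpha> t) (\<lambda>s t. \<beta> s = \<beta> t) qv qu \<and>
    n * eRate (aux_law p ch qv qu qx) = (\<Sum>i<n. eRate (letter_law i (V i) (U i))) \<and>
    n * eC1 (aux_law p ch qv qu qx) \<le> (\<Sum>i<n. eC1 (letter_law i (V i) (U i))) \<and>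
    n * eC2 (aux_law p ch qv qu qx) = (\<Sum>i<n. eC2 (letter_law i (V i) (U i))) \<and>
    n * eC2C (aux_law p ch qv qu qx) = (\<Sum>i<n. eC2C (letter_law i (V i) (U i)))"
proof -
  define kv where "kv i s1 s2 = cond_law (pre i) (V i) (\<lambda>\<omega>. \<alpha> (St i \<omega>)) (\<alpha> (s1, s2))" for i s1 s2
  define ku where "ku i s1 s2 v = cond_law (pre i) (U i) (\<lambda>\<omega>. (\<beta> (St i \<omega>), V i \<omega>)) (\<beta> (s1, s2), v)" for i s1 s2 v
  define kx where "kx i u s1 v = cond_law (pre i) (X i) (\<lambda>\<omega>. (U i \<omega>, fst (St i \<omega>), V i \<omega>)) (u, s1, v)" for i u s1 v
  have L: "letter_law i (V i) (U i) = aux_law p ch (kv i) (ku i) (kx i)" if i: "i < n" for i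
  proof -
    have "letter_law i (V i) (U i) = map_pmf (\<lambda>(\<omega>, y). (fst (St i \<omega>), snd (St i \<omega>), V i \<omega>, U i \<omega>, X i \<omega>, y)) (map_pmf (\<lambda>\<omega>. (trunc i \<omega>, Y \<omega> i)) P)"
      unfolding letter_law_def map_pmf_comp by (simp add: tr fst_St snd_St)
    also have "\<dots> = bind_pmf (pre i) (\<lambda>\<omega>. map_pmf (\<lambda>y. (fst (St i \<omega>), snd (St i \<omega>), V i \<omega>, U i \<omega>, X i \<omega>, y)) (ch (X i \<omega>) (fst (St i \<omega>)) (snd (St i \<omega>))))"
      unfolding map_trunc[OF i] by (simp add: map_bind_pmf map_pmf_comp)
    also have "\<dots> = aux_law p ch (kv i) (ku i) (kx i)"
      unfolding kv_def ku_def kx_def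
      by (rule kernels_aux_law) (use i ci in \<open>auto simp: map_St fst_St\<close>)
    finally show ?thesis .
  qed
  let ?L = "pmf_of_set {..<n}"
  have fin: "finite (set_pmf ?L)" "\<And>q s1 s2. finite (set_pmf (kv q s1 s2))" "\<And>q s1 s2 v. finite (set_pmf (ku q s1 s2 v))"
    using n by (auto simp: kv_def ku_def set_pmf_of_set lessThan_empty_iff intro!: finite_cond_law finite_pre)
  note ts = time_sharing[of ?L kv ku p ch kx, OF fin]
  have E: "real n * measure_pmf.expectation ?L (\<lambda>q. f (aux_law p ch (kv q) (ku q) (kx q))) = (\<Sum>i<n. f (letter_law i (V i) (U i)))" for f :: "_ \<Rightarrow> real"
    using n L by (subst integral_pmf_of_set) (auto simp: lessThan_empty_iff)
  show ?thesis
  proof (intro exI conjI allI)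
    show "kernel_class (\<lambda>s t. \<alpha> s = \<alpha> t) (\<lambda>s t. \<beta> s = \<beta> t) (mix_v ?L kv) (mix_u ku)"
      unfolding kernel_class_def mix_v_def mix_u_def by (auto simp: kv_def ku_def)
    show "finite (set_pmf (mix_v ?L kv s1 s2))" for s1 s2
      unfolding mix_v_def using fin by (auto simp del: set_pmf_of_set)
    show "finite (set_pmf (mix_u ku s1 s2 v))" for s1 s2 v
      unfolding mix_u_def by (rule fin)
    show "n * eRate (aux_law p ch (mix_v ?L kv) (mix_u ku) (mix_x kx)) = (\<Sum>i<n. eRate (letter_law i (V i) (U i)))"
      unfolding ts(1) by (rule E)
    show "n * eC1 (aux_law p ch (mix_v ?L kv) (mix_u ku) (mix_x kx)) \<le> (\<Sum>i<n. eC1 (letter_law i (V i) (U i)))"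
      unfolding E[symmetric] using ts(2) by (intro mult_left_mono) auto
    show "n * eC2 (aux_law p ch (mix_v ?L kv) (mix_u ku) (mix_x kx)) = (\<Sum>i<n. eC2 (letter_law i (V i) (U i)))"
      unfolding ts(3) by (rule E)
    show "n * eC2C (aux_law p ch (mix_v ?L kv) (mix_u ku) (mix_x kx)) = (\<Sum>i<n. eC2C (letter_law i (V i) (U i)))"
      unfolding ts(4) by (rule E)
  qed
qed

end

lemma lo_hi_cases: "h = (\<lambda>j. if j < i then lo i h j else hi i h j)"
  by (auto simp: lo_def hi_def fun_eq_iff)

lemma hi_at: "hi i h i = h i" by (simp add: hi_def)

lemma lo_upd: "lo i (h(i := u)) = lo i h" by (auto simp: lo_eq_iff)

section \<open>Conditional independences of the block variables\<close>

context block
begin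

text \<open>The states have the same law under every \<open>pre i\<close>. An independence among
  states alone may be checked at \<open>i = 0\<close>, where no output restricts the splice.\<close>

lemma cind_pre_states:
  assumes "cind (pre 0) (\<lambda>\<omega>. A (fst (snd \<omega>))) (\<lambda>\<omega>. B (fst (snd \<omega>))) (\<lambda>\<omega>. C (fst (snd \<omega>)))"
  shows "cind (pre i) (\<lambda>\<omega>. A (fst (snd \<omega>))) (\<lambda>\<omega>. B (fst (snd \<omega>))) (\<lambda>\<omega>. C (fst (snd \<omega>)))"
proof -
  have "map_pmf (\<lambda>\<omega>. fst (snd \<omega>)) (pre 0) = map_pmf (\<lambda>\<omega>. fst (snd \<omega>)) (pre i)"
    using arg_cong[OF trans[OF map_states[of 0] map_states[of i, symmetric]], of "map_pmf snd"]
    by (simp add: map_pmf_comp)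
  note e = this
  have "cind (map_pmf (\<lambda>\<omega>. fst (snd \<omega>)) (pre 0)) A B C" unfolding cind_map by (rule assms)
  then show ?thesis unfolding e cind_map .
qed

text \<open>The encoder as a function of what it really sees, the first state sequence and the
  description. The choice operator picks some pair of state sequences with these data; by
  \<open>X_eq\<close> it does not matter which.\<close>

definition "XS w g t = xin w (SOME s. (\<forall>j. fst (s j) = g j) \<and> T s = t)" for w g t

lemma X_eq:
  assumes "\<And>w s s'. (\<And>j. fst (s j) = fst (s' j)) \<Longrightarrow> T s = T s' \<Longrightarrow> xin w s = xin w s'"
  shows "X i \<omega> = XS (W \<omega>) (S1 \<omega>) (D \<omega>) i"
proof -
  let ?Q = "\<lambda>s. (\<forall>j. fst (s j) = S1 \<omega> j) \<and> T s = D \<omega>"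
  have "?Q (fst (snd \<omega>))" by (auto simp: rv_defs)
  then have "?Q (SOME s. ?Q s)" by (rule someI[of ?Q])
  then have "xin (W \<omega>) (SOME s. ?Q s) = xin (W \<omega>) (fst (snd \<omega>))"
    by (intro assms) (auto simp: rv_defs)
  then show ?thesis by (simp add: XS_def X_def W_def)
qed

text \<open>The splice takes the first states from one copy and the second states from the other.
  Before \<open>i\<close> the second states agree, from \<open>i\<close> on the first states agree,
  so at each position the splice is one of the two given pairs and the product of \<open>p\<close>
  is kept. The description is a function of the second states and agrees too, hence the inputs do
  not change.\<close>

lemma base_ub:
  assumes xd: "\<And>w s s'. (\<And>j. fst (s j) = fst (s' j)) \<Longrightarrow> T s = T s' \<Longrightarrow> xin w s = xin w s'"
    and T2: "\<And>s s'. (\<And>j. snd (s j) = snd (s' j)) \<Longrightarrow> T s = T s'"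
  shows "cind (pre i) (\<lambda>\<omega>. (W \<omega>, lo i (S1 \<omega>))) S2 (\<lambda>\<omega>. (D \<omega>, lo i (Y \<omega>), lo i (S2 \<omega>), hi i (S1 \<omega>)))"
proof (rule pre_swap[where mix="\<lambda>s s' j. (fst (s j), snd (s' j))"])
  fix w s y w' s' y'
  assume a: "(w, s, y) \<in> set_pmf (pre i)" "(w', s', y') \<in> set_pmf (pre i)"
    and c: "(D (w, s, y), lo i (Y (w, s, y)), lo i (S2 (w, s, y)), hi i (S1 (w, s, y))) =
      (D (w', s', y'), lo i (Y (w', s', y')), lo i (S2 (w', s', y')), hi i (S1 (w', s', y')))"
  have t: "T s = T s'" and l2: "\<And>j. j < i \<Longrightarrow> snd (s j) = snd (s' j)" and h1: "\<And>j. j \<ge> i \<Longrightarrow> fst (s j) = fst (s' j)"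
    using c by (auto simp: rv_defs lo_eq_iff hi_eq_iff)
  have tm: "T (\<lambda>j. (fst (s j), snd (s' j))) = T s'" by (rule T2) simp
  have xm: "xin w (\<lambda>j. (fst (s j), snd (s' j))) = xin w s" by (rule xd) (auto simp: tm t)
  have pp: "pmf p (fst (s j), snd (s' j)) * pmf p (fst (s' j), snd (s j)) = pmf p (s j) * pmf p (s' j)" for j
  proof (cases "j < i")
    case True
    then show ?thesis using l2[OF True] by (metis prod.collapse)
  next
    case False
    then have "fst (s j) = fst (s' j)" by (intro h1) simp
    then show ?thesis by (metis mult.commute prod.collapse)
  qed
  have dd: "(fst (s j), snd (s' j)) = undefined" if "j \<ge> n" for j
    using set_pre[OF a(1)] set_pre[OF a(2)] that by simp
  have l2': "lo i (\<lambda>j. snd (s' j)) = lo i (\<lambda>j. snd (s j))" using l2 by (auto simp: lo_eq_iff)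
  show "(W (w, \<lambda>j. (fst (s j), snd (s' j)), y), lo i (S1 (w, \<lambda>j. (fst (s j), snd (s' j)), y))) = (W (w, s, y), lo i (S1 (w, s, y))) \<and>
    S2 (w, \<lambda>j. (fst (s j), snd (s' j)), y) = S2 (w', s', y') \<and>
    (D (w, \<lambda>j. (fst (s j), snd (s' j)), y), lo i (Y (w, \<lambda>j. (fst (s j), snd (s' j)), y)), lo i (S2 (w, \<lambda>j. (fst (s j), snd (s' j)), y)), hi i (S1 (w, \<lambda>j. (fst (s j), snd (s' j)), y))) =
    (D (w, s, y), lo i (Y (w, s, y)), lo i (S2 (w, s, y)), hi i (S1 (w, s, y))) \<and>
    (\<lambda>j. (fst (fst (s j), snd (s' j)), snd (fst (s' j), snd (s j)))) = s \<and>
    (\<forall>j<n. pmf p (fst (s j), snd (s' j)) * pmf p (fst (s' j), snd (s j)) = pmf p (s j) * pmf p (s' j)) \<and>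
    (\<forall>j\<ge>n. (fst (s j), snd (s' j)) = undefined) \<and>
    (\<forall>j<i. ch (xin w (\<lambda>j. (fst (s j), snd (s' j))) j) (fst (fst (s j), snd (s' j))) (snd (fst (s j), snd (s' j))) =
           ch (xin w s j) (fst (s j)) (snd (s j)))"
    using pp dd l2' l2 by (simp add: rv_defs tm t xm)
qed

text \<open>The splice of \<open>base_ub\<close>, with all first states in the condition. The past
  outputs then belong to the independent side, which allows them to be dropped when the description
  constraint is bounded.\<close>

lemma base_ub':
  assumes xd: "\<And>w s s'. (\<And>j. fst (s j) = fst (s' j)) \<Longrightarrow> T s = T s' \<Longrightarrow> xin w s = xin w s'"
    and T2: "\<And>s s'. (\<And>j. snd (s j) = snd (s' j)) \<Longrightarrow> T s = T s'"
  shows "cind (pre i) (\<lambda>\<omega>. (W \<omega>, Y \<omega>)) S2 (\<lambda>\<omega>. (S1 \<omega>, D \<omega>, lo i (S2 \<omega>)))"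
proof (rule pre_swap[where mix="\<lambda>s s' j. (fst (s j), snd (s' j))"])
  fix w s y w' s' y'
  assume a: "(w, s, y) \<in> set_pmf (pre i)" "(w', s', y') \<in> set_pmf (pre i)"
    and c: "(S1 (w, s, y), D (w, s, y), lo i (S2 (w, s, y))) =
      (S1 (w', s', y'), D (w', s', y'), lo i (S2 (w', s', y')))"
  have t: "T s = T s'" and l2: "\<And>j. j < i \<Longrightarrow> snd (s j) = snd (s' j)" and h0: "(\<lambda>j. fst (s j)) = (\<lambda>j. fst (s' j))"
    using c by (auto simp: rv_defs lo_eq_iff)
  have h1: "fst (s j) = fst (s' j)" for j using fun_cong[OF h0, of j] .
  have tm: "T (\<lambda>j. (fst (s j), snd (s' j))) = T s'" by (rule T2) simp
  have xm: "xin w (\<lambda>j. (fst (s j), snd (s' j))) = xin w s" by (rule xd) (auto simp: tm t)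
  have pp: "pmf p (fst (s j), snd (s' j)) * pmf p (fst (s' j), snd (s j)) = pmf p (s j) * pmf p (s' j)" for j
    using h1[of j] by (metis mult.commute prod.collapse)
  have dd: "(fst (s j), snd (s' j)) = undefined" if "j \<ge> n" for j
    using set_pre[OF a(1)] set_pre[OF a(2)] that by simp
  have l2': "lo i (\<lambda>j. snd (s' j)) = lo i (\<lambda>j. snd (s j))" using l2 by (auto simp: lo_eq_iff)
  show "(W (w, \<lambda>j. (fst (s j), snd (s' j)), y), Y (w, \<lambda>j. (fst (s j), snd (s' j)), y)) = (W (w, s, y), Y (w, s, y)) \<and>
    S2 (w, \<lambda>j. (fst (s j), snd (s' j)), y) = S2 (w', s', y') \<and>
    (S1 (w, \<lambda>j. (fst (s j), snd (s' j)), y), D (w, \<lambda>j. (fst (s j), snd (s' j)), y), lo i (S2 (w, \<lambda>j. (fst (s j), snd (s' j)), y))) =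
    (S1 (w, s, y), D (w, s, y), lo i (S2 (w, s, y))) \<and>
    (\<lambda>j. (fst (fst (s j), snd (s' j)), snd (fst (s' j), snd (s j)))) = s \<and>
    (\<forall>j<n. pmf p (fst (s j), snd (s' j)) * pmf p (fst (s' j), snd (s j)) = pmf p (s j) * pmf p (s' j)) \<and>
    (\<forall>j\<ge>n. (fst (s j), snd (s' j)) = undefined) \<and>
    (\<forall>j<i. ch (xin w (\<lambda>j. (fst (s j), snd (s' j))) j) (fst (fst (s j), snd (s' j))) (snd (fst (s j), snd (s' j))) =
           ch (xin w s j) (fst (s j)) (snd (s j)))"
    using pp dd l2' l2 by (simp add: rv_defs tm t xm)
qed

text \<open>The splice cuts at time \<open>i\<close>, past from one copy and the rest from the
  other. As the past second states agree, the splice has the second states of the other copy, and so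
  the same description. Inputs at positions below \<open>k\<close> must not see beyond their own
  time: \<open>k = i\<close> serves the causal encoder, and \<open>k = 0\<close> makes the condition
  void when only states are concerned.\<close>

lemma base_past:
  assumes xc: "\<And>w s s' j. j < k \<Longrightarrow> (\<And>j'. j' \<le> j \<Longrightarrow> fst (s j') = fst (s' j')) \<Longrightarrow> T s = T s' \<Longrightarrow> xin w s j = xin w s' j"
    and T2: "\<And>s s'. (\<And>j. snd (s j) = snd (s' j)) \<Longrightarrow> T s = T s'" and ki: "k \<le> i"
  shows "cind (pre k) (\<lambda>\<omega>. (W \<omega>, lo i (S1 \<omega>), Y \<omega>)) (\<lambda>\<omega>. hi i (fst (snd \<omega>))) (\<lambda>\<omega>. (D \<omega>, lo i (S2 \<omega>)))"
proof (rule pre_swap[where mix="\<lambda>s s' j. if j < i then s j else s' j"])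
  fix w s y w' s' y'
  assume a: "(w, s, y) \<in> set_pmf (pre k)" "(w', s', y') \<in> set_pmf (pre k)"
    and c: "(D (w, s, y), lo i (S2 (w, s, y))) = (D (w', s', y'), lo i (S2 (w', s', y')))"
  have t: "T s = T s'" and l2: "\<And>j. j < i \<Longrightarrow> snd (s j) = snd (s' j)"
    using c by (auto simp: rv_defs lo_eq_iff)
  let ?m = "\<lambda>j. if j < i then s j else s' j"
  have tm: "T ?m = T s" unfolding t by (rule T2) (auto simp: l2)
  have xm: "xin w ?m j = xin w s j" if "j < k" for j by (rule xc) (use that ki in \<open>auto simp: tm t\<close>)
  have dd: "?m j = undefined" if "j \<ge> n" for j
    using set_pre[OF a(1)] set_pre[OF a(2)] that by simp
  have l: "lo i (\<lambda>j. fst (if j < i then s j else s' j)) = lo i (\<lambda>j. fst (s j))"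
    "lo i (\<lambda>j. snd (if j < i then s j else s' j)) = lo i (\<lambda>j. snd (s j))"
    "hi i (\<lambda>j. if j < i then s j else s' j) = hi i s'" by (auto simp: lo_eq_iff hi_eq_iff)
  show "(W (w, ?m, y), lo i (S1 (w, ?m, y)), Y (w, ?m, y)) = (W (w, s, y), lo i (S1 (w, s, y)), Y (w, s, y)) \<and>
    hi i (fst (snd (w, ?m, y))) = hi i (fst (snd (w', s', y'))) \<and>
    (D (w, ?m, y), lo i (S2 (w, ?m, y))) = (D (w, s, y), lo i (S2 (w, s, y))) \<and>
    (\<lambda>j. if j < i then if j < i then s j else s' j else if j < i then s' j else s j) = s \<and>
    (\<forall>j<n. pmf p (if j < i then s j else s' j) * pmf p (if j < i then s' j else s j) = pmf p (s j) * pmf p (s' j)) \<and>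
    (\<forall>j\<ge>n. (if j < i then s j else s' j) = undefined) \<and>
    (\<forall>j<k. ch (xin w ?m j) (fst (if j < i then s j else s' j)) (snd (if j < i then s j else s' j)) =
           ch (xin w s j) (fst (s j)) (snd (s j)))"
    using dd ki by (auto simp add: rv_defs tm xm l)
qed

text \<open>Exchanging one first state between copies whose second states agree at this position
  uses only that the pairs of states are independent over time.\<close>

lemma base_current:
  shows "cind (pre i) S2 (\<lambda>\<omega>. S1 \<omega> j) (\<lambda>\<omega>. S2 \<omega> j)"
proof -
  have "cind (pre 0) S2 (\<lambda>\<omega>. S1 \<omega> j) (\<lambda>\<omega>. S2 \<omega> j)"
  proof (rule pre_swap[where mix="\<lambda>s s'. s(j := (fst (s' j), snd (s j)))"])
    fix w s y w' s' y'
    assume a: "(w, s, y) \<in> set_pmf (pre 0)" "(w', s', y') \<in> set_pmf (pre 0)" and c: "S2 (w, s, y) j = S2 (w', s', y') j"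
    then have c': "snd (s j) = snd (s' j)" by (simp add: rv_defs)
    have pp: "pmf p (fst (s' j), snd (s j)) * pmf p (fst (s j), snd (s' j)) = pmf p (s j) * pmf p (s' j)"
      using c' by (metis mult.commute prod.collapse)
    have dd: "\<forall>k\<ge>n. (s(j := (fst (s' j), snd (s j)))) k = undefined"
      using set_pre[OF a(1)] set_pre[OF a(2)] by simp
    show "S2 (w, s(j := (fst (s' j), snd (s j))), y) = S2 (w, s, y) \<and>
      S1 (w, s(j := (fst (s' j), snd (s j))), y) j = S1 (w', s', y') j \<and>
      S2 (w, s(j := (fst (s' j), snd (s j))), y) j = S2 (w, s, y) j \<and>
      (s(j := (fst (s' j), snd (s j))))(j := (fst ((s'(j := (fst (s j), snd (s' j)))) j), snd ((s(j := (fst (s' j), snd (s j)))) j))) = s \<and>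
      (\<forall>k<n. pmf p ((s(j := (fst (s' j), snd (s j)))) k) * pmf p ((s'(j := (fst (s j), snd (s' j)))) k) = pmf p (s k) * pmf p (s' k)) \<and>
      (\<forall>k\<ge>n. (s(j := (fst (s' j), snd (s j)))) k = undefined) \<and>
      (\<forall>k<0. ch (xin w (s(j := (fst (s' j), snd (s j)))) k) (fst ((s(j := (fst (s' j), snd (s j)))) k)) (snd ((s(j := (fst (s' j), snd (s j)))) k)) =
             ch (xin w s k) (fst (s k)) (snd (s k)))"
      using pp dd by (auto simp: rv_defs fun_eq_iff)
  qed
  then show ?thesis
    using cind_pre_states[of "\<lambda>s k. snd (s k)" "\<lambda>s. fst (s j)" "\<lambda>s. snd (s j)" i]
    by (simp add: S1_def S2_def)
qed

text \<open>In Case 1 neither the description nor the encoder looks at the second states, and output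
  \<open>i\<close> is not yet drawn. The single letter \<open>S2 \<omega> i\<close> can thus be
  exchanged without touching anything else; the update by \<open>undefined\<close> removes just this
  letter.\<close>

lemma base_1:
  assumes xd: "\<And>w s s'. (\<And>j. fst (s j) = fst (s' j)) \<Longrightarrow> T s = T s' \<Longrightarrow> xin w s = xin w s'"
    and T1: "\<And>s s'. (\<And>j. fst (s j) = fst (s' j)) \<Longrightarrow> T s = T s'"
  shows "cind (pre i) (\<lambda>\<omega>. (W \<omega>, S1 \<omega>, (S2 \<omega>)(i := undefined), Y \<omega>)) (\<lambda>\<omega>. S2 \<omega> i) (\<lambda>\<omega>. S1 \<omega> i)"
proof (rule pre_swap[where mix="\<lambda>s s'. s(i := (fst (s i), snd (s' i)))"])
  fix w s y w' s' y'
  assume a: "(w, s, y) \<in> set_pmf (pre i)" "(w', s', y') \<in> set_pmf (pre i)" and c: "S1 (w, s, y) i = S1 (w', s', y') i"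
  then have c': "fst (s i) = fst (s' i)" by (simp add: rv_defs)
  let ?m = "s(i := (fst (s i), snd (s' i)))"
  have pp: "pmf p (fst (s i), snd (s' i)) * pmf p (fst (s' i), snd (s i)) = pmf p (s i) * pmf p (s' i)"
    using c' by (metis mult.commute prod.collapse)
  have dd: "\<forall>k\<ge>n. ?m k = undefined"
    using set_pre[OF a(1)] set_pre[OF a(2)] by simp
  have tm: "T ?m = T s" by (rule T1) simp
  have xm: "xin w ?m = xin w s" by (rule xd) (auto simp: tm)
  show "(W (w, ?m, y), S1 (w, ?m, y), (S2 (w, ?m, y))(i := undefined), Y (w, ?m, y)) = (W (w, s, y), S1 (w, s, y), (S2 (w, s, y))(i := undefined), Y (w, s, y)) \<and>
    S2 (w, ?m, y) i = S2 (w', s', y') i \<and> S1 (w, ?m, y) i = S1 (w, s, y) i \<and>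
    ?m(i := (fst (?m i), snd ((s'(i := (fst (s' i), snd (s i)))) i))) = s \<and>
    (\<forall>k<n. pmf p (?m k) * pmf p ((s'(i := (fst (s' i), snd (s i)))) k) = pmf p (s k) * pmf p (s' k)) \<and>
    (\<forall>k\<ge>n. ?m k = undefined) \<and>
    (\<forall>k<i. ch (xin w ?m k) (fst (?m k)) (snd (?m k)) = ch (xin w s k) (fst (s k)) (snd (s k)))"
    using pp dd by (auto simp: rv_defs fun_eq_iff xm)
qed

text \<open>Case 1 and the first upper bound of Case 2 use \<open>V = Va\<close>, \<open>U = W\<close>; the second upper bound uses
  \<open>V = Vb\<close>, \<open>U = Ub\<close>; Case \<open>2C\<close> uses \<open>V = Vb\<close>, \<open>U = Uc\<close>.\<close>

definition "Va i = (\<lambda>\<omega>. (D \<omega>, lo i (Y \<omega>), lo i (S2 \<omega>), hi (Suc i) (S1 \<omega>)))" for i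
definition "Vb i = (\<lambda>\<omega>. (D \<omega>, lo i (S2 \<omega>)))" for i
definition "Ub i = (\<lambda>\<omega>. (W \<omega>, lo i (Y \<omega>), hi (Suc i) (S1 \<omega>)))" for i
definition "Uc i = (\<lambda>\<omega>. (W \<omega>, lo i (S1 \<omega>), lo i (Y \<omega>)))" for i

lemmas aux_defs = Va_def Vb_def Ub_def Uc_def

text \<open>The letter \<open>S1 \<omega> i\<close> completes the strict future in \<open>Va\<close>
  to \<open>hi i\<close>, which gives the condition of \<open>base_ub\<close>.\<close>

lemma cind_U_ub1:
  assumes xd: "\<And>w s s'. (\<And>j. fst (s j) = fst (s' j)) \<Longrightarrow> T s = T s' \<Longrightarrow> xin w s = xin w s'"
    and T2: "\<And>s s'. (\<And>j. snd (s j) = snd (s' j)) \<Longrightarrow> T s = T s'"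
  shows "cind (pre i) W (St i) (\<lambda>\<omega>. (fst (St i \<omega>), Va i \<omega>))"
  by (rule cind_derive[OF base_ub[OF xd T2], where fa="\<lambda>a c. fst a" and fb="\<lambda>b c. (snd (snd (snd c)) i, b i)" and k="\<lambda>_ _. ()"])
    (auto simp: hi_at fst_St snd_St prod_eq_iff Va_def hi_Suc_eq_iff[of i])

text \<open>The input is a function of the message, the past first states and the condition of
  \<open>base_ub\<close>. The message moves from the independent side into the condition by means of
  \<open>k\<close> in \<open>cind_derive\<close>.\<close>

lemma cind_X_ub:
  assumes xd: "\<And>w s s'. (\<And>j. fst (s j) = fst (s' j)) \<Longrightarrow> T s = T s' \<Longrightarrow> xin w s = xin w s'"
    and T2: "\<And>s s'. (\<And>j. snd (s j) = snd (s' j)) \<Longrightarrow> T s = T s'"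
  shows "cind (pre i) (X i) (St i) (\<lambda>\<omega>. (W \<omega>, S1 \<omega> i, Va i \<omega>))"
    and "cind (pre i) (X i) (St i) (\<lambda>\<omega>. (Ub i \<omega>, S1 \<omega> i, Vb i \<omega>))"
proof -
  have x: "X i \<omega> = XS (W \<omega>) (\<lambda>j. if j < i then lo i (S1 \<omega>) j else hi i (S1 \<omega>) j) (D \<omega>) i" for \<omega>
    by (subst lo_hi_cases[symmetric]) (rule X_eq[OF xd])
  show "cind (pre i) (X i) (St i) (\<lambda>\<omega>. (W \<omega>, S1 \<omega> i, Va i \<omega>))"
    by (rule cind_derive[OF base_ub[OF xd T2], where fa="\<lambda>a c. XS (fst a) (\<lambda>j. if j < i then snd a j else snd (snd (snd c)) j) (fst c) i"
       and fb="\<lambda>b c. (snd (snd (snd c)) i, b i)" and k="\<lambda>a _. fst a"])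
     (auto simp: hi_at fst_St snd_St prod_eq_iff Va_def hi_Suc_eq_iff[of i] x cong: if_cong)
  show "cind (pre i) (X i) (St i) (\<lambda>\<omega>. (Ub i \<omega>, S1 \<omega> i, Vb i \<omega>))"
    by (rule cind_derive[OF base_ub[OF xd T2], where fa="\<lambda>a c. XS (fst a) (\<lambda>j. if j < i then snd a j else snd (snd (snd c)) j) (fst c) i"
       and fb="\<lambda>b c. (snd (snd (snd c)) i, b i)" and k="\<lambda>a _. fst a"])
     (auto simp: hi_at fst_St snd_St prod_eq_iff Ub_def Vb_def hi_Suc_eq_iff[of i] x cong: if_cong)
qed

text \<open>The description and the past are functions of the second states, and given its own
  second state the current first state is independent of all of them.\<close>

lemma cind_Vb:
  assumes T2: "\<And>s s'. (\<And>j. snd (s j) = snd (s' j)) \<Longrightarrow> T s = T s'"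
  shows "cind (pre i) (Vb i) (St i) (\<lambda>\<omega>. snd (St i \<omega>))"
proof -
  have d: "D \<omega> = T (\<lambda>j. (undefined, S2 \<omega> j))" for \<omega>
    unfolding D_def by (rule T2) (simp add: S2_def)
  show ?thesis
    by (rule cind_derive[OF base_current[of i i], where fa="\<lambda>a c. (T (\<lambda>j. (undefined, a j)), lo i a)" and fb="\<lambda>b c. (b, c)" and k="\<lambda>_ _. ()"])
      (auto simp: fst_St snd_St prod_eq_iff Vb_def d)
qed

text \<open>The first independence is \<open>base_past\<close> at the current time. The second is
  degenerate: under causality \<open>Uc\<close>, the current first state and \<open>Vb\<close>
  determine the input.\<close>

lemma cind_2C:
  assumes xc: "\<And>w s s' j. (\<And>j'. j' \<le> j \<Longrightarrow> fst (s j') = fst (s' j')) \<Longrightarrow> T s = T s' \<Longrightarrow> xin w s j = xin w s' j"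
    and T2: "\<And>s s'. (\<And>j. snd (s j) = snd (s' j)) \<Longrightarrow> T s = T s'"
  shows "cind (pre i) (Uc i) (St i) (\<lambda>\<omega>. ((), Vb i \<omega>))"
    and "cind (pre i) (X i) (St i) (\<lambda>\<omega>. (Uc i \<omega>, S1 \<omega> i, Vb i \<omega>))"
proof -
  have b: "cind (pre i) (\<lambda>\<omega>. (W \<omega>, lo i (S1 \<omega>), Y \<omega>)) (\<lambda>\<omega>. hi i (fst (snd \<omega>))) (\<lambda>\<omega>. (D \<omega>, lo i (S2 \<omega>)))"
  proof (rule base_past)
    fix w and s s' :: "nat \<Rightarrow> 's1 \<times> 's2" and j assume "\<And>j'. j' \<le> j \<Longrightarrow> fst (s j') = fst (s' j')" "T s = T s'"
    then show "xin w s j = xin w s' j" by (rule xc)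
  next
    fix s s' :: "nat \<Rightarrow> 's1 \<times> 's2" assume "\<And>j. snd (s j) = snd (s' j)"
    then show "T s = T s'" by (rule T2)
  qed auto
  show "cind (pre i) (Uc i) (St i) (\<lambda>\<omega>. ((), Vb i \<omega>))"
    by (rule cind_derive[OF b, where fa="\<lambda>a c. (fst a, fst (snd a), lo i (snd (snd a)))" and fb="\<lambda>b c. b i" and k="\<lambda>_ _. ()"])
      (auto simp: Uc_def Vb_def hi_at St_def)
  show "cind (pre i) (X i) (St i) (\<lambda>\<omega>. (Uc i \<omega>, S1 \<omega> i, Vb i \<omega>))"
  proof (rule cind_determined(2))
    fix \<omega> \<omega>' assume e: "(Uc i \<omega>, S1 \<omega> i, Vb i \<omega>) = (Uc i \<omega>', S1 \<omega>' i, Vb i \<omega>')"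
    then have "\<forall>j<i. S1 \<omega> j = S1 \<omega>' j" "S1 \<omega> i = S1 \<omega>' i" by (auto simp: Uc_def lo_eq_iff)
    then have s: "S1 \<omega> j = S1 \<omega>' j" if "j \<le> i" for j using that by (cases "j = i") auto
    have dw: "D \<omega> = D \<omega>'" "W \<omega> = W \<omega>'" using e by (auto simp: Uc_def Vb_def)
    have "xin (fst \<omega>') (fst (snd \<omega>)) i = xin (fst \<omega>') (fst (snd \<omega>')) i"
      by (rule xc) (use s dw in \<open>simp_all add: S1_def D_def\<close>)
    then show "X i \<omega> = X i \<omega>'" using dw(2) by (simp add: X_def W_def)
  qed
qed

text \<open>\<open>Va\<close>, the message and the input are functions of the large tuple in
  \<open>base_1\<close>; \<open>lo i\<close> does not notice that letter \<open>i\<close> has been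
  erased there.\<close>

lemma cind_case1:
  assumes xd: "\<And>w s s'. (\<And>j. fst (s j) = fst (s' j)) \<Longrightarrow> T s = T s' \<Longrightarrow> xin w s = xin w s'"
    and T1: "\<And>s s'. (\<And>j. fst (s j) = fst (s' j)) \<Longrightarrow> T s = T s'"
  shows "cind (pre i) (Va i) (St i) (\<lambda>\<omega>. fst (St i \<omega>))"
    and "cind (pre i) W (St i) (\<lambda>\<omega>. (fst (St i \<omega>), Va i \<omega>))"
    and "cind (pre i) (X i) (St i) (\<lambda>\<omega>. (W \<omega>, S1 \<omega> i, Va i \<omega>))"
proof -
  have d: "D \<omega> = T (\<lambda>j. (S1 \<omega> j, undefined))" for \<omega>
    unfolding D_def by (rule T1) (simp add: S1_def)
  have x: "X i \<omega> = XS (W \<omega>) (S1 \<omega>) (D \<omega>) i" for \<omega> by (rule X_eq[OF xd])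
  let ?va = "\<lambda>a. (T (\<lambda>j. (fst (snd a) j, undefined)), lo i (snd (snd (snd a))), lo i (fst (snd (snd a))), hi (Suc i) (fst (snd a)))"
  show "cind (pre i) (Va i) (St i) (\<lambda>\<omega>. fst (St i \<omega>))"
    by (rule cind_derive[OF base_1[OF xd T1], where fa="\<lambda>a c. ?va a" and fb="\<lambda>b c. (c, b)" and k="\<lambda>_ _. ()"])
      (auto simp: fst_St snd_St prod_eq_iff Va_def d lo_upd)
  show "cind (pre i) W (St i) (\<lambda>\<omega>. (fst (St i \<omega>), Va i \<omega>))"
    by (rule cind_derive[OF base_1[OF xd T1], where fa="\<lambda>a c. fst a" and fb="\<lambda>b c. (c, b)" and k="\<lambda>a _. ?va a"])
      (auto simp: fst_St snd_St prod_eq_iff Va_def d lo_upd)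
  show "cind (pre i) (X i) (St i) (\<lambda>\<omega>. (W \<omega>, S1 \<omega> i, Va i \<omega>))"
    by (rule cind_derive[OF base_1[OF xd T1], where fa="\<lambda>a c. XS (fst a) (fst (snd a)) (T (\<lambda>j. (fst (snd a) j, undefined))) i" and fb="\<lambda>b c. (c, b)" and k="\<lambda>a _. (fst a, ?va a)"])
      (auto simp: fst_St snd_St prod_eq_iff Va_def d lo_upd x)
qed

end

section \<open>Telescoping sums of entropies\<close>

context block
begin

abbreviation "H F \<equiv> ent P F"

definition "Z = (\<lambda>\<omega>. (D \<omega>, lo n (Y \<omega>), lo n (S2 \<omega>)))"
text \<open>The mutual information of the message and the observation of the decoder, since the
  uniform message has entropy \<open>log 2 (card M)\<close>.\<close>

definition "Info = H Z - H (\<lambda>\<omega>. (W \<omega>, Z \<omega>)) + log 2 (card M)"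
text \<open>A hybrid between first states and observations: raising \<open>i\<close> by one trades
  \<open>S1 \<omega> i\<close> for \<open>Y \<omega> i\<close> and \<open>S2 \<omega> i\<close>. At
  \<open>i = n\<close> only the observation \<open>Z\<close> is left, at \<open>i = 0\<close> only
  the first states with the description.\<close>

definition "e i = H (\<lambda>\<omega>. (D \<omega>, lo i (Y \<omega>), lo i (S2 \<omega>), hi i (S1 \<omega>)))" for i
definition "eW i = H (\<lambda>\<omega>. (W \<omega>, D \<omega>, lo i (Y \<omega>), lo i (S2 \<omega>), hi i (S1 \<omega>)))" for i

lemma finP: "finite (set_pmf P)" by (rule finite_pre)

lemma S_default: "\<omega> \<in> set_pmf P \<Longrightarrow> n \<le> j \<Longrightarrow> S1 \<omega> j = fst (undefined :: 's1 \<times> 's2)"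
  "\<omega> \<in> set_pmf P \<Longrightarrow> n \<le> j \<Longrightarrow> S2 \<omega> j = snd (undefined :: 's1 \<times> 's2)"
  using set_pre[of "fst \<omega>" "fst (snd \<omega>)" "snd (snd \<omega>)" n] by (auto simp: S1_def S2_def)

lemma hi_n: "\<omega> \<in> set_pmf P \<Longrightarrow> \<omega>' \<in> set_pmf P \<Longrightarrow> hi n (S1 \<omega>) = hi n (S1 \<omega>')"
  by (auto simp: hi_eq_iff S_default)

lemma lo_n: "\<omega> \<in> set_pmf P \<Longrightarrow> \<omega>' \<in> set_pmf P \<Longrightarrow> lo n (S1 \<omega>) = lo n (S1 \<omega>') \<longleftrightarrow> S1 \<omega> = S1 \<omega>'"
   "\<omega> \<in> set_pmf P \<Longrightarrow> \<omega>' \<in> set_pmf P \<Longrightarrow> lo n (S2 \<omega>) = lo n (S2 \<omega>') \<longleftrightarrow> S2 \<omega> = S2 \<omega>'"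
proof -
  assume w: "\<omega> \<in> set_pmf P" "\<omega>' \<in> set_pmf P"
  have "S1 \<omega> j = S1 \<omega>' j" "S2 \<omega> j = S2 \<omega>' j" if "\<not> j < n" for j
    using that S_default[OF w(1)] S_default[OF w(2)] by simp_all
  then show "lo n (S1 \<omega>) = lo n (S1 \<omega>') \<longleftrightarrow> S1 \<omega> = S1 \<omega>'" "lo n (S2 \<omega>) = lo n (S2 \<omega>') \<longleftrightarrow> S2 \<omega> = S2 \<omega>'"
    unfolding lo_eq_iff by (auto simp: fun_eq_iff)
qed

lemma hi_0: "hi 0 h = hi 0 h' \<longleftrightarrow> h = h'" and lo_0: "lo 0 h = lo 0 h'"
  unfolding hi_eq_iff lo_eq_iff by auto

lemma tel: "(\<Sum>i<n. f (Suc i)) - (\<Sum>i<n. f i) = f n - (f 0 :: real)" for f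
  by (simp add: sum_subtractf[symmetric] sum_lessThan_telescope)

lemma ent_W: "H (\<lambda>\<omega>. (W \<omega>, G (fst (snd \<omega>)))) = log 2 (card M) + H (\<lambda>\<omega>. G (fst (snd \<omega>)))"
proof -
  let ?L = "pmf_of_set M" and ?Q = "Pi_pmf {..<n} undefined (\<lambda>_. p)"
  have st: "map_pmf (\<lambda>\<omega>. (W \<omega>, fst (snd \<omega>))) P = bind_pmf ?L (\<lambda>w. map_pmf (Pair w) ?Q)"
    unfolding map_states by (simp add: pair_pmf_def map_pmf_def)
  have "H (\<lambda>\<omega>. (W \<omega>, G (fst (snd \<omega>)))) = ent (map_pmf (\<lambda>\<omega>. (W \<omega>, fst (snd \<omega>))) P) (\<lambda>(w, s). (w, G s))"
    by (simp add: ent_map)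
  also have "\<dots> = ent ?L id + measure_pmf.expectation ?L (\<lambda>w. ent ?Q G)"
    unfolding st by (rule ent_pair_bind) (use M in \<open>auto simp: finite_Pi\<close>)
  also have "ent ?L id = measure_pmf.expectation ?L (\<lambda>_. log 2 (card M))"
    unfolding ent_def by (intro expectation_cong_pmf) (use M in \<open>auto simp: pr_pmf_map log_divide card_gt_0_iff\<close>)
  also have "ent ?Q G = H (\<lambda>\<omega>. G (fst (snd \<omega>)))"
  proof (rule ent_law_cong)
    have "map_pmf (\<lambda>\<omega>. G (fst (snd \<omega>))) P = map_pmf (\<lambda>x. G (snd x)) (map_pmf (\<lambda>\<omega>. (W \<omega>, fst (snd \<omega>))) P)"
      by (simp add: map_pmf_comp)
    also have "\<dots> = map_pmf G (map_pmf snd (pair_pmf ?L ?Q))" unfolding map_states by (simp add: map_pmf_comp)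
    finally show "map_pmf G ?Q = map_pmf (\<lambda>\<omega>. G (fst (snd \<omega>))) P" by (simp add: map_snd_pair_pmf)
  qed
  finally show ?thesis by simp
qed

lemma e_n: "e n = H Z" "eW n = H (\<lambda>\<omega>. (W \<omega>, Z \<omega>))"
  unfolding e_def eW_def Z_def by (rule ent_cong; auto dest: hi_n)+

lemma e_0: "e 0 = H (\<lambda>\<omega>. (D \<omega>, S1 \<omega>))" "eW 0 = log 2 (card M) + H (\<lambda>\<omega>. (D \<omega>, S1 \<omega>))"
proof -
  show "e 0 = H (\<lambda>\<omega>. (D \<omega>, S1 \<omega>))"
    unfolding e_def by (rule ent_cong) (auto simp: hi_0 intro: lo_0)
  have "eW 0 = H (\<lambda>\<omega>. (W \<omega>, (\<lambda>s. (T s, \<lambda>j. fst (s j))) (fst (snd \<omega>))))"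
    unfolding eW_def by (rule ent_cong) (auto simp: hi_0 D_def S1_def intro: lo_0)
  then show "eW 0 = log 2 (card M) + H (\<lambda>\<omega>. (D \<omega>, S1 \<omega>))"
    using ent_W[of "\<lambda>s. (T s, \<lambda>j. fst (s j))"] by (simp add: D_def S1_def)
qed

lemma ent_Si: "i < n \<Longrightarrow> H (\<lambda>\<omega>. f (S1 \<omega> i) (S2 \<omega> i)) = ent p (\<lambda>s. f (fst s) (snd s))"
  using ent_map[of "St i" P "\<lambda>s. f (fst s) (snd s)"] map_St[of i n] by (simp add: fst_St snd_St)

lemma ent_S_lo: "H (\<lambda>\<omega>. lo n (\<lambda>j. f (S1 \<omega> j) (S2 \<omega> j))) = real n * ent p (\<lambda>s. f (fst s) (snd s))"
proof -
  have "map_pmf (\<lambda>\<omega>. fst (snd \<omega>)) P = map_pmf snd (map_pmf (\<lambda>\<omega>. (W \<omega>, fst (snd \<omega>))) P)"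
    by (simp add: map_pmf_comp)
  then have *: "map_pmf (\<lambda>\<omega>. fst (snd \<omega>)) P = Pi_pmf {..<n} undefined (\<lambda>_. p)"
    by (simp add: map_states map_snd_pair_pmf)
  have "H (\<lambda>\<omega>. lo n (\<lambda>j. f (S1 \<omega> j) (S2 \<omega> j))) = ent (map_pmf (\<lambda>\<omega>. fst (snd \<omega>)) P) (\<lambda>s. lo n (\<lambda>j. f (fst (s j)) (snd (s j))))"
    by (simp add: ent_map S1_def S2_def)
  also have "\<dots> = real n * ent p (\<lambda>s. f (fst s) (snd s))"
    unfolding * by (rule ent_Pi_pmf)
  finally show ?thesis .
qed

lemma ent_S1: "H S1 = real n * ent p fst" and ent_S2: "H S2 = real n * ent p snd"
  and ent_S12: "H (\<lambda>\<omega>. (S1 \<omega>, S2 \<omega>)) = real n * ent p (\<lambda>s. s)"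
proof -
  have "H S1 = H (\<lambda>\<omega>. lo n (\<lambda>j. S1 \<omega> j))" by (rule ent_cong) (simp add: lo_n)
  also have "\<dots> = real n * ent p fst" using ent_S_lo[of "\<lambda>a b. a"] by simp
  finally show "H S1 = real n * ent p fst" .
  have "H S2 = H (\<lambda>\<omega>. lo n (\<lambda>j. S2 \<omega> j))" by (rule ent_cong) (simp add: lo_n)
  also have "\<dots> = real n * ent p snd" using ent_S_lo[of "\<lambda>a b. b"] by simp
  finally show "H S2 = real n * ent p snd" .
  have "H (\<lambda>\<omega>. (S1 \<omega>, S2 \<omega>)) = H (\<lambda>\<omega>. lo n (\<lambda>j. (S1 \<omega> j, S2 \<omega> j)))"
  proof (rule ent_cong)
    fix \<omega> \<omega>' assume a: "\<omega> \<in> set_pmf P" "\<omega>' \<in> set_pmf P"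
    show "(S1 \<omega>', S2 \<omega>') = (S1 \<omega>, S2 \<omega>) \<longleftrightarrow> lo n (\<lambda>j. (S1 \<omega>' j, S2 \<omega>' j)) = lo n (\<lambda>j. (S1 \<omega> j, S2 \<omega> j))"
      using lo_n[OF a(2,1)] by (auto simp: lo_eq_iff)
  qed
  also have "\<dots> = real n * ent p (\<lambda>s. s)" using ent_S_lo[of Pair] by simp
  finally show "H (\<lambda>\<omega>. (S1 \<omega>, S2 \<omega>)) = real n * ent p (\<lambda>s. s)" .
qed

lemma ent_letter_law: "ent (letter_law i V U) f = H (\<lambda>\<omega>. f (S1 \<omega> i, S2 \<omega> i, V \<omega>, U \<omega>, X i \<omega>, Y \<omega> i))"
  unfolding letter_law_def ent_map ..

lemma eW_Suc: "H (\<lambda>\<omega>. (W \<omega>, Y \<omega> i, S2 \<omega> i, Va i \<omega>)) = eW (Suc i)" "H (\<lambda>\<omega>. (W \<omega>, S1 \<omega> i, Va i \<omega>)) = eW i"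
   "H (\<lambda>\<omega>. (Y \<omega> i, S2 \<omega> i, Va i \<omega>)) = e (Suc i)" "H (\<lambda>\<omega>. (S1 \<omega> i, Va i \<omega>)) = e i"
   "H (\<lambda>\<omega>. (Ub i \<omega>, Y \<omega> i, S2 \<omega> i, Vb i \<omega>)) = eW (Suc i)" "H (\<lambda>\<omega>. (Ub i \<omega>, S1 \<omega> i, Vb i \<omega>)) = eW i"
  unfolding e_def eW_def by (rule ent_cong, auto simp: aux_defs lo_Suc_eq_iff hi_Suc_eq_iff[of i])+

text \<open>Each letter contributes an increment of \<open>e - eW\<close>, so the sum is exact. The
  boundary term at 0 is the entropy of the message, which is independent of the states and the
  description.\<close>

lemma sum_rate_a: "(\<Sum>i<n. eRate (letter_law i (Va i) W)) = Info"
proof -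
  have "eRate (letter_law i (Va i) W) = (e (Suc i) - eW (Suc i)) - (e i - eW i)" for i
    unfolding eRate_def ent_letter_law by (simp add: eW_Suc)
  then have "(\<Sum>i<n. eRate (letter_law i (Va i) W)) = (e n - eW n) - (e 0 - eW 0)"
    using tel[of "\<lambda>i. e i - eW i"] by (simp add: sum_subtractf)
  then show ?thesis by (simp add: e_n e_0 Info_def)
qed

lemma cond_mono: "H (\<lambda>\<omega>. (A \<omega>, B \<omega>, C \<omega>)) - H (\<lambda>\<omega>. (B \<omega>, C \<omega>)) \<le> H (\<lambda>\<omega>. (A \<omega>, C \<omega>)) - H C"
  using ent_submodular[OF finP, of A B C] by simp

text \<open>The sum is the entropy of all first states, minus the sum of the letterwise entropies of
  output and second state, plus \<open>e n - e 0\<close>. Here \<open>e 0\<close> is at least the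
  first term, and \<open>e n = H Z\<close> exceeds the sum by at most \<open>H D\<close>.\<close>

lemma sum_c1: "(\<Sum>i<n. eC1 (letter_law i (Va i) W)) \<le> H D"
proof -
  have "eC1 (letter_law i (Va i) W) = H (\<lambda>\<omega>. S1 \<omega> i) - H (\<lambda>\<omega>. (Y \<omega> i, S2 \<omega> i)) + (e (Suc i) - e i)" for i
    unfolding eC1_def ent_letter_law by (simp add: eW_Suc)
  then have "(\<Sum>i<n. eC1 (letter_law i (Va i) W)) = (\<Sum>i<n. H (\<lambda>\<omega>. S1 \<omega> i)) - (\<Sum>i<n. H (\<lambda>\<omega>. (Y \<omega> i, S2 \<omega> i))) + (e n - e 0)"
    using tel[of e] by (simp add: sum.distrib sum_subtractf)
  moreover have "(\<Sum>i<n. H (\<lambda>\<omega>. S1 \<omega> i)) = H S1"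
    using ent_Si[of _ "\<lambda>a b. a"] by (simp add: ent_S1)
  moreover have "H S1 \<le> e 0" unfolding e_0 by (rule ent_mono[OF finP]) simp
  moreover have "H Z \<le> H D + H (\<lambda>\<omega>. (lo n (Y \<omega>), lo n (S2 \<omega>)))"
    unfolding Z_def by (rule ent_subadd[OF finP])
  moreover have "H (\<lambda>\<omega>. (lo k (Y \<omega>), lo k (S2 \<omega>))) \<le> (\<Sum>i<k. H (\<lambda>\<omega>. (Y \<omega> i, S2 \<omega> i)))" for k
  proof (induction k)
    case 0
    have "H (\<lambda>\<omega>. (lo 0 (Y \<omega>), lo 0 (S2 \<omega>))) = 0"
      by (rule ent_const[where c="(lo 0 undefined, lo 0 undefined)"]) (auto intro: lo_0)
    then show ?case by simp
  next
    case (Suc k)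
    have "H (\<lambda>\<omega>. (lo (Suc k) (Y \<omega>), lo (Suc k) (S2 \<omega>))) = H (\<lambda>\<omega>. ((lo k (Y \<omega>), lo k (S2 \<omega>)), (Y \<omega> k, S2 \<omega> k)))"
      by (rule ent_cong) (auto simp: lo_Suc_eq_iff)
    also have "\<dots> \<le> H (\<lambda>\<omega>. (lo k (Y \<omega>), lo k (S2 \<omega>))) + H (\<lambda>\<omega>. (Y \<omega> k, S2 \<omega> k))"
      by (rule ent_subadd[OF finP])
    finally show ?case using Suc by simp
  qed
  from this[of n] have "H (\<lambda>\<omega>. (lo n (Y \<omega>), lo n (S2 \<omega>))) \<le> (\<Sum>i<n. H (\<lambda>\<omega>. (Y \<omega> i, S2 \<omega> i)))" .
  ultimately show ?thesis by (simp add: e_n)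
qed

definition "a i = H (\<lambda>\<omega>. (S1 \<omega>, D \<omega>, lo i (S2 \<omega>)))" for i
definition "b i = H (\<lambda>\<omega>. (D \<omega>, lo i (S2 \<omega>)))" for i

text \<open>The sum telescopes to H(S1,S2) - H(S1) - (\<open>a n\<close> - \<open>a 0\<close>). As
  \<open>a n\<close> is at least H(S1,S2) and \<open>a 0\<close> = H(S1,D) is at most H(S1) + H(D),
  only the entropy of the description remains.\<close>

lemma a_sum: "(\<Sum>i<n. H (\<lambda>\<omega>. (S1 \<omega> i, S2 \<omega> i)) - H (\<lambda>\<omega>. S1 \<omega> i) - (a (Suc i) - a i)) \<le> H D"
proof -
  have "(\<Sum>i<n. H (\<lambda>\<omega>. (S1 \<omega> i, S2 \<omega> i)) - H (\<lambda>\<omega>. S1 \<omega> i) - (a (Suc i) - a i)) =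
     real n * ent p (\<lambda>s. s) - real n * ent p fst - (a n - a 0)"
    using ent_Si[of _ "\<lambda>a b. a"] ent_Si[of _ "\<lambda>a b. (a, b)"]
    using tel[of a] by (simp add: sum_subtractf right_diff_distrib)
  moreover have "real n * ent p (\<lambda>s. s) \<le> a n"
    unfolding a_def ent_S12[symmetric]
  proof (rule order_trans[OF eq_refl ent_mono[OF finP]])
    show "H (\<lambda>\<omega>. (S1 \<omega>, S2 \<omega>)) = H (\<lambda>\<omega>. (S1 \<omega>, lo n (S2 \<omega>)))"
      by (rule ent_cong) (simp add: lo_n)
  qed auto
  moreover have "a 0 = H (\<lambda>\<omega>. (S1 \<omega>, D \<omega>))" unfolding a_def by (rule ent_cong) (auto intro: lo_0)
  moreover have "\<dots> \<le> H S1 + H D" by (rule ent_subadd[OF finP])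
  ultimately show ?thesis by (simp add: ent_S1)
qed

text \<open>Conditioning on all first states can only lower the entropy of
  \<open>S2 \<omega> i\<close> given \<open>S1 \<omega> i\<close> and \<open>Va\<close>. After that
  the past outputs are conditionally independent of \<open>S2 \<omega> i\<close> and drop out, which
  leaves the increment of \<open>a\<close>.\<close>

lemma sum_c2_a:
  assumes "\<And>i. cind (pre i) (\<lambda>\<omega>. (W \<omega>, Y \<omega>)) S2 (\<lambda>\<omega>. (S1 \<omega>, D \<omega>, lo i (S2 \<omega>)))"
  shows "(\<Sum>i<n. eC2 (letter_law i (Va i) W)) \<le> H D"
proof -
  have "eC2 (letter_law i (Va i) W) \<le> H (\<lambda>\<omega>. (S1 \<omega> i, S2 \<omega> i)) - H (\<lambda>\<omega>. S1 \<omega> i) - (a (Suc i) - a i)" if i: "i < n" for i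
  proof -
    let ?C = "\<lambda>\<omega>. (S1 \<omega>, D \<omega>, lo i (S2 \<omega>))"
    have "cind (pre i) (\<lambda>\<omega>. lo i (Y \<omega>)) (\<lambda>\<omega>. S2 \<omega> i) ?C"
      by (rule cind_derive[OF assms, where fa="\<lambda>a c. lo i (snd a)" and fb="\<lambda>b c. b i" and k="\<lambda>_ _. ()"]) auto
    \<comment> \<open>Truncation turns the full law into \<open>pre i\<close> and changes none of
      the three variables, so the independence at time \<open>i\<close> holds under the full
      law.\<close>
    moreover have "map_pmf (trunc i) P = pre i"
      using arg_cong[OF map_trunc[OF i], of "map_pmf fst"] by (simp add: map_bind_pmf map_pmf_comp bind_return_pmf')
    ultimately have "cind P (\<lambda>\<omega>. lo i (Y \<omega>)) (\<lambda>\<omega>. S2 \<omega> i) ?C"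
      using cind_map[of "trunc i" P "\<lambda>\<omega>. lo i (Y \<omega>)" "\<lambda>\<omega>. S2 \<omega> i" ?C] by simp
    note ent_cind[OF finP this]
    moreover have "H (\<lambda>\<omega>. (S2 \<omega> i, ?C \<omega>)) = a (Suc i)" unfolding a_def by (rule ent_cong) (auto simp: lo_Suc_eq_iff)
    moreover have "H ?C = a i" by (simp add: a_def)
    ultimately have 1: "H (\<lambda>\<omega>. (lo i (Y \<omega>), S2 \<omega> i, ?C \<omega>)) - H (\<lambda>\<omega>. (lo i (Y \<omega>), ?C \<omega>)) = a (Suc i) - a i" by simp
    have "H (\<lambda>\<omega>. (S2 \<omega> i, S1 \<omega>, S1 \<omega> i, Va i \<omega>)) - H (\<lambda>\<omega>. (S1 \<omega>, S1 \<omega> i, Va i \<omega>)) \<le>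
       H (\<lambda>\<omega>. (S2 \<omega> i, S1 \<omega> i, Va i \<omega>)) - H (\<lambda>\<omega>. (S1 \<omega> i, Va i \<omega>))"
      by (rule cond_mono)
    moreover have "H (\<lambda>\<omega>. (S2 \<omega> i, S1 \<omega>, S1 \<omega> i, Va i \<omega>)) = H (\<lambda>\<omega>. (lo i (Y \<omega>), S2 \<omega> i, ?C \<omega>))"
      "H (\<lambda>\<omega>. (S1 \<omega>, S1 \<omega> i, Va i \<omega>)) = H (\<lambda>\<omega>. (lo i (Y \<omega>), ?C \<omega>))"
      "H (\<lambda>\<omega>. (S2 \<omega> i, S1 \<omega> i, Va i \<omega>)) = H (\<lambda>\<omega>. (S1 \<omega> i, S2 \<omega> i, Va i \<omega>))"
      by (rule ent_cong, auto simp: Va_def)+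
    ultimately show ?thesis
      unfolding eC2_def ent_letter_law using 1 by simp
  qed
  then have "(\<Sum>i<n. eC2 (letter_law i (Va i) W)) \<le> (\<Sum>i<n. H (\<lambda>\<omega>. (S1 \<omega> i, S2 \<omega> i)) - H (\<lambda>\<omega>. S1 \<omega> i) - (a (Suc i) - a i))"
    by (intro sum_mono) simp
  then show ?thesis using a_sum by simp
qed

lemma sum_c2_b: "(\<Sum>i<n. eC2 (letter_law i (Vb i) (U i))) \<le> H D"
proof -
  have "eC2 (letter_law i (Vb i) (U i)) \<le> H (\<lambda>\<omega>. (S1 \<omega> i, S2 \<omega> i)) - H (\<lambda>\<omega>. S1 \<omega> i) - (a (Suc i) - a i)" for i
  proof -
    have "H (\<lambda>\<omega>. (S2 \<omega> i, S1 \<omega>, S1 \<omega> i, Vb i \<omega>)) - H (\<lambda>\<omega>. (S1 \<omega>, S1 \<omega> i, Vb i \<omega>)) \<le>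
       H (\<lambda>\<omega>. (S2 \<omega> i, S1 \<omega> i, Vb i \<omega>)) - H (\<lambda>\<omega>. (S1 \<omega> i, Vb i \<omega>))"
      by (rule cond_mono)
    moreover have "H (\<lambda>\<omega>. (S2 \<omega> i, S1 \<omega>, S1 \<omega> i, Vb i \<omega>)) = a (Suc i)"
      "H (\<lambda>\<omega>. (S1 \<omega>, S1 \<omega> i, Vb i \<omega>)) = a i"
      "H (\<lambda>\<omega>. (S2 \<omega> i, S1 \<omega> i, Vb i \<omega>)) = H (\<lambda>\<omega>. (S1 \<omega> i, S2 \<omega> i, Vb i \<omega>))"
      unfolding a_def by (rule ent_cong, auto simp: Vb_def lo_Suc_eq_iff)+
    ultimately show ?thesis unfolding eC2_def ent_letter_law by simp
  qed
  then have "(\<Sum>i<n. eC2 (letter_law i (Vb i) (U i))) \<le> (\<Sum>i<n. H (\<lambda>\<omega>. (S1 \<omega> i, S2 \<omega> i)) - H (\<lambda>\<omega>. S1 \<omega> i) - (a (Suc i) - a i))"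
    by (intro sum_mono) simp
  then show ?thesis using a_sum by simp
qed

text \<open>Every letter gives H(\<open>S2 \<omega> i\<close>) minus an increment of
  \<open>b\<close>; the sum is at most the mutual information of the description and the second
  states, hence at most \<open>H D\<close>.\<close>

lemma sum_c2C_b: "(\<Sum>i<n. eC2C (letter_law i (Vb i) (U i))) \<le> H D"
proof -
  have "eC2C (letter_law i (Vb i) (U i)) = H (\<lambda>\<omega>. S2 \<omega> i) - (b (Suc i) - b i)" for i
  proof -
    have "H (\<lambda>\<omega>. (S2 \<omega> i, Vb i \<omega>)) = b (Suc i)" "H (\<lambda>\<omega>. Vb i \<omega>) = b i"
      unfolding b_def by (rule ent_cong, auto simp: Vb_def lo_Suc_eq_iff)+
    then show ?thesis unfolding eC2C_def ent_letter_law by simp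
  qed
  then have "(\<Sum>i<n. eC2C (letter_law i (Vb i) (U i))) = real n * ent p snd - (b n - b 0)"
    using ent_Si[of _ "\<lambda>a b. b"] tel[of b] by (simp add: sum_subtractf)
  moreover have "real n * ent p snd \<le> b n"
    unfolding ent_S2[symmetric] b_def
  proof (rule order_trans[OF eq_refl ent_mono[OF finP]])
    show "H S2 = H (\<lambda>\<omega>. lo n (S2 \<omega>))" by (rule ent_cong) (simp add: lo_n)
  qed auto
  moreover have "b 0 = H D" unfolding b_def by (rule ent_cong) (auto intro: lo_0)
  ultimately show ?thesis by simp
qed

text \<open>Two monotonicity steps make every term telescope. The entropy of
  \<open>Y \<omega> i\<close> can only fall when all second states are given. The entropy of
  \<open>S1 \<omega> i\<close> given \<open>Vb\<close> is not changed by the past first states, by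
  the assumed independence, and can only grow when the past second states are then dropped. The
  boundary values of \<open>b\<close> cancel in the total.\<close>

lemma sum_rate_b:
  assumes "\<And>i. i < n \<Longrightarrow> cind P (\<lambda>\<omega>. lo i (S1 \<omega>)) (\<lambda>\<omega>. S1 \<omega> i) (\<lambda>\<omega>. (D \<omega>, lo i (S2 \<omega>)))"
  shows "Info \<le> (\<Sum>i<n. eRate (letter_law i (Vb i) (Ub i)))"
proof -
  define c where "c i = H (\<lambda>\<omega>. (D \<omega>, S2 \<omega>, lo i (Y \<omega>)))" for i
  define g where "g i = H (\<lambda>\<omega>. (D \<omega>, lo i (S1 \<omega>)))" for i
  have 1: "c (Suc i) - c i \<le> H (\<lambda>\<omega>. (Y \<omega> i, S2 \<omega> i, Vb i \<omega>)) - b (Suc i)" for i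
  proof -
    have "H (\<lambda>\<omega>. (Y \<omega> i, (S2 \<omega>, lo i (Y \<omega>)), S2 \<omega> i, Vb i \<omega>)) - H (\<lambda>\<omega>. ((S2 \<omega>, lo i (Y \<omega>)), S2 \<omega> i, Vb i \<omega>)) \<le>
       H (\<lambda>\<omega>. (Y \<omega> i, S2 \<omega> i, Vb i \<omega>)) - H (\<lambda>\<omega>. (S2 \<omega> i, Vb i \<omega>))"
      by (rule cond_mono)
    moreover have "H (\<lambda>\<omega>. (Y \<omega> i, (S2 \<omega>, lo i (Y \<omega>)), S2 \<omega> i, Vb i \<omega>)) = c (Suc i)"
      "H (\<lambda>\<omega>. ((S2 \<omega>, lo i (Y \<omega>)), S2 \<omega> i, Vb i \<omega>)) = c i" "H (\<lambda>\<omega>. (S2 \<omega> i, Vb i \<omega>)) = b (Suc i)"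
      unfolding c_def b_def by (rule ent_cong, auto simp: Vb_def lo_Suc_eq_iff)+
    ultimately show ?thesis by simp
  qed
  have 2: "H (\<lambda>\<omega>. (S1 \<omega> i, Vb i \<omega>)) - b i \<le> g (Suc i) - g i" if i: "i < n" for i
  proof -
    have "H (\<lambda>\<omega>. (lo i (S1 \<omega>), S1 \<omega> i, D \<omega>, lo i (S2 \<omega>))) + b i = H (\<lambda>\<omega>. (lo i (S1 \<omega>), D \<omega>, lo i (S2 \<omega>))) + H (\<lambda>\<omega>. (S1 \<omega> i, D \<omega>, lo i (S2 \<omega>)))"
      unfolding b_def by (rule ent_cind[OF finP assms[OF i]])
    moreover have "H (\<lambda>\<omega>. (S1 \<omega> i, lo i (S2 \<omega>), D \<omega>, lo i (S1 \<omega>))) - H (\<lambda>\<omega>. (lo i (S2 \<omega>), D \<omega>, lo i (S1 \<omega>))) \<le>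
       H (\<lambda>\<omega>. (S1 \<omega> i, D \<omega>, lo i (S1 \<omega>))) - H (\<lambda>\<omega>. (D \<omega>, lo i (S1 \<omega>)))"
      by (rule cond_mono)
    moreover have "H (\<lambda>\<omega>. (S1 \<omega> i, lo i (S2 \<omega>), D \<omega>, lo i (S1 \<omega>))) = H (\<lambda>\<omega>. (lo i (S1 \<omega>), S1 \<omega> i, D \<omega>, lo i (S2 \<omega>)))"
      "H (\<lambda>\<omega>. (lo i (S2 \<omega>), D \<omega>, lo i (S1 \<omega>))) = H (\<lambda>\<omega>. (lo i (S1 \<omega>), D \<omega>, lo i (S2 \<omega>)))"
      "H (\<lambda>\<omega>. (S1 \<omega> i, D \<omega>, lo i (S1 \<omega>))) = g (Suc i)"
      "H (\<lambda>\<omega>. (D \<omega>, lo i (S1 \<omega>))) = g i"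
      "H (\<lambda>\<omega>. (S1 \<omega> i, D \<omega>, lo i (S2 \<omega>))) = H (\<lambda>\<omega>. (S1 \<omega> i, Vb i \<omega>))"
      unfolding g_def by (rule ent_cong, auto simp: Vb_def lo_Suc_eq_iff)+
    ultimately show ?thesis by simp
  qed
  have "eRate (letter_law i (Vb i) (Ub i)) = (H (\<lambda>\<omega>. (Y \<omega> i, S2 \<omega> i, Vb i \<omega>)) - b (Suc i)) - (H (\<lambda>\<omega>. (S1 \<omega> i, Vb i \<omega>)) - b i)
      + (b (Suc i) - b i) - (eW (Suc i) - eW i)" for i
    unfolding eRate_def ent_letter_law by (simp add: eW_Suc)
  moreover have "(c (Suc i) - c i) - (g (Suc i) - g i) + (b (Suc i) - b i) - (eW (Suc i) - eW i) \<le>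
      (H (\<lambda>\<omega>. (Y \<omega> i, S2 \<omega> i, Vb i \<omega>)) - b (Suc i)) - (H (\<lambda>\<omega>. (S1 \<omega> i, Vb i \<omega>)) - b i)
      + (b (Suc i) - b i) - (eW (Suc i) - eW i)" if "i < n" for i
    using 1[of i] 2[OF that] by linarith
  ultimately have "(\<Sum>i<n. (c (Suc i) - c i) - (g (Suc i) - g i) + (b (Suc i) - b i) - (eW (Suc i) - eW i)) \<le> (\<Sum>i<n. eRate (letter_law i (Vb i) (Ub i)))"
    by (intro sum_mono) auto
  then have "(c n - c 0) - (g n - g 0) + (b n - b 0) - (eW n - eW 0) \<le> (\<Sum>i<n. eRate (letter_law i (Vb i) (Ub i)))"
    using tel[of c] tel[of g] tel[of b] tel[of eW] by (simp add: sum.distrib sum_subtractf)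
  moreover have "c n = H Z" "c 0 = b n" "g n = H (\<lambda>\<omega>. (D \<omega>, S1 \<omega>))" "g 0 = b 0"
    unfolding c_def b_def g_def Z_def by (rule ent_cong, auto simp: lo_n intro: lo_0)+
  ultimately show ?thesis unfolding Info_def e_n e_0 by simp
qed

text \<open>By the assumed independence \<open>Uc\<close> carries no information on
  \<open>S1 \<omega> i\<close> given \<open>Vb\<close>, so only the information on the output and
  the second state counts. It can only grow when the past outputs leave the first condition and the
  past first states enter the second.\<close>

lemma sum_rate_c:
  assumes "\<And>i. i < n \<Longrightarrow> cind P (Uc i) (\<lambda>\<omega>. S1 \<omega> i) (Vb i)"
  shows "Info \<le> (\<Sum>i<n. eRate (letter_law i (Vb i) (Uc i)))"
proof -
  define z where "z i = H (\<lambda>\<omega>. (D \<omega>, lo i (Y \<omega>), lo i (S2 \<omega>)))" for i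
  define zW where "zW i = H (\<lambda>\<omega>. (W \<omega>, D \<omega>, lo i (Y \<omega>), lo i (S2 \<omega>)))" for i
  have "(z (Suc i) - z i) - (zW (Suc i) - zW i) \<le> eRate (letter_law i (Vb i) (Uc i))" if i: "i < n" for i
  proof -
    have c: "H (\<lambda>\<omega>. (Uc i \<omega>, S1 \<omega> i, Vb i \<omega>)) + H (Vb i) = H (\<lambda>\<omega>. (Uc i \<omega>, Vb i \<omega>)) + H (\<lambda>\<omega>. (S1 \<omega> i, Vb i \<omega>))"
      by (rule ent_cind[OF finP assms[OF i]])
    have 1: "H (\<lambda>\<omega>. ((Y \<omega> i, S2 \<omega> i), lo i (Y \<omega>), Vb i \<omega>)) - H (\<lambda>\<omega>. (lo i (Y \<omega>), Vb i \<omega>)) \<le>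
       H (\<lambda>\<omega>. ((Y \<omega> i, S2 \<omega> i), Vb i \<omega>)) - H (Vb i)" by (rule cond_mono)
    have 2: "H (\<lambda>\<omega>. ((Y \<omega> i, S2 \<omega> i), lo i (S1 \<omega>), W \<omega>, lo i (Y \<omega>), Vb i \<omega>)) - H (\<lambda>\<omega>. (lo i (S1 \<omega>), W \<omega>, lo i (Y \<omega>), Vb i \<omega>)) \<le>
       H (\<lambda>\<omega>. ((Y \<omega> i, S2 \<omega> i), W \<omega>, lo i (Y \<omega>), Vb i \<omega>)) - H (\<lambda>\<omega>. (W \<omega>, lo i (Y \<omega>), Vb i \<omega>))" by (rule cond_mono)
    have "H (\<lambda>\<omega>. ((Y \<omega> i, S2 \<omega> i), lo i (Y \<omega>), Vb i \<omega>)) = z (Suc i)" "H (\<lambda>\<omega>. (lo i (Y \<omega>), Vb i \<omega>)) = z i"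
      "H (\<lambda>\<omega>. ((Y \<omega> i, S2 \<omega> i), Vb i \<omega>)) = H (\<lambda>\<omega>. (Y \<omega> i, S2 \<omega> i, Vb i \<omega>))"
      "H (\<lambda>\<omega>. ((Y \<omega> i, S2 \<omega> i), lo i (S1 \<omega>), W \<omega>, lo i (Y \<omega>), Vb i \<omega>)) = H (\<lambda>\<omega>. (Uc i \<omega>, Y \<omega> i, S2 \<omega> i, Vb i \<omega>))"
      "H (\<lambda>\<omega>. (lo i (S1 \<omega>), W \<omega>, lo i (Y \<omega>), Vb i \<omega>)) = H (\<lambda>\<omega>. (Uc i \<omega>, Vb i \<omega>))"
      "H (\<lambda>\<omega>. ((Y \<omega> i, S2 \<omega> i), W \<omega>, lo i (Y \<omega>), Vb i \<omega>)) = zW (Suc i)"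
      "H (\<lambda>\<omega>. (W \<omega>, lo i (Y \<omega>), Vb i \<omega>)) = zW i"
      unfolding z_def zW_def by (rule ent_cong, auto simp: Vb_def Uc_def lo_Suc_eq_iff)+
    then show ?thesis using 1 2 c unfolding eRate_def ent_letter_law by simp
  qed
  then have "(\<Sum>i<n. (z (Suc i) - z i) - (zW (Suc i) - zW i)) \<le> (\<Sum>i<n. eRate (letter_law i (Vb i) (Uc i)))"
    by (intro sum_mono) auto
  then have "(z n - z 0) - (zW n - zW 0) \<le> (\<Sum>i<n. eRate (letter_law i (Vb i) (Uc i)))"
    using tel[of z] tel[of zW] by (simp add: sum_subtractf)
  moreover have "z n = H Z" "zW n = H (\<lambda>\<omega>. (W \<omega>, Z \<omega>))" unfolding z_def zW_def Z_def by (rule refl)+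
  moreover have "z 0 = H (\<lambda>\<omega>. T (fst (snd \<omega>)))" "zW 0 = H (\<lambda>\<omega>. (W \<omega>, T (fst (snd \<omega>))))"
    unfolding z_def zW_def by (rule ent_cong, auto simp: D_def intro: lo_0)+
  ultimately show ?thesis unfolding Info_def ent_W by simp
qed

lemma Info_ge:
  "log 2 (card M) \<le> Info + 1 + measure_pmf.prob P {\<omega>. g (Y \<omega>) (S2 \<omega>) (D \<omega>) \<noteq> W \<omega>} * log 2 (card M)"
proof -
  \<comment> \<open>\<open>Z\<close> shows the second states only below \<open>n\<close>, whereas
    the decoder takes a function on all of \<open>nat\<close>; \<open>?g\<close> restores the
    constant value at the other positions.\<close>
  let ?g = "\<lambda>(t, y, s). g y (\<lambda>j. if j < n then s j else snd (undefined :: 's1 \<times> 's2)) t"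
  have "W ` set_pmf P \<subseteq> M"
    using set_pre[of _ _ _ n] by (force simp: W_def)
  then have "H (\<lambda>\<omega>. (W \<omega>, Z \<omega>)) - H Z \<le> 1 + measure_pmf.prob P {\<omega>. ?g (Z \<omega>) \<noteq> W \<omega>} * log 2 (card M)"
    by (rule fano[OF finP M(1)])
  also have "measure_pmf.prob P {\<omega>. ?g (Z \<omega>) \<noteq> W \<omega>} = measure_pmf.prob P {\<omega>. g (Y \<omega>) (S2 \<omega>) (D \<omega>) \<noteq> W \<omega>}"
  proof -
    have "?g (Z \<omega>) = g (Y \<omega>) (S2 \<omega>) (D \<omega>)" if w: "\<omega> \<in> set_pmf P" for \<omega>
    proof -
      have "lo n (Y \<omega>) = Y \<omega>"
        using set_pre[of "fst \<omega>" "fst (snd \<omega>)" "snd (snd \<omega>)" n] w by (auto simp: lo_def restrict_def Y_def fun_eq_iff)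
      moreover have "(\<lambda>j. if j < n then lo n (S2 \<omega>) j else snd (undefined :: 's1 \<times> 's2)) = S2 \<omega>"
        using S_default(2)[OF w] by (auto simp: fun_eq_iff lo_def)
      ultimately show ?thesis by (simp add: Z_def)
    qed
    then show ?thesis by (intro measure_prob_cong_0) (auto simp: pmf_eq_0_set_pmf)
  qed
  finally show ?thesis by (simp add: Info_def)
qed

end

section \<open>From block codes to single-letter bounds\<close>

definition finite_law where
  "finite_law Ev Eu p ch P \<longleftrightarrow> (\<exists>qv qu qx. P = aux_law p ch qv qu qx \<and> kernel_class Ev Eu qv qu \<and>
     (\<forall>s1 s2. finite (set_pmf (qv s1 s2))) \<and> (\<forall>s1 s2 v. finite (set_pmf (qu s1 s2 v))))"

text \<open>The dummy argument fixes the types of the auxiliary variables, over which a formula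
  cannot quantify. The converse uses three choices of types and the maxima one more, and each gets
  its own bound.\<close>

definition suffices :: "nat \<Rightarrow> ('s1::finite \<times> 's2::finite \<times> 'v \<times> 'u \<times> 'x::finite \<times> 'y::finite) itself \<Rightarrow> bool" where
  "suffices K _ \<longleftrightarrow> (\<forall>Ev Eu p ch (P :: ('s1 \<times> 's2 \<times> 'v \<times> 'u \<times> 'x \<times> 'y) pmf). finite_law Ev Eu p ch P \<longrightarrow>
     (\<exists>Q\<in>class_laws K Ev Eu p ch. eRate Q = eRate P \<and> eC1 Q = eC1 P \<and> eC2 Q = eC2 P \<and> eC2C Q = eC2C P))"

lemma class_laws_mono: "k \<le> k' \<Longrightarrow> class_laws k Ev Eu p ch \<subseteq> class_laws k' Ev Eu p ch"
proof
  fix P assume k: "k \<le> k'" and "P \<in> class_laws k Ev Eu p ch"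
  then obtain qv qu qx where q: "P = aux_law p ch qv qu qx" "kernel_class Ev Eu qv qu"
     "\<forall>s1 s2. set_pmf (qv s1 s2) \<subseteq> {..<k}" "\<forall>s1 s2 v. set_pmf (qu s1 s2 v) \<subseteq> {..<k}" unfolding class_laws_def by blast
  have sub: "{..<k} \<subseteq> {..<k'}" using k by auto
  have "\<forall>s1 s2. set_pmf (qv s1 s2) \<subseteq> {..<k'}" "\<forall>s1 s2 v. set_pmf (qu s1 s2 v) \<subseteq> {..<k'}"
    by (intro allI subset_trans[OF q(3)[rule_format] sub] subset_trans[OF q(4)[rule_format] sub])+
  then show "P \<in> class_laws k' Ev Eu p ch" unfolding class_laws_def using q(1,2) by blast
qed

lemma suffices_mono: "suffices K t \<Longrightarrow> K \<le> K' \<Longrightarrow> suffices K' t"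
  unfolding suffices_def using class_laws_mono by blast

lemma ex_suffices: "\<exists>K. suffices K TYPE('s1::finite \<times> 's2::finite \<times> 'v \<times> 'u \<times> 'x::finite \<times> 'y::finite)"
proof -
  obtain K where K: "\<forall>(p :: ('s1 \<times> 's2) pmf) (ch :: 'x \<Rightarrow> 's1 \<Rightarrow> 's2 \<Rightarrow> 'y pmf)
     (qv :: 's1 \<Rightarrow> 's2 \<Rightarrow> 'v pmf) (qu :: 's1 \<Rightarrow> 's2 \<Rightarrow> 'v \<Rightarrow> 'u pmf) (qx :: 'u \<Rightarrow> 's1 \<Rightarrow> 'v \<Rightarrow> 'x pmf) Ev Eu.
     (\<forall>s1 s2. finite (set_pmf (qv s1 s2))) \<longrightarrow> (\<forall>s1 s2 v. finite (set_pmf (qu s1 s2 v))) \<longrightarrow> kernel_class Ev Eu qv qu \<longrightarrow>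
     (\<exists>(qv' :: 's1 \<Rightarrow> 's2 \<Rightarrow> nat pmf) (qu' :: 's1 \<Rightarrow> 's2 \<Rightarrow> nat \<Rightarrow> nat pmf) qx'. kernel_class Ev Eu qv' qu' \<and>
        (\<forall>s1 s2. set_pmf (qv' s1 s2) \<subseteq> {..<K}) \<and> (\<forall>s1 s2 v. set_pmf (qu' s1 s2 v) \<subseteq> {..<K}) \<and>
        eRate (aux_law p ch qv' qu' qx') = eRate (aux_law p ch qv qu qx) \<and>
        eC1 (aux_law p ch qv' qu' qx') = eC1 (aux_law p ch qv qu qx) \<and>
        eC2 (aux_law p ch qv' qu' qx') = eC2 (aux_law p ch qv qu qx) \<and>
        eC2C (aux_law p ch qv' qu' qx') = eC2C (aux_law p ch qv qu qx))"
    using cardinality_bound by blast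
  have "suffices K TYPE('s1 \<times> 's2 \<times> 'v \<times> 'u \<times> 'x \<times> 'y)"
    unfolding suffices_def
  proof (intro allI impI)
    fix Ev Eu p ch and P :: "('s1 \<times> 's2 \<times> 'v \<times> 'u \<times> 'x \<times> 'y) pmf"
    assume "finite_law Ev Eu p ch P"
    then obtain qv qu qx where q: "P = aux_law p ch qv qu qx" "kernel_class Ev Eu qv qu"
     "\<forall>s1 s2. finite (set_pmf (qv s1 s2))" "\<forall>s1 s2 v. finite (set_pmf (qu s1 s2 v))" unfolding finite_law_def by blast
    from K[rule_format, OF q(3)[rule_format] q(4)[rule_format] q(2), of p ch qx]
    show "\<exists>Q\<in>class_laws K Ev Eu p ch. eRate Q = eRate P \<and> eC1 Q = eC1 P \<and> eC2 Q = eC2 P \<and> eC2C Q = eC2C P"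
      unfolding q(1) class_laws_def by blast
  qed
  then show ?thesis ..
qed

lemma index_set_eq: "index_set n R = {1..nat \<lfloor>2 powr (real n * R)\<rfloor>}"
  unfolding index_set_def by (auto simp: le_nat_floor le_floor_iff) linarith+

lemma finite_index_set: "finite (index_set n R)" by (simp add: index_set_eq)

lemma index_set_nonempty: "0 \<le> R \<Longrightarrow> 1 \<in> index_set n R"
  by (auto simp: index_set_def intro!: ge_one_powr_ge_zero)

text \<open>Since 2^(n R) is at least 1, rounding down loses at most a factor 2, that is, one bit of
  the logarithm.\<close>

lemma card_index_set:
  assumes "0 \<le> R"
  shows "real (card (index_set n R)) \<le> 2 powr (real n * R)" "2 powr (real n * R) / 2 \<le> real (card (index_set n R))"
    "log 2 (card (index_set n R)) \<le> real n * R" "real n * R - 1 \<le> log 2 (card (index_set n R))" "0 < card (index_set n R)"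
proof -
  have 1: "1 \<le> 2 powr (real n * R)" using assms by (intro ge_one_powr_ge_zero) auto
  then have c: "real (card (index_set n R)) = of_int \<lfloor>2 powr (real n * R)\<rfloor>" by (simp add: index_set_eq)
  show le: "real (card (index_set n R)) \<le> 2 powr (real n * R)" unfolding c by simp
  have "1 \<le> \<lfloor>2 powr (real n * R)\<rfloor>" using 1 by simp
  then show ge: "2 powr (real n * R) / 2 \<le> real (card (index_set n R))" unfolding c by linarith
  show pos: "0 < card (index_set n R)" using index_set_nonempty[OF assms, of n] finite_index_set[of n R] by (auto simp: card_gt_0_iff)
  have "log 2 (card (index_set n R)) \<le> log 2 (2 powr (real n * R))" using le pos by (intro log_mono) auto
  then show "log 2 (card (index_set n R)) \<le> real n * R" by simp
  have "log 2 (2 powr (real n * R) / 2) \<le> log 2 (card (index_set n R))" using ge pos by (intro log_mono) auto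
  then show "real n * R - 1 \<le> log 2 (card (index_set n R))" by (simp add: log_divide)
qed

lemma block_law_eq:
  fixes d :: "(nat \<Rightarrow> 's1::finite) \<Rightarrow> (nat \<Rightarrow> 's2::finite) \<Rightarrow> nat" and f :: "nat \<Rightarrow> (nat \<Rightarrow> 's1) \<Rightarrow> nat \<Rightarrow> nat \<Rightarrow> 'x::finite"
    and ch :: "'x \<Rightarrow> 's1 \<Rightarrow> 's2 \<Rightarrow> 'y::finite pmf"
  defines "T \<equiv> \<lambda>s. d (\<lambda>i. fst (s i)) (\<lambda>i. snd (s i))"
  defines "xin \<equiv> \<lambda>w s. f w (\<lambda>i. fst (s i)) (T s)"
  assumes "finite M" "M \<noteq> {}" "0 < n"
  shows "block_law n M p ch d f = map_pmf (\<lambda>\<omega>. (block.W \<omega>, block.S1 \<omega>, block.S2 \<omega>, block.Y \<omega>)) (block.pre n M p ch xin n)"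
proof -
  interpret block n M p ch xin T by unfold_locales fact+
  show ?thesis unfolding block_law_def pre_def
    by (simp add: map_bind_pmf Let_def W_def S1_def S2_def Y_def xin_def T_def)
qed

text \<open>The message is uniform, so the average of the conditional error probabilities is the
  probability of the error event under the joint law.\<close>

lemma error_prob_eq:
  assumes M: "finite M" "M \<noteq> {}"
  shows "error_prob n M p ch d f g = measure_pmf.prob (block_law n M p ch d f) {(w, s1, s2, y). g y s2 (d s1 s2) \<noteq> w}"
proof -
  let ?B = "block_law n M p ch d f"
  have fst: "map_pmf fst ?B = pmf_of_set M"
    unfolding block_law_def by (simp add: map_bind_pmf Let_def bind_return_pmf')
  have pw: "measure_pmf.prob ?B {\<omega>. fst \<omega> = w} = 1 / card M" if "w \<in> M" for w
  proof -
    have "measure_pmf.prob ?B {\<omega>. fst \<omega> = w} = pmf (map_pmf fst ?B) w" by (simp add: pmf_map vimage_def)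
    then show ?thesis using M that by (simp add: fst)
  qed
  have sup: "fst ` set_pmf ?B \<subseteq> M"
    using arg_cong[OF fst, of set_pmf] M by simp
  let ?E = "\<lambda>\<omega>. case \<omega> of (w', s1, s2, y) \<Rightarrow> g y s2 (d s1 s2) \<noteq> w'"
  have "error_prob n M p ch d f g = (\<Sum>w\<in>M. measure_pmf.prob ?B {\<omega>. ?E \<omega> \<and> fst \<omega> = w} / (1 / card M)) / card M"
    unfolding error_prob_def cond_prob_def by (simp add: pw)
  also have "\<dots> = (\<Sum>w\<in>M. measure_pmf.prob ?B {\<omega>. ?E \<omega> \<and> fst \<omega> = w})"
    using M by (simp add: sum_distrib_right[symmetric])
  also have "\<dots> = measure_pmf.prob ?B (\<Union>w\<in>M. {\<omega>. ?E \<omega> \<and> fst \<omega> = w})"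
    using M by (intro measure_pmf.finite_measure_finite_Union[symmetric]) (auto simp: disjoint_family_on_def)
  also have "\<dots> = measure_pmf.prob ?B {\<omega>. ?E \<omega>}"
    using sup by (intro measure_prob_cong_0) (auto simp: pmf_eq_0_set_pmf)
  finally show ?thesis by (simp add: split_def)
qed

text \<open>Division by \<open>n\<close> leaves (1 - \<open>pe n\<close>) (R - 1/n) \<le> m + 1/n.
  One of the two terms 1/n pays for rounding the number of messages, the other for the additive
  constant in Fano's inequality.\<close>

lemma converse_limit:
  assumes R: "0 \<le> R" and pe: "pe \<longlonglongrightarrow> 0" "\<And>n. pe n \<le> 1"
    and le: "\<And>n. 0 < n \<Longrightarrow> log 2 (card (index_set n R)) \<le> n * m + 1 + pe n * log 2 (card (index_set n R))"
  shows "R \<le> m"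
proof -
  have "(1 - pe n) * (R - 1 / n) \<le> m + 1 / n" if n: "0 < n" for n :: nat
  proof -
    have "(1 - pe n) * (real n * R - 1) \<le> (1 - pe n) * log 2 (card (index_set n R))"
      using card_index_set(4)[OF R] pe(2) by (intro mult_left_mono) (auto simp: field_simps)
    also have "\<dots> \<le> n * m + 1" using le[OF n] by (simp add: algebra_simps)
    finally have "(1 - pe n) * (real n * R - 1) / n \<le> (n * m + 1) / n" using n by (intro divide_right_mono) auto
    then show ?thesis using n by (simp add: field_simps)
  qed
  then have ev: "\<forall>\<^sub>F n in sequentially. (1 - pe n) * (R - 1 / n) \<le> m + 1 / n"
    by (auto intro!: eventually_sequentiallyI[of 1])
  have "(\<lambda>n. (1 - pe n) * (R - 1 / n)) \<longlonglongrightarrow> (1 - 0) * (R - 0)"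
    by (intro tendsto_intros pe lim_1_over_n)
  moreover have "(\<lambda>n. m + 1 / n) \<longlonglongrightarrow> m + 0" by (intro tendsto_intros lim_1_over_n)
  ultimately show ?thesis using tendsto_le[OF _ _ _ ev] by force
qed

context block
begin

text \<open>After \<open>single_letter\<close> the position is a component of \<open>V\<close>,
  whence the type \<open>nat \<times> 'v\<close> in the assumption on \<open>K\<close>.\<close>

lemma reduce_to_class_laws:
  fixes V :: "nat \<Rightarrow> (nat \<times> (nat \<Rightarrow> 's1 \<times> 's2) \<times> (nat \<Rightarrow> 'y)) \<Rightarrow> 'v" and U :: "nat \<Rightarrow> (nat \<times> (nat \<Rightarrow> 's1 \<times> 's2) \<times> (nat \<Rightarrow> 'y)) \<Rightarrow> 'u"
  assumes K: "suffices K TYPE('s1 \<times> 's2 \<times> (nat \<times> 'v) \<times> 'u \<times> 'x \<times> 'y)"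
    and tr: "\<And>i \<omega>. V i (trunc i \<omega>) = V i \<omega>" "\<And>i \<omega>. U i (trunc i \<omega>) = U i \<omega>"
    and ci: "\<And>i. i < n \<Longrightarrow> cind (pre i) (V i) (St i) (\<lambda>\<omega>. \<alpha> (St i \<omega>))"
       "\<And>i. i < n \<Longrightarrow> cind (pre i) (U i) (St i) (\<lambda>\<omega>. (\<beta> (St i \<omega>), V i \<omega>))"
       "\<And>i. i < n \<Longrightarrow> cind (pre i) (X i) (St i) (\<lambda>\<omega>. (U i \<omega>, S1 \<omega> i, V i \<omega>))"
  shows "\<exists>Q\<in>class_laws K (\<lambda>s t. \<alpha> s = \<alpha> t) (\<lambda>s t. \<beta> s = \<beta> t) p ch.
    n * eRate Q = (\<Sum>i<n. eRate (letter_law i (V i) (U i))) \<and>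
    n * eC1 Q \<le> (\<Sum>i<n. eC1 (letter_law i (V i) (U i))) \<and>
    n * eC2 Q = (\<Sum>i<n. eC2 (letter_law i (V i) (U i))) \<and>
    n * eC2C Q = (\<Sum>i<n. eC2C (letter_law i (V i) (U i)))"
proof -
  obtain qv :: "'s1 \<Rightarrow> 's2 \<Rightarrow> (nat \<times> 'v) pmf" and qu :: "'s1 \<Rightarrow> 's2 \<Rightarrow> (nat \<times> 'v) \<Rightarrow> 'u pmf" and qx where
    q: "\<forall>s1 s2. finite (set_pmf (qv s1 s2))" "\<forall>s1 s2 v. finite (set_pmf (qu s1 s2 v))"
    "kernel_class (\<lambda>s t. \<alpha> s = \<alpha> t) (\<lambda>s t. \<beta> s = \<beta> t) qv qu"
    "n * eRate (aux_law p ch qv qu qx) = (\<Sum>i<n. eRate (letter_law i (V i) (U i)))"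
    "n * eC1 (aux_law p ch qv qu qx) \<le> (\<Sum>i<n. eC1 (letter_law i (V i) (U i)))"
    "n * eC2 (aux_law p ch qv qu qx) = (\<Sum>i<n. eC2 (letter_law i (V i) (U i)))"
    "n * eC2C (aux_law p ch qv qu qx) = (\<Sum>i<n. eC2C (letter_law i (V i) (U i)))"
    using single_letter[of V U \<alpha> \<beta>, OF tr ci] by blast
  have "finite_law (\<lambda>s t. \<alpha> s = \<alpha> t) (\<lambda>s t. \<beta> s = \<beta> t) p ch (aux_law p ch qv qu qx)"
    unfolding finite_law_def using q(1-3) by blast
  then obtain Q where "Q\<in>class_laws K (\<lambda>s t. \<alpha> s = \<alpha> t) (\<lambda>s t. \<beta> s = \<beta> t) p ch" "eRate Q = eRate (aux_law p ch qv qu qx)"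
    "eC1 Q = eC1 (aux_law p ch qv qu qx)" "eC2 Q = eC2 (aux_law p ch qv qu qx)" "eC2C Q = eC2C (aux_law p ch qv qu qx)"
    using K unfolding suffices_def by blast
  then show ?thesis using q(4-7) by (intro bexI[of _ Q]) auto
qed

lemma aux_trunc: "Va i (trunc i \<omega>) = Va i \<omega>" "Vb i (trunc i \<omega>) = Vb i \<omega>" "Ub i (trunc i \<omega>) = Ub i \<omega>" "Uc i (trunc i \<omega>) = Uc i \<omega>"
  by (auto simp: aux_defs)

lemma H_D_le:
  assumes "finite I" "\<And>\<omega>. D \<omega> \<in> I"
  shows "H D \<le> log 2 (card I)"
  by (rule ent_le_log_card[OF finP assms(1)]) (use assms(2) in auto)

lemma mean_le: "real n * q \<le> s \<Longrightarrow> s \<le> h \<Longrightarrow> h \<le> real n * R \<Longrightarrow> q \<le> R"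
  using n by (meson mult_le_cancel_left_pos of_nat_0_less_iff order_trans)

lemma bound_1:
  assumes xd: "\<And>w s s'. (\<And>j. fst (s j) = fst (s' j)) \<Longrightarrow> T s = T s' \<Longrightarrow> xin w s = xin w s'"
    and T1: "\<And>s s'. (\<And>j. fst (s j) = fst (s' j)) \<Longrightarrow> T s = T s'"
    and K: "suffices K TYPE('s1 \<times> 's2 \<times> (nat \<times> nat \<times> (nat \<Rightarrow> 'y) \<times> (nat \<Rightarrow> 's2) \<times> (nat \<Rightarrow> 's1)) \<times> nat \<times> 'x \<times> 'y)"
    and hd: "H D \<le> real n * R'"
  shows "\<exists>Q\<in>class_laws K (\<lambda>s t. fst s = fst t) (\<lambda>s t. fst s = fst t) p ch. Info \<le> n * eRate Q \<and> eC1 Q \<le> R'"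
proof -
  obtain Q where Q: "Q \<in> class_laws K (\<lambda>s t. fst s = fst t) (\<lambda>s t. fst s = fst t) p ch"
    "n * eRate Q = (\<Sum>i<n. eRate (letter_law i (Va i) W))" "n * eC1 Q \<le> (\<Sum>i<n. eC1 (letter_law i (Va i) W))"
    using reduce_to_class_laws[of K Va "\<lambda>_. W" fst fst, OF K aux_trunc(1) rv_trunc(1) cind_case1(1)[OF xd T1] cind_case1(2)[OF xd T1] cind_case1(3)[OF xd T1]]
    by blast
  then show ?thesis using mean_le[OF Q(3) sum_c1 hd] by (intro bexI[of _ Q]) (auto simp: sum_rate_a)
qed

lemma bound_2ub1:
  assumes xd: "\<And>w s s'. (\<And>j. fst (s j) = fst (s' j)) \<Longrightarrow> T s = T s' \<Longrightarrow> xin w s = xin w s'"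
    and T2: "\<And>s s'. (\<And>j. snd (s j) = snd (s' j)) \<Longrightarrow> T s = T s'"
    and K: "suffices K TYPE('s1 \<times> 's2 \<times> (nat \<times> nat \<times> (nat \<Rightarrow> 'y) \<times> (nat \<Rightarrow> 's2) \<times> (nat \<Rightarrow> 's1)) \<times> nat \<times> 'x \<times> 'y)"
    and hd: "H D \<le> real n * R'"
  shows "\<exists>Q\<in>class_laws K (\<lambda>s t. s = t) (\<lambda>s t. fst s = fst t) p ch. Info \<le> n * eRate Q \<and> eC2 Q \<le> R'"
proof -
  have c1: "cind (pre i) (Va i) (St i) (\<lambda>\<omega>. (\<lambda>s. s) (St i \<omega>))" for i
    by (rule cind_determined(1)) simp
  obtain Q where Q: "Q \<in> class_laws K (\<lambda>s t. s = t) (\<lambda>s t. fst s = fst t) p ch"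
    "n * eRate Q = (\<Sum>i<n. eRate (letter_law i (Va i) W))" "n * eC2 Q = (\<Sum>i<n. eC2 (letter_law i (Va i) W))"
    using reduce_to_class_laws[of K Va "\<lambda>_. W" "\<lambda>s. s" fst, OF K aux_trunc(1) rv_trunc(1) c1 cind_U_ub1[OF xd T2] cind_X_ub(1)[OF xd T2]]
    by blast
  then show ?thesis using mean_le[OF eq_refl[OF Q(3)] sum_c2_a[OF base_ub'[OF xd T2]] hd]
    by (intro bexI[of _ Q]) (auto simp: sum_rate_a)
qed

lemma bound_2ub2:
  assumes xd: "\<And>w s s'. (\<And>j. fst (s j) = fst (s' j)) \<Longrightarrow> T s = T s' \<Longrightarrow> xin w s = xin w s'"
    and T2: "\<And>s s'. (\<And>j. snd (s j) = snd (s' j)) \<Longrightarrow> T s = T s'"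
    and K: "suffices K TYPE('s1 \<times> 's2 \<times> (nat \<times> nat \<times> (nat \<Rightarrow> 's2)) \<times> (nat \<times> (nat \<Rightarrow> 'y) \<times> (nat \<Rightarrow> 's1)) \<times> 'x \<times> 'y)"
    and hd: "H D \<le> real n * R'"
  shows "\<exists>Q\<in>class_laws K (\<lambda>s t. snd s = snd t) (\<lambda>s t. s = t) p ch. Info \<le> n * eRate Q \<and> eC2 Q \<le> R'"
proof -
  have c1: "cind (pre i) (Ub i) (St i) (\<lambda>\<omega>. ((\<lambda>s. s) (St i \<omega>), Vb i \<omega>))" for i
    by (rule cind_determined(1)) simp
  obtain Q where Q: "Q \<in> class_laws K (\<lambda>s t. snd s = snd t) (\<lambda>s t. s = t) p ch"
    "n * eRate Q = (\<Sum>i<n. eRate (letter_law i (Vb i) (Ub i)))" "n * eC2 Q = (\<Sum>i<n. eC2 (letter_law i (Vb i) (Ub i)))"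
    using reduce_to_class_laws[of K Vb Ub snd "\<lambda>s. s", OF K aux_trunc(2) aux_trunc(3) cind_Vb[OF T2] c1 cind_X_ub(2)[OF xd T2]]
    by blast
  have "cind P (\<lambda>\<omega>. lo i (S1 \<omega>)) (\<lambda>\<omega>. S1 \<omega> i) (\<lambda>\<omega>. (D \<omega>, lo i (S2 \<omega>)))" for i
  proof -
    \<comment> \<open>The encoder is not causal here, so the splice in time is made before any
      output exists; the variables are functions of the states, hence the independence carries over
      to the full law.\<close>
    have "cind (pre 0) (\<lambda>\<omega>. (W \<omega>, lo i (S1 \<omega>), Y \<omega>)) (\<lambda>\<omega>. hi i (fst (snd \<omega>))) (\<lambda>\<omega>. (D \<omega>, lo i (S2 \<omega>)))"
    proof (rule base_past)
      fix s s' :: "nat \<Rightarrow> 's1 \<times> 's2" assume "\<And>j. snd (s j) = snd (s' j)"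
      then show "T s = T s'" by (rule T2)
    qed auto
    from cind_derive[OF this, where fa="\<lambda>a c. fst (snd a)" and fb="\<lambda>b c. fst (b i)" and k="\<lambda>_ _. ()" and A'="\<lambda>\<omega>. lo i (S1 \<omega>)"
       and B'="\<lambda>\<omega>. S1 \<omega> i" and C'="\<lambda>\<omega>. (D \<omega>, lo i (S2 \<omega>))"]
    have "cind (pre 0) (\<lambda>\<omega>. lo i (S1 \<omega>)) (\<lambda>\<omega>. S1 \<omega> i) (\<lambda>\<omega>. (D \<omega>, lo i (S2 \<omega>)))"
      by (simp add: hi_at S1_def)
    then show ?thesis
      using cind_pre_states[of "\<lambda>s. lo i (\<lambda>j. fst (s j))" "\<lambda>s. fst (s i)" "\<lambda>s. (T s, lo i (\<lambda>j. snd (s j)))" n]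
      by (simp add: S1_def S2_def D_def)
  qed
  then have "Info \<le> n * eRate Q" unfolding Q(2) by (intro sum_rate_b)
  then show ?thesis using Q(1) mean_le[OF eq_refl[OF Q(3)] sum_c2_b hd] by blast
qed

lemma bound_2C:
  assumes xc: "\<And>w s s' j. (\<And>j'. j' \<le> j \<Longrightarrow> fst (s j') = fst (s' j')) \<Longrightarrow> T s = T s' \<Longrightarrow> xin w s j = xin w s' j"
    and T2: "\<And>s s'. (\<And>j. snd (s j) = snd (s' j)) \<Longrightarrow> T s = T s'"
    and K: "suffices K TYPE('s1 \<times> 's2 \<times> (nat \<times> nat \<times> (nat \<Rightarrow> 's2)) \<times> (nat \<times> (nat \<Rightarrow> 's1) \<times> (nat \<Rightarrow> 'y)) \<times> 'x \<times> 'y)"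
    and hd: "H D \<le> real n * R'"
  shows "\<exists>Q\<in>class_laws K (\<lambda>s t. snd s = snd t) (\<lambda>s t. True) p ch. Info \<le> n * eRate Q \<and> eC2C Q \<le> R'"
proof -
  obtain Q where Q: "Q \<in> class_laws K (\<lambda>s t. snd s = snd t) (\<lambda>s t. () = ()) p ch"
    "n * eRate Q = (\<Sum>i<n. eRate (letter_law i (Vb i) (Uc i)))" "n * eC2C Q = (\<Sum>i<n. eC2C (letter_law i (Vb i) (Uc i)))"
    using reduce_to_class_laws[of K Vb Uc snd "\<lambda>_. ()", OF K aux_trunc(2) aux_trunc(4) cind_Vb[OF T2] cind_2C(1)[OF xc T2] cind_2C(2)[OF xc T2]]
    by blast
  have "cind P (Uc i) (\<lambda>\<omega>. S1 \<omega> i) (Vb i)" if i: "i < n" for i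
  proof -
    have "cind (pre i) (Uc i) (\<lambda>\<omega>. S1 \<omega> i) (Vb i)"
      by (rule cind_derive[OF cind_2C(1)[OF xc T2], where fa="\<lambda>a c. a" and fb="\<lambda>b c. fst b" and k="\<lambda>_ _. ()"]) (auto simp: fst_St)
    moreover have "map_pmf (trunc i) P = pre i"
      using arg_cong[OF map_trunc[OF i], of "map_pmf fst"] by (simp add: map_bind_pmf map_pmf_comp bind_return_pmf')
    ultimately show ?thesis
      using cind_map[of "trunc i" P "Uc i" "\<lambda>\<omega>. S1 \<omega> i" "Vb i"] by (simp add: aux_trunc)
  qed
  then have "Info \<le> n * eRate Q" unfolding Q(2) by (intro sum_rate_c)
  then show ?thesis using Q(1) mean_le[OF eq_refl[OF Q(3)] sum_c2C_b hd] by auto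
qed

end

lemma Info_error_prob:
  fixes d :: "(nat \<Rightarrow> 's1::finite) \<Rightarrow> (nat \<Rightarrow> 's2::finite) \<Rightarrow> nat" and f :: "nat \<Rightarrow> (nat \<Rightarrow> 's1) \<Rightarrow> nat \<Rightarrow> nat \<Rightarrow> 'x::finite"
    and ch :: "'x \<Rightarrow> 's1 \<Rightarrow> 's2 \<Rightarrow> 'y::finite pmf" and T xin
  assumes T: "T = (\<lambda>s. d (\<lambda>i. fst (s i)) (\<lambda>i. snd (s i)))" and xin: "xin = (\<lambda>w s. f w (\<lambda>i. fst (s i)) (T s))"
    and M: "finite M" "M \<noteq> {}" and n: "0 < n"
  shows "log 2 (card M) \<le> block.Info n M p ch xin T + 1 + error_prob n M p ch d f g * log 2 (card M)"
proof -
  interpret block n M p ch xin T by unfold_locales fact+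
  have B: "block_law n M p ch d f = map_pmf (\<lambda>\<omega>. (W \<omega>, S1 \<omega>, S2 \<omega>, Y \<omega>)) P"
    using block_law_eq[OF M n, of p ch d f] by (simp only: T xin)
  have "error_prob n M p ch d f g = measure_pmf.prob P {\<omega>. g (Y \<omega>) (S2 \<omega>) (D \<omega>) \<noteq> W \<omega>}"
    unfolding error_prob_eq[OF M] B D_def S1_def S2_def by (simp add: vimage_def T)
  then show ?thesis using Info_ge[of g] by simp
qed

lemma error_prob_le_1:
  assumes "finite M" "M \<noteq> {}"
  shows "error_prob n M p ch d f g \<le> 1"
  by (simp add: error_prob_eq[OF assms])

lemma converse_1:
  fixes p :: "('s1::finite \<times> 's2::finite) pmf" and ch :: "'x::finite \<Rightarrow> 's1 \<Rightarrow> 's2 \<Rightarrow> 'y::finite pmf"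
  assumes ach: "achievable1 p ch R R'" and R': "0 \<le> R'"
    and K: "suffices K TYPE('s1 \<times> 's2 \<times> (nat \<times> nat \<times> (nat \<Rightarrow> 'y) \<times> (nat \<Rightarrow> 's2) \<times> (nat \<Rightarrow> 's1)) \<times> nat \<times> 'x \<times> 'y)"
    and m: "\<And>Q. Q \<in> class_laws K (\<lambda>s t. fst s = fst t) (\<lambda>s t. fst s = fst t) p ch \<Longrightarrow> eC1 Q \<le> R' \<Longrightarrow> eRate Q \<le> m"
  shows "R \<le> m"
proof -
  from ach obtain fv f g where R: "0 \<le> R" and fv: "\<And>n s. fv n s \<in> index_set n R'"
    and lim: "(\<lambda>n. error_prob n (index_set n R) p ch (\<lambda>s1 s2. fv n s1) (f n) (g n)) \<longlonglongrightarrow> 0"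
    unfolding achievable1_def by blast
  have M: "finite (index_set n R)" "index_set n R \<noteq> {}" for n
    using finite_index_set index_set_nonempty[OF R] by auto
  show ?thesis
  proof (rule converse_limit[OF R lim])
    show "error_prob n (index_set n R) p ch (\<lambda>s1 s2. fv n s1) (f n) (g n) \<le> 1" for n
      by (rule error_prob_le_1[OF M])
    fix n :: nat assume n: "0 < n"
    define T :: "(nat \<Rightarrow> 's1 \<times> 's2) \<Rightarrow> nat" where "T = (\<lambda>s. fv n (\<lambda>i. fst (s i)))"
    define xin :: "nat \<Rightarrow> (nat \<Rightarrow> 's1 \<times> 's2) \<Rightarrow> nat \<Rightarrow> 'x" where "xin = (\<lambda>w s. f n w (\<lambda>i. fst (s i)) (T s))"
    interpret block n "index_set n R" p ch xin T by unfold_locales fact+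
    have hd: "H D \<le> real n * R'"
      by (rule order_trans[OF H_D_le[OF finite_index_set[of n R']] card_index_set(3)[OF R', of n]]) (unfold D_def, simp add: fv T_def)
    have "\<exists>Q\<in>class_laws K (\<lambda>s t. fst s = fst t) (\<lambda>s t. fst s = fst t) p ch. Info \<le> n * eRate Q \<and> eC1 Q \<le> R'"
      by (rule bound_1[OF _ _ K hd]) (simp_all add: xin_def T_def)
    then obtain Q where Q: "Q \<in> class_laws K (\<lambda>s t. fst s = fst t) (\<lambda>s t. fst s = fst t) p ch" "Info \<le> n * eRate Q" "eC1 Q \<le> R'"
      by blast
    have "Info \<le> n * m" using Q(2) mult_left_mono[OF m[OF Q(1,3)], of "real n"] by simp
    then show "log 2 (card (index_set n R)) \<le> n * m + 1 +
       error_prob n (index_set n R) p ch (\<lambda>s1 s2. fv n s1) (f n) (g n) * log 2 (card (index_set n R))"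
      using Info_error_prob[of T "\<lambda>s1 s2. fv n s1" xin "f n", OF T_def xin_def M n, of p ch "g n"] by linarith
  qed
qed

lemma converse_2:
  fixes p :: "('s1::finite \<times> 's2::finite) pmf" and ch :: "'x::finite \<Rightarrow> 's1 \<Rightarrow> 's2 \<Rightarrow> 'y::finite pmf"
  assumes ach: "achievable2 p ch R R'" and R': "0 \<le> R'"
    and K: "suffices K TYPE('s1 \<times> 's2 \<times> (nat \<times> nat \<times> (nat \<Rightarrow> 'y) \<times> (nat \<Rightarrow> 's2) \<times> (nat \<Rightarrow> 's1)) \<times> nat \<times> 'x \<times> 'y)"
       "suffices K TYPE('s1 \<times> 's2 \<times> (nat \<times> nat \<times> (nat \<Rightarrow> 's2)) \<times> (nat \<times> (nat \<Rightarrow> 'y) \<times> (nat \<Rightarrow> 's1)) \<times> 'x \<times> 'y)"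
    and m1: "\<And>Q. Q \<in> class_laws K (\<lambda>s t. s = t) (\<lambda>s t. fst s = fst t) p ch \<Longrightarrow> eC2 Q \<le> R' \<Longrightarrow> eRate Q \<le> m1"
    and m2: "\<And>Q. Q \<in> class_laws K (\<lambda>s t. snd s = snd t) (\<lambda>s t. s = t) p ch \<Longrightarrow> eC2 Q \<le> R' \<Longrightarrow> eRate Q \<le> m2"
  shows "R \<le> min m1 m2"
proof -
  from ach obtain fv f g where R: "0 \<le> R" and fv: "\<And>n s. fv n s \<in> index_set n R'"
    and lim: "(\<lambda>n. error_prob n (index_set n R) p ch (\<lambda>s1 s2. fv n s2) (f n) (g n)) \<longlonglongrightarrow> 0"
    unfolding achievable2_def by blast
  have M: "finite (index_set n R)" "index_set n R \<noteq> {}" for n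
    using finite_index_set index_set_nonempty[OF R] by auto
  show ?thesis
  proof (rule converse_limit[OF R lim])
    show "error_prob n (index_set n R) p ch (\<lambda>s1 s2. fv n s2) (f n) (g n) \<le> 1" for n
      by (rule error_prob_le_1[OF M])
    fix n :: nat assume n: "0 < n"
    define T :: "(nat \<Rightarrow> 's1 \<times> 's2) \<Rightarrow> nat" where "T = (\<lambda>s. fv n (\<lambda>i. snd (s i)))"
    define xin :: "nat \<Rightarrow> (nat \<Rightarrow> 's1 \<times> 's2) \<Rightarrow> nat \<Rightarrow> 'x" where "xin = (\<lambda>w s. f n w (\<lambda>i. fst (s i)) (T s))"
    interpret block n "index_set n R" p ch xin T by unfold_locales fact+
    have hd: "H D \<le> real n * R'"
      by (rule order_trans[OF H_D_le[OF finite_index_set[of n R']] card_index_set(3)[OF R', of n]]) (unfold D_def, simp add: fv T_def)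
    have "\<exists>Q\<in>class_laws K (\<lambda>s t. s = t) (\<lambda>s t. fst s = fst t) p ch. Info \<le> n * eRate Q \<and> eC2 Q \<le> R'"
      by (rule bound_2ub1[OF _ _ K(1) hd]) (simp_all add: xin_def T_def)
    then obtain Q where Q: "Q \<in> class_laws K (\<lambda>s t. s = t) (\<lambda>s t. fst s = fst t) p ch" "Info \<le> n * eRate Q" "eC2 Q \<le> R'"
      by blast
    have i1: "Info \<le> n * m1" using Q(2) mult_left_mono[OF m1[OF Q(1,3)], of "real n"] by simp
    have "\<exists>Q\<in>class_laws K (\<lambda>s t. snd s = snd t) (\<lambda>s t. s = t) p ch. Info \<le> n * eRate Q \<and> eC2 Q \<le> R'"
      by (rule bound_2ub2[OF _ _ K(2) hd]) (simp_all add: xin_def T_def)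
    then obtain Q' where Q': "Q' \<in> class_laws K (\<lambda>s t. snd s = snd t) (\<lambda>s t. s = t) p ch" "Info \<le> n * eRate Q'" "eC2 Q' \<le> R'"
      by blast
    have i2: "Info \<le> n * m2" using Q'(2) mult_left_mono[OF m2[OF Q'(1,3)], of "real n"] by simp
    have "Info \<le> n * min m1 m2" using i1 i2 by (auto simp: min_def)
    then show "log 2 (card (index_set n R)) \<le> n * min m1 m2 + 1 +
       error_prob n (index_set n R) p ch (\<lambda>s1 s2. fv n s2) (f n) (g n) * log 2 (card (index_set n R))"
      using Info_error_prob[of T "\<lambda>s1 s2. fv n s2" xin "f n", OF T_def xin_def M n, of p ch "g n"] by linarith
  qed
qed

lemma converse_2C:
  fixes p :: "('s1::finite \<times> 's2::finite) pmf" and ch :: "'x::finite \<Rightarrow> 's1 \<Rightarrow> 's2 \<Rightarrow> 'y::finite pmf"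
  assumes ach: "achievable2C p ch R R'" and R': "0 \<le> R'"
    and K: "suffices K TYPE('s1 \<times> 's2 \<times> (nat \<times> nat \<times> (nat \<Rightarrow> 's2)) \<times> (nat \<times> (nat \<Rightarrow> 's1) \<times> (nat \<Rightarrow> 'y)) \<times> 'x \<times> 'y)"
    and m: "\<And>Q. Q \<in> class_laws K (\<lambda>s t. snd s = snd t) (\<lambda>s t. True) p ch \<Longrightarrow> eC2C Q \<le> R' \<Longrightarrow> eRate Q \<le> m"
  shows "R \<le> m"
proof -
  from ach obtain fv f g where R: "0 \<le> R" and fv: "\<And>n s. fv n s \<in> index_set n R'"
    and lim: "(\<lambda>n. error_prob n (index_set n R) p ch (\<lambda>s1 s2. fv n s2) (\<lambda>w s1 t i. f n i w (restrict s1 {..i}) t) (g n)) \<longlonglongrightarrow> 0"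
    unfolding achievable2C_def by blast
  have M: "finite (index_set n R)" "index_set n R \<noteq> {}" for n
    using finite_index_set index_set_nonempty[OF R] by auto
  show ?thesis
  proof (rule converse_limit[OF R lim])
    show "error_prob n (index_set n R) p ch (\<lambda>s1 s2. fv n s2) (\<lambda>w s1 t i. f n i w (restrict s1 {..i}) t) (g n) \<le> 1" for n
      by (rule error_prob_le_1[OF M])
    fix n :: nat assume n: "0 < n"
    define T :: "(nat \<Rightarrow> 's1 \<times> 's2) \<Rightarrow> nat" where "T = (\<lambda>s. fv n (\<lambda>i. snd (s i)))"
    define xin :: "nat \<Rightarrow> (nat \<Rightarrow> 's1 \<times> 's2) \<Rightarrow> nat \<Rightarrow> 'x" where "xin = (\<lambda>w s i. f n i w (restrict (\<lambda>i. fst (s i)) {..i}) (T s))"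
    interpret block n "index_set n R" p ch xin T by unfold_locales fact+
    have hd: "H D \<le> real n * R'"
      by (rule order_trans[OF H_D_le[OF finite_index_set[of n R']] card_index_set(3)[OF R', of n]]) (unfold D_def, simp add: fv T_def)
    have "\<exists>Q\<in>class_laws K (\<lambda>s t. snd s = snd t) (\<lambda>s t. True) p ch. Info \<le> n * eRate Q \<and> eC2C Q \<le> R'"
    proof (rule bound_2C[OF _ _ K hd])
      fix w j and s s' :: "nat \<Rightarrow> 's1 \<times> 's2"
      assume a: "\<And>j'. j' \<le> j \<Longrightarrow> fst (s j') = fst (s' j')" "T s = T s'"
      have "restrict (\<lambda>i. fst (s i)) {..j} = restrict (\<lambda>i. fst (s' i)) {..j}"
        using a(1) by (auto simp: restrict_def)
      then show "xin w s j = xin w s' j" by (simp add: xin_def a(2))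
    qed (simp add: T_def)
    then obtain Q where Q: "Q \<in> class_laws K (\<lambda>s t. snd s = snd t) (\<lambda>s t. True) p ch" "Info \<le> n * eRate Q" "eC2C Q \<le> R'"
      by blast
    have "Info \<le> n * m" using Q(2) mult_left_mono[OF m[OF Q(1,3)], of "real n"] by simp
    then show "log 2 (card (index_set n R)) \<le> n * m + 1 +
       error_prob n (index_set n R) p ch (\<lambda>s1 s2. fv n s2) (\<lambda>w s1 t i. f n i w (restrict s1 {..i}) t) (g n) * log 2 (card (index_set n R))"
      using Info_error_prob[of T "\<lambda>s1 s2. fv n s2" xin "\<lambda>w s1 t i. f n i w (restrict s1 {..i}) t", OF T_def xin_def M n, of p ch "g n"] by linarith
  qed
qed

section \<open>Exponential races and matching\<close>

definition expo :: "real measure" where "expo = density lborel (exponential_density 1)"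

lemma prob_space_expo: "prob_space expo"
  unfolding expo_def by (rule prob_space_exponential_density) simp

lemma sets_expo [measurable_cong]: "sets expo = sets borel" by (simp add: expo_def)

lemma space_expo: "space expo = UNIV" by (simp add: expo_def)

lemma emeasure_expo_tail: "0 \<le> t \<Longrightarrow> emeasure expo {t<..} = ennreal (exp (- t))"
proof -
  assume t: "0 \<le> t"
  interpret prob_space expo by (rule prob_space_expo)
  have "distributed expo lborel (\<lambda>x. x) (exponential_density 1)"
    unfolding distributed_def by (auto simp: expo_def intro!: distr_id2)
  from exponential_distributedD_gt[OF this t] have "prob {x\<in>space expo. t < x} = exp (- t)" by simp
  moreover have "{x\<in>space expo. t < x} = {t<..}" by (auto simp: space_expo)
  ultimately show ?thesis by (simp add: emeasure_eq_measure)
qed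

text \<open>Given that the clock of \<open>a\<close> shows y, each other clock exceeds
  \<open>c b * y\<close> independently with probability exp(- c b y). Integrating the product exp(-
  C y) against the exponential density gives 1/(1 + C).\<close>

lemma race:
  fixes c :: "'a \<Rightarrow> real"
  assumes A: "finite A" "a \<in> A" and c: "\<And>b. 0 \<le> c b"
  shows "measure (Pi\<^sub>M A (\<lambda>_. expo)) {z\<in>space (Pi\<^sub>M A (\<lambda>_. expo)). 0 \<le> z a \<and> (\<forall>b\<in>A - {a}. c b * z a < z b)} =
    1 / (1 + (\<Sum>b\<in>A - {a}. c b))"
proof -
  interpret E: prob_space expo by (rule prob_space_expo)
  interpret PS: product_prob_space "\<lambda>_ :: 'a. expo" A by standard
  define I where "I = A - {a}"
  define C where "C = (\<Sum>b\<in>I. c b)"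
  have I: "finite I" "a \<notin> I" "A = insert a I" using A by (auto simp: I_def)
  have C0: "0 \<le> C" unfolding C_def by (intro sum_nonneg c)
  let ?M = "Pi\<^sub>M A (\<lambda>_. expo)"
  let ?S = "{z\<in>space ?M. 0 \<le> z a \<and> (\<forall>b\<in>I. c b * z a < z b)}"
  have comp [measurable]: "(\<lambda>z. z b) \<in> borel_measurable ?M" if "b \<in> A" for b
    using measurable_component_singleton[OF that, of "\<lambda>_. expo"] by (simp add: measurable_cong_sets[OF refl sets_expo])
  have S: "?S \<in> sets ?M"
  proof -
    have "?S = {z\<in>space ?M. 0 \<le> z a} \<inter> (\<Inter>b\<in>I. {z\<in>space ?M. c b * z a < z b}) \<inter> space ?M" by auto
    moreover have "{z\<in>space ?M. 0 \<le> z a} \<in> sets ?M" using A by measurable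
    moreover have "(\<Inter>b\<in>I. {z\<in>space ?M. c b * z a < z b}) \<inter> space ?M \<in> sets ?M"
    proof (cases "I = {}")
      case False
      have "{z\<in>space ?M. c b * z a < z b} \<in> sets ?M" if "b \<in> I" for b
      proof -
        have "b \<in> A" using that I by auto
        then show ?thesis using A by measurable
      qed
      then have "(\<Inter>b\<in>I. {z\<in>space ?M. c b * z a < z b}) \<in> sets ?M"
        using False I by (intro sets.finite_INT) auto
      then show ?thesis by (intro sets.Int) auto
    qed simp
    ultimately show ?thesis by (auto simp: Int_assoc)
  qed
  have "emeasure ?M ?S = (\<integral>\<^sup>+z. indicator ?S z \<partial>?M)" using S by simp
  also have "\<dots> = (\<integral>\<^sup>+y. (\<integral>\<^sup>+x. indicator ?S (x(a := y)) \<partial>Pi\<^sub>M I (\<lambda>_. expo)) \<partial>expo)"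
    unfolding I(3) by (rule PS.product_nn_integral_insert_rev) (use I S in auto)
  also have "\<dots> = (\<integral>\<^sup>+y. ennreal (indicator {0..} y * exp (- C * y)) \<partial>expo)"
  proof (intro nn_integral_cong)
    fix y
    show "(\<integral>\<^sup>+x. indicator ?S (x(a := y)) \<partial>Pi\<^sub>M I (\<lambda>_. expo)) = ennreal (indicator {0..} y * exp (- C * y))"
    proof (cases "0 \<le> y")
      case True
      have "(\<integral>\<^sup>+x. indicator ?S (x(a := y)) \<partial>Pi\<^sub>M I (\<lambda>_. expo)) =
          (\<integral>\<^sup>+x. indicator (PiE I (\<lambda>b. {c b * y<..})) x \<partial>Pi\<^sub>M I (\<lambda>_. expo))"
      proof (intro nn_integral_cong)
        fix x assume x: "x \<in> space (Pi\<^sub>M I (\<lambda>_. expo))"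
        have sp: "x(a := y) \<in> space ?M" using x I by (auto simp: space_PiM space_expo PiE_def extensional_def)
        have "(\<forall>b\<in>I. c b * y < (x(a := y)) b) \<longleftrightarrow> (\<forall>b\<in>I. c b * y < x b)" using I(2) by (intro ball_cong) auto
        then have "x(a := y) \<in> ?S \<longleftrightarrow> x \<in> PiE I (\<lambda>b. {c b * y<..})"
          using x sp True by (auto simp: space_PiM PiE_def extensional_def)
        then show "indicator ?S (x(a := y)) = (indicator (PiE I (\<lambda>b. {c b * y<..})) x :: ennreal)"
          by (simp add: indicator_def)
      qed
      also have "\<dots> = emeasure (Pi\<^sub>M I (\<lambda>_. expo)) (PiE I (\<lambda>b. {c b * y<..}))"
        using I by (intro nn_integral_indicator sets_PiM_I_finite) (auto simp: sets_expo)
      also have "\<dots> = (\<Prod>b\<in>I. emeasure expo {c b * y<..})"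
        using I by (intro PS.emeasure_PiM) (auto simp: sets_expo)
      also have "\<dots> = (\<Prod>b\<in>I. ennreal (exp (- (c b * y))))"
        using True c by (intro prod.cong refl emeasure_expo_tail) auto
      also have "\<dots> = ennreal (\<Prod>b\<in>I. exp (- (c b * y)))" by (intro prod_ennreal) auto
      also have "(\<Prod>b\<in>I. exp (- (c b * y))) = exp (- C * y)"
        using I by (simp add: exp_sum[symmetric] C_def sum_distrib_right sum_negf)
      finally show ?thesis using True by (simp del: fun_upd_apply)
    next
      case False
      then have "indicator ?S (x(a := y)) = (0 :: ennreal)" for x by (auto simp: indicator_def)
      then show ?thesis using False by simp
    qed
  qed
  also have "\<dots> = (\<integral>\<^sup>+y. ennreal (exponential_density 1 y) * ennreal (indicator {0..} y * exp (- C * y)) \<partial>lborel)"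
    unfolding expo_def by (subst nn_integral_density) auto
  also have "\<dots> = (\<integral>\<^sup>+y. ennreal (1 / (1 + C)) * ennreal (exponential_density (1 + C) y) \<partial>lborel)"
  proof (intro nn_integral_cong)
    fix y :: real
    have "exp (- y) * exp (- C * y) = exp (- y * (1 + C))"
      by (simp add: exp_add[symmetric] algebra_simps)
    also have "\<dots> = 1 / (1 + C) * ((1 + C) * exp (- y * (1 + C)))"
      using C0 by simp
    finally have "exp (- y) * exp (- C * y) = 1 / (1 + C) * ((1 + C) * exp (- y * (1 + C)))" .
    then show "ennreal (exponential_density 1 y) * ennreal (indicator {0..} y * exp (- C * y)) =
        ennreal (1 / (1 + C)) * ennreal (exponential_density (1 + C) y)"
      using C0 by (simp add: exponential_density_def indicator_def ennreal_mult[symmetric])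
  qed
  also have "\<dots> = ennreal (1 / (1 + C)) * (\<integral>\<^sup>+y. ennreal (exponential_density (1 + C) y) \<partial>lborel)"
    by (intro nn_integral_cmult) auto
  also have "(\<integral>\<^sup>+y. ennreal (exponential_density (1 + C) y) \<partial>lborel) = 1"
  proof -
    interpret X: prob_space "density lborel (exponential_density (1 + C))"
      using C0 by (intro prob_space_exponential_density) auto
    have "emeasure (density lborel (exponential_density (1 + C))) UNIV = 1" using X.emeasure_space_1 by simp
    then show ?thesis by (subst (asm) emeasure_density) auto
  qed
  finally have "emeasure ?M ?S = ennreal (1 / (1 + C))" by simp
  then show ?thesis unfolding I_def[symmetric] C_def[symmetric] using C0 by (simp add: measure_def)
qed

text \<open>Only finitely many outcomes of a race are possible. Their law is turned into a pmf, so
  that the continuous clocks do not appear beyond the construction of selectors.\<close>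

lemma finite_pmf_of_rv:
  assumes "prob_space N" and F: "finite F" "\<And>z. z \<in> space N \<Longrightarrow> g z \<in> F"
    and meas: "\<And>\<phi>. \<phi> \<in> F \<Longrightarrow> {z\<in>space N. g z = \<phi>} \<in> sets N"
  shows "\<exists>\<Phi>. set_pmf \<Phi> \<subseteq> F \<and> (\<forall>R. measure_pmf.prob \<Phi> {\<phi>. R \<phi>} = measure N {z\<in>space N. R (g z)})"
proof -
  interpret prob_space N by fact
  define w where "w \<phi> = (if \<phi> \<in> F then prob {z\<in>space N. g z = \<phi>} else 0)" for \<phi>
  have un: "prob {z\<in>space N. R (g z)} = (\<Sum>\<phi>\<in>{\<phi>\<in>F. R \<phi>}. w \<phi>)" for R
  proof -
    have "{z\<in>space N. R (g z)} = (\<Union>\<phi>\<in>{\<phi>\<in>F. R \<phi>}. {z\<in>space N. g z = \<phi>})" using F(2) by auto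
    then have "prob {z\<in>space N. R (g z)} = prob (\<Union>\<phi>\<in>{\<phi>\<in>F. R \<phi>}. {z\<in>space N. g z = \<phi>})" by simp
    also have "\<dots> = (\<Sum>\<phi>\<in>{\<phi>\<in>F. R \<phi>}. prob {z\<in>space N. g z = \<phi>})"
      using F meas by (intro finite_measure_finite_Union) (auto simp: disjoint_family_on_def)
    finally show ?thesis by (simp add: w_def)
  qed
  have w0: "0 \<le> w \<phi>" for \<phi> by (simp add: w_def)
  have "(\<integral>\<^sup>+ \<phi>. ennreal (w \<phi>) \<partial>count_space UNIV) = (\<Sum>\<phi>\<in>F. ennreal (w \<phi>))"
    using F by (intro nn_integral_count_space') (auto simp: w_def)
  also have "\<dots> = ennreal (\<Sum>\<phi>\<in>F. w \<phi>)" by (intro sum_ennreal w0)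
  also have "(\<Sum>\<phi>\<in>F. w \<phi>) = 1" using un[of "\<lambda>_. True"] by (simp add: prob_space)
  finally have e: "pmf (embed_pmf w) \<phi> = w \<phi>" for \<phi> by (intro pmf_embed_pmf w0) simp
  have sub: "set_pmf (embed_pmf w) \<subseteq> F" by (auto simp: set_pmf_iff e w_def split: if_splits)
  have "measure_pmf.prob (embed_pmf w) {\<phi>. R \<phi>} = prob {z\<in>space N. R (g z)}" for R
  proof -
    have "measure_pmf.prob (embed_pmf w) {\<phi>. R \<phi>} = measure_pmf.prob (embed_pmf w) {\<phi>\<in>F. R \<phi>}"
      using sub by (intro measure_prob_cong_0) (auto simp: pmf_eq_0_set_pmf)
    then show ?thesis using F by (simp add: measure_measure_pmf_finite un e)
  qed
  then show ?thesis using sub by blast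
qed

text \<open>Two parties who run the same exponential race, weighted by \<open>P\<close> and by \<open>Q\<close>, disagree with probability at
  most \<open>mismatch P Q a\<close> if the winner under \<open>P\<close> is \<open>a\<close>; they always agree if \<open>P = Q\<close>.\<close>

definition mismatch :: "'a pmf \<Rightarrow> 'a pmf \<Rightarrow> 'a \<Rightarrow> real" where
  "mismatch P Q a = (if P = Q then 0 else pmf P a / (pmf P a + pmf Q a))"

lemma mismatch_nonneg: "0 \<le> mismatch P Q a" by (simp add: mismatch_def)

text \<open>Common randomness is encoded as a random function from laws to outcomes. Values lie in
  \<open>A\<close> even at laws outside \<Xi>, so the resulting codes are total; marginals and
  agreement are promised on \<Xi> only.\<close>

definition selector :: "'a set \<Rightarrow> 'a pmf set \<Rightarrow> ('a pmf \<Rightarrow> 'a) pmf \<Rightarrow> bool" where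
  "selector A \<Xi> \<Phi> \<longleftrightarrow> (\<forall>\<phi>\<in>set_pmf \<Phi>. \<forall>Q. \<phi> Q \<in> A) \<and> (\<forall>P\<in>\<Xi>. map_pmf (\<lambda>\<phi>. \<phi> P) \<Phi> = P) \<and>
    (\<forall>P\<in>\<Xi>. \<forall>Q\<in>\<Xi>. \<forall>a. measure_pmf.prob \<Phi> {\<phi>. \<phi> P = a \<and> \<phi> Q \<noteq> a} \<le> pmf P a * mismatch P Q a)"

text \<open>The winner under \<open>Q\<close> is the \<open>a\<close> with the least ratio of clock
  to weight. If every other clock exceeds \<open>z a\<close> times the sum of the two weight ratios,
  then \<open>a\<close> wins under both laws. By \<open>race\<close> this has probability 1/(1/P(a)
  + 1/Q(a) - 1), which is at least P(a) Q(a)/(P(a) + Q(a)).\<close>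

lemma ex_selector:
  fixes A :: "'a set"
  assumes A: "finite A" "A \<noteq> {}" and \<Xi>: "finite \<Xi>" "\<And>Q. Q \<in> \<Xi> \<Longrightarrow> set_pmf Q \<subseteq> A"
  shows "\<exists>\<Phi>. selector A \<Xi> \<Phi>"
proof -
  interpret E: prob_space expo by (rule prob_space_expo)
  interpret PS: product_prob_space "\<lambda>_ :: 'a. expo" A by standard
  let ?N = "Pi\<^sub>M A (\<lambda>_. expo)"
  have Nps: "prob_space ?N" by (intro prob_space_PiM prob_space_expo)
  obtain a0 where a0: "a0 \<in> A" using A by auto
  \<comment> \<open>Ratios of clocks and weights are compared after cross multiplication, which also
    makes sense at weight zero; strictness makes the winner unique.\<close>
  define win where "win z Q a \<longleftrightarrow> a \<in> A \<and> (\<forall>b\<in>A - {a}. pmf Q b * z a < pmf Q a * z b)" for z :: "'a \<Rightarrow> real" and Q a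
  define sel where "sel z Q = (if \<exists>a. win z Q a then SOME a. win z Q a else a0)" for z Q
  have win_unique: "a = b" if "win z Q a" "win z Q b" for z Q a b
  proof (rule ccontr)
    assume "a \<noteq> b"
    then have "pmf Q b * z a < pmf Q a * z b" "pmf Q a * z b < pmf Q b * z a"
      using that unfolding win_def by auto
    then show False by simp
  qed
  have sel_win: "sel z Q = a" if "win z Q a" for z Q a
    using that win_unique unfolding sel_def by (auto intro: some_equality)
  have selA: "sel z Q \<in> A" for z Q
  proof (cases "\<exists>a. win z Q a")
    case True
    then have "win z Q (sel z Q)" unfolding sel_def by (simp add: someI_ex)
    then show ?thesis by (simp add: win_def)
  qed (simp add: sel_def a0)
  have sel_iff: "sel z Q = a \<longleftrightarrow> win z Q a \<or> a = a0 \<and> (\<forall>b\<in>A. \<not> win z Q b)" for z Q a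
  proof (cases "\<exists>b. win z Q b")
    case True
    then obtain b where b: "win z Q b" by blast
    then show ?thesis using sel_win[OF b] win_unique by (auto simp: win_def)
  qed (auto simp: sel_def)
  have comp [measurable]: "(\<lambda>z. z b) \<in> borel_measurable ?N" if "b \<in> A" for b
    using measurable_component_singleton[OF that, of "\<lambda>_. expo"] by (simp add: measurable_cong_sets[OF refl sets_expo])
  have mwin: "{z\<in>space ?N. win z Q a} \<in> sets ?N" for Q a
  proof (cases "a \<in> A")
    case True
    have "{z\<in>space ?N. pmf Q b * z a < pmf Q a * z b} \<in> sets ?N" if "b \<in> A" for b
      using True that by measurable
    then have "{z\<in>space ?N. \<forall>b\<in>A - {a}. pmf Q b * z a < pmf Q a * z b} \<in> sets ?N"
      using A by (intro sets.sets_Collect_finite_All) auto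
    then show ?thesis using True by (simp add: win_def)
  qed (simp add: win_def)
  have msel: "{z\<in>space ?N. sel z Q = a} \<in> sets ?N" for Q a
  proof -
    have "{z\<in>space ?N. \<forall>b\<in>A. \<not> win z Q b} \<in> sets ?N"
      using A mwin by (intro sets.sets_Collect_finite_All sets.sets_Collect_neg) auto
    then show ?thesis unfolding sel_iff using mwin
      by (intro sets.sets_Collect_disj sets.sets_Collect_conj) auto
  qed
  \<comment> \<open>Outside \<Xi> the constant \<open>a0\<close> is used, so that only finitely many
    functions can occur.\<close>
  define g where "g z = (\<lambda>Q. if Q \<in> \<Xi> then sel z Q else a0)" for z
  define F where "F = PiE_dflt \<Xi> a0 (\<lambda>_. A)"
  have F: "finite F" unfolding F_def using A \<Xi> by (intro finite_PiE_dflt) auto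
  have gF: "g z \<in> F" for z by (auto simp: F_def g_def PiE_dflt_def selA)
  have mg: "{z\<in>space ?N. g z = \<phi>} \<in> sets ?N" if "\<phi> \<in> F" for \<phi>
  proof -
    have "{z\<in>space ?N. g z = \<phi>} = {z\<in>space ?N. \<forall>Q\<in>\<Xi>. sel z Q = \<phi> Q}"
      using that by (auto simp: g_def F_def PiE_dflt_def fun_eq_iff)
    also have "\<dots> \<in> sets ?N" using \<Xi> msel by (intro sets.sets_Collect_finite_All) auto
    finally show ?thesis .
  qed
  obtain \<Phi> where \<Phi>: "set_pmf \<Phi> \<subseteq> F" "\<And>R. measure_pmf.prob \<Phi> {\<phi>. R \<phi>} = measure ?N {z\<in>space ?N. R (g z)}"
    using finite_pmf_of_rv[of ?N F g, OF Nps F gF mg] by blast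
  have both: "pmf P a * pmf Q a / (pmf P a + pmf Q a) \<le> measure ?N {z\<in>space ?N. win z P a \<and> win z Q a}"
    and single: "pmf P a \<le> measure ?N {z\<in>space ?N. win z P a}"
    if PQ: "P \<in> \<Xi>" "Q \<in> \<Xi>" for P Q a
  proof -
    have sumA: "(\<Sum>b\<in>A - {a}. pmf R b) = 1 - pmf R a" if "R \<in> \<Xi>" "a \<in> A" for R
    proof -
      have "(\<Sum>b\<in>A. pmf R b) = 1" by (rule sum_pmf_eq_1[OF A(1) \<Xi>(2)[OF that(1)]])
      then show ?thesis using A that by (simp add: sum_diff1)
    qed
    have w: "win z R a" if "0 < pmf R a" "a \<in> A" "\<forall>b\<in>A - {a}. pmf R b / pmf R a * z a < z b" for z R
      using that by (auto simp: win_def field_simps)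
    show "pmf P a * pmf Q a / (pmf P a + pmf Q a) \<le> measure ?N {z\<in>space ?N. win z P a \<and> win z Q a}"
    proof (cases "0 < pmf P a \<and> 0 < pmf Q a")
      case True
      then have aA: "a \<in> A" using \<Xi>(2)[OF PQ(1)] by (auto simp: pmf_positive_iff)
      \<comment> \<open>The sum of the two ratios dominates each of them, so a single race yields
        both wins.\<close>
      define c where "c b = pmf P b / pmf P a + pmf Q b / pmf Q a" for b
      have c0: "0 \<le> c b" for b by (simp add: c_def)
      have "1 / (1 + (\<Sum>b\<in>A - {a}. c b)) = measure ?N {z\<in>space ?N. 0 \<le> z a \<and> (\<forall>b\<in>A - {a}. c b * z a < z b)}"
        by (rule race[OF A(1) aA c0, symmetric])
      also have "\<dots> \<le> measure ?N {z\<in>space ?N. win z P a \<and> win z Q a}"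
      proof (intro PS.finite_measure_mono subsetI)
        fix z assume z: "z \<in> {z\<in>space ?N. 0 \<le> z a \<and> (\<forall>b\<in>A - {a}. c b * z a < z b)}"
        have "pmf P b / pmf P a * z a < z b \<and> pmf Q b / pmf Q a * z a < z b" if b: "b \<in> A - {a}" for b
        proof -
          have "pmf P b / pmf P a \<le> c b" "pmf Q b / pmf Q a \<le> c b" by (auto simp: c_def)
          then have "pmf P b / pmf P a * z a \<le> c b * z a" "pmf Q b / pmf Q a * z a \<le> c b * z a"
            using z by (blast intro: mult_right_mono)+
          moreover have "c b * z a < z b" using z b by blast
          ultimately show ?thesis by (blast intro: le_less_trans)
        qed
        note d = this
        have "win z P a" using True aA d by (intro w) blast+
        moreover have "win z Q a" using True aA d by (intro w) blast+
        ultimately show "z \<in> {z\<in>space ?N. win z P a \<and> win z Q a}" using z by blast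
      next
        show "{z\<in>space ?N. win z P a \<and> win z Q a} \<in> sets ?N"
          using mwin by (intro sets.sets_Collect_conj) auto
      qed
      also have "(\<Sum>b\<in>A - {a}. c b) = (1 - pmf P a) / pmf P a + (1 - pmf Q a) / pmf Q a"
        unfolding c_def by (simp add: sum.distrib sum_divide_distrib[symmetric] sumA[OF PQ(1) aA] sumA[OF PQ(2) aA])
      finally have le: "1 / (1 + ((1 - pmf P a) / pmf P a + (1 - pmf Q a) / pmf Q a)) \<le> measure ?N {z\<in>space ?N. win z P a \<and> win z Q a}" .
      have "pmf P a * pmf Q a / (pmf P a + pmf Q a) = 1 / (1 / pmf P a + 1 / pmf Q a)"
        using True by (simp add: field_simps)
      \<comment> \<open>The two denominators differ by 1, and the smaller one is exact for the
        race.\<close>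
      also have "\<dots> \<le> 1 / (1 + ((1 - pmf P a) / pmf P a + (1 - pmf Q a) / pmf Q a))"
      proof (rule divide_left_mono)
        show "1 + ((1 - pmf P a) / pmf P a + (1 - pmf Q a) / pmf Q a) \<le> 1 / pmf P a + 1 / pmf Q a"
          using True by (simp add: diff_divide_distrib)
        have "0 < 1 + ((1 - pmf P a) / pmf P a + (1 - pmf Q a) / pmf Q a)"
          using True pmf_le_1[of P a] pmf_le_1[of Q a] by (intro add_pos_nonneg add_nonneg_nonneg divide_nonneg_pos) auto
        then show "0 < (1 / pmf P a + 1 / pmf Q a) * (1 + ((1 - pmf P a) / pmf P a + (1 - pmf Q a) / pmf Q a))"
          using True by (intro mult_pos_pos[OF add_pos_pos]) auto
      qed simp
      finally show ?thesis using le by simp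
    qed (auto simp: less_le)
    show "pmf P a \<le> measure ?N {z\<in>space ?N. win z P a}"
    proof (cases "0 < pmf P a")
      case True
      then have aA: "a \<in> A" using \<Xi>(2)[OF PQ(1)] by (auto simp: pmf_positive_iff)
      define c where "c b = pmf P b / pmf P a" for b
      have c0: "0 \<le> c b" for b by (simp add: c_def)
      have "pmf P a = 1 / (1 + (\<Sum>b\<in>A - {a}. c b))"
        unfolding c_def using True by (simp add: sum_divide_distrib[symmetric] sumA[OF PQ(1) aA] field_simps)
      also have "\<dots> = measure ?N {z\<in>space ?N. 0 \<le> z a \<and> (\<forall>b\<in>A - {a}. c b * z a < z b)}"
        by (rule race[OF A(1) aA c0, symmetric])
      also have "\<dots> \<le> measure ?N {z\<in>space ?N. win z P a}"
        using mwin True aA by (intro PS.finite_measure_mono subsetI) (auto intro!: w simp: c_def)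
      finally show ?thesis .
    qed (auto simp: less_le)
  qed
  \<comment> \<open>Only one inequality between the pmfs is available, but a pmf that lies nowhere
    above another equals it. In this way ties never have to be shown to have probability
    zero.\<close>
  have marg: "map_pmf (\<lambda>\<phi>. \<phi> P) \<Phi> = P" if P: "P \<in> \<Xi>" for P
  proof (rule ccontr)
    assume ne: "map_pmf (\<lambda>\<phi>. \<phi> P) \<Phi> \<noteq> P"
    have "pmf P a \<le> pmf (map_pmf (\<lambda>\<phi>. \<phi> P) \<Phi>) a" for a
    proof -
      have "pmf P a \<le> measure ?N {z\<in>space ?N. win z P a}" by (rule single[OF P P])
      also have "\<dots> \<le> measure ?N {z\<in>space ?N. g z P = a}"
        using P msel[of P a] by (intro PS.finite_measure_mono) (auto simp: g_def sel_win)
      also have "\<dots> = measure_pmf.prob \<Phi> {\<phi>. \<phi> P = a}" by (rule \<Phi>(2)[symmetric])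
      finally show ?thesis by (simp add: pmf_map vimage_def)
    qed
    then show False using pmf_neq_exists_less[OF ne] by (meson not_less)
  qed
  have "measure_pmf.prob \<Phi> {\<phi>. \<phi> P = a \<and> \<phi> Q \<noteq> a} \<le> pmf P a * mismatch P Q a" if PQ: "P \<in> \<Xi>" "Q \<in> \<Xi>" for P Q a
  proof (cases "P = Q")
    case True
    then have "{\<phi>. \<phi> P = a \<and> \<phi> Q \<noteq> a} = {}" by auto
    then show ?thesis using True by (simp add: mismatch_def)
  next
    case False
    have "pmf P a * pmf Q a / (pmf P a + pmf Q a) \<le> measure ?N {z\<in>space ?N. win z P a \<and> win z Q a}"
      by (rule both[OF PQ])
    also have "\<dots> \<le> measure ?N {z\<in>space ?N. g z P = a \<and> g z Q = a}"
      using PQ msel[of P a] msel[of Q a] by (intro PS.finite_measure_mono sets.sets_Collect_conj) (auto simp: g_def sel_win)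
    also have "\<dots> = measure_pmf.prob \<Phi> {\<phi>. \<phi> P = a \<and> \<phi> Q = a}" by (rule \<Phi>(2)[symmetric])
    finally have 1: "pmf P a * pmf Q a / (pmf P a + pmf Q a) \<le> measure_pmf.prob \<Phi> {\<phi>. \<phi> P = a \<and> \<phi> Q = a}" .
    have "pmf P a = measure_pmf.prob \<Phi> {\<phi>. \<phi> P = a}"
      using arg_cong[OF marg[OF PQ(1)], of "\<lambda>R. pmf R a"] by (simp add: pmf_map vimage_def)
    also have "\<dots> = measure_pmf.prob \<Phi> ({\<phi>. \<phi> P = a \<and> \<phi> Q = a} \<union> {\<phi>. \<phi> P = a \<and> \<phi> Q \<noteq> a})"
      by (intro arg_cong[where f="measure_pmf.prob \<Phi>"]) auto
    also have "\<dots> = measure_pmf.prob \<Phi> {\<phi>. \<phi> P = a \<and> \<phi> Q = a} + measure_pmf.prob \<Phi> {\<phi>. \<phi> P = a \<and> \<phi> Q \<noteq> a}"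
      by (intro measure_pmf.finite_measure_Union) auto
    finally have "measure_pmf.prob \<Phi> {\<phi>. \<phi> P = a \<and> \<phi> Q \<noteq> a} \<le> pmf P a - pmf P a * pmf Q a / (pmf P a + pmf Q a)"
      using 1 by simp
    also have "\<dots> = pmf P a * mismatch P Q a"
    proof (cases "pmf P a + pmf Q a = 0")
      case True
      then have "pmf P a = 0" using pmf_nonneg[of P a] pmf_nonneg[of Q a] by linarith
      then show ?thesis by simp
    next
      case nz: False
      have "pmf P a - pmf P a * pmf Q a / (pmf P a + pmf Q a) = (pmf P a * (pmf P a + pmf Q a) - pmf P a * pmf Q a) / (pmf P a + pmf Q a)"
        using nz by (simp add: diff_divide_distrib)
      then show ?thesis using False by (simp add: mismatch_def algebra_simps)
    qed
    finally show ?thesis .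
  qed
  moreover have "\<forall>\<phi>\<in>set_pmf \<Phi>. \<forall>Q. \<phi> Q \<in> A"
  proof (intro ballI allI)
    fix \<phi> Q assume "\<phi> \<in> set_pmf \<Phi>"
    then have "\<phi> \<in> F" using \<Phi>(1) by auto
    then show "\<phi> Q \<in> A" using a0 by (cases "Q \<in> \<Xi>") (auto simp: F_def PiE_dflt_def)
  qed
  ultimately show ?thesis unfolding selector_def using marg by blast
qed

section \<open>Parties who share a selector\<close>

lemma nn_integral_swap_pmf: "(\<integral>\<^sup>+x. (\<integral>\<^sup>+y. f x y \<partial>measure_pmf Q) \<partial>measure_pmf P) = (\<integral>\<^sup>+y. (\<integral>\<^sup>+x. f x y \<partial>measure_pmf P) \<partial>measure_pmf Q)"
proof -
  have "(\<integral>\<^sup>+z. case_prod f z \<partial>measure_pmf (bind_pmf P (\<lambda>x. bind_pmf Q (\<lambda>y. return_pmf (x, y))))) =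
    (\<integral>\<^sup>+z. case_prod f z \<partial>measure_pmf (bind_pmf Q (\<lambda>y. bind_pmf P (\<lambda>x. return_pmf (x, y)))))"
    by (subst bind_commute_pmf) (rule refl)
  then show ?thesis by simp
qed

text \<open>One party selects with \<open>P\<close>; the observation \<open>b\<close> is then
  produced from the winner, and the other party selects with a law that depends on both. Splitting
  by the winner \<open>a\<close> fixes that law, so the selector property applies for each
  \<open>a\<close> and \<open>b\<close> separately.\<close>

lemma match_bound:
  fixes \<Phi> :: "('a pmf \<Rightarrow> 'a) pmf" and \<kappa> :: "'a \<Rightarrow> 'b pmf"
  assumes sel: "selector A \<Xi> \<Phi>" and A: "finite A" and P: "P \<in> \<Xi>" and Q: "\<And>a b. a \<in> A \<Longrightarrow> b \<in> set_pmf (\<kappa> a) \<Longrightarrow> Q a b \<in> \<Xi>"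
    and PA: "set_pmf P \<subseteq> A"
  shows "(\<integral>\<^sup>+\<phi>. (\<integral>\<^sup>+b. indicator {b. \<phi> (Q (\<phi> P) b) \<noteq> \<phi> P} b \<partial>measure_pmf (\<kappa> (\<phi> P))) \<partial>measure_pmf \<Phi>) \<le>
    (\<integral>\<^sup>+a. (\<integral>\<^sup>+b. ennreal (mismatch P (Q a b) a) \<partial>measure_pmf (\<kappa> a)) \<partial>measure_pmf P)"
proof -
  have "(\<integral>\<^sup>+\<phi>. (\<integral>\<^sup>+b. indicator {b. \<phi> (Q (\<phi> P) b) \<noteq> \<phi> P} b \<partial>measure_pmf (\<kappa> (\<phi> P))) \<partial>measure_pmf \<Phi>) =
    (\<integral>\<^sup>+\<phi>. (\<Sum>a\<in>A. (\<integral>\<^sup>+b. indicator {\<phi>. \<phi> P = a \<and> \<phi> (Q a b) \<noteq> a} \<phi> \<partial>measure_pmf (\<kappa> a))) \<partial>measure_pmf \<Phi>)"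
  proof (intro nn_integral_cong_AE AE_pmfI)
    fix \<phi> assume "\<phi> \<in> set_pmf \<Phi>"
    then have pA: "\<phi> P \<in> A" using sel by (auto simp: selector_def)
    have "(\<Sum>a\<in>A. (\<integral>\<^sup>+b. indicator {\<phi>. \<phi> P = a \<and> \<phi> (Q a b) \<noteq> a} \<phi> \<partial>measure_pmf (\<kappa> a))) =
        (\<Sum>a\<in>{\<phi> P}. (\<integral>\<^sup>+b. indicator {\<phi>. \<phi> P = a \<and> \<phi> (Q a b) \<noteq> a} \<phi> \<partial>measure_pmf (\<kappa> a)))"
    proof (intro sum.mono_neutral_right ballI A)
      fix a assume "a \<in> A - {\<phi> P}"
      then have "indicator {\<phi>. \<phi> P = a \<and> \<phi> (Q a b) \<noteq> a} \<phi> = (0 :: ennreal)" for b by auto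
      then show "(\<integral>\<^sup>+b. indicator {\<phi>. \<phi> P = a \<and> \<phi> (Q a b) \<noteq> a} \<phi> \<partial>measure_pmf (\<kappa> a)) = 0" by simp
    qed (use pA in auto)
    also have "\<dots> = (\<integral>\<^sup>+b. indicator {b. \<phi> (Q (\<phi> P) b) \<noteq> \<phi> P} b \<partial>measure_pmf (\<kappa> (\<phi> P)))"
      by (simp add: indicator_def)
    finally show "(\<integral>\<^sup>+b. indicator {b. \<phi> (Q (\<phi> P) b) \<noteq> \<phi> P} b \<partial>measure_pmf (\<kappa> (\<phi> P))) =
       (\<Sum>a\<in>A. (\<integral>\<^sup>+b. indicator {\<phi>. \<phi> P = a \<and> \<phi> (Q a b) \<noteq> a} \<phi> \<partial>measure_pmf (\<kappa> a)))" ..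
  qed
  also have "\<dots> = (\<Sum>a\<in>A. \<integral>\<^sup>+\<phi>. (\<integral>\<^sup>+b. indicator {\<phi>. \<phi> P = a \<and> \<phi> (Q a b) \<noteq> a} \<phi> \<partial>measure_pmf (\<kappa> a)) \<partial>measure_pmf \<Phi>)"
    by (rule nn_integral_sum) simp
  also have "\<dots> = (\<Sum>a\<in>A. \<integral>\<^sup>+b. (\<integral>\<^sup>+\<phi>. indicator {\<phi>. \<phi> P = a \<and> \<phi> (Q a b) \<noteq> a} \<phi> \<partial>measure_pmf \<Phi>) \<partial>measure_pmf (\<kappa> a))"
    by (intro sum.cong refl nn_integral_swap_pmf)
  also have "\<dots> \<le> (\<Sum>a\<in>A. \<integral>\<^sup>+b. ennreal (pmf P a) * ennreal (mismatch P (Q a b) a) \<partial>measure_pmf (\<kappa> a))"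
  proof (intro sum_mono nn_integral_mono_AE AE_pmfI)
    fix a b assume "a \<in> A" "b \<in> set_pmf (\<kappa> a)"
    then have "Q a b \<in> \<Xi>" by (rule Q)
    then have "measure_pmf.prob \<Phi> {\<phi>. \<phi> P = a \<and> \<phi> (Q a b) \<noteq> a} \<le> pmf P a * mismatch P (Q a b) a"
      using sel P unfolding selector_def by blast
    then show "(\<integral>\<^sup>+\<phi>. indicator {\<phi>. \<phi> P = a \<and> \<phi> (Q a b) \<noteq> a} \<phi> \<partial>measure_pmf \<Phi>) \<le> ennreal (pmf P a) * ennreal (mismatch P (Q a b) a)"
      by (simp add: measure_pmf.emeasure_eq_measure ennreal_mult[symmetric] mismatch_nonneg ennreal_leI)
  qed
  also have "\<dots> = (\<Sum>a\<in>A. (\<integral>\<^sup>+b. ennreal (mismatch P (Q a b) a) \<partial>measure_pmf (\<kappa> a)) * ennreal (pmf P a))"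
    by (simp add: nn_integral_cmult mult.commute)
  also have "\<dots> = (\<integral>\<^sup>+a. (\<integral>\<^sup>+b. ennreal (mismatch P (Q a b) a) \<partial>measure_pmf (\<kappa> a)) \<partial>measure_pmf P)"
    using A PA by (intro nn_integral_measure_pmf_support[symmetric]) auto
  finally show ?thesis .
qed

text \<open>The probabilistic method: some value of the support does no worse than the mean.\<close>

lemma nn_integral_le_pmfE:
  assumes "(\<integral>\<^sup>+x. f x \<partial>measure_pmf P) \<le> c"
  shows "\<exists>x\<in>set_pmf P. f x \<le> (c :: ennreal)"
proof (cases "c = \<infinity>")
  case True
  then show ?thesis using set_pmf_not_empty[of P] by auto
next
  case False
  show ?thesis
  proof (rule ccontr)
    assume "\<not> ?thesis"
    then have gt: "\<And>x. x \<in> set_pmf P \<Longrightarrow> c < f x" by (auto simp: not_le)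
    have "(\<integral>\<^sup>+x. f x \<partial>measure_pmf P) \<noteq> \<infinity>" using assms False by (auto simp: top_unique)
    moreover have "(\<integral>\<^sup>+x. c \<partial>measure_pmf P) < (\<integral>\<^sup>+x. f x \<partial>measure_pmf P)"
    proof (rule nn_integral_less)
      show "(\<integral>\<^sup>+x. c \<partial>measure_pmf P) \<noteq> \<infinity>" using False by simp
      show "AE x in measure_pmf P. c \<le> f x" using gt by (auto simp: AE_measure_pmf_iff less_imp_le)
      show "\<not> (AE x in measure_pmf P. f x \<le> c)"
        using gt set_pmf_not_empty[of P] by (auto simp: AE_measure_pmf_iff not_le)
    qed auto
    ultimately show False using assms by (simp add: not_le[symmetric])
  qed
qed

text \<open>The randomness consists of \<phi> for descriptions, \<psi> for codewords and \<gamma>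
  for the inputs. The message is lost only if the encoder or the decoder misguesses the description,
  or the decoder selects another codeword. The mean probability of each event is bounded by a
  mismatch under the ideal law, in which everybody knows the description; averaging over states and
  message then fixes the randomness.\<close>

lemma one_shot:
  fixes p :: "('s1 \<times> 's2) pmf" and Qv :: "'s1 \<Rightarrow> 's2 \<Rightarrow> 'v pmf" and Qu :: "'s1 \<Rightarrow> 'v \<Rightarrow> 'u pmf"
    and qx :: "'u \<Rightarrow> 's1 \<Rightarrow> 'v \<Rightarrow> 'x pmf" and CH :: "'x \<Rightarrow> 's1 \<Rightarrow> 's2 \<Rightarrow> 'y pmf"
    and Re :: "'s1 \<Rightarrow> nat \<Rightarrow> ('v \<times> nat) pmf" and Rd :: "'y \<Rightarrow> 's2 \<Rightarrow> nat \<Rightarrow> ('v \<times> nat) pmf"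
    and ru :: "'y \<Rightarrow> 's2 \<Rightarrow> 'v \<Rightarrow> 'u pmf" and \<Gamma> :: "('u \<Rightarrow> 's1 \<Rightarrow> 'v \<Rightarrow> 'x) pmf"
    and T M :: "nat set"
  assumes fin: "finite (set_pmf p)" "finite VV" "finite UU" "finite YY" "finite T" "T \<noteq> {}" "finite M" "M \<noteq> {}"
    and sup: "\<And>s1 s2. set_pmf (Qv s1 s2) \<subseteq> VV" "\<And>s1 t. t \<in> T \<Longrightarrow> set_pmf (Re s1 t) \<subseteq> VV \<times> T"
      "\<And>y s2 t. t \<in> T \<Longrightarrow> set_pmf (Rd y s2 t) \<subseteq> VV \<times> T" "\<And>s1 v. set_pmf (Qu s1 v) \<subseteq> UU"
      "\<And>y s2 v. set_pmf (ru y s2 v) \<subseteq> UU" "\<And>x s1 s2. set_pmf (CH x s1 s2) \<subseteq> YY"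
    and ne: "VV \<noteq> {}" "UU \<noteq> {}"
    and \<Gamma>: "\<And>u s1 v. u \<in> UU \<Longrightarrow> v \<in> VV \<Longrightarrow> map_pmf (\<lambda>\<gamma>. \<gamma> u s1 v) \<Gamma> = qx u s1 v"
  defines "PV \<equiv> \<lambda>s1 s2. pair_pmf (Qv s1 s2) (pmf_of_set T)"
    and "PU \<equiv> \<lambda>s1 v w. pair_pmf (Qu s1 v) (return_pmf w)"
    and "RU \<equiv> \<lambda>y s2 v. pair_pmf (ru y s2 v) (pmf_of_set M)"
  shows "\<exists>\<phi> \<psi> \<gamma>. (\<forall>P. \<phi> P \<in> VV \<times> T) \<and> (\<forall>P. \<psi> P \<in> UU \<times> M) \<and> \<gamma> \<in> set_pmf \<Gamma> \<and>
    (\<integral>\<^sup>+w. (\<integral>\<^sup>+(s1, s2). emeasure (measure_pmf (CH (\<gamma> (fst (\<psi> (PU s1 (fst (\<phi> (Re s1 (snd (\<phi> (PV s1 s2)))))) w))) s1 (fst (\<phi> (Re s1 (snd (\<phi> (PV s1 s2))))))) s1 s2))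
       {y. snd (\<psi> (RU y s2 (fst (\<phi> (Rd y s2 (snd (\<phi> (PV s1 s2)))))))) \<noteq> w} \<partial>measure_pmf p) \<partial>measure_pmf (pmf_of_set M)) \<le>
    (\<integral>\<^sup>+w. (\<integral>\<^sup>+(s1, s2). (\<integral>\<^sup>+(v, t). ennreal (mismatch (PV s1 s2) (Re s1 t) (v, t)) +
       (\<integral>\<^sup>+u. (\<integral>\<^sup>+x. (\<integral>\<^sup>+y. ennreal (mismatch (PV s1 s2) (Rd y s2 t) (v, t)) + ennreal (mismatch (PU s1 v w) (RU y s2 v) (u, w))
          \<partial>measure_pmf (CH x s1 s2)) \<partial>measure_pmf (qx u s1 v)) \<partial>measure_pmf (Qu s1 v))
        \<partial>measure_pmf (PV s1 s2)) \<partial>measure_pmf p) \<partial>measure_pmf (pmf_of_set M))"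
proof -
  define A1 where "A1 = VV \<times> T"
  define A2 where "A2 = UU \<times> M"
  define Xi1 where "Xi1 = (\<lambda>(s1, s2). PV s1 s2) ` set_pmf p \<union> (\<lambda>((s1, s2), t). Re s1 t) ` (set_pmf p \<times> T) \<union>
      (\<lambda>((s1, s2), y, t). Rd y s2 t) ` (set_pmf p \<times> YY \<times> T)"
  define Xi2 where "Xi2 = (\<lambda>((s1, s2), v, w). PU s1 v w) ` (set_pmf p \<times> VV \<times> M) \<union>
      (\<lambda>((s1, s2), y, v). RU y s2 v) ` (set_pmf p \<times> YY \<times> VV)"
  have A: "finite A1" "A1 \<noteq> {}" "finite A2" "A2 \<noteq> {}" using fin ne by (auto simp: A1_def A2_def)
  have X: "finite Xi1" "finite Xi2" using fin by (auto simp: Xi1_def Xi2_def)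
  have PVs: "set_pmf (PV s1 s2) \<subseteq> A1" for s1 s2 using sup(1) fin by (auto simp: PV_def A1_def)
  have PUs: "set_pmf (PU s1 v w) \<subseteq> A2" if "w \<in> M" for s1 v w using sup(4) that by (auto simp: PU_def A2_def)
  have RUs: "set_pmf (RU y s2 v) \<subseteq> A2" for y s2 v using sup(5) fin by (auto simp: RU_def A2_def)
  have S1: "set_pmf Q \<subseteq> A1" if "Q \<in> Xi1" for Q
    using that PVs sup(2,3) unfolding Xi1_def A1_def by fast
  have S2: "set_pmf Q \<subseteq> A2" if "Q \<in> Xi2" for Q
    using that PUs RUs unfolding Xi2_def by fast
  obtain \<Phi> where \<Phi>: "selector A1 Xi1 \<Phi>" using ex_selector[OF A(1,2) X(1) S1] by blast
  obtain \<Psi> where \<Psi>: "selector A2 Xi2 \<Psi>" using ex_selector[OF A(3,4) X(2) S2] by blast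
  have \<phi>A: "\<phi> Q \<in> A1" if "\<phi> \<in> set_pmf \<Phi>" for \<phi> Q using \<Phi> that unfolding selector_def by blast
  have \<psi>A: "\<psi> Q \<in> A2" if "\<psi> \<in> set_pmf \<Psi>" for \<psi> Q using \<Psi> that unfolding selector_def by blast
  have marg1: "map_pmf (\<lambda>\<phi>. \<phi> P) \<Phi> = P" if "P \<in> Xi1" for P using \<Phi> that unfolding selector_def by blast
  have marg2: "map_pmf (\<lambda>\<phi>. \<phi> P) \<Psi> = P" if "P \<in> Xi2" for P using \<Psi> that unfolding selector_def by blast
  define err where "err \<phi> \<psi> \<gamma> w s1 s2 = emeasure (measure_pmf (CH (\<gamma> (fst (\<psi> (PU s1 (fst (\<phi> (Re s1 (snd (\<phi> (PV s1 s2)))))) w))) s1 (fst (\<phi> (Re s1 (snd (\<phi> (PV s1 s2))))))) s1 s2))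
       {y. snd (\<psi> (RU y s2 (fst (\<phi> (Rd y s2 (snd (\<phi> (PV s1 s2)))))))) \<noteq> w}" for \<phi> \<psi> and \<gamma> :: "'u \<Rightarrow> 's1 \<Rightarrow> 'v \<Rightarrow> 'x" and w s1 s2
  define E1 where "E1 s1 s2 a = ennreal (mismatch (PV s1 s2) (Re s1 (snd a)) a)" for s1 s2 and a :: "'v \<times> nat"
  define KY where "KY s1 s2 v = bind_pmf (Qu s1 v) (\<lambda>u. bind_pmf (qx u s1 v) (\<lambda>x. CH x s1 s2))" for s1 s2 v
  have KYY: "set_pmf (KY s1 s2 v) \<subseteq> YY" for s1 s2 v using sup(6) by (auto simp: KY_def)
  have main: "(\<integral>\<^sup>+\<phi>. (\<integral>\<^sup>+\<psi>. (\<integral>\<^sup>+\<gamma>. err \<phi> \<psi> \<gamma> w s1 s2 \<partial>measure_pmf \<Gamma>) \<partial>measure_pmf \<Psi>) \<partial>measure_pmf \<Phi>) \<le>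
     (\<integral>\<^sup>+(v, t). ennreal (mismatch (PV s1 s2) (Re s1 t) (v, t)) +
       (\<integral>\<^sup>+u. (\<integral>\<^sup>+x. (\<integral>\<^sup>+y. ennreal (mismatch (PV s1 s2) (Rd y s2 t) (v, t)) + ennreal (mismatch (PU s1 v w) (RU y s2 v) (u, w))
          \<partial>measure_pmf (CH x s1 s2)) \<partial>measure_pmf (qx u s1 v)) \<partial>measure_pmf (Qu s1 v))
        \<partial>measure_pmf (PV s1 s2))"
    if s: "(s1, s2) \<in> set_pmf p" and w: "w \<in> M" for s1 s2 w
  proof -
    let ?P = "PV s1 s2"
    have PX: "?P \<in> Xi1" unfolding Xi1_def using s by force
    have ReX: "Re s1 t \<in> Xi1" if "t \<in> T" for t unfolding Xi1_def using s that by force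
    have RdX: "Rd y s2 t \<in> Xi1" if "t \<in> T" "y \<in> YY" for t y unfolding Xi1_def using s that by force
    have PUX: "PU s1 v w \<in> Xi2" if "v \<in> VV" for v unfolding Xi2_def using s w that by force
    have RUX: "RU y s2 v \<in> Xi2" if "v \<in> VV" "y \<in> YY" for v y unfolding Xi2_def using s that by force
    define g where "g \<psi> \<gamma> v = CH (\<gamma> (fst (\<psi> (PU s1 v w))) s1 v) s1 s2" for \<psi> :: "('u \<times> nat) pmf \<Rightarrow> 'u \<times> nat" and \<gamma> :: "'u \<Rightarrow> 's1 \<Rightarrow> 'v \<Rightarrow> 'x" and v
    define e1 where "e1 \<phi> = (indicator {\<phi>. \<phi> (Re s1 (snd (\<phi> ?P))) \<noteq> \<phi> ?P} \<phi> :: ennreal)" for \<phi> :: "('v \<times> nat) pmf \<Rightarrow> 'v \<times> nat"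
    define e2 where "e2 \<phi> = {y. \<phi> (Rd y s2 (snd (\<phi> ?P))) \<noteq> \<phi> ?P}" for \<phi> :: "('v \<times> nat) pmf \<Rightarrow> 'v \<times> nat"
    define e3 where "e3 \<psi> v = {y. \<psi> (RU y s2 v) \<noteq> \<psi> (PU s1 v w)}" for \<psi> :: "('u \<times> nat) pmf \<Rightarrow> 'u \<times> nat" and v
    have Gx: "bind_pmf \<Gamma> (\<lambda>\<gamma>. CH (\<gamma> u s1 v) s1 s2) = bind_pmf (qx u s1 v) (\<lambda>x. CH x s1 s2)" if "u \<in> UU" "v \<in> VV" for u v
      unfolding \<Gamma>[OF that, symmetric] bind_map_pmf ..
    \<comment> \<open>Averaged over \<psi> and \<gamma>, the output for a given description has
      exactly the ideal law, because a selector has the right marginals.\<close>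
    have gK: "bind_pmf \<Psi> (\<lambda>\<psi>. bind_pmf \<Gamma> (\<lambda>\<gamma>. g \<psi> \<gamma> v)) = KY s1 s2 v" if v: "v \<in> VV" for v
    proof -
      have "bind_pmf \<Psi> (\<lambda>\<psi>. bind_pmf \<Gamma> (\<lambda>\<gamma>. g \<psi> \<gamma> v)) =
         bind_pmf \<Psi> (\<lambda>\<psi>. bind_pmf (qx (fst (\<psi> (PU s1 v w))) s1 v) (\<lambda>x. CH x s1 s2))"
        unfolding g_def using \<psi>A by (intro bind_pmf_cong refl Gx v) (auto simp: A2_def mem_Times_iff)
      also have "\<dots> = bind_pmf (map_pmf (\<lambda>\<psi>. \<psi> (PU s1 v w)) \<Psi>) (\<lambda>a. bind_pmf (qx (fst a) s1 v) (\<lambda>x. CH x s1 s2))"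
        by (simp add: bind_map_pmf)
      also have "\<dots> = KY s1 s2 v"
        unfolding marg2[OF PUX[OF v]] by (simp add: PU_def KY_def pair_return_pmf2 bind_map_pmf)
      finally show ?thesis .
    qed
    \<comment> \<open>If the encoder guesses right, the output law is that of the true description,
      and a wrong message forces one of the two events of the decoder. Otherwise the term
      \<open>e1\<close> alone is 1.\<close>
    have pt: "err \<phi> \<psi> \<gamma> w s1 s2 \<le> e1 \<phi> + (emeasure (g \<psi> \<gamma> (fst (\<phi> ?P))) (e2 \<phi>) + emeasure (g \<psi> \<gamma> (fst (\<phi> ?P))) (e3 \<psi> (fst (\<phi> ?P))))"
      if "\<phi> \<in> set_pmf \<Phi>" "\<psi> \<in> set_pmf \<Psi>" for \<phi> \<psi> \<gamma>
    proof (cases "\<phi> (Re s1 (snd (\<phi> ?P))) = \<phi> ?P")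
      case False
      then have "e1 \<phi> = 1" by (simp add: e1_def)
      moreover have "err \<phi> \<psi> \<gamma> w s1 s2 \<le> 1" unfolding err_def by (rule measure_pmf.emeasure_le_1)
      ultimately show ?thesis by (metis add_increasing2 zero_le)
    next
      case True
      have vV: "fst (\<phi> ?P) \<in> VV" using \<phi>A[OF that(1), of ?P] by (auto simp: A1_def)
      \<comment> \<open>The law \<open>PU\<close> fixes its second component, so the selected
        codeword carries the message that was sent.\<close>
      have w2: "snd (\<psi> (PU s1 (fst (\<phi> ?P)) w)) = w"
      proof -
        have "\<psi> (PU s1 (fst (\<phi> ?P)) w) \<in> set_pmf (map_pmf (\<lambda>\<psi>. \<psi> (PU s1 (fst (\<phi> ?P)) w)) \<Psi>)" using that(2) by auto
        then show ?thesis unfolding marg2[OF PUX[OF vV]] by (auto simp: PU_def)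
      qed
      have "err \<phi> \<psi> \<gamma> w s1 s2 = emeasure (g \<psi> \<gamma> (fst (\<phi> ?P))) {y. snd (\<psi> (RU y s2 (fst (\<phi> (Rd y s2 (snd (\<phi> ?P))))))) \<noteq> w}"
        unfolding err_def g_def True ..
      also have "\<dots> \<le> emeasure (g \<psi> \<gamma> (fst (\<phi> ?P))) (e2 \<phi> \<union> e3 \<psi> (fst (\<phi> ?P)))"
        using w2 by (intro emeasure_mono) (auto simp: e2_def e3_def)
      also have "\<dots> \<le> emeasure (g \<psi> \<gamma> (fst (\<phi> ?P))) (e2 \<phi>) + emeasure (g \<psi> \<gamma> (fst (\<phi> ?P))) (e3 \<psi> (fst (\<phi> ?P)))"
        by (rule emeasure_subadditive) auto
      finally show ?thesis by (simp add: add_increasing)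
    qed
    have "(\<integral>\<^sup>+\<phi>. (\<integral>\<^sup>+\<psi>. (\<integral>\<^sup>+\<gamma>. err \<phi> \<psi> \<gamma> w s1 s2 \<partial>measure_pmf \<Gamma>) \<partial>measure_pmf \<Psi>) \<partial>measure_pmf \<Phi>) \<le>
      (\<integral>\<^sup>+\<phi>. (\<integral>\<^sup>+\<psi>. (\<integral>\<^sup>+\<gamma>. e1 \<phi> + (emeasure (g \<psi> \<gamma> (fst (\<phi> ?P))) (e2 \<phi>) + emeasure (g \<psi> \<gamma> (fst (\<phi> ?P))) (e3 \<psi> (fst (\<phi> ?P)))) \<partial>measure_pmf \<Gamma>) \<partial>measure_pmf \<Psi>) \<partial>measure_pmf \<Phi>)"
      by (intro nn_integral_mono_AE AE_pmfI pt)
    also have "\<dots> = (\<integral>\<^sup>+\<phi>. e1 \<phi> \<partial>measure_pmf \<Phi>) + ((\<integral>\<^sup>+\<phi>. (\<integral>\<^sup>+\<psi>. (\<integral>\<^sup>+\<gamma>. emeasure (g \<psi> \<gamma> (fst (\<phi> ?P))) (e2 \<phi>) \<partial>measure_pmf \<Gamma>) \<partial>measure_pmf \<Psi>) \<partial>measure_pmf \<Phi>) +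
       (\<integral>\<^sup>+\<phi>. (\<integral>\<^sup>+\<psi>. (\<integral>\<^sup>+\<gamma>. emeasure (g \<psi> \<gamma> (fst (\<phi> ?P))) (e3 \<psi> (fst (\<phi> ?P))) \<partial>measure_pmf \<Gamma>) \<partial>measure_pmf \<Psi>) \<partial>measure_pmf \<Phi>))"
      by (simp add: nn_integral_add)
    also have "\<dots> \<le> (\<integral>\<^sup>+a. E1 s1 s2 a \<partial>measure_pmf ?P) + ((\<integral>\<^sup>+a. (\<integral>\<^sup>+y. ennreal (mismatch ?P (Rd y s2 (snd a)) a) \<partial>measure_pmf (KY s1 s2 (fst a))) \<partial>measure_pmf ?P) +
       (\<integral>\<^sup>+a. (\<integral>\<^sup>+u. (\<integral>\<^sup>+x. (\<integral>\<^sup>+y. ennreal (mismatch (PU s1 (fst a) w) (RU y s2 (fst a)) (u, w)) \<partial>measure_pmf (CH x s1 s2)) \<partial>measure_pmf (qx u s1 (fst a))) \<partial>measure_pmf (Qu s1 (fst a))) \<partial>measure_pmf ?P))"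
    proof (intro add_mono)
      have "(\<integral>\<^sup>+\<phi>. e1 \<phi> \<partial>measure_pmf \<Phi>) = (\<integral>\<^sup>+\<phi>. (\<integral>\<^sup>+b. indicator {b. \<phi> ((\<lambda>a (b :: unit). Re s1 (snd a)) (\<phi> ?P) b) \<noteq> \<phi> ?P} b \<partial>measure_pmf ((\<lambda>a. return_pmf ()) (\<phi> ?P))) \<partial>measure_pmf \<Phi>)"
        by (auto simp: e1_def indicator_def intro!: nn_integral_cong)
      also have "\<dots> \<le> (\<integral>\<^sup>+a. (\<integral>\<^sup>+b. ennreal (mismatch ?P ((\<lambda>a (b :: unit). Re s1 (snd a)) a b) a) \<partial>measure_pmf ((\<lambda>a. return_pmf ()) a)) \<partial>measure_pmf ?P)"
        by (rule match_bound[OF \<Phi> A(1) PX _ PVs]) (auto simp: A1_def ReX)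
      finally show "(\<integral>\<^sup>+\<phi>. e1 \<phi> \<partial>measure_pmf \<Phi>) \<le> (\<integral>\<^sup>+a. E1 s1 s2 a \<partial>measure_pmf ?P)"
        by (simp add: E1_def)
    next
      have "(\<integral>\<^sup>+\<phi>. (\<integral>\<^sup>+\<psi>. (\<integral>\<^sup>+\<gamma>. emeasure (g \<psi> \<gamma> (fst (\<phi> ?P))) (e2 \<phi>) \<partial>measure_pmf \<Gamma>) \<partial>measure_pmf \<Psi>) \<partial>measure_pmf \<Phi>) =
         (\<integral>\<^sup>+\<phi>. emeasure (bind_pmf \<Psi> (\<lambda>\<psi>. bind_pmf \<Gamma> (\<lambda>\<gamma>. g \<psi> \<gamma> (fst (\<phi> ?P))))) (e2 \<phi>) \<partial>measure_pmf \<Phi>)"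
        by simp
      also have "\<dots> = (\<integral>\<^sup>+\<phi>. emeasure (KY s1 s2 (fst (\<phi> ?P))) (e2 \<phi>) \<partial>measure_pmf \<Phi>)"
      proof (intro nn_integral_cong_AE AE_pmfI)
        fix \<phi> assume "\<phi> \<in> set_pmf \<Phi>"
        then have "fst (\<phi> ?P) \<in> VV" using \<phi>A[of \<phi> ?P] by (auto simp: A1_def)
        then show "emeasure (bind_pmf \<Psi> (\<lambda>\<psi>. bind_pmf \<Gamma> (\<lambda>\<gamma>. g \<psi> \<gamma> (fst (\<phi> ?P))))) (e2 \<phi>) = emeasure (KY s1 s2 (fst (\<phi> ?P))) (e2 \<phi>)"
          by (simp only: gK)
      qed
      also have "\<dots> = (\<integral>\<^sup>+\<phi>. (\<integral>\<^sup>+b. indicator {b. \<phi> ((\<lambda>a y. Rd y s2 (snd a)) (\<phi> ?P) b) \<noteq> \<phi> ?P} b \<partial>measure_pmf ((\<lambda>a. KY s1 s2 (fst a)) (\<phi> ?P))) \<partial>measure_pmf \<Phi>)"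
        by (simp add: e2_def)
      also have "\<dots> \<le> (\<integral>\<^sup>+a. (\<integral>\<^sup>+b. ennreal (mismatch ?P ((\<lambda>a y. Rd y s2 (snd a)) a b) a) \<partial>measure_pmf ((\<lambda>a. KY s1 s2 (fst a)) a)) \<partial>measure_pmf ?P)"
        by (rule match_bound[OF \<Phi> A(1) PX _ PVs]) (use KYY in \<open>auto simp: A1_def intro!: RdX\<close>)
      finally show "(\<integral>\<^sup>+\<phi>. (\<integral>\<^sup>+\<psi>. (\<integral>\<^sup>+\<gamma>. emeasure (g \<psi> \<gamma> (fst (\<phi> ?P))) (e2 \<phi>) \<partial>measure_pmf \<Gamma>) \<partial>measure_pmf \<Psi>) \<partial>measure_pmf \<Phi>) \<le>
        (\<integral>\<^sup>+a. (\<integral>\<^sup>+y. ennreal (mismatch ?P (Rd y s2 (snd a)) a) \<partial>measure_pmf (KY s1 s2 (fst a))) \<partial>measure_pmf ?P)" .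
    next
      have inner: "(\<integral>\<^sup>+\<psi>. (\<integral>\<^sup>+\<gamma>. emeasure (g \<psi> \<gamma> v) (e3 \<psi> v) \<partial>measure_pmf \<Gamma>) \<partial>measure_pmf \<Psi>) \<le>
        (\<integral>\<^sup>+u. (\<integral>\<^sup>+x. (\<integral>\<^sup>+y. ennreal (mismatch (PU s1 v w) (RU y s2 v) (u, w)) \<partial>measure_pmf (CH x s1 s2)) \<partial>measure_pmf (qx u s1 v)) \<partial>measure_pmf (Qu s1 v))"
        if v: "v \<in> VV" for v
      proof -
        let ?k = "\<lambda>a. bind_pmf (qx (fst a) s1 v) (\<lambda>x. CH x s1 s2)"
        have "(\<integral>\<^sup>+\<psi>. (\<integral>\<^sup>+\<gamma>. emeasure (g \<psi> \<gamma> v) (e3 \<psi> v) \<partial>measure_pmf \<Gamma>) \<partial>measure_pmf \<Psi>) =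
          (\<integral>\<^sup>+\<psi>. emeasure (bind_pmf \<Gamma> (\<lambda>\<gamma>. g \<psi> \<gamma> v)) (e3 \<psi> v) \<partial>measure_pmf \<Psi>)" by simp
        also have "\<dots> = (\<integral>\<^sup>+\<psi>. (\<integral>\<^sup>+b. indicator {b. \<psi> ((\<lambda>_ y. RU y s2 v) (\<psi> (PU s1 v w)) b) \<noteq> \<psi> (PU s1 v w)} b \<partial>measure_pmf (?k (\<psi> (PU s1 v w)))) \<partial>measure_pmf \<Psi>)"
        proof (intro nn_integral_cong_AE AE_pmfI)
          fix \<psi> assume "\<psi> \<in> set_pmf \<Psi>"
          then have "fst (\<psi> (PU s1 v w)) \<in> UU" using \<psi>A[of \<psi> "PU s1 v w"] by (auto simp: A2_def)
          then have "bind_pmf \<Gamma> (\<lambda>\<gamma>. g \<psi> \<gamma> v) = ?k (\<psi> (PU s1 v w))" unfolding g_def using v by (rule Gx)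
          then show "emeasure (bind_pmf \<Gamma> (\<lambda>\<gamma>. g \<psi> \<gamma> v)) (e3 \<psi> v) = (\<integral>\<^sup>+b. indicator {b. \<psi> ((\<lambda>_ y. RU y s2 v) (\<psi> (PU s1 v w)) b) \<noteq> \<psi> (PU s1 v w)} b \<partial>measure_pmf (?k (\<psi> (PU s1 v w))))"
            by (simp only: e3_def nn_integral_indicator sets_measure_pmf UNIV_I)
        qed
        also have "\<dots> \<le> (\<integral>\<^sup>+a. (\<integral>\<^sup>+b. ennreal (mismatch (PU s1 v w) ((\<lambda>_ y. RU y s2 v) a b) a) \<partial>measure_pmf (?k a)) \<partial>measure_pmf (PU s1 v w))"
          by (rule match_bound[OF \<Psi> A(3) PUX[OF v] _ PUs[OF w]]) (use sup(6) in \<open>auto intro!: RUX v\<close>)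
        finally show ?thesis by (simp add: PU_def pair_return_pmf2)
      qed
      have "(\<integral>\<^sup>+\<phi>. (\<integral>\<^sup>+\<psi>. (\<integral>\<^sup>+\<gamma>. emeasure (g \<psi> \<gamma> (fst (\<phi> ?P))) (e3 \<psi> (fst (\<phi> ?P))) \<partial>measure_pmf \<Gamma>) \<partial>measure_pmf \<Psi>) \<partial>measure_pmf \<Phi>) =
        (\<integral>\<^sup>+a. (\<integral>\<^sup>+\<psi>. (\<integral>\<^sup>+\<gamma>. emeasure (g \<psi> \<gamma> (fst a)) (e3 \<psi> (fst a)) \<partial>measure_pmf \<Gamma>) \<partial>measure_pmf \<Psi>) \<partial>measure_pmf (map_pmf (\<lambda>\<phi>. \<phi> ?P) \<Phi>))"
        by simp
      also have "\<dots> = (\<integral>\<^sup>+a. (\<integral>\<^sup>+\<psi>. (\<integral>\<^sup>+\<gamma>. emeasure (g \<psi> \<gamma> (fst a)) (e3 \<psi> (fst a)) \<partial>measure_pmf \<Gamma>) \<partial>measure_pmf \<Psi>) \<partial>measure_pmf ?P)"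
        unfolding marg1[OF PX] ..
      also have "\<dots> \<le> (\<integral>\<^sup>+a. (\<integral>\<^sup>+u. (\<integral>\<^sup>+x. (\<integral>\<^sup>+y. ennreal (mismatch (PU s1 (fst a) w) (RU y s2 (fst a)) (u, w)) \<partial>measure_pmf (CH x s1 s2)) \<partial>measure_pmf (qx u s1 (fst a))) \<partial>measure_pmf (Qu s1 (fst a))) \<partial>measure_pmf ?P)"
        using PVs[of s1 s2] by (intro nn_integral_mono_AE AE_pmfI inner) (auto simp: A1_def)
      finally show "(\<integral>\<^sup>+\<phi>. (\<integral>\<^sup>+\<psi>. (\<integral>\<^sup>+\<gamma>. emeasure (g \<psi> \<gamma> (fst (\<phi> ?P))) (e3 \<psi> (fst (\<phi> ?P))) \<partial>measure_pmf \<Gamma>) \<partial>measure_pmf \<Psi>) \<partial>measure_pmf \<Phi>) \<le> \<dots>" .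
    qed
    also have "\<dots> = (\<integral>\<^sup>+(v, t). ennreal (mismatch (PV s1 s2) (Re s1 t) (v, t)) +
       (\<integral>\<^sup>+u. (\<integral>\<^sup>+x. (\<integral>\<^sup>+y. ennreal (mismatch (PV s1 s2) (Rd y s2 t) (v, t)) + ennreal (mismatch (PU s1 v w) (RU y s2 v) (u, w))
          \<partial>measure_pmf (CH x s1 s2)) \<partial>measure_pmf (qx u s1 v)) \<partial>measure_pmf (Qu s1 v))
        \<partial>measure_pmf (PV s1 s2))"
      by (simp add: nn_integral_add split_def E1_def KY_def)
    finally show ?thesis .
  qed
  let ?B = "\<lambda>w (s1, s2). (\<integral>\<^sup>+(v, t). ennreal (mismatch (PV s1 s2) (Re s1 t) (v, t)) +
       (\<integral>\<^sup>+u. (\<integral>\<^sup>+x. (\<integral>\<^sup>+y. ennreal (mismatch (PV s1 s2) (Rd y s2 t) (v, t)) + ennreal (mismatch (PU s1 v w) (RU y s2 v) (u, w))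
          \<partial>measure_pmf (CH x s1 s2)) \<partial>measure_pmf (qx u s1 v)) \<partial>measure_pmf (Qu s1 v))
        \<partial>measure_pmf (PV s1 s2))"
  define tot where "tot \<phi> \<psi> \<gamma> = (\<integral>\<^sup>+w. (\<integral>\<^sup>+s. err \<phi> \<psi> \<gamma> w (fst s) (snd s) \<partial>measure_pmf p) \<partial>measure_pmf (pmf_of_set M))" for \<phi> \<psi> \<gamma>
  have "(\<integral>\<^sup>+\<phi>. (\<integral>\<^sup>+\<psi>. (\<integral>\<^sup>+\<gamma>. tot \<phi> \<psi> \<gamma> \<partial>measure_pmf \<Gamma>) \<partial>measure_pmf \<Psi>) \<partial>measure_pmf \<Phi>) =
     (\<integral>\<^sup>+z. tot (fst z) (fst (snd z)) (snd (snd z)) \<partial>measure_pmf (pair_pmf \<Phi> (pair_pmf \<Psi> \<Gamma>)))"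
    by (simp add: nn_integral_pair_pmf')
  also have "\<dots> = (\<integral>\<^sup>+w. (\<integral>\<^sup>+s. (\<integral>\<^sup>+z. err (fst z) (fst (snd z)) (snd (snd z)) w (fst s) (snd s) \<partial>measure_pmf (pair_pmf \<Phi> (pair_pmf \<Psi> \<Gamma>))) \<partial>measure_pmf p) \<partial>measure_pmf (pmf_of_set M))"
    unfolding tot_def by (subst nn_integral_swap_pmf, intro nn_integral_cong, subst nn_integral_swap_pmf) (rule refl)
  also have "\<dots> \<le> (\<integral>\<^sup>+w. (\<integral>\<^sup>+s. ?B w s \<partial>measure_pmf p) \<partial>measure_pmf (pmf_of_set M))"
  proof (intro nn_integral_mono_AE AE_pmfI)
    fix w s assume "w \<in> set_pmf (pmf_of_set M)" and s: "s \<in> set_pmf p"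
    then have w: "w \<in> M" using fin by simp
    obtain s1 s2 where s12: "s = (s1, s2)" by (cases s)
    show "(\<integral>\<^sup>+z. err (fst z) (fst (snd z)) (snd (snd z)) w (fst s) (snd s) \<partial>measure_pmf (pair_pmf \<Phi> (pair_pmf \<Psi> \<Gamma>))) \<le> ?B w s"
      using main[OF s[unfolded s12] w] unfolding s12 by (simp add: nn_integral_pair_pmf')
  qed
  finally have "(\<integral>\<^sup>+\<phi>. (\<integral>\<^sup>+\<psi>. (\<integral>\<^sup>+\<gamma>. tot \<phi> \<psi> \<gamma> \<partial>measure_pmf \<Gamma>) \<partial>measure_pmf \<Psi>) \<partial>measure_pmf \<Phi>) \<le>
      (\<integral>\<^sup>+w. (\<integral>\<^sup>+s. ?B w s \<partial>measure_pmf p) \<partial>measure_pmf (pmf_of_set M))" .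
  \<comment> \<open>The three selections are fixed one after the other, each without exceeding the
    bound on the mean.\<close>
  from nn_integral_le_pmfE[OF this] obtain \<phi> where \<phi>: "\<phi> \<in> set_pmf \<Phi>"
    and "(\<integral>\<^sup>+\<psi>. (\<integral>\<^sup>+\<gamma>. tot \<phi> \<psi> \<gamma> \<partial>measure_pmf \<Gamma>) \<partial>measure_pmf \<Psi>) \<le> (\<integral>\<^sup>+w. (\<integral>\<^sup>+s. ?B w s \<partial>measure_pmf p) \<partial>measure_pmf (pmf_of_set M))" by blast
  from nn_integral_le_pmfE[OF this(2)] obtain \<psi> where \<psi>: "\<psi> \<in> set_pmf \<Psi>"
    and "(\<integral>\<^sup>+\<gamma>. tot \<phi> \<psi> \<gamma> \<partial>measure_pmf \<Gamma>) \<le> (\<integral>\<^sup>+w. (\<integral>\<^sup>+s. ?B w s \<partial>measure_pmf p) \<partial>measure_pmf (pmf_of_set M))" by blast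
  from nn_integral_le_pmfE[OF this(2)] obtain \<gamma> where \<gamma>: "\<gamma> \<in> set_pmf \<Gamma>" and
    "tot \<phi> \<psi> \<gamma> \<le> (\<integral>\<^sup>+w. (\<integral>\<^sup>+s. ?B w s \<partial>measure_pmf p) \<partial>measure_pmf (pmf_of_set M))" by blast
  note this(2) \<gamma>
  moreover have "\<forall>P. \<phi> P \<in> VV \<times> T" using \<phi>A[OF \<phi>] unfolding A1_def by blast
  moreover have "\<forall>P. \<psi> P \<in> UU \<times> M" using \<psi>A[OF \<psi>] unfolding A2_def by blast
  ultimately show ?thesis
    unfolding tot_def err_def split_def by (intro exI conjI)
qed

section \<open>Block codes\<close>

text \<open>For \<theta> between 0 and 1 the minimum of 1 and r is at most r to the power \<theta>.
  The mean of 2^(\<theta> Z) is 1 at \<theta> = 0 with negative derivative, so it is below 1 for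
  some small \<theta>, and its n-th power tends to 0.\<close>

lemma chernoff:
  fixes J :: "'a pmf" and Z :: "'a \<Rightarrow> real"
  assumes fin: "finite (set_pmf J)" and mean: "measure_pmf.expectation J Z < 0" and C: "0 \<le> C"
  shows "(\<lambda>n. \<integral>\<^sup>+\<omega>. ennreal (min 1 (C * 2 powr (\<Sum>i<n. Z (\<omega> i)))) \<partial>measure_pmf (Pi_pmf {..<n} d (\<lambda>_. J))) \<longlonglongrightarrow> 0"
proof -
  define f where "f \<theta> = (\<Sum>a\<in>set_pmf J. pmf J a * 2 powr (\<theta> * Z a))" for \<theta> :: real
  have f0: "f 0 = 1" using fin by (simp add: f_def sum_pmf_eq_1)
  have "(f has_real_derivative (\<Sum>a\<in>set_pmf J. pmf J a * (2 powr (0 * Z a) * (Z a * ln 2)))) (at 0)"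
    unfolding f_def by (auto intro!: derivative_eq_intros sum.cong simp: algebra_simps)
  also have "(\<Sum>a\<in>set_pmf J. pmf J a * (2 powr (0 * Z a) * (Z a * ln 2))) = measure_pmf.expectation J Z * ln 2"
    using fin by (simp add: expectation_sum[of "set_pmf J"] sum_distrib_right mult.assoc)
  finally have der: "(f has_real_derivative (measure_pmf.expectation J Z * ln 2)) (at 0)" .
  have "measure_pmf.expectation J Z * ln 2 < 0" using mean by (simp add: mult_neg_pos)
  from DERIV_neg_dec_right[OF der this] obtain e where e: "0 < e" "\<And>h. 0 < h \<Longrightarrow> h < e \<Longrightarrow> f (0 + h) < f 0" by blast
  \<comment> \<open>Half of \<open>e\<close> stays inside the interval where \<open>f\<close> has
    dropped below 1; the cap at 1 keeps the power bound valid.\<close>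
  define \<theta> where "\<theta> = min (e / 2) 1"
  have \<theta>: "0 < \<theta>" "\<theta> \<le> 1" "f \<theta> < 1"
    using e(1) e(2)[of \<theta>] f0 by (auto simp: \<theta>_def min_def)
  have f_nn: "0 \<le> f \<theta>" unfolding f_def by (intro sum_nonneg) auto
  have le: "(\<integral>\<^sup>+\<omega>. ennreal (min 1 (C * 2 powr (\<Sum>i<n. Z (\<omega> i)))) \<partial>measure_pmf (Pi_pmf {..<n} d (\<lambda>_. J))) \<le> ennreal (C powr \<theta> * f \<theta> ^ n)" for n
  proof -
    have "(\<integral>\<^sup>+\<omega>. ennreal (min 1 (C * 2 powr (\<Sum>i<n. Z (\<omega> i)))) \<partial>measure_pmf (Pi_pmf {..<n} d (\<lambda>_. J))) \<le>
      (\<integral>\<^sup>+\<omega>. ennreal (C powr \<theta>) * (\<Prod>i<n. ennreal (2 powr (\<theta> * Z (\<omega> i)))) \<partial>measure_pmf (Pi_pmf {..<n} d (\<lambda>_. J)))"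
    proof (intro nn_integral_mono)
      fix \<omega>
      let ?r = "C * 2 powr (\<Sum>i<n. Z (\<omega> i))"
      have r0: "0 \<le> ?r" using C by simp
      have "min 1 ?r \<le> ?r powr \<theta>"
      proof (cases "1 \<le> ?r")
        case True
        then show ?thesis using \<theta> by (auto intro: ge_one_powr_ge_zero)
      next
        case False
        have "?r powr 1 \<le> ?r powr \<theta>" by (rule powr_mono') (use False \<theta> r0 in auto)
        then show ?thesis using r0 by simp
      qed
      also have "?r powr \<theta> = C powr \<theta> * (\<Prod>i<n. 2 powr (\<theta> * Z (\<omega> i)))"
        using C by (simp add: powr_mult powr_powr powr_sum[symmetric] sum_distrib_left mult.commute)
      finally show "ennreal (min 1 ?r) \<le> ennreal (C powr \<theta>) * (\<Prod>i<n. ennreal (2 powr (\<theta> * Z (\<omega> i))))"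
        by (simp add: prod_ennreal ennreal_mult[symmetric] prod_nonneg ennreal_leI)
    qed
    also have "\<dots> = ennreal (C powr \<theta>) * (\<Prod>i<n. \<integral>\<^sup>+a. ennreal (2 powr (\<theta> * Z a)) \<partial>measure_pmf J)"
      by (simp add: nn_integral_cmult nn_integral_prod_Pi_pmf[where f="\<lambda>_ a. ennreal (2 powr (\<theta> * Z a))"])
    also have "(\<integral>\<^sup>+a. ennreal (2 powr (\<theta> * Z a)) \<partial>measure_pmf J) = ennreal (f \<theta>)"
      using fin by (simp add: nn_integral_measure_pmf_finite f_def ennreal_mult[symmetric] mult.commute)
    also have "ennreal (C powr \<theta>) * (\<Prod>i<n. ennreal (f \<theta>)) = ennreal (C powr \<theta> * f \<theta> ^ n)"
      using f_nn by (simp add: ennreal_mult ennreal_power)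
    finally show ?thesis .
  qed
  have "(\<lambda>n. C powr \<theta> * f \<theta> ^ n) \<longlonglongrightarrow> C powr \<theta> * 0"
    using f_nn \<theta>(3) by (intro tendsto_intros LIMSEQ_realpow_zero) auto
  then have "(\<lambda>n. ennreal (C powr \<theta> * f \<theta> ^ n)) \<longlonglongrightarrow> ennreal 0" by (intro tendsto_ennrealI) simp
  then have lim: "(\<lambda>n. ennreal (C powr \<theta> * f \<theta> ^ n)) \<longlonglongrightarrow> 0" by simp
  show ?thesis
    by (rule tendsto_sandwich[OF _ _ tendsto_const lim]) (auto intro!: always_eventually le)
qed

lemma Pi_pmf_map_dep:
  assumes "finite A"
  shows "Pi_pmf A d (\<lambda>i. map_pmf (h i) (P i)) = map_pmf (\<lambda>f i. if i \<in> A then h i (f i) else d) (Pi_pmf A d' P)"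
  unfolding map_pmf_def using assms by (subst Pi_pmf_bind[where d'=d']) auto

lemma Pi_pmf_bind_undefined:
  "Pi_pmf {..<n::nat} d (\<lambda>i. bind_pmf (a i) (b i)) = bind_pmf (Pi_pmf {..<n} undefined a) (\<lambda>f. Pi_pmf {..<n} d (\<lambda>i. b i (f i)))"
  by (rule Pi_pmf_bind) simp

text \<open>Drawing \<open>n\<close> independent letters of the joint law is the same as drawing one
  block after the other: states, \<open>V\<close>, \<open>U\<close>, inputs, outputs.\<close>

lemma nn_integral_Pi_aux_law:
  "(\<integral>\<^sup>+\<omega>. G \<omega> \<partial>measure_pmf (Pi_pmf {..<n::nat} d (\<lambda>_. aux_law p ch qv qu qx))) =
   (\<integral>\<^sup>+s. (\<integral>\<^sup>+v. (\<integral>\<^sup>+u. (\<integral>\<^sup>+x. (\<integral>\<^sup>+y. G (\<lambda>i. if i < n then (fst (s i), snd (s i), v i, u i, x i, y i) else d)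
     \<partial>measure_pmf (Pi_pmf {..<n} undefined (\<lambda>i. ch (x i) (fst (s i)) (snd (s i)))))
     \<partial>measure_pmf (Pi_pmf {..<n} undefined (\<lambda>i. qx (u i) (fst (s i)) (v i))))
     \<partial>measure_pmf (Pi_pmf {..<n} undefined (\<lambda>i. qu (fst (s i)) (snd (s i)) (v i))))
     \<partial>measure_pmf (Pi_pmf {..<n} undefined (\<lambda>i. qv (fst (s i)) (snd (s i)))))
     \<partial>measure_pmf (Pi_pmf {..<n} undefined (\<lambda>_. p)))"
proof -
  have "Pi_pmf {..<n} d (\<lambda>_. aux_law p ch qv qu qx) = do {
    s \<leftarrow> Pi_pmf {..<n} undefined (\<lambda>_. p);
    v \<leftarrow> Pi_pmf {..<n} undefined (\<lambda>i. qv (fst (s i)) (snd (s i)));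
    u \<leftarrow> Pi_pmf {..<n} undefined (\<lambda>i. qu (fst (s i)) (snd (s i)) (v i));
    x \<leftarrow> Pi_pmf {..<n} undefined (\<lambda>i. qx (u i) (fst (s i)) (v i));
    y \<leftarrow> Pi_pmf {..<n} undefined (\<lambda>i. ch (x i) (fst (s i)) (snd (s i)));
    return_pmf (\<lambda>i. if i < n then (fst (s i), snd (s i), v i, u i, x i, y i) else d)}"
    unfolding aux_law_def split_def
    by (simp only: Pi_pmf_bind_undefined Pi_pmf_return_pmf[OF finite_lessThan] lessThan_iff)
  then show ?thesis by simp
qed

section \<open>Likelihood ratio bounds for blocks\<close>

lemma mismatch_le_ratio:
  assumes "0 < pmf Q a" "pmf P a / pmf Q a \<le> r"
  shows "mismatch P Q a \<le> min 1 r"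
proof -
  have "mismatch P Q a \<le> pmf P a / (pmf P a + pmf Q a)" by (simp add: mismatch_def)
  moreover have "pmf P a / (pmf P a + pmf Q a) \<le> 1" using assms(1) by (simp add: divide_le_eq add_nonneg_pos)
  moreover have "pmf P a / (pmf P a + pmf Q a) \<le> pmf P a / pmf Q a"
    using assms(1) by (intro divide_left_mono) (auto intro!: mult_pos_pos add_nonneg_pos)
  ultimately show ?thesis using assms(2) by auto
qed

lemma prod_ratio_powr:
  assumes "\<And>i. i < n \<Longrightarrow> 0 < f i" "\<And>i. i < n \<Longrightarrow> 0 < g i"
  shows "(\<Prod>i<n. f i) / (\<Prod>i<n. g i) * 2 powr (real n * c) = 2 powr (\<Sum>i<n. log 2 (f i / g i) + c)"
proof -
  have "2 powr (\<Sum>i<n. log 2 (f i / g i) + c) = (\<Prod>i<n. 2 powr (log 2 (f i / g i) + c))"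
    by (simp add: powr_sum)
  also have "\<dots> = (\<Prod>i<n. f i / g i * 2 powr c)"
    by (intro prod.cong refl) (simp add: powr_add assms)
  also have "\<dots> = (\<Prod>i<n. f i) / (\<Prod>i<n. g i) * (2 powr c) ^ n" by (simp add: prod.distrib prod_dividef)
  also have "(2 powr c) ^ n = 2 powr (real n * c)" by (simp add: powr_realpow[symmetric] powr_powr mult.commute)
  finally show ?thesis ..
qed


text \<open>The index is uniform for the party that describes and known to the party that guesses,
  so the likelihood ratio is divided by the number of indices. The leading factor 2 pays for
  rounding this number down.\<close>

lemma mismatch_description:
  assumes R: "0 \<le> R'" and v: "v \<in> set_pmf (Pi_pmf {..<n} undefined q)" and r: "\<And>i. i < n \<Longrightarrow> v i \<in> set_pmf (r i)"
    and t: "t \<in> index_set n R'"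
  shows "mismatch (pair_pmf (Pi_pmf {..<n} undefined q) (pmf_of_set (index_set n R'))) (pair_pmf (Pi_pmf {..<n} undefined r) (return_pmf t)) (v, t) \<le>
    min 1 (2 * 2 powr (\<Sum>i<n. log 2 (pmf (q i) (v i) / pmf (r i) (v i)) + - R'))"
proof -
  let ?T = "index_set n R'"
  have T: "finite ?T" "?T \<noteq> {}" using finite_index_set t by auto
  have vd: "v i = undefined" if "i \<notin> {..<n}" for i using that v set_Pi_pmf_default[of v n undefined q i] by simp
  have Pv: "pmf (Pi_pmf {..<n} undefined h) v = (\<Prod>i<n. pmf (h i) (v i))" for h
    by (rule pmf_Pi') (auto simp: vd)
  have q0: "0 < pmf (q i) (v i)" if "i < n" for i
    using v that by (subst (asm) set_Pi_pmf) (auto simp: PiE_dflt_def pmf_positive_iff)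
  have r0: "0 < pmf (r i) (v i)" if "i < n" for i using r[OF that] by (simp add: pmf_positive_iff)
  have Q: "pmf (pair_pmf (Pi_pmf {..<n} undefined r) (return_pmf t)) (v, t) = (\<Prod>i<n. pmf (r i) (v i))"
    by (simp add: pmf_pair Pv)
  have P: "pmf (pair_pmf (Pi_pmf {..<n} undefined q) (pmf_of_set ?T)) (v, t) = (\<Prod>i<n. pmf (q i) (v i)) / card ?T"
    using T t by (simp add: pmf_pair Pv)
  have rp: "0 < (\<Prod>i<n. pmf (r i) (v i))" by (intro prod_pos) (simp add: r0)
  have "1 / card ?T \<le> 1 / (2 powr (real n * R') / 2)"
    using card_index_set(2,5)[OF R, of n] by (intro divide_left_mono) auto
  also have "\<dots> = 2 * 2 powr (real n * - R')" by (simp add: powr_minus_divide)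
  finally have c: "1 / card ?T \<le> 2 * 2 powr (real n * - R')" .
  have "(\<Prod>i<n. pmf (q i) (v i)) / card ?T / (\<Prod>i<n. pmf (r i) (v i)) =
     (\<Prod>i<n. pmf (q i) (v i)) / (\<Prod>i<n. pmf (r i) (v i)) * (1 / card ?T)" by simp
  also have "\<dots> \<le> (\<Prod>i<n. pmf (q i) (v i)) / (\<Prod>i<n. pmf (r i) (v i)) * (2 * 2 powr (real n * - R'))"
    using c by (intro mult_left_mono divide_nonneg_pos rp prod_nonneg) auto
  also have "\<dots> = 2 * ((\<Prod>i<n. pmf (q i) (v i)) / (\<Prod>i<n. pmf (r i) (v i)) * 2 powr (real n * - R'))" by simp
  also have "\<dots> = 2 * 2 powr (\<Sum>i<n. log 2 (pmf (q i) (v i) / pmf (r i) (v i)) + - R')"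
    by (subst prod_ratio_powr) (auto simp: q0 r0)
  finally show ?thesis by (intro mismatch_le_ratio) (simp_all only: P Q rp)
qed

text \<open>The roles are reversed: the encoder knows the message and the decoder sees it as
  uniform, which multiplies the ratio by the number of messages. This number is at most 2^(n R), so
  rounding costs nothing.\<close>

lemma mismatch_message:
  assumes R: "0 \<le> R" and v: "v \<in> set_pmf (Pi_pmf {..<n} undefined q)" and r: "\<And>i. i < n \<Longrightarrow> v i \<in> set_pmf (r i)"
    and t: "t \<in> index_set n R"
  shows "mismatch (pair_pmf (Pi_pmf {..<n} undefined q) (return_pmf t)) (pair_pmf (Pi_pmf {..<n} undefined r) (pmf_of_set (index_set n R))) (v, t) \<le>
    min 1 (1 * 2 powr (\<Sum>i<n. log 2 (pmf (q i) (v i) / pmf (r i) (v i)) + R))"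
proof -
  let ?T = "index_set n R"
  have T: "finite ?T" "?T \<noteq> {}" using finite_index_set t by auto
  have vd: "v i = undefined" if "i \<notin> {..<n}" for i using that v set_Pi_pmf_default[of v n undefined q i] by simp
  have Pv: "pmf (Pi_pmf {..<n} undefined h) v = (\<Prod>i<n. pmf (h i) (v i))" for h
    by (rule pmf_Pi') (auto simp: vd)
  have q0: "0 < pmf (q i) (v i)" if "i < n" for i
    using v that by (subst (asm) set_Pi_pmf) (auto simp: PiE_dflt_def pmf_positive_iff)
  have r0: "0 < pmf (r i) (v i)" if "i < n" for i using r[OF that] by (simp add: pmf_positive_iff)
  have c: "0 < real (card ?T)" "real (card ?T) \<le> 2 powr (real n * R)" using card_index_set(1,5)[OF R, of n] by auto
  have Q: "pmf (pair_pmf (Pi_pmf {..<n} undefined r) (pmf_of_set ?T)) (v, t) = (\<Prod>i<n. pmf (r i) (v i)) / card ?T"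
    using T t by (simp add: pmf_pair Pv)
  have P: "pmf (pair_pmf (Pi_pmf {..<n} undefined q) (return_pmf t)) (v, t) = (\<Prod>i<n. pmf (q i) (v i))"
    by (simp add: pmf_pair Pv)
  have rp: "0 < (\<Prod>i<n. pmf (r i) (v i))" by (intro prod_pos) (simp add: r0)
  have "(\<Prod>i<n. pmf (q i) (v i)) / ((\<Prod>i<n. pmf (r i) (v i)) / card ?T) =
     (\<Prod>i<n. pmf (q i) (v i)) / (\<Prod>i<n. pmf (r i) (v i)) * card ?T" by simp
  also have "\<dots> \<le> (\<Prod>i<n. pmf (q i) (v i)) / (\<Prod>i<n. pmf (r i) (v i)) * 2 powr (real n * R)"
    using c by (intro mult_left_mono divide_nonneg_pos rp prod_nonneg) auto
  also have "\<dots> = 1 * 2 powr (\<Sum>i<n. log 2 (pmf (q i) (v i) / pmf (r i) (v i)) + R)"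
    by (subst prod_ratio_powr) (auto simp: q0 r0)
  finally have le: "(\<Prod>i<n. pmf (q i) (v i)) / ((\<Prod>i<n. pmf (r i) (v i)) / card ?T) \<le> 1 * 2 powr (\<Sum>i<n. log 2 (pmf (q i) (v i) / pmf (r i) (v i)) + R)" .
  show ?thesis
    by (rule mismatch_le_ratio) (simp only: Q divide_pos_pos[OF rp c(1)], simp only: P Q le)
qed

text \<open>The laws whose race winners are, in this order, the description and its index, the codeword and the
  message, the decoded codeword and message, and the guesses of the description by encoder and decoder. The flag \<open>e\<close>
  says that the party knows the law of the description exactly and therefore does not need the index.\<close>

definition sel_pv :: "nat \<Rightarrow> nat set \<Rightarrow> ('s1 \<Rightarrow> 's2 \<Rightarrow> 'v pmf) \<Rightarrow> (nat \<Rightarrow> 's1) \<Rightarrow> (nat \<Rightarrow> 's2) \<Rightarrow> ((nat \<Rightarrow> 'v) \<times> nat) pmf" where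
  "sel_pv n T qv s1 s2 = pair_pmf (Pi_pmf {..<n} undefined (\<lambda>i. qv (s1 i) (s2 i))) (pmf_of_set T)"

definition sel_pu :: "nat \<Rightarrow> ('s1 \<Rightarrow> 'v \<Rightarrow> 'u pmf) \<Rightarrow> (nat \<Rightarrow> 's1) \<Rightarrow> (nat \<Rightarrow> 'v) \<Rightarrow> nat \<Rightarrow> ((nat \<Rightarrow> 'u) \<times> nat) pmf" where
  "sel_pu n qu s1 v w = pair_pmf (Pi_pmf {..<n} undefined (\<lambda>i. qu (s1 i) (v i))) (return_pmf w)"

definition sel_ru :: "nat \<Rightarrow> nat set \<Rightarrow> ('y \<Rightarrow> 's2 \<Rightarrow> 'v \<Rightarrow> 'u pmf) \<Rightarrow> (nat \<Rightarrow> 'y) \<Rightarrow> (nat \<Rightarrow> 's2) \<Rightarrow> (nat \<Rightarrow> 'v) \<Rightarrow> ((nat \<Rightarrow> 'u) \<times> nat) pmf" where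
  "sel_ru n M ru y s2 v = pair_pmf (Pi_pmf {..<n} undefined (\<lambda>i. ru (y i) (s2 i) (v i))) (pmf_of_set M)"

definition sel_re :: "bool \<Rightarrow> nat \<Rightarrow> nat set \<Rightarrow> ('s1 \<Rightarrow> 'v pmf) \<Rightarrow> (nat \<Rightarrow> 's1) \<Rightarrow> nat \<Rightarrow> ((nat \<Rightarrow> 'v) \<times> nat) pmf" where
  "sel_re e n T re s1 t = pair_pmf (Pi_pmf {..<n} undefined (\<lambda>i. re (s1 i))) (if e then pmf_of_set T else return_pmf t)"

definition sel_rd :: "bool \<Rightarrow> nat \<Rightarrow> nat set \<Rightarrow> ('y \<Rightarrow> 's2 \<Rightarrow> 'v pmf) \<Rightarrow> (nat \<Rightarrow> 'y) \<Rightarrow> (nat \<Rightarrow> 's2) \<Rightarrow> nat \<Rightarrow> ((nat \<Rightarrow> 'v) \<times> nat) pmf" where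
  "sel_rd e n T rd y s2 t = pair_pmf (Pi_pmf {..<n} undefined (\<lambda>i. rd (y i) (s2 i))) (if e then pmf_of_set T else return_pmf t)"

lemma tendsto_add_0_ennreal: "f \<longlonglongrightarrow> (0::ennreal) \<Longrightarrow> g \<longlonglongrightarrow> 0 \<Longrightarrow> (\<lambda>n. f n + g n) \<longlonglongrightarrow> 0"
  using tendsto_add[of f 0 sequentially g 0] by simp

text \<open>\<open>re\<close> and \<open>rd\<close> are the laws by which encoder and decoder guess
  the description, \<open>ru\<close> the law by which the decoder selects a codeword. The support
  conditions \<open>pe\<close>, \<open>pd\<close>, \<open>pu\<close> keep the denominators of the
  likelihood ratios positive, and \<open>me\<close>, \<open>md\<close>, \<open>mu\<close> are the
  negative means that \<open>chernoff\<close> asks for. With a flag set, the guessing law is exactly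
  \<open>qv\<close> and no such conditions are imposed.\<close>

locale scheme =
  fixes p :: "('s1::finite \<times> 's2::finite) pmf" and ch :: "'x::finite \<Rightarrow> 's1 \<Rightarrow> 's2 \<Rightarrow> 'y::finite pmf"
    and qv :: "'s1 \<Rightarrow> 's2 \<Rightarrow> 'v pmf" and qu :: "'s1 \<Rightarrow> 'v \<Rightarrow> 'u pmf" and qx :: "'u \<Rightarrow> 's1 \<Rightarrow> 'v \<Rightarrow> 'x pmf"
    and re :: "'s1 \<Rightarrow> 'v pmf" and rd :: "'y \<Rightarrow> 's2 \<Rightarrow> 'v pmf" and ru :: "'y \<Rightarrow> 's2 \<Rightarrow> 'v \<Rightarrow> 'u pmf"
    and ee ed :: bool and VL :: "'v set" and UL :: "'u set" and R R' :: real
  assumes fin: "finite VL" "finite UL"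
    and sup: "\<And>s1 s2. set_pmf (qv s1 s2) \<subseteq> VL" "\<And>s1. set_pmf (re s1) \<subseteq> VL" "\<And>y s2. set_pmf (rd y s2) \<subseteq> VL"
      "\<And>s1 v. set_pmf (qu s1 v) \<subseteq> UL" "\<And>y s2 v. set_pmf (ru y s2 v) \<subseteq> UL"
    and R: "0 \<le> R" "0 \<le> R'"
    and ee: "ee \<Longrightarrow> (s1, s2) \<in> set_pmf p \<Longrightarrow> re s1 = qv s1 s2"
    and ed: "ed \<Longrightarrow> (s1, s2) \<in> set_pmf p \<Longrightarrow> rd y s2 = qv s1 s2"
    and pe: "\<not> ee \<Longrightarrow> (s1, s2) \<in> set_pmf p \<Longrightarrow> v \<in> set_pmf (qv s1 s2) \<Longrightarrow> v \<in> set_pmf (re s1)"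
    and pd: "\<not> ed \<Longrightarrow> (s1, s2, v, u, x, y) \<in> set_pmf (aux_law p ch qv (\<lambda>s1 s2. qu s1) qx) \<Longrightarrow> v \<in> set_pmf (rd y s2)"
    and pu: "(s1, s2, v, u, x, y) \<in> set_pmf (aux_law p ch qv (\<lambda>s1 s2. qu s1) qx) \<Longrightarrow> u \<in> set_pmf (ru y s2 v)"
    and me: "\<not> ee \<Longrightarrow> measure_pmf.expectation (aux_law p ch qv (\<lambda>s1 s2. qu s1) qx)
       (\<lambda>(s1, s2, v, u, x, y). log 2 (pmf (qv s1 s2) v / pmf (re s1) v)) < R'"
    and md: "\<not> ed \<Longrightarrow> measure_pmf.expectation (aux_law p ch qv (\<lambda>s1 s2. qu s1) qx)
       (\<lambda>(s1, s2, v, u, x, y). log 2 (pmf (qv s1 s2) v / pmf (rd y s2) v)) < R'"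
    and mu: "measure_pmf.expectation (aux_law p ch qv (\<lambda>s1 s2. qu s1) qx)
       (\<lambda>(s1, s2, v, u, x, y). log 2 (pmf (qu s1 v) u / pmf (ru y s2 v) u)) < - R"
begin

abbreviation "J \<equiv> aux_law p ch qv (\<lambda>s1 s2. qu s1) qx"

definition "Ze = (\<lambda>(s1, s2, v, u, x, y). log 2 (pmf (qv s1 s2) v / pmf (re s1) v) + - R')"
definition "Zd = (\<lambda>(s1, s2, v, u, x, y). log 2 (pmf (qv s1 s2) v / pmf (rd y s2) v) + - R')"
definition "Zu = (\<lambda>(s1, s2, v, u, x, y). log 2 (pmf (qu s1 v) u / pmf (ru y s2 v) u) + R)"

definition "Be n \<omega> = (if ee then 0 else min 1 (2 * 2 powr (\<Sum>i<n. Ze (\<omega> i))))" for n :: nat and \<omega> :: "nat \<Rightarrow> 's1 \<times> 's2 \<times> 'v \<times> 'u \<times> 'x \<times> 'y"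
definition "Bd n \<omega> = (if ed then 0 else min 1 (2 * 2 powr (\<Sum>i<n. Zd (\<omega> i))))" for n :: nat and \<omega> :: "nat \<Rightarrow> 's1 \<times> 's2 \<times> 'v \<times> 'u \<times> 'x \<times> 'y"
definition "Bu n \<omega> = min 1 (1 * 2 powr (\<Sum>i<n. Zu (\<omega> i)))" for n :: nat and \<omega> :: "nat \<Rightarrow> 's1 \<times> 's2 \<times> 'v \<times> 'u \<times> 'x \<times> 'y"

text \<open>The mean is taken under independent letters of the ideal law \<open>J\<close>; the error
  of the actual code is compared with this mean.\<close>

definition "bound n = (\<integral>\<^sup>+\<omega>. ennreal (Be n \<omega>) + (ennreal (Bd n \<omega>) + ennreal (Bu n \<omega>)) \<partial>measure_pmf (Pi_pmf {..<n} undefined (\<lambda>_. J)))" for n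

lemma finJ: "finite (set_pmf J)"
  by (intro finite_set_aux_law finite_subset[OF sup(1) fin(1)] finite_subset[OF sup(4) fin(2)])

lemma bound_limit: "bound \<longlonglongrightarrow> 0"
proof -
  note int = integrable_measure_pmf_finite[OF finJ]
  have shift: "measure_pmf.expectation J (\<lambda>(s1, s2, v, u, x, y). h s1 s2 v u x y + c) =
     measure_pmf.expectation J (\<lambda>(s1, s2, v, u, x, y). h s1 s2 v u x y) + c" for h :: "'s1 \<Rightarrow> 's2 \<Rightarrow> 'v \<Rightarrow> 'u \<Rightarrow> 'x \<Rightarrow> 'y \<Rightarrow> real" and c
    unfolding split_def by (subst Bochner_Integration.integral_add) (auto intro!: int)
  have e: "(\<lambda>n. \<integral>\<^sup>+\<omega>. ennreal (Be n \<omega>) \<partial>measure_pmf (Pi_pmf {..<n} undefined (\<lambda>_. J))) \<longlonglongrightarrow> 0"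
  proof (cases ee)
    case False
    have "measure_pmf.expectation J Ze < 0" unfolding Ze_def shift using me[OF False] by simp
    then show ?thesis unfolding Be_def using False by (simp del: min_less_iff_conj add: chernoff[OF finJ])
  next
    case True
    then show ?thesis unfolding Be_def by simp
  qed
  have d: "(\<lambda>n. \<integral>\<^sup>+\<omega>. ennreal (Bd n \<omega>) \<partial>measure_pmf (Pi_pmf {..<n} undefined (\<lambda>_. J))) \<longlonglongrightarrow> 0"
  proof (cases ed)
    case False
    have "measure_pmf.expectation J Zd < 0" unfolding Zd_def shift using md[OF False] by simp
    then show ?thesis unfolding Bd_def using False by (simp del: min_less_iff_conj add: chernoff[OF finJ])
  next
    case True
    then show ?thesis unfolding Bd_def by simp
  qed
  have "measure_pmf.expectation J Zu < 0" unfolding Zu_def shift using mu by simp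
  then have u: "(\<lambda>n. \<integral>\<^sup>+\<omega>. ennreal (Bu n \<omega>) \<partial>measure_pmf (Pi_pmf {..<n} undefined (\<lambda>_. J))) \<longlonglongrightarrow> 0"
    unfolding Bu_def by (intro chernoff[OF finJ]) auto
  have "bound = (\<lambda>n. (\<integral>\<^sup>+\<omega>. ennreal (Be n \<omega>) \<partial>measure_pmf (Pi_pmf {..<n} undefined (\<lambda>_. J))) +
     ((\<integral>\<^sup>+\<omega>. ennreal (Bd n \<omega>) \<partial>measure_pmf (Pi_pmf {..<n} undefined (\<lambda>_. J))) +
      (\<integral>\<^sup>+\<omega>. ennreal (Bu n \<omega>) \<partial>measure_pmf (Pi_pmf {..<n} undefined (\<lambda>_. J)))))"
    unfolding bound_def by (simp add: nn_integral_add)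
  then show ?thesis using tendsto_add_0_ennreal[OF e tendsto_add_0_ennreal[OF d u]] by simp
qed

text \<open>\<open>one_shot\<close> applied to whole blocks. Its bound under the ideal block law
  becomes a mean over \<open>n\<close> independent letters, in which each mismatch is at most a
  power of 2 of a sum of logarithmic likelihood ratios.\<close>

lemma block_code:
  fixes n :: nat
  defines "T \<equiv> index_set n R'" and "M \<equiv> index_set n R"
  shows "\<exists>\<phi> \<psi> (\<gamma> :: nat \<Rightarrow> 'u \<times> 's1 \<times> 'v \<Rightarrow> 'x). (\<forall>P. snd (\<phi> P) \<in> T) \<and> (\<forall>P. snd (\<psi> P) \<in> M) \<and>
    ennreal (error_prob n M p ch (\<lambda>s1 s2. snd (\<phi> (sel_pv n T qv s1 s2)))
      (\<lambda>w s1 t. let v = fst (\<phi> (sel_re ee n T re s1 t)); u = fst (\<psi> (sel_pu n qu s1 v w)) in (\<lambda>i. \<gamma> i (u i, s1 i, v i)))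
      (\<lambda>y s2 t. snd (\<psi> (sel_ru n M ru y s2 (fst (\<phi> (sel_rd ed n T rd y s2 t))))))) \<le> bound n"
proof -
  have T: "finite T" "T \<noteq> {}" and M: "finite M" "M \<noteq> {}"
    unfolding T_def M_def using finite_index_set index_set_nonempty[OF R(1)] index_set_nonempty[OF R(2)] by blast+
  define pn where "pn = map_pmf (\<lambda>s. (\<lambda>i. fst (s i), \<lambda>i. snd (s i))) (Pi_pmf {..<n} undefined (\<lambda>_. p))"
  define VV where "VV = PiE_dflt {..<n} (undefined :: 'v) (\<lambda>_. VL)"
  define UU where "UU = PiE_dflt {..<n} (undefined :: 'u) (\<lambda>_. UL)"
  define YY where "YY = PiE_dflt {..<n} (undefined :: 'y) (\<lambda>_. UNIV)"
  define Qv where "Qv s1 s2 = Pi_pmf {..<n} undefined (\<lambda>i. qv (s1 i) (s2 i))" for s1 s2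
  define Qu where "Qu s1 v = Pi_pmf {..<n} undefined (\<lambda>i. qu (s1 i) (v i))" for s1 v
  define QX where "QX u s1 v = Pi_pmf {..<n} undefined (\<lambda>i. qx (u i) (s1 i) (v i))" for u s1 v
  define CH where "CH x s1 s2 = Pi_pmf {..<n} undefined (\<lambda>i. ch (x i) (s1 i) (s2 i))" for x s1 s2
  define Ru where "Ru y s2 v = Pi_pmf {..<n} undefined (\<lambda>i. ru (y i) (s2 i) (v i))" for y s2 v
  have subVV: "set_pmf (Pi_pmf {..<n} undefined q) \<subseteq> VV" if "\<And>i. set_pmf (q i) \<subseteq> VL" for q
    unfolding VV_def using that by (subst set_Pi_pmf) (auto simp: PiE_dflt_def)
  have subUU: "set_pmf (Pi_pmf {..<n} undefined q) \<subseteq> UU" if "\<And>i. set_pmf (q i) \<subseteq> UL" for q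
    unfolding UU_def using that by (subst set_Pi_pmf) (auto simp: PiE_dflt_def)
  define BB where "BB = UL \<times> (UNIV :: 's1 set) \<times> VL"
  \<comment> \<open>The kernel of the input is random, while a code must be deterministic. A random
    table from letters of \<open>U\<close>, \<open>S1\<close> and \<open>V\<close> to inputs is
    drawn for each position, and fixing the tables turns the kernel into functions. Each table sees
    only its own position, which preserves causality.\<close>
  define G0 where "G0 = Pi_pmf BB undefined (\<lambda>(u, s1, v). qx u s1 v)"
  define \<Gamma>0 where "\<Gamma>0 = Pi_pmf {..<n} (undefined :: 'u \<times> 's1 \<times> 'v \<Rightarrow> 'x) (\<lambda>_. G0)"
  define ap where "ap g u s1 v = (\<lambda>i. if i \<in> {..<n} then g i (u i, s1 i, v i) else undefined)" for g :: "nat \<Rightarrow> 'u \<times> 's1 \<times> 'v \<Rightarrow> 'x" and u s1 v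
  define \<Gamma> where "\<Gamma> = map_pmf ap \<Gamma>0"
  have G: "map_pmf (\<lambda>\<gamma>. \<gamma> u s1 v) \<Gamma> = QX u s1 v" if u: "u \<in> UU" and v: "v \<in> VV" for u s1 v
  proof -
    have "map_pmf (\<lambda>\<gamma>. \<gamma> u s1 v) \<Gamma> = map_pmf (\<lambda>g i. if i \<in> {..<n} then (\<lambda>h. h (u i, s1 i, v i)) (g i) else undefined) \<Gamma>0"
      by (simp add: \<Gamma>_def map_pmf_comp ap_def)
    also have "\<dots> = Pi_pmf {..<n} undefined (\<lambda>i. map_pmf (\<lambda>h. h (u i, s1 i, v i)) G0)"
      unfolding \<Gamma>0_def by (rule Pi_pmf_map_dep[symmetric]) simp
    also have "\<dots> = QX u s1 v"
      unfolding QX_def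
    proof (rule Pi_pmf_cong)
      fix i assume "i \<in> {..<n}"
      then have "(u i, s1 i, v i) \<in> BB" using u v by (auto simp: UU_def VV_def BB_def PiE_dflt_def)
      moreover have "finite BB" using fin by (simp add: BB_def)
      ultimately show "map_pmf (\<lambda>h. h (u i, s1 i, v i)) G0 = qx (u i) (s1 i) (v i)"
        unfolding G0_def by (subst Pi_pmf_component) auto
    qed auto
    finally show ?thesis .
  qed
  have VLne: "VL \<noteq> {}" using sup(2)[of undefined] set_pmf_not_empty[of "re undefined"] by blast
  have ULne: "UL \<noteq> {}" using sup(4)[of undefined undefined] set_pmf_not_empty[of "qu undefined undefined"] by blast
  have nonempty: "VV \<noteq> {}" "UU \<noteq> {}" using VLne ULne by (auto simp: VV_def UU_def)
  have fins: "finite (set_pmf pn)" "finite VV" "finite UU" "finite YY"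
    unfolding pn_def VV_def UU_def YY_def using fin
    by (auto intro!: finite_PiE_dflt simp: set_Pi_pmf)
  have reS: "set_pmf (sel_re ee n T re s1 t) \<subseteq> VV \<times> T" if "t \<in> T" for s1 t
    unfolding sel_re_def using subVV[of "\<lambda>i. re (s1 i)"] sup(2) T that by (auto split: if_splits)
  have rdS: "set_pmf (sel_rd ed n T rd y s2 t) \<subseteq> VV \<times> T" if "t \<in> T" for y s2 t
    unfolding sel_rd_def using subVV[of "\<lambda>i. rd (y i) (s2 i)"] sup(3) T that by (auto split: if_splits)
  have chS: "set_pmf (CH x s1 s2) \<subseteq> YY" for x s1 s2
    unfolding CH_def YY_def by (subst set_Pi_pmf) (auto simp: PiE_dflt_def)
  have qvS: "set_pmf (Qv s1 s2) \<subseteq> VV" for s1 s2 unfolding Qv_def by (rule subVV) (rule sup)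
  have quS: "set_pmf (Qu s1 v) \<subseteq> UU" for s1 v unfolding Qu_def by (rule subUU) (rule sup)
  have ruS: "set_pmf (Ru y s2 v) \<subseteq> UU" for y s2 v unfolding Ru_def by (rule subUU) (rule sup)
  note os = one_shot[of pn VV UU YY T M Qv "sel_re ee n T re" "sel_rd ed n T rd" Qu Ru CH \<Gamma> QX,
     OF fins T M qvS reS rdS quS ruS chS nonempty G]
  obtain \<phi> \<psi> \<gamma>' where \<phi>: "\<forall>P. \<phi> P \<in> VV \<times> T" and \<psi>: "\<forall>P. \<psi> P \<in> UU \<times> M" and \<gamma>': "\<gamma>' \<in> set_pmf \<Gamma>" and le:
    "(\<integral>\<^sup>+w. (\<integral>\<^sup>+(s1, s2). emeasure (measure_pmf (CH (\<gamma>' (fst (\<psi> (sel_pu n qu s1 (fst (\<phi> (sel_re ee n T re s1 (snd (\<phi> (sel_pv n T qv s1 s2)))))) w))) s1 (fst (\<phi> (sel_re ee n T re s1 (snd (\<phi> (sel_pv n T qv s1 s2))))))) s1 s2))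
       {y. snd (\<psi> (sel_ru n M ru y s2 (fst (\<phi> (sel_rd ed n T rd y s2 (snd (\<phi> (sel_pv n T qv s1 s2)))))))) \<noteq> w} \<partial>measure_pmf pn) \<partial>measure_pmf (pmf_of_set M)) \<le>
    (\<integral>\<^sup>+w. (\<integral>\<^sup>+(s1, s2). (\<integral>\<^sup>+(v, t). ennreal (mismatch (sel_pv n T qv s1 s2) (sel_re ee n T re s1 t) (v, t)) +
       (\<integral>\<^sup>+u. (\<integral>\<^sup>+x. (\<integral>\<^sup>+y. ennreal (mismatch (sel_pv n T qv s1 s2) (sel_rd ed n T rd y s2 t) (v, t)) + ennreal (mismatch (sel_pu n qu s1 v w) (sel_ru n M ru y s2 v) (u, w))
          \<partial>measure_pmf (CH x s1 s2)) \<partial>measure_pmf (QX u s1 v)) \<partial>measure_pmf (Qu s1 v))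
        \<partial>measure_pmf (sel_pv n T qv s1 s2)) \<partial>measure_pmf pn) \<partial>measure_pmf (pmf_of_set M))"
    using os unfolding Qv_def Qu_def Ru_def sel_pv_def[symmetric] sel_pu_def[symmetric] sel_ru_def[symmetric] by blast
  obtain \<gamma> where \<gamma>: "\<gamma>' = ap \<gamma>" using \<gamma>' by (auto simp: \<Gamma>_def)
  define tup where "tup s v u x y = (\<lambda>i. if i < n then (fst (s i :: 's1 \<times> 's2), snd (s i), v i :: 'v, u i :: 'u, x i :: 'x, y i :: 'y) else undefined)" for s v u x y
  let ?d = "\<lambda>s1 s2. snd (\<phi> (sel_pv n T qv s1 s2))"
  let ?f = "\<lambda>w s1 t. let v = fst (\<phi> (sel_re ee n T re s1 t)); u = fst (\<psi> (sel_pu n qu s1 v w)) in (\<lambda>i. \<gamma> i (u i, s1 i, v i))"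
  let ?g = "\<lambda>y s2 t. snd (\<psi> (sel_ru n M ru y s2 (fst (\<phi> (sel_rd ed n T rd y s2 t)))))"
  have CHc: "CH (ap \<gamma> u s1 v) s1 s2 = Pi_pmf {..<n} undefined (\<lambda>i. ch (\<gamma> i (u i, s1 i, v i)) (s1 i) (s2 i))" for u s1 v s2
    unfolding CH_def ap_def by (rule Pi_pmf_cong) auto
  have "ennreal (error_prob n M p ch ?d ?f ?g) = emeasure (block_law n M p ch ?d ?f) {(w, s1, s2, y). ?g y s2 (?d s1 s2) \<noteq> w}"
    unfolding error_prob_eq[OF M] by (rule measure_pmf.emeasure_eq_measure[symmetric])
  also have "\<dots> = (\<integral>\<^sup>+w. (\<integral>\<^sup>+(s1, s2). emeasure (measure_pmf (CH (\<gamma>' (fst (\<psi> (sel_pu n qu s1 (fst (\<phi> (sel_re ee n T re s1 (snd (\<phi> (sel_pv n T qv s1 s2)))))) w))) s1 (fst (\<phi> (sel_re ee n T re s1 (snd (\<phi> (sel_pv n T qv s1 s2))))))) s1 s2))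
       {y. snd (\<psi> (sel_ru n M ru y s2 (fst (\<phi> (sel_rd ed n T rd y s2 (snd (\<phi> (sel_pv n T qv s1 s2)))))))) \<noteq> w} \<partial>measure_pmf pn) \<partial>measure_pmf (pmf_of_set M))"
    unfolding block_law_def pn_def \<gamma> CHc Let_def
    by (simp add: emeasure_bind_pmf nn_integral_indicator[symmetric] indicator_def del: nn_integral_indicator)
  also note le
  also have "(\<integral>\<^sup>+w. (\<integral>\<^sup>+(s1, s2). (\<integral>\<^sup>+(v, t). ennreal (mismatch (sel_pv n T qv s1 s2) (sel_re ee n T re s1 t) (v, t)) +
       (\<integral>\<^sup>+u. (\<integral>\<^sup>+x. (\<integral>\<^sup>+y. ennreal (mismatch (sel_pv n T qv s1 s2) (sel_rd ed n T rd y s2 t) (v, t)) + ennreal (mismatch (sel_pu n qu s1 v w) (sel_ru n M ru y s2 v) (u, w))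
          \<partial>measure_pmf (CH x s1 s2)) \<partial>measure_pmf (QX u s1 v)) \<partial>measure_pmf (Qu s1 v))
        \<partial>measure_pmf (sel_pv n T qv s1 s2)) \<partial>measure_pmf pn) \<partial>measure_pmf (pmf_of_set M)) =
     (\<integral>\<^sup>+w. (\<integral>\<^sup>+s. (\<integral>\<^sup>+v. (\<integral>\<^sup>+t. (\<integral>\<^sup>+u. (\<integral>\<^sup>+x. (\<integral>\<^sup>+y.
       ennreal (mismatch (sel_pv n T qv (\<lambda>i. fst (s i)) (\<lambda>i. snd (s i))) (sel_re ee n T re (\<lambda>i. fst (s i)) t) (v, t)) +
      (ennreal (mismatch (sel_pv n T qv (\<lambda>i. fst (s i)) (\<lambda>i. snd (s i))) (sel_rd ed n T rd y (\<lambda>i. snd (s i)) t) (v, t)) +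
       ennreal (mismatch (sel_pu n qu (\<lambda>i. fst (s i)) v w) (sel_ru n M ru y (\<lambda>i. snd (s i)) v) (u, w)))
          \<partial>measure_pmf (CH x (\<lambda>i. fst (s i)) (\<lambda>i. snd (s i)))) \<partial>measure_pmf (QX u (\<lambda>i. fst (s i)) v)) \<partial>measure_pmf (Qu (\<lambda>i. fst (s i)) v))
        \<partial>measure_pmf (pmf_of_set T)) \<partial>measure_pmf (Qv (\<lambda>i. fst (s i)) (\<lambda>i. snd (s i)))) \<partial>measure_pmf (Pi_pmf {..<n} undefined (\<lambda>_. p))) \<partial>measure_pmf (pmf_of_set M))"
    unfolding pn_def sel_pv_def Qv_def[symmetric] by (simp add: nn_integral_pair_pmf' nn_integral_add)
  also have "\<dots> \<le> (\<integral>\<^sup>+w. (\<integral>\<^sup>+s. (\<integral>\<^sup>+v. (\<integral>\<^sup>+t. (\<integral>\<^sup>+u. (\<integral>\<^sup>+x. (\<integral>\<^sup>+y.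
       ennreal (Be n (tup s v u x y)) + (ennreal (Bd n (tup s v u x y)) + ennreal (Bu n (tup s v u x y)))
          \<partial>measure_pmf (CH x (\<lambda>i. fst (s i)) (\<lambda>i. snd (s i)))) \<partial>measure_pmf (QX u (\<lambda>i. fst (s i)) v)) \<partial>measure_pmf (Qu (\<lambda>i. fst (s i)) v))
        \<partial>measure_pmf (pmf_of_set T)) \<partial>measure_pmf (Qv (\<lambda>i. fst (s i)) (\<lambda>i. snd (s i)))) \<partial>measure_pmf (Pi_pmf {..<n} undefined (\<lambda>_. p))) \<partial>measure_pmf (pmf_of_set M))"
  proof (intro nn_integral_mono_AE AE_pmfI add_mono ennreal_leI)
    fix w s v t u x y
    assume "w \<in> set_pmf (pmf_of_set M)" and s: "s \<in> set_pmf (Pi_pmf {..<n} undefined (\<lambda>_. p))"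
      and v: "v \<in> set_pmf (Qv (\<lambda>i. fst (s i)) (\<lambda>i. snd (s i)))" and "t \<in> set_pmf (pmf_of_set T)"
      and u: "u \<in> set_pmf (Qu (\<lambda>i. fst (s i)) v)" and x: "x \<in> set_pmf (QX u (\<lambda>i. fst (s i)) v)"
      and y: "y \<in> set_pmf (CH x (\<lambda>i. fst (s i)) (\<lambda>i. snd (s i)))"
    then have w: "w \<in> M" and t: "t \<in> T" using M T by auto
    have sp: "(fst (s i), snd (s i)) \<in> set_pmf p" if "i < n" for i
      using s that by (subst (asm) set_Pi_pmf) (auto simp: PiE_dflt_def)
    have vp: "v i \<in> set_pmf (qv (fst (s i)) (snd (s i)))" if "i < n" for i
      using v that unfolding Qv_def by (subst (asm) set_Pi_pmf) (auto simp: PiE_dflt_def)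
    have up: "u i \<in> set_pmf (qu (fst (s i)) (v i))" if "i < n" for i
      using u that unfolding Qu_def by (subst (asm) set_Pi_pmf) (auto simp: PiE_dflt_def)
    have xp: "x i \<in> set_pmf (qx (u i) (fst (s i)) (v i))" if "i < n" for i
      using x that unfolding QX_def by (subst (asm) set_Pi_pmf) (auto simp: PiE_dflt_def)
    have yp: "y i \<in> set_pmf (ch (x i) (fst (s i)) (snd (s i)))" if "i < n" for i
      using y that unfolding CH_def by (subst (asm) set_Pi_pmf) (auto simp: PiE_dflt_def)
    have Jp: "(fst (s i), snd (s i), v i, u i, x i, y i) \<in> set_pmf J" if "i < n" for i
      using sp[OF that] vp[OF that] up[OF that] xp[OF that] yp[OF that] by (simp add: set_pmf_iff pmf_aux_law)
    show "mismatch (sel_pv n T qv (\<lambda>i. fst (s i)) (\<lambda>i. snd (s i))) (sel_re ee n T re (\<lambda>i. fst (s i)) t) (v, t) \<le> Be n (tup s v u x y)"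
    proof (cases ee)
      case True
      have "Pi_pmf {..<n} undefined (\<lambda>i. qv (fst (s i)) (snd (s i))) = Pi_pmf {..<n} undefined (\<lambda>i. re (fst (s i)))"
        using ee[OF True sp] by (intro Pi_pmf_cong) auto
      then show ?thesis unfolding sel_pv_def sel_re_def mismatch_def Be_def using True by simp
    next
      case False
      have "mismatch (sel_pv n T qv (\<lambda>i. fst (s i)) (\<lambda>i. snd (s i))) (sel_re ee n T re (\<lambda>i. fst (s i)) t) (v, t) \<le>
        min 1 (2 * 2 powr (\<Sum>i<n. log 2 (pmf (qv (fst (s i)) (snd (s i))) (v i) / pmf (re (fst (s i))) (v i)) + - R'))"
        unfolding sel_pv_def sel_re_def T_def if_not_P[OF False]
        by (rule mismatch_description[OF R(2) v[unfolded Qv_def] pe[OF False sp vp] t[unfolded T_def]])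
      then show ?thesis unfolding Be_def Ze_def tup_def if_not_P[OF False] by simp
    qed
    show "mismatch (sel_pv n T qv (\<lambda>i. fst (s i)) (\<lambda>i. snd (s i))) (sel_rd ed n T rd y (\<lambda>i. snd (s i)) t) (v, t) \<le> Bd n (tup s v u x y)"
    proof (cases ed)
      case True
      have "Pi_pmf {..<n} undefined (\<lambda>i. qv (fst (s i)) (snd (s i))) = Pi_pmf {..<n} undefined (\<lambda>i. rd (y i) (snd (s i)))"
        using ed[OF True sp] by (intro Pi_pmf_cong) auto
      then show ?thesis unfolding sel_pv_def sel_rd_def mismatch_def Bd_def using True by simp
    next
      case False
      have "mismatch (sel_pv n T qv (\<lambda>i. fst (s i)) (\<lambda>i. snd (s i))) (sel_rd ed n T rd y (\<lambda>i. snd (s i)) t) (v, t) \<le>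
        min 1 (2 * 2 powr (\<Sum>i<n. log 2 (pmf (qv (fst (s i)) (snd (s i))) (v i) / pmf (rd (y i) (snd (s i))) (v i)) + - R'))"
        unfolding sel_pv_def sel_rd_def T_def if_not_P[OF False]
        by (rule mismatch_description[OF R(2) v[unfolded Qv_def] pd[OF False Jp] t[unfolded T_def]])
      then show ?thesis unfolding Bd_def Zd_def tup_def if_not_P[OF False] by simp
    qed
    have "mismatch (sel_pu n qu (\<lambda>i. fst (s i)) v w) (sel_ru n M ru y (\<lambda>i. snd (s i)) v) (u, w) \<le>
       min 1 (1 * 2 powr (\<Sum>i<n. log 2 (pmf (qu (fst (s i)) (v i)) (u i) / pmf (ru (y i) (snd (s i)) (v i)) (u i)) + R))"
      unfolding sel_pu_def sel_ru_def M_def by (rule mismatch_message[OF R(1) u[unfolded Qu_def] pu[OF Jp] w[unfolded M_def]])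
    then show "mismatch (sel_pu n qu (\<lambda>i. fst (s i)) v w) (sel_ru n M ru y (\<lambda>i. snd (s i)) v) (u, w) \<le> Bu n (tup s v u x y)"
      by (simp add: Bu_def tup_def Zu_def)
  qed
  also have "\<dots> = bound n"
    unfolding bound_def nn_integral_Pi_aux_law tup_def Qv_def Qu_def QX_def CH_def by simp
  finally have "ennreal (error_prob n M p ch ?d ?f ?g) \<le> bound n" .
  then show ?thesis using \<phi> \<psi> by (intro exI[of _ \<phi>] exI[of _ \<psi>] exI[of _ \<gamma>] conjI) (auto simp: mem_Times_iff)
qed

end

section \<open>Mean logarithmic likelihood ratios as mutual informations\<close>

lemma kernel_ratio:
  assumes fin: "finite (set_pmf P)" and ker: "map_pmf (\<lambda>\<omega>. (C \<omega>, A \<omega>)) P = bind_pmf (map_pmf C P) (\<lambda>c. map_pmf (Pair c) (\<kappa> c))"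
  shows "measure_pmf.expectation P (\<lambda>\<omega>. log 2 (pmf (\<kappa> (C \<omega>)) (A \<omega>))) = ent P C - ent P (\<lambda>\<omega>. (C \<omega>, A \<omega>))"
    and "\<omega> \<in> set_pmf P \<Longrightarrow> 0 < pmf (\<kappa> (C \<omega>)) (A \<omega>)"
proof -
  have eq: "pr P (\<lambda>\<omega>. (C \<omega>, A \<omega>)) \<omega> = pr P C \<omega> * pmf (\<kappa> (C \<omega>)) (A \<omega>)" for \<omega>
  proof -
    have "pr P (\<lambda>\<omega>. (C \<omega>, A \<omega>)) \<omega> = pmf (bind_pmf (map_pmf C P) (\<lambda>c. map_pmf (Pair c) (\<kappa> c))) (C \<omega>, A \<omega>)"
      unfolding pr_pmf_map ker ..
    also have "\<dots> = pmf (map_pmf C P) (C \<omega>) * pmf (map_pmf (Pair (C \<omega>)) (\<kappa> (C \<omega>))) (C \<omega>, A \<omega>)"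
      by (rule pmf_bind_determined) auto
    also have "pmf (map_pmf (Pair (C \<omega>)) (\<kappa> (C \<omega>))) (C \<omega>, A \<omega>) = pmf (\<kappa> (C \<omega>)) (A \<omega>)"
      by (rule pmf_map_inj') (simp add: inj_on_def)
    finally show ?thesis by (simp add: pr_pmf_map)
  qed
  have pos: "0 < pmf (\<kappa> (C \<omega>)) (A \<omega>)" if "\<omega> \<in> set_pmf P" for \<omega>
    using pr_pos[OF that, of C] pr_pos[OF that, of "\<lambda>\<omega>. (C \<omega>, A \<omega>)"] unfolding eq by (simp add: zero_less_mult_iff)
  then show "\<omega> \<in> set_pmf P \<Longrightarrow> 0 < pmf (\<kappa> (C \<omega>)) (A \<omega>)" .
  have "ent P C - ent P (\<lambda>\<omega>. (C \<omega>, A \<omega>)) =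
    measure_pmf.expectation P (\<lambda>\<omega>. - log 2 (pr P C \<omega>) - - log 2 (pr P (\<lambda>\<omega>. (C \<omega>, A \<omega>)) \<omega>))"
    unfolding ent_def by (subst Bochner_Integration.integral_diff) (auto intro!: integrable_measure_pmf_finite fin)
  also have "\<dots> = measure_pmf.expectation P (\<lambda>\<omega>. log 2 (pmf (\<kappa> (C \<omega>)) (A \<omega>)))"
  proof (rule expectation_cong_pmf)
    fix \<omega> assume w: "\<omega> \<in> set_pmf P"
    show "- log 2 (pr P C \<omega>) - - log 2 (pr P (\<lambda>\<omega>. (C \<omega>, A \<omega>)) \<omega>) = log 2 (pmf (\<kappa> (C \<omega>)) (A \<omega>))"
      using pr_pos[OF w, of C] pos[OF w] by (simp add: eq log_mult)
  qed
  finally show "measure_pmf.expectation P (\<lambda>\<omega>. log 2 (pmf (\<kappa> (C \<omega>)) (A \<omega>))) = ent P C - ent P (\<lambda>\<omega>. (C \<omega>, A \<omega>))" ..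
qed

text \<open>The mean is H(A|D) - H(A|C), where \<kappa> is the true kernel given \<open>C\<close>
  and the competing law is the conditional law given \<open>D\<close>. Values that occur have
  positive probability under both.\<close>

lemma kernel_divergence:
  assumes fin: "finite (set_pmf P)" and ker: "map_pmf (\<lambda>\<omega>. (C \<omega>, A \<omega>)) P = bind_pmf (map_pmf C P) (\<lambda>c. map_pmf (Pair c) (\<kappa> c))"
  shows "measure_pmf.expectation P (\<lambda>\<omega>. log 2 (pmf (\<kappa> (C \<omega>)) (A \<omega>) / pmf (cond_law P A D (D \<omega>)) (A \<omega>))) =
     ent P C - ent P (\<lambda>\<omega>. (C \<omega>, A \<omega>)) - ent P D + ent P (\<lambda>\<omega>. (D \<omega>, A \<omega>))"
    and "\<omega> \<in> set_pmf P \<Longrightarrow> A \<omega> \<in> set_pmf (cond_law P A D (D \<omega>))"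
proof -
  note k = kernel_ratio[OF fin ker] and c = kernel_ratio[OF fin disintegrate[of D A P]]
  show "\<omega> \<in> set_pmf P \<Longrightarrow> A \<omega> \<in> set_pmf (cond_law P A D (D \<omega>))" using c(2) by (simp add: pmf_positive_iff)
  have "measure_pmf.expectation P (\<lambda>\<omega>. log 2 (pmf (\<kappa> (C \<omega>)) (A \<omega>) / pmf (cond_law P A D (D \<omega>)) (A \<omega>))) =
    measure_pmf.expectation P (\<lambda>\<omega>. log 2 (pmf (\<kappa> (C \<omega>)) (A \<omega>)) - log 2 (pmf (cond_law P A D (D \<omega>)) (A \<omega>)))"
  proof (rule expectation_cong_pmf)
    fix \<omega> assume w: "\<omega> \<in> set_pmf P"
    show "log 2 (pmf (\<kappa> (C \<omega>)) (A \<omega>) / pmf (cond_law P A D (D \<omega>)) (A \<omega>)) = log 2 (pmf (\<kappa> (C \<omega>)) (A \<omega>)) - log 2 (pmf (cond_law P A D (D \<omega>)) (A \<omega>))"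
      using k(2)[OF w] c(2)[OF w] by (simp add: log_divide)
  qed
  also have "\<dots> = measure_pmf.expectation P (\<lambda>\<omega>. log 2 (pmf (\<kappa> (C \<omega>)) (A \<omega>))) -
      measure_pmf.expectation P (\<lambda>\<omega>. log 2 (pmf (cond_law P A D (D \<omega>)) (A \<omega>)))"
    by (rule Bochner_Integration.integral_diff) (auto intro!: integrable_measure_pmf_finite fin)
  finally show "measure_pmf.expectation P (\<lambda>\<omega>. log 2 (pmf (\<kappa> (C \<omega>)) (A \<omega>) / pmf (cond_law P A D (D \<omega>)) (A \<omega>))) =
     ent P C - ent P (\<lambda>\<omega>. (C \<omega>, A \<omega>)) - ent P D + ent P (\<lambda>\<omega>. (D \<omega>, A \<omega>))"
    unfolding k(1) c(1) by simp
qed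

lemma aux_law_kernel_u:
  fixes p ch qv qu qx
  defines "J \<equiv> aux_law p ch qv (\<lambda>s1 s2. qu s1) qx"
  shows "map_pmf (\<lambda>\<omega>. ((\<lambda>(s1,s2,v,u,x,y). (s1,v)) \<omega>, (\<lambda>(s1,s2,v,u,x,y). u) \<omega>)) J =
    bind_pmf (map_pmf (\<lambda>(s1,s2,v,u,x,y). (s1,v)) J) (\<lambda>c. map_pmf (Pair c) ((\<lambda>(s1,v). qu s1 v) c))"
  unfolding J_def aux_law_def by (simp add: map_pmf_def bind_assoc_pmf bind_return_pmf split_def bind_pmf_const)

lemma aux_law_kernel_v:
  fixes p ch qv qu qx
  assumes qv: "\<And>s1 s2. qv s1 s2 = \<kappa> (\<alpha> s1 s2)"
  defines "J \<equiv> aux_law p ch qv qu qx"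
  shows "map_pmf (\<lambda>\<omega>. ((\<lambda>(s1,s2,v,u,x,y). \<alpha> s1 s2) \<omega>, (\<lambda>(s1,s2,v,u,x,y). v) \<omega>)) J =
    bind_pmf (map_pmf (\<lambda>(s1,s2,v,u,x,y). \<alpha> s1 s2) J) (\<lambda>c. map_pmf (Pair c) (\<kappa> c))"
  unfolding J_def aux_law_def by (simp add: map_pmf_def bind_assoc_pmf bind_return_pmf split_def bind_pmf_const qv)

text \<open>The mean is H(U|Y,S2,V) - H(U|S1,V). The race between the codeword law and the posterior
  of the decoder therefore succeeds at every rate below \<open>eRate\<close>.\<close>

lemma
  fixes p ch qv qu qx
  defines "J \<equiv> aux_law p ch qv (\<lambda>s1 s2. qu s1) qx"
  defines "ru \<equiv> \<lambda>y s2 v. cond_law J (\<lambda>(s1,s2,v,u,x,y). u) (\<lambda>(s1,s2,v,u,x,y). (y,s2,v)) (y,s2,v)"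
  assumes fin: "finite (set_pmf J)"
  shows divergence_u: "measure_pmf.expectation J (\<lambda>(s1,s2,v,u,x,y). log 2 (pmf (qu s1 v) u / pmf (ru y s2 v) u)) = - eRate J"
    and support_u: "(s1,s2,v,u,x,y) \<in> set_pmf J \<Longrightarrow> u \<in> set_pmf (ru y s2 v)"
proof -
  let ?C = "\<lambda>(s1,s2,v,u,x,y). (s1,v)" and ?A = "\<lambda>(s1,s2,v,u,x,y). u" and ?D = "\<lambda>(s1,s2,v,u,x,y). (y,s2,v)"
  note k = kernel_divergence[OF fin aux_law_kernel_u[of p ch qv qu qx, folded J_def], where D="?D"]
  show "(s1,s2,v,u,x,y) \<in> set_pmf J \<Longrightarrow> u \<in> set_pmf (ru y s2 v)"
    using k(2)[where \<omega>="(s1,s2,v,u,x,y)"] by (simp add: ru_def)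
  have "measure_pmf.expectation J (\<lambda>(s1,s2,v,u,x,y). log 2 (pmf (qu s1 v) u / pmf (ru y s2 v) u)) =
    measure_pmf.expectation J (\<lambda>\<omega>. log 2 (pmf ((\<lambda>(s1,v). qu s1 v) (?C \<omega>)) (?A \<omega>) / pmf (cond_law J ?A ?D (?D \<omega>)) (?A \<omega>)))"
    by (rule expectation_cong_pmf) (auto simp: ru_def)
  also have "\<dots> = ent J ?C - ent J (\<lambda>\<omega>. (?C \<omega>, ?A \<omega>)) - ent J ?D + ent J (\<lambda>\<omega>. (?D \<omega>, ?A \<omega>))" by (rule k(1))
  also have "ent J (\<lambda>\<omega>. (?C \<omega>, ?A \<omega>)) = ent J (\<lambda>(s1,s2,v,u,x,y). (u,s1,v))" by (rule ent_cong) auto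
  also have "ent J (\<lambda>\<omega>. (?D \<omega>, ?A \<omega>)) = ent J (\<lambda>(s1,s2,v,u,x,y). (u,y,s2,v))" by (rule ent_cong) auto
  finally show "measure_pmf.expectation J (\<lambda>(s1,s2,v,u,x,y). log 2 (pmf (qu s1 v) u / pmf (ru y s2 v) u)) = - eRate J"
    unfolding eRate_def by linarith
qed

text \<open>For the guess of the decoder in Case 1 the mean is H(V|Y,S2) - H(V|S1), which is the
  constraint of this case.\<close>

lemma
  fixes p ch qv qu qx
  assumes qv: "\<And>s1 s2 t2. qv s1 s2 = qv s1 t2"
  defines "J \<equiv> aux_law p ch qv qu qx"
  defines "rd \<equiv> \<lambda>y s2. cond_law J (\<lambda>(s1,s2,v,u,x,y). v) (\<lambda>(s1,s2,v,u,x,y). (y,s2)) (y,s2)"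
  assumes fin: "finite (set_pmf J)"
  shows divergence_1: "measure_pmf.expectation J (\<lambda>(s1,s2,v,u,x,y). log 2 (pmf (qv s1 s2) v / pmf (rd y s2) v)) = eC1 J"
    and support_1: "(s1,s2,v,u,x,y) \<in> set_pmf J \<Longrightarrow> v \<in> set_pmf (rd y s2)"
proof -
  let ?C = "\<lambda>(s1,s2,v,u,x,y). s1" and ?A = "\<lambda>(s1,s2,v,u,x,y). v" and ?D = "\<lambda>(s1,s2,v,u,x,y). (y,s2)"
  let ?k = "\<lambda>s1. qv s1 undefined"
  have "qv s1 s2 = ?k ((\<lambda>s1 s2. s1) s1 s2)" for s1 s2 by (rule qv)
  from aux_law_kernel_v[of qv ?k "\<lambda>s1 s2. s1" p ch qu qx, OF this]
  have "map_pmf (\<lambda>\<omega>. (?C \<omega>, ?A \<omega>)) J = bind_pmf (map_pmf ?C J) (\<lambda>c. map_pmf (Pair c) (?k c))"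
    by (simp only: J_def)
  note k = kernel_divergence[OF fin this, where D="?D"]
  show "(s1,s2,v,u,x,y) \<in> set_pmf J \<Longrightarrow> v \<in> set_pmf (rd y s2)"
    using k(2)[where \<omega>="(s1,s2,v,u,x,y)"] by (simp add: rd_def)
  have "measure_pmf.expectation J (\<lambda>(s1,s2,v,u,x,y). log 2 (pmf (qv s1 s2) v / pmf (rd y s2) v)) =
    measure_pmf.expectation J (\<lambda>\<omega>. log 2 (pmf (?k (?C \<omega>)) (?A \<omega>) / pmf (cond_law J ?A ?D (?D \<omega>)) (?A \<omega>)))"
  proof (rule expectation_cong_pmf, clarsimp simp: rd_def)
    fix s1 s2 v y show "log 2 (pmf (qv s1 s2) v / pmf (cond_law J ?A ?D (y, s2)) v) = log 2 (pmf (qv s1 undefined) v / pmf (cond_law J ?A ?D (y, s2)) v)"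
      by (subst qv[of s1 s2 undefined]) (rule refl)
  qed
  also have "\<dots> = ent J ?C - ent J (\<lambda>\<omega>. (?C \<omega>, ?A \<omega>)) - ent J ?D + ent J (\<lambda>\<omega>. (?D \<omega>, ?A \<omega>))" by (rule k(1))
  also have "ent J (\<lambda>\<omega>. (?C \<omega>, ?A \<omega>)) = ent J (\<lambda>(s1,s2,v,u,x,y). (s1,v))" by (rule ent_cong) auto
  also have "ent J (\<lambda>\<omega>. (?D \<omega>, ?A \<omega>)) = ent J (\<lambda>(s1,s2,v,u,x,y). (y,s2,v))" by (rule ent_cong) auto
  finally show "measure_pmf.expectation J (\<lambda>(s1,s2,v,u,x,y). log 2 (pmf (qv s1 s2) v / pmf (rd y s2) v)) = eC1 J"
    unfolding eC1_def by linarith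
qed

text \<open>For the guess of the encoder in Case 2 the mean is H(V|S1) - H(V|S1,S2), which is
  I(V;S2|S1).\<close>

lemma
  fixes p ch qv qu qx
  defines "J \<equiv> aux_law p ch qv qu qx"
  defines "re \<equiv> \<lambda>s1. cond_law J (\<lambda>(s1,s2,v,u,x,y). v) (\<lambda>(s1,s2,v,u,x,y). s1) s1"
  assumes fin: "finite (set_pmf J)"
  shows divergence_2: "measure_pmf.expectation J (\<lambda>(s1,s2,v,u,x,y). log 2 (pmf (qv s1 s2) v / pmf (re s1) v)) = eC2 J"
    and support_2: "(s1,s2,v,u,x,y) \<in> set_pmf J \<Longrightarrow> v \<in> set_pmf (re s1)"
proof -
  let ?C = "\<lambda>(s1,s2,v,u,x,y). (s1,s2)" and ?A = "\<lambda>(s1,s2,v,u,x,y). v" and ?D = "\<lambda>(s1,s2,v,u,x,y). s1"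
  let ?k = "\<lambda>(s1,s2). qv s1 s2"
  have "qv s1 s2 = ?k (s1, s2)" for s1 s2 by simp
  from aux_law_kernel_v[of qv ?k "\<lambda>s1 s2. (s1,s2)" p ch qu qx, OF this]
  have "map_pmf (\<lambda>\<omega>. (?C \<omega>, ?A \<omega>)) J = bind_pmf (map_pmf ?C J) (\<lambda>c. map_pmf (Pair c) (?k c))"
    by (simp only: J_def)
  note k = kernel_divergence[OF fin this, where D="?D"]
  show "(s1,s2,v,u,x,y) \<in> set_pmf J \<Longrightarrow> v \<in> set_pmf (re s1)"
    using k(2)[where \<omega>="(s1,s2,v,u,x,y)"] by (simp add: re_def)
  have "measure_pmf.expectation J (\<lambda>(s1,s2,v,u,x,y). log 2 (pmf (qv s1 s2) v / pmf (re s1) v)) =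
    measure_pmf.expectation J (\<lambda>\<omega>. log 2 (pmf (?k (?C \<omega>)) (?A \<omega>) / pmf (cond_law J ?A ?D (?D \<omega>)) (?A \<omega>)))"
    by (rule expectation_cong_pmf) (auto simp: re_def)
  also have "\<dots> = ent J ?C - ent J (\<lambda>\<omega>. (?C \<omega>, ?A \<omega>)) - ent J ?D + ent J (\<lambda>\<omega>. (?D \<omega>, ?A \<omega>))" by (rule k(1))
  also have "ent J (\<lambda>\<omega>. (?C \<omega>, ?A \<omega>)) = ent J (\<lambda>(s1,s2,v,u,x,y). (s1,s2,v))" by (rule ent_cong) auto
  also have "ent J (\<lambda>\<omega>. (?D \<omega>, ?A \<omega>)) = ent J (\<lambda>(s1,s2,v,u,x,y). (s1,v))" by (rule ent_cong) auto
  finally show "measure_pmf.expectation J (\<lambda>(s1,s2,v,u,x,y). log 2 (pmf (qv s1 s2) v / pmf (re s1) v)) = eC2 J"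
    unfolding eC2_def by linarith
qed

text \<open>For an encoder that must guess without looking at \<open>S1\<close> the mean is H(V) -
  H(V|S2). Conditioning on the constant \<open>()\<close> expresses the plain law of
  \<open>V\<close>.\<close>

lemma
  fixes p ch qv qu qx
  assumes qv: "\<And>s1 s2 t1. qv s1 s2 = qv t1 s2"
  defines "J \<equiv> aux_law p ch qv qu qx"
  defines "re \<equiv> cond_law J (\<lambda>(s1,s2,v,u,x,y). v) (\<lambda>_. ()) ()"
  assumes fin: "finite (set_pmf J)"
  shows divergence_2C: "measure_pmf.expectation J (\<lambda>(s1,s2,v,u,x,y). log 2 (pmf (qv s1 s2) v / pmf re v)) = eC2C J"
    and support_2C: "(s1,s2,v,u,x,y) \<in> set_pmf J \<Longrightarrow> v \<in> set_pmf re"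
proof -
  let ?C = "\<lambda>(s1,s2,v,u,x,y). s2" and ?A = "\<lambda>(s1,s2,v,u,x,y). v" and ?D = "\<lambda>_. ()"
  let ?k = "qv undefined"
  have "qv s1 s2 = ?k ((\<lambda>s1 s2. s2) s1 s2)" for s1 s2 by (rule qv)
  from aux_law_kernel_v[of qv ?k "\<lambda>s1 s2. s2" p ch qu qx, OF this]
  have "map_pmf (\<lambda>\<omega>. (?C \<omega>, ?A \<omega>)) J = bind_pmf (map_pmf ?C J) (\<lambda>c. map_pmf (Pair c) (?k c))"
    by (simp only: J_def)
  note k = kernel_divergence[OF fin this, where D="?D"]
  show "(s1,s2,v,u,x,y) \<in> set_pmf J \<Longrightarrow> v \<in> set_pmf re"
    using k(2)[where \<omega>="(s1,s2,v,u,x,y)"] by (simp add: re_def)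
  have "measure_pmf.expectation J (\<lambda>(s1,s2,v,u,x,y). log 2 (pmf (qv s1 s2) v / pmf re v)) =
    measure_pmf.expectation J (\<lambda>\<omega>. log 2 (pmf (?k (?C \<omega>)) (?A \<omega>) / pmf (cond_law J ?A ?D (?D \<omega>)) (?A \<omega>)))"
  proof (rule expectation_cong_pmf, clarsimp simp: re_def)
    fix s1 s2 v show "log 2 (pmf (qv s1 s2) v / pmf (cond_law J ?A ?D ()) v) = log 2 (pmf (qv undefined s2) v / pmf (cond_law J ?A ?D ()) v)"
      by (subst qv[of s1 s2 undefined]) (rule refl)
  qed
  also have "\<dots> = ent J ?C - ent J (\<lambda>\<omega>. (?C \<omega>, ?A \<omega>)) - ent J ?D + ent J (\<lambda>\<omega>. (?D \<omega>, ?A \<omega>))" by (rule k(1))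
  also have "ent J (\<lambda>\<omega>. (?C \<omega>, ?A \<omega>)) = ent J (\<lambda>(s1,s2,v,u,x,y). (s2,v))" by (rule ent_cong) auto
  also have "ent J (\<lambda>\<omega>. (?D \<omega>, ?A \<omega>)) = ent J ?A" by (rule ent_cong) auto
  also have "ent J ?D = 0" by (rule ent_const) simp
  finally show "measure_pmf.expectation J (\<lambda>(s1,s2,v,u,x,y). log 2 (pmf (qv s1 s2) v / pmf re v)) = eC2C J"
    unfolding eC2C_def by linarith
qed

lemma pmf_eq_on_support:
  assumes "finite (set_pmf q)" "\<And>v. v \<in> set_pmf q \<Longrightarrow> pmf r v = pmf q v"
  shows "r = q"
proof (rule pmf_eqI)
  have "measure_pmf.prob r (set_pmf q) = (\<Sum>v\<in>set_pmf q. pmf r v)" using assms(1) by (rule measure_measure_pmf_finite)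
  also have "\<dots> = 1" using assms by (simp add: sum_pmf_eq_1)
  finally have "set_pmf r \<subseteq> set_pmf q" by (simp add: measure_pmf.prob_eq_1 AE_measure_pmf_iff subset_eq)
  then show "pmf r v = pmf q v" for v
    using assms(2) by (cases "v \<in> set_pmf q") (auto simp: set_pmf_iff)
qed

text \<open>The case of equality in \<open>gibbs\<close>: the mean is a divergence, so if it is not
  positive, the ratio of the kernels is 1 wherever \<open>qv\<close> gives mass, for every pair of
  states that occurs. This settles description rate zero, where the constraint leaves no other
  possibility.\<close>

lemma kernel_eq_if_divergence_le_0:
  fixes p :: "('s1::finite \<times> 's2::finite) pmf" and ch :: "'x::finite \<Rightarrow> 's1 \<Rightarrow> 's2 \<Rightarrow> 'y::finite pmf"
    and qv re :: "'s1 \<Rightarrow> 's2 \<Rightarrow> 'v pmf" and qu :: "'s1 \<Rightarrow> 's2 \<Rightarrow> 'v \<Rightarrow> 'd pmf" and qx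
  defines "J \<equiv> aux_law p ch qv qu qx"
  assumes VL: "finite VL" "\<And>s1 s2. set_pmf (qv s1 s2) \<subseteq> VL" and fin: "finite (set_pmf J)"
    and supp: "\<And>s1 s2 v u x y. (s1,s2,v,u,x,y) \<in> set_pmf J \<Longrightarrow> v \<in> set_pmf (re s1 s2)"
    and div: "measure_pmf.expectation J (\<lambda>(s1,s2,v,u,x,y). log 2 (pmf (qv s1 s2) v / pmf (re s1 s2) v)) \<le> 0"
    and s: "(s1, s2) \<in> set_pmf p"
  shows "re s1 s2 = qv s1 s2"
proof -
  define r where "r = (\<lambda>(s1,s2,v). pmf (re s1 s2) v / pmf (qv s1 s2) v)"
  define g where "g = (\<lambda>(s1 :: 's1,s2 :: 's2,v :: 'v,u :: 'd,x :: 'x,y :: 'y). (s1,s2,v))"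
  have map_g: "map_pmf g J = bind_pmf p (\<lambda>(s1,s2). map_pmf (\<lambda>v. (s1,s2,v)) (qv s1 s2))"
    unfolding J_def g_def map_aux_law by (simp add: map_pmf_def split_def bind_pmf_const)
  have pmf_g: "pmf (map_pmf g J) (s1, s2, v) = pmf p (s1, s2) * pmf (qv s1 s2) v" for s1 s2 v
  proof -
    have "pmf (map_pmf g J) (s1, s2, v) = pmf p (s1, s2) * pmf ((\<lambda>(s1,s2). map_pmf (\<lambda>v. (s1,s2,v)) (qv s1 s2)) (s1, s2)) (s1, s2, v)"
      unfolding map_g by (rule pmf_bind_determined) auto
    also have "pmf ((\<lambda>(s1,s2). map_pmf (\<lambda>v. (s1,s2,v)) (qv s1 s2)) (s1, s2)) (s1, s2, v) = pmf (qv s1 s2) v"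
      by (simp only: prod.case) (rule pmf_map_inj', simp add: inj_on_def)
    finally show ?thesis .
  qed
  have pos: "0 < pmf (re s1 s2) v \<and> 0 < pmf (qv s1 s2) v" if "(s1,s2,v,u,x,y) \<in> set_pmf J" for s1 s2 v u x y
  proof
    show "0 < pmf (re s1 s2) v" using supp[OF that] by (simp add: pmf_positive_iff)
    have "v \<in> set_pmf (qv s1 s2)" using that unfolding J_def by (auto simp: set_pmf_iff pmf_aux_law)
    then show "0 < pmf (qv s1 s2) v" by (simp add: pmf_positive_iff)
  qed
  have rpos: "0 < r (g \<omega>)" if "\<omega> \<in> set_pmf J" for \<omega>
    using that pos by (cases \<omega>) (auto simp: r_def g_def)
  have "measure_pmf.expectation J (\<lambda>\<omega>. r (g \<omega>)) = measure_pmf.expectation (map_pmf g J) r" by simp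
  also have "\<dots> = (\<Sum>a\<in>UNIV \<times> UNIV \<times> VL. pmf (map_pmf g J) a * r a)"
    by (rule expectation_sum) (use VL(1) VL(2)[THEN subsetD] in \<open>auto simp: map_g\<close>)
  also have "\<dots> = (\<Sum>s1\<in>UNIV. \<Sum>s2\<in>UNIV. \<Sum>v\<in>VL. pmf (map_pmf g J) (s1,s2,v) * r (s1,s2,v))"
    by (simp add: sum.cartesian_product split_def)
  also have "\<dots> \<le> (\<Sum>s1\<in>UNIV. \<Sum>s2\<in>UNIV. pmf p (s1, s2) * 1)"
  proof (intro sum_mono)
    fix s1 s2
    have "(\<Sum>v\<in>VL. pmf (map_pmf g J) (s1,s2,v) * r (s1,s2,v)) \<le> (\<Sum>v\<in>VL. pmf p (s1, s2) * pmf (re s1 s2) v)"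
      by (intro sum_mono) (simp add: pmf_g r_def)
    also have "\<dots> = pmf p (s1, s2) * measure_pmf.prob (re s1 s2) VL"
      by (simp add: measure_measure_pmf_finite[OF VL(1)] sum_distrib_left)
    also have "\<dots> \<le> pmf p (s1, s2) * 1" by (intro mult_left_mono) auto
    finally show "(\<Sum>v\<in>VL. pmf (map_pmf g J) (s1,s2,v) * r (s1,s2,v)) \<le> pmf p (s1, s2) * 1" .
  qed
  also have "\<dots> = (\<Sum>s\<in>UNIV. pmf p s)" by (simp add: sum.cartesian_product split_def UNIV_Times_UNIV[symmetric] del: UNIV_Times_UNIV)
  also have "\<dots> = 1" by (rule sum_pmf_eq_1) auto
  finally have le: "measure_pmf.expectation J (\<lambda>\<omega>. r (g \<omega>)) \<le> 1" .
  have eq: "measure_pmf.expectation J (\<lambda>\<omega>. - log 2 (r (g \<omega>))) =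
    measure_pmf.expectation J (\<lambda>(s1,s2,v,u,x,y). log 2 (pmf (qv s1 s2) v / pmf (re s1 s2) v))"
  proof (rule expectation_cong_pmf)
    fix \<omega> assume w: "\<omega> \<in> set_pmf J"
    obtain s1 s2 v u x y where \<omega>: "\<omega> = (s1,s2,v,u,x,y)" by (cases \<omega>) auto
    show "- log 2 (r (g \<omega>)) = (\<lambda>(s1,s2,v,u,x,y). log 2 (pmf (qv s1 s2) v / pmf (re s1 s2) v)) \<omega>"
      using pos[of s1 s2 v u x y] w by (simp add: \<omega> r_def g_def log_divide)
  qed
  have zero: "measure_pmf.expectation J (\<lambda>\<omega>. - log 2 (r (g \<omega>))) = 0"
    using gibbs(1)[OF fin rpos le] div unfolding eq by simp
  note one = gibbs(2)[OF fin rpos le zero]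
  show ?thesis
  proof (rule pmf_eq_on_support)
    show "finite (set_pmf (qv s1 s2))" using VL finite_subset by blast
    fix v assume v: "v \<in> set_pmf (qv s1 s2)"
    have "pmf (map_pmf g J) (s1, s2, v) \<noteq> 0" using s v by (simp add: set_pmf_iff pmf_g)
    then have "(s1, s2, v) \<in> set_pmf (map_pmf g J)" unfolding set_pmf_iff .
    then obtain \<omega> where "\<omega> \<in> set_pmf J" "g \<omega> = (s1, s2, v)" by auto
    then have "r (s1, s2, v) = 1" using one by metis
    then show "pmf (re s1 s2) v = pmf (qv s1 s2) v" by (auto simp: r_def divide_eq_1_iff)
  qed
qed

section \<open>Codes extracted from a scheme\<close>

context scheme
begin

definition "code_error n \<phi> \<psi> \<gamma> = error_prob n (index_set n R) p ch (\<lambda>s1 s2. snd (\<phi> (sel_pv n (index_set n R') qv s1 s2)))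
      (\<lambda>w s1 t. let v = fst (\<phi> (sel_re ee n (index_set n R') re s1 t)); u = fst (\<psi> (sel_pu n qu s1 v w)) in (\<lambda>i. \<gamma> i (u i, s1 i, v i)))
      (\<lambda>y s2 t. snd (\<psi> (sel_ru n (index_set n R) ru y s2 (fst (\<phi> (sel_rd ed n (index_set n R') rd y s2 t))))))"
  for n \<phi> \<psi> and \<gamma> :: "nat \<Rightarrow> 'u \<times> 's1 \<times> 'v \<Rightarrow> 'x"

lemma vanishing_error_codes:
  obtains \<phi> \<psi> \<gamma> where "\<forall>n P. snd (\<phi> n P) \<in> index_set n R'" "\<forall>n P. snd (\<psi> n P) \<in> index_set n R"
    "(\<lambda>n. code_error n (\<phi> n) (\<psi> n) (\<gamma> n)) \<longlonglongrightarrow> 0"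
proof -
  have "\<forall>n. \<exists>\<phi> \<psi> \<gamma>. (\<forall>P. snd (\<phi> P) \<in> index_set n R') \<and> (\<forall>P. snd (\<psi> P) \<in> index_set n R) \<and> ennreal (code_error n \<phi> \<psi> \<gamma>) \<le> bound n"
    unfolding code_error_def by (intro allI block_code)
  from choice[OF this] obtain \<phi> where "\<forall>n. \<exists>\<psi> \<gamma>. (\<forall>P. snd (\<phi> n P) \<in> index_set n R') \<and> (\<forall>P. snd (\<psi> P) \<in> index_set n R) \<and> ennreal (code_error n (\<phi> n) \<psi> \<gamma>) \<le> bound n"
    by blast
  from choice[OF this] obtain \<psi> where "\<forall>n. \<exists>\<gamma>. (\<forall>P. snd (\<phi> n P) \<in> index_set n R') \<and> (\<forall>P. snd (\<psi> n P) \<in> index_set n R) \<and> ennreal (code_error n (\<phi> n) (\<psi> n) \<gamma>) \<le> bound n"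
    by blast
  from choice[OF this] obtain \<gamma> where c: "\<forall>n. (\<forall>P. snd (\<phi> n P) \<in> index_set n R') \<and> (\<forall>P. snd (\<psi> n P) \<in> index_set n R) \<and> ennreal (code_error n (\<phi> n) (\<psi> n) (\<gamma> n)) \<le> bound n"
    by blast
  then have le: "ennreal (code_error n (\<phi> n) (\<psi> n) (\<gamma> n)) \<le> bound n" for n by blast
  have nn: "0 \<le> code_error n (\<phi> n) (\<psi> n) (\<gamma> n)" for n unfolding code_error_def error_prob_def
    by (intro divide_nonneg_nonneg sum_nonneg) (auto simp: cond_prob_def)
  have "(\<lambda>n. ennreal (code_error n (\<phi> n) (\<psi> n) (\<gamma> n))) \<longlonglongrightarrow> 0"
    by (rule tendsto_sandwich[OF _ _ tendsto_const bound_limit]) (auto intro!: always_eventually le)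
  then have "(\<lambda>n. code_error n (\<phi> n) (\<psi> n) (\<gamma> n)) \<longlonglongrightarrow> 0" using nn by (simp add: tendsto_ennreal_iff[where x=0, simplified])
  then show ?thesis using c by (intro that) auto
qed

lemma scheme_achievable1:
  assumes qv: "\<And>s1 s2 t2. qv s1 s2 = qv s1 t2"
  shows "achievable1 p ch R R'"
proof -
  obtain \<phi> \<psi> \<gamma> where \<phi>: "\<forall>n P. snd (\<phi> n P) \<in> index_set n R'" and \<psi>: "\<forall>n P. snd (\<psi> n P) \<in> index_set n R" and
    lim: "(\<lambda>n. code_error n (\<phi> n) (\<psi> n) (\<gamma> n)) \<longlonglongrightarrow> 0"
    by (rule vanishing_error_codes)
  \<comment> \<open>The law of the description ignores the second states, so the side information
    encoder may insert any sequence for them.\<close>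
  define fv where "fv n s = snd (\<phi> n (sel_pv n (index_set n R') qv s (\<lambda>_. undefined)))" for n s
  have fv: "snd (\<phi> n (sel_pv n (index_set n R') qv s1 s2)) = fv n s1" for n s1 s2
  proof -
    have "(\<lambda>i. qv (s1 i) (s2 i)) = (\<lambda>i. qv (s1 i) undefined)" by (rule ext) (rule qv)
    then show ?thesis unfolding fv_def sel_pv_def by (simp only:)
  qed
  have "fv n s \<in> index_set n R'" for n s using \<phi> by (simp add: fv_def)
  then show ?thesis unfolding achievable1_def using R(1) \<psi> lim unfolding code_error_def fv by (intro conjI exI) auto
qed

text \<open>In the causal case neither the guess of the description nor the codeword law looks at
  the first states. The blocks of \<open>V\<close> and \<open>U\<close> are therefore selected in
  advance, and the first state enters only through the table of the current position.\<close>

lemma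
  assumes qv: "\<And>s1 t1 s2. qv s1 s2 = qv t1 s2"
  shows scheme_achievable2: "achievable2 p ch R R'"
    and scheme_achievable2C: "(\<And>s1 t1. re s1 = re t1) \<Longrightarrow> (\<And>s1 t1. qu s1 = qu t1) \<Longrightarrow> achievable2C p ch R R'"
proof -
  obtain \<phi> \<psi> \<gamma> where \<phi>: "\<forall>n P. snd (\<phi> n P) \<in> index_set n R'" and \<psi>: "\<forall>n P. snd (\<psi> n P) \<in> index_set n R" and
    lim: "(\<lambda>n. code_error n (\<phi> n) (\<psi> n) (\<gamma> n)) \<longlonglongrightarrow> 0"
    by (rule vanishing_error_codes)
  define fv where "fv n s = snd (\<phi> n (sel_pv n (index_set n R') qv (\<lambda>_. undefined) s))" for n s
  have fv: "snd (\<phi> n (sel_pv n (index_set n R') qv s1 s2)) = fv n s2" for n s1 s2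
  proof -
    have "(\<lambda>i. qv (s1 i) (s2 i)) = (\<lambda>i. qv undefined (s2 i))" by (rule ext) (rule qv)
    then show ?thesis unfolding fv_def sel_pv_def by (simp only:)
  qed
  have fvi: "fv n s \<in> index_set n R'" for n s using \<phi> by (simp add: fv_def)
  then show "achievable2 p ch R R'" unfolding achievable2_def using R(1) \<psi> lim unfolding code_error_def fv by (intro conjI exI) auto
  assume re: "\<And>s1 t1. re s1 = re t1" and qu: "\<And>s1 t1. qu s1 = qu t1"
  define V where "V n t = fst (\<phi> n (sel_re ee n (index_set n R') re (\<lambda>_. undefined) t))" for n t
  define U where "U n v w = fst (\<psi> n (sel_pu n qu (\<lambda>_. undefined) v w))" for n v w
  have V: "fst (\<phi> n (sel_re ee n (index_set n R') re s1 t)) = V n t" for n s1 t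
  proof -
    have "(\<lambda>i. re (s1 i)) = (\<lambda>i :: nat. re undefined)" by (rule ext) (rule re)
    then show ?thesis unfolding V_def sel_re_def by (simp only:)
  qed
  have U: "fst (\<psi> n (sel_pu n qu s1 v w)) = U n v w" for n s1 v w
  proof -
    have "qu (s1 i) (v i) = qu undefined (v i)" for i :: nat by (rule fun_cong) (rule qu)
    then have "(\<lambda>i. qu (s1 i) (v i)) = (\<lambda>i. qu undefined (v i))" by (rule ext)
    then show ?thesis unfolding U_def sel_pu_def by (simp only:)
  qed
  define f where "f n i w s t = \<gamma> n i (U n (V n t) w i, s i, V n t i)" for n i w s t
  have f: "\<gamma> n i (U n (V n t) w i, s1 i, V n t i) = f n i w (restrict s1 {..i}) t" for n i w s1 t by (simp add: f_def)
  have lim': "(\<lambda>n. error_prob n (index_set n R) p ch (\<lambda>s1 s2. fv n s2)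
      (\<lambda>w s1 t i. f n i w (restrict s1 {..i}) t)
      (\<lambda>y s2 t. snd (\<psi> n (sel_ru n (index_set n R) ru y s2 (fst (\<phi> n (sel_rd ed n (index_set n R') rd y s2 t))))))) \<longlonglongrightarrow> 0"
    using lim unfolding code_error_def fv V U Let_def f .
  show "achievable2C p ch R R'" unfolding achievable2C_def
    by (intro conjI R(1) exI[of _ fv] exI[of _ f] exI[of _ "\<lambda>n y s2 t. snd (\<psi> n (sel_ru n (index_set n R) ru y s2 (fst (\<phi> n (sel_rd ed n (index_set n R') rd y s2 t)))))"])
      (use fvi \<psi> lim' in auto)
qed

end

text \<open>The junk value of \<open>cond_law\<close> is the reason why \<open>undefined\<close> is
  added to the alphabets of the guessing laws.\<close>

lemma set_cond_law: "set_pmf (cond_law P A C c) \<subseteq> insert undefined (A ` set_pmf P)"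
proof (cases "c \<in> C ` set_pmf P")
  case True
  then have "set_pmf (cond_pmf P {\<omega>. C \<omega> = c}) = set_pmf P \<inter> {\<omega>. C \<omega> = c}" by (intro set_cond_pmf) auto
  then show ?thesis using True by (auto simp: cond_law_def)
qed (simp add: cond_law_def)

lemma trivial_law:
  fixes p :: "('s1 \<times> 's2) pmf" and ch :: "'x \<Rightarrow> 's1 \<Rightarrow> 's2 \<Rightarrow> 'y pmf" and a :: 'v and b :: 'u and qx
  defines "P \<equiv> aux_law p ch (\<lambda>_ _. return_pmf a) (\<lambda>_ _ _. return_pmf b) qx"
  shows "eRate P = 0" "eC1 P = 0" "eC2 P = 0" "eC2C P = 0"
proof -
  have s: "v = a \<and> u = b" if "(s1,s2,v,u,x,y) \<in> set_pmf P" for s1 s2 v u x y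
    using set_aux_law_subset[of "\<lambda>_ _. return_pmf a" "{a}" "\<lambda>_ _ _. return_pmf b" "\<lambda>_. {b}", OF _ _ that[unfolded P_def]] by simp
  have e: "ent P (\<lambda>(s1,s2,v,u,x,y). (y,s2,v)) = ent P (\<lambda>(s1,s2,v,u,x,y). (y,s2))"
    "ent P (\<lambda>(s1,s2,v,u,x,y). (u,y,s2,v)) = ent P (\<lambda>(s1,s2,v,u,x,y). (y,s2))"
    "ent P (\<lambda>(s1,s2,v,u,x,y). (s1,v)) = ent P (\<lambda>(s1,s2,v,u,x,y). s1)"
    "ent P (\<lambda>(s1,s2,v,u,x,y). (u,s1,v)) = ent P (\<lambda>(s1,s2,v,u,x,y). s1)"
    "ent P (\<lambda>(s1,s2,v,u,x,y). (s1,s2,v)) = ent P (\<lambda>(s1,s2,v,u,x,y). (s1,s2))"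
    "ent P (\<lambda>(s1,s2,v,u,x,y). (s2,v)) = ent P (\<lambda>(s1,s2,v,u,x,y). s2)"
    by (rule ent_cong, auto dest!: s)+
  have "ent P (\<lambda>(s1,s2,v,u,x,y). v) = 0" by (rule ent_const[where c=a]) (auto dest!: s)
  with e show "eRate P = 0" "eC1 P = 0" "eC2 P = 0" "eC2C P = 0"
    unfolding eRate_def eC1_def eC2_def eC2C_def by linarith+
qed

text \<open>Time sharing with a trivial law, which has rate and constraint zero.\<close>

lemma strict_constraint:
  fixes p :: "('s1::finite \<times> 's2::finite) pmf" and ch :: "'x::finite \<Rightarrow> 's1 \<Rightarrow> 's2 \<Rightarrow> 'y::finite pmf"
    and qv :: "'s1 \<Rightarrow> 's2 \<Rightarrow> 'v pmf" and qu :: "'s1 \<Rightarrow> 'v \<Rightarrow> 'u pmf" and qx :: "'u \<Rightarrow> 's1 \<Rightarrow> 'v \<Rightarrow> 'x pmf"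
    and con :: "('s1 \<times> 's2 \<times> 'v \<times> 'u \<times> 'x \<times> 'y) pmf \<Rightarrow> real"
    and con' :: "('s1 \<times> 's2 \<times> (bool \<times> 'v) \<times> 'u \<times> 'x \<times> 'y) pmf \<Rightarrow> real"
  defines "J \<equiv> aux_law p ch qv (\<lambda>s1 s2. qu s1) qx"
  assumes fin: "finite VL" "\<And>s1 s2. set_pmf (qv s1 s2) \<subseteq> VL" "finite UL" "\<And>s1 v. set_pmf (qu s1 v) \<subseteq> UL"
    and con: "con = eC1 \<and> con' = eC1 \<or> con = eC2 \<and> con' = eC2 \<or> con = eC2C \<and> con' = eC2C"
    and R': "0 < R'" "con J \<le> R'" and R: "0 \<le> R" "R < eRate J"
  obtains qv' :: "'s1 \<Rightarrow> 's2 \<Rightarrow> (bool \<times> 'v) pmf" and qu' :: "'s1 \<Rightarrow> (bool \<times> 'v) \<Rightarrow> 'u pmf" and qx' VL' UL' where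
    "finite VL'" "\<And>s1 s2. set_pmf (qv' s1 s2) \<subseteq> VL'" "finite UL'" "\<And>s1 v. set_pmf (qu' s1 v) \<subseteq> UL'"
    "\<And>s1 s2 t1 t2. qv s1 s2 = qv t1 t2 \<Longrightarrow> qv' s1 s2 = qv' t1 t2" "\<And>s1 t1. qu s1 = qu t1 \<Longrightarrow> qu' s1 = qu' t1"
    "R < eRate (aux_law p ch qv' (\<lambda>s1 s2. qu' s1) qx')" "con' (aux_law p ch qv' (\<lambda>s1 s2. qu' s1) qx') < R'"
proof -
  \<comment> \<open>The trivial law gets so small a share that the rate of the mixture is the
    midpoint of \<open>R\<close> and \<open>eRate J\<close>.\<close>
  define l where "l = (eRate J - R) / (2 * eRate J)"
  have l: "0 < l" "l < 1" "(1 - l) * eRate J = (eRate J + R) / 2" using R by (auto simp: l_def field_simps)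
  define L where "L = bernoulli_pmf l"
  have EL: "measure_pmf.expectation L h = l * h True + (1 - l) * h False" for h :: "bool \<Rightarrow> real"
    using l by (simp add: L_def)
  define qvb where "qvb b = (if b then (\<lambda>_ _. return_pmf undefined) else qv)" for b
  define qub where "qub b = (if b then (\<lambda>_ _ _. return_pmf undefined) else (\<lambda>s1 (s2 :: 's2). qu s1))" for b
  define qv' where "qv' = mix_v L qvb"
  define qu' where "qu' s1 w = (if fst w then return_pmf undefined else qu s1 (snd w))" for s1 w
  define qx' where "qx' = mix_x (\<lambda>_ :: bool. qx)"
  have qub: "mix_u qub = (\<lambda>s1 s2. qu' s1)" by (intro ext) (simp add: mix_u_def qub_def qu'_def)
  have finv: "finite (set_pmf (qvb b s1 s2))" for b s1 s2 using fin(1) finite_subset[OF fin(2)] by (simp add: qvb_def)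
  have finu: "finite (set_pmf (qub b s1 s2 v))" for b s1 s2 v using fin(3) finite_subset[OF fin(4)] by (simp add: qub_def)
  have finL: "finite (set_pmf L)" by (rule finite_subset[of _ UNIV]) auto
  note ts = time_sharing[of L qvb qub p ch "\<lambda>_. qx", OF finL finv finu, folded qv'_def qx'_def, unfolded qub EL]
  have T: "eRate (aux_law p ch (qvb True) (qub True) qx) = 0" "eC1 (aux_law p ch (qvb True) (qub True) qx) = 0"
    "eC2 (aux_law p ch (qvb True) (qub True) qx) = 0" "eC2C (aux_law p ch (qvb True) (qub True) qx) = 0"
    unfolding qvb_def qub_def if_True by (rule trivial_law)+
  have F: "aux_law p ch (qvb False) (qub False) qx = J" by (simp add: qvb_def qub_def J_def)
  let ?J = "aux_law p ch qv' (\<lambda>s1 s2. qu' s1) qx'"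
  have rate: "R < eRate ?J" using ts(1) l(3) R(2) unfolding T F by simp
  have "con' ?J \<le> (1 - l) * con J" using con ts(2-4) unfolding T F by auto
  also have "\<dots> \<le> (1 - l) * R'" using l R' by (intro mult_left_mono) auto
  \<comment> \<open>The gain comes from the factor \<open>1 - l\<close> and requires
    \<open>0 < R'\<close>.\<close>
  also have "\<dots> < R'" using l R' by (simp add: algebra_simps)
  finally have con': "con' ?J < R'" .
  have v: "set_pmf (qv' s1 s2) \<subseteq> UNIV \<times> insert undefined VL" for s1 s2
    using fin(2)[of s1 s2] by (auto simp: qv'_def mix_v_def qvb_def split: if_splits)
  have u: "set_pmf (qu' s1 w) \<subseteq> insert undefined UL" for s1 w using fin(4)[of s1 "snd w"] by (auto simp: qu'_def)
  have sv: "qv' s1 s2 = qv' t1 t2" if "qv s1 s2 = qv t1 t2" for s1 s2 t1 t2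
  proof -
    have "qvb b s1 s2 = qvb b t1 t2" for b using that by (simp add: qvb_def)
    then show ?thesis by (simp add: qv'_def mix_v_def)
  qed
  have su: "qu' s1 = qu' t1" if "qu s1 = qu t1" for s1 t1 using that by (intro ext) (simp add: qu'_def)
  show ?thesis
    by (rule that[of "UNIV \<times> insert undefined VL" qv' "insert undefined UL" qu' qx', OF _ v _ u sv su rate con']) (use fin in auto)
qed

text \<open>The decoder always selects the codeword by the posterior law of \<open>U\<close> given
  its observation and the description. Only the two ways of guessing the description differ between
  the cases.\<close>

lemma schemeI:
  fixes p :: "('s1::finite \<times> 's2::finite) pmf" and ch :: "'x::finite \<Rightarrow> 's1 \<Rightarrow> 's2 \<Rightarrow> 'y::finite pmf"
    and qv :: "'s1 \<Rightarrow> 's2 \<Rightarrow> 'v pmf" and qu :: "'s1 \<Rightarrow> 'v \<Rightarrow> 'u pmf" and qx :: "'u \<Rightarrow> 's1 \<Rightarrow> 'v \<Rightarrow> 'x pmf"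
    and re :: "'s1 \<Rightarrow> 'v pmf" and rd :: "'y \<Rightarrow> 's2 \<Rightarrow> 'v pmf"
  defines "J \<equiv> aux_law p ch qv (\<lambda>s1 s2. qu s1) qx"
  assumes fin: "finite VL" "\<And>s1 s2. set_pmf (qv s1 s2) \<subseteq> VL" "finite UL" "\<And>s1 v. set_pmf (qu s1 v) \<subseteq> UL"
    and fin': "\<And>s1. finite (set_pmf (re s1))" "\<And>y s2. finite (set_pmf (rd y s2))"
    and R: "0 \<le> R" "0 \<le> R'" "R < eRate J"
    and ee: "\<And>s1 s2. ee \<Longrightarrow> (s1, s2) \<in> set_pmf p \<Longrightarrow> re s1 = qv s1 s2"
    and ed: "\<And>y s1 s2. ed \<Longrightarrow> (s1, s2) \<in> set_pmf p \<Longrightarrow> rd y s2 = qv s1 s2"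
    and pe: "\<And>s1 s2 v u x y. \<not> ee \<Longrightarrow> (s1,s2,v,u,x,y) \<in> set_pmf J \<Longrightarrow> v \<in> set_pmf (re s1)"
    and pd: "\<And>s1 s2 v u x y. \<not> ed \<Longrightarrow> (s1,s2,v,u,x,y) \<in> set_pmf J \<Longrightarrow> v \<in> set_pmf (rd y s2)"
    and me: "\<not> ee \<Longrightarrow> measure_pmf.expectation J (\<lambda>(s1,s2,v,u,x,y). log 2 (pmf (qv s1 s2) v / pmf (re s1) v)) < R'"
    and md: "\<not> ed \<Longrightarrow> measure_pmf.expectation J (\<lambda>(s1,s2,v,u,x,y). log 2 (pmf (qv s1 s2) v / pmf (rd y s2) v)) < R'"
  shows "\<exists>ru VL UL. scheme p ch qv qu qx re rd ru ee ed VL UL R R'"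
proof -
  define ru where "ru = (\<lambda>y s2 v. cond_law J (\<lambda>(s1,s2,v,u,x,y). u) (\<lambda>(s1,s2,v,u,x,y). (y,s2,v)) (y,s2,v))"
  define VV where "VV = VL \<union> (\<Union>s1. set_pmf (re s1)) \<union> (\<Union>y. \<Union>s2. set_pmf (rd y s2))"
  have J: "v \<in> VL \<and> u \<in> UL" if "(s1,s2,v,u,x,y) \<in> set_pmf J" for s1 s2 v u x y
    using set_aux_law_subset[of qv VL "\<lambda>s1 s2. qu s1" "\<lambda>_. UL", OF fin(2) fin(4) that[unfolded J_def]] .
  have finJ: "finite (set_pmf J)" unfolding J_def
    by (intro finite_set_aux_law finite_subset[OF fin(2) fin(1)] finite_subset[OF fin(4) fin(3)])
  note du = divergence_u[of p ch qv qu qx, folded J_def, OF finJ]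
  have su: "u \<in> set_pmf (ru y s2 v)" if "(s1,s2,v,u,x,y) \<in> set_pmf J" for s1 s2 v u x y
    unfolding ru_def using support_u[of p ch qv qu qx, folded J_def, OF finJ that] .
  have pe': "v \<in> set_pmf (re s1)" if e: "\<not> ee" and s: "(s1, s2) \<in> set_pmf p" and v: "v \<in> set_pmf (qv s1 s2)" for s1 s2 v
  proof -
    obtain u where u: "u \<in> set_pmf (qu s1 v)" using set_pmf_not_empty[of "qu s1 v"] by blast
    obtain x where x: "x \<in> set_pmf (qx u s1 v)" using set_pmf_not_empty[of "qx u s1 v"] by blast
    obtain y where y: "y \<in> set_pmf (ch x s1 s2)" using set_pmf_not_empty[of "ch x s1 s2"] by blast
    have "(s1,s2,v,u,x,y) \<in> set_pmf J" using s v u x y unfolding J_def by (simp add: set_pmf_iff pmf_aux_law)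
    from pe[OF e this] show ?thesis .
  qed
  have "scheme p ch qv qu qx re rd ru ee ed VV (insert undefined UL) R R'"
  proof (rule scheme.intro)
    show "finite VV" "finite (insert undefined UL)" using fin fin' by (auto simp: VV_def)
    show "set_pmf (qv s1 s2) \<subseteq> VV" "set_pmf (re s1) \<subseteq> VV" "set_pmf (rd y s2) \<subseteq> VV" for s1 s2 y
      using fin(2)[of s1 s2] by (auto simp: VV_def)
    show "set_pmf (qu s1 v) \<subseteq> insert undefined UL" for s1 v using fin(4)[of s1 v] by auto
    have "(\<lambda>(s1,s2,v,u,x,y). u) ` set_pmf J \<subseteq> UL" using J by auto
    then show "set_pmf (ru y s2 v) \<subseteq> insert undefined UL" for y s2 v
      unfolding ru_def by (intro order_trans[OF set_cond_law]) auto
    show "measure_pmf.expectation (aux_law p ch qv (\<lambda>s1 s2. qu s1) qx) (\<lambda>(s1,s2,v,u,x,y). log 2 (pmf (qu s1 v) u / pmf (ru y s2 v) u)) < - R"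
      unfolding J_def[symmetric] ru_def using du R(3) by simp
  qed (unfold J_def[symmetric], (fact R ee ed pe' pd su me md)+)
  then show ?thesis by blast
qed

text \<open>In Case 1 the encoder knows the law of the description, so its guess is always right.
  The decoder uses its posterior law and the index, or knows the law as well if it does not depend
  on the states.\<close>

lemma achievable1_strict:
  fixes p :: "('s1::finite \<times> 's2::finite) pmf" and ch :: "'x::finite \<Rightarrow> 's1 \<Rightarrow> 's2 \<Rightarrow> 'y::finite pmf"
    and qv :: "'s1 \<Rightarrow> 's2 \<Rightarrow> 'v pmf" and qu :: "'s1 \<Rightarrow> 'v \<Rightarrow> 'u pmf" and qx :: "'u \<Rightarrow> 's1 \<Rightarrow> 'v \<Rightarrow> 'x pmf"
  defines "J \<equiv> aux_law p ch qv (\<lambda>s1 s2. qu s1) qx"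
  assumes fin: "finite VL" "\<And>s1 s2. set_pmf (qv s1 s2) \<subseteq> VL" "finite UL" "\<And>s1 v. set_pmf (qu s1 v) \<subseteq> UL"
    and qv: "\<And>s1 s2 t2. qv s1 s2 = qv s1 t2"
    and R: "0 \<le> R" "0 \<le> R'" "R < eRate J" and con: "eC1 J < R' \<or> (\<exists>q. \<forall>s1 s2. qv s1 s2 = q)"
  shows "achievable1 p ch R R'"
proof -
  have finv: "finite (set_pmf (qv s1 s2))" for s1 s2 by (rule finite_subset[OF fin(2) fin(1)])
  have finJ: "finite (set_pmf J)" unfolding J_def by (intro finite_set_aux_law finv finite_subset[OF fin(4) fin(3)])
  let ?re = "\<lambda>s1. qv s1 undefined"
  have "\<exists>rd ed ru VL UL. scheme p ch qv qu qx ?re rd ru True ed VL UL R R'"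
    using con
  proof
    assume lt: "eC1 J < R'"
    let ?rd = "\<lambda>y s2. cond_law J (\<lambda>(s1,s2,v,u,x,y). v) (\<lambda>(s1,s2,v,u,x,y). (y,s2)) (y,s2)"
    have "\<exists>ru VL UL. scheme p ch qv qu qx ?re ?rd ru True False VL UL R R'"
    proof (rule schemeI[OF fin])
      show "qv s1 undefined = qv s1 s2" for s1 s2 by (rule qv)
      show "v \<in> set_pmf (?rd y s2)" if "(s1,s2,v,u,x,y) \<in> set_pmf (aux_law p ch qv (\<lambda>s1 s2. qu s1) qx)" for s1 s2 v u x y
        using support_1[of qv p ch _ qx, OF qv] finJ that unfolding J_def by blast
      show "measure_pmf.expectation (aux_law p ch qv (\<lambda>s1 s2. qu s1) qx) (\<lambda>(s1,s2,v,u,x,y). log 2 (pmf (qv s1 s2) v / pmf (?rd y s2) v)) < R'"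
        using divergence_1[of qv p ch "\<lambda>s1 s2. qu s1" qx, OF qv] finJ lt unfolding J_def by simp
    qed (use R finv finite_cond_law[OF finJ] in \<open>auto simp: J_def\<close>)
    then show ?thesis by blast
  next
    assume "\<exists>q. \<forall>s1 s2. qv s1 s2 = q"
    then obtain q where q: "qv s1 s2 = q" for s1 s2 by blast
    have "\<exists>ru VL UL. scheme p ch qv qu qx ?re (\<lambda>_ _. q) ru True True VL UL R R'"
    proof (rule schemeI[OF fin])
      show "R < eRate (aux_law p ch qv (\<lambda>s1 s2. qu s1) qx)" using R(3) unfolding J_def .
      show "finite (set_pmf q)" using finv[of undefined undefined] unfolding q .
    qed (use R finv in \<open>auto simp: q\<close>)
    then show ?thesis by blast
  qed
  then obtain rd ed ru VL UL where "scheme p ch qv qu qx ?re rd ru True ed VL UL R R'" by blast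
  then show ?thesis by (rule scheme.scheme_achievable1) (rule qv)
qed

text \<open>In Case 2 the decoder holds the second states and knows the law of the description,
  while the encoder guesses from the first states. The flag of the encoder is set exactly when the
  constraint is not strict.\<close>

lemma achievable2_strict:
  fixes p :: "('s1::finite \<times> 's2::finite) pmf" and ch :: "'x::finite \<Rightarrow> 's1 \<Rightarrow> 's2 \<Rightarrow> 'y::finite pmf"
    and qv :: "'s1 \<Rightarrow> 's2 \<Rightarrow> 'v pmf" and qu :: "'s1 \<Rightarrow> 'v \<Rightarrow> 'u pmf" and qx :: "'u \<Rightarrow> 's1 \<Rightarrow> 'v \<Rightarrow> 'x pmf"
  defines "J \<equiv> aux_law p ch qv (\<lambda>s1 s2. qu s1) qx"
  assumes fin: "finite VL" "\<And>s1 s2. set_pmf (qv s1 s2) \<subseteq> VL" "finite UL" "\<And>s1 v. set_pmf (qu s1 v) \<subseteq> UL"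
    and qv: "\<And>s1 t1 s2. qv s1 s2 = qv t1 s2"
    and R: "0 \<le> R" "0 \<le> R'" "R < eRate J" and con: "eC2 J < R' \<or> R' = 0 \<and> eC2 J \<le> 0"
  shows "achievable2 p ch R R'"
proof -
  have finv: "finite (set_pmf (qv s1 s2))" for s1 s2 by (rule finite_subset[OF fin(2) fin(1)])
  have finJ: "finite (set_pmf J)" unfolding J_def by (intro finite_set_aux_law finv finite_subset[OF fin(4) fin(3)])
  let ?rd = "\<lambda>y. qv undefined"
  let ?re = "\<lambda>s1. cond_law J (\<lambda>(s1,s2,v,u,x,y). v) (\<lambda>(s1,s2,v,u,x,y). s1) s1"
  have supp: "v \<in> set_pmf (?re s1)" if "(s1,s2,v,u,x,y) \<in> set_pmf (aux_law p ch qv (\<lambda>s1 s2. qu s1) qx)" for s1 s2 v u x y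
    using support_2[of p ch qv _ qx] finJ that unfolding J_def by blast
  have div: "measure_pmf.expectation (aux_law p ch qv (\<lambda>s1 s2. qu s1) qx) (\<lambda>(s1,s2,v,u,x,y). log 2 (pmf (qv s1 s2) v / pmf (?re s1) v)) = eC2 J"
    using divergence_2[of p ch qv "\<lambda>s1 s2. qu s1" qx] finJ unfolding J_def by simp
  \<comment> \<open>A constraint that is not strict means rate zero and a divergence that is at most
    zero, hence the conditional law given the first state is \<open>qv\<close> itself.\<close>
  have eq: "?re s1 = qv s1 s2" if "\<not> eC2 J < R'" "(s1, s2) \<in> set_pmf p" for s1 s2
    by (rule kernel_eq_if_divergence_le_0[where re="\<lambda>s1 s2. ?re s1", OF fin(1) fin(2) finJ[unfolded J_def] supp _ that(2)])
      (use div con that(1) in auto)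
  have "\<exists>ru VL UL. scheme p ch qv qu qx ?re ?rd ru (\<not> eC2 J < R') True VL UL R R'"
  proof (rule schemeI[OF fin])
    show "qv undefined s2 = qv s1 s2" for s1 s2 by (rule qv)
    show "v \<in> set_pmf (?re s1)" if "(s1,s2,v,u,x,y) \<in> set_pmf (aux_law p ch qv (\<lambda>s1 s2. qu s1) qx)" for s1 s2 v u x y
      using that by (rule supp)
  qed (use R finv finite_cond_law[OF finJ] div eq in \<open>auto simp: J_def\<close>)
  then obtain ru VL UL where "scheme p ch qv qu qx ?re ?rd ru (\<not> eC2 J < R') True VL UL R R'" by blast
  then show ?thesis by (rule scheme.scheme_achievable2) (rule qv)
qed

lemma achievable2C_strict:
  fixes p :: "('s1::finite \<times> 's2::finite) pmf" and ch :: "'x::finite \<Rightarrow> 's1 \<Rightarrow> 's2 \<Rightarrow> 'y::finite pmf"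
    and qv :: "'s1 \<Rightarrow> 's2 \<Rightarrow> 'v pmf" and qu :: "'s1 \<Rightarrow> 'v \<Rightarrow> 'u pmf" and qx :: "'u \<Rightarrow> 's1 \<Rightarrow> 'v \<Rightarrow> 'x pmf"
  defines "J \<equiv> aux_law p ch qv (\<lambda>s1 s2. qu s1) qx"
  assumes fin: "finite VL" "\<And>s1 s2. set_pmf (qv s1 s2) \<subseteq> VL" "finite UL" "\<And>s1 v. set_pmf (qu s1 v) \<subseteq> UL"
    and qv: "\<And>s1 t1 s2. qv s1 s2 = qv t1 s2" and qu: "\<And>s1 t1. qu s1 = qu t1"
    and R: "0 \<le> R" "0 \<le> R'" "R < eRate J" and con: "eC2C J < R' \<or> R' = 0 \<and> eC2C J \<le> 0"
  shows "achievable2C p ch R R'"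
proof -
  have finv: "finite (set_pmf (qv s1 s2))" for s1 s2 by (rule finite_subset[OF fin(2) fin(1)])
  have finJ: "finite (set_pmf J)" unfolding J_def by (intro finite_set_aux_law finv finite_subset[OF fin(4) fin(3)])
  let ?rd = "\<lambda>y. qv undefined"
  \<comment> \<open>The plain law of \<open>V\<close>: a guess of the whole block from the first
    states would look into the future.\<close>
  let ?re = "\<lambda>s1. cond_law J (\<lambda>(s1,s2,v,u,x,y). v) (\<lambda>_. ()) ()"
  have supp: "v \<in> set_pmf (?re s1)" if "(s1,s2,v,u,x,y) \<in> set_pmf (aux_law p ch qv (\<lambda>s1 s2. qu s1) qx)" for s1 s2 v u x y
    using support_2C[of qv p ch _ qx, OF qv] finJ that unfolding J_def by blast
  have div: "measure_pmf.expectation (aux_law p ch qv (\<lambda>s1 s2. qu s1) qx) (\<lambda>(s1,s2,v,u,x,y). log 2 (pmf (qv s1 s2) v / pmf (?re s1) v)) = eC2C J"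
    using divergence_2C[of qv p ch "\<lambda>s1 s2. qu s1" qx, OF qv] finJ unfolding J_def by simp
  have eq: "?re s1 = qv s1 s2" if "\<not> eC2C J < R'" "(s1, s2) \<in> set_pmf p" for s1 s2
    by (rule kernel_eq_if_divergence_le_0[where re="\<lambda>s1 s2. ?re s1", OF fin(1) fin(2) finJ[unfolded J_def] supp _ that(2)])
      (use div con that(1) in auto)
  have "\<exists>ru VL UL. scheme p ch qv qu qx ?re ?rd ru (\<not> eC2C J < R') True VL UL R R'"
  proof (rule schemeI[OF fin])
    show "qv undefined s2 = qv s1 s2" for s1 s2 by (rule qv)
    show "v \<in> set_pmf (?re s1)" if "(s1,s2,v,u,x,y) \<in> set_pmf (aux_law p ch qv (\<lambda>s1 s2. qu s1) qx)" for s1 s2 v u x y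
      using that by (rule supp)
  qed (use R finv finite_cond_law[OF finJ] div eq in \<open>auto simp: J_def\<close>)
  then obtain ru VL UL where "scheme p ch qv qu qx ?re ?rd ru (\<not> eC2C J < R') True VL UL R R'" by blast
  then show ?thesis by (rule scheme.scheme_achievable2C) (rule qv refl qu)+
qed

text \<open>With no description rate, \<open>V\<close> can be absorbed into \<open>U\<close>.\<close>

lemma eRate_absorb:
  fixes p :: "('s1::finite \<times> 's2::finite) pmf" and ch :: "'x::finite \<Rightarrow> 's1 \<Rightarrow> 's2 \<Rightarrow> 'y::finite pmf"
    and qv :: "'s1 \<Rightarrow> 'v pmf" and qu :: "'s1 \<Rightarrow> 'v \<Rightarrow> 'u pmf" and qx :: "'u \<Rightarrow> 's1 \<Rightarrow> 'v \<Rightarrow> 'x pmf"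
  shows "eRate (aux_law p ch (\<lambda>_ _. return_pmf ()) (\<lambda>s1 s2 _. bind_pmf (qv s1) (\<lambda>v. map_pmf (Pair v) (qu s1 v))) (\<lambda>w s1 _. qx (snd w) s1 (fst w))) =
    eRate (aux_law p ch (\<lambda>s1 s2. qv s1) (\<lambda>s1 s2. qu s1) qx) - eC1 (aux_law p ch (\<lambda>s1 s2. qv s1) (\<lambda>s1 s2. qu s1) qx)"
proof -
  define J where "J = aux_law p ch (\<lambda>s1 s2. qv s1) (\<lambda>s1 s2. qu s1) qx"
  have "aux_law p ch (\<lambda>_ _. return_pmf ()) (\<lambda>s1 s2 _. bind_pmf (qv s1) (\<lambda>v. map_pmf (Pair v) (qu s1 v))) (\<lambda>w s1 _. qx (snd w) s1 (fst w)) =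
    map_pmf (\<lambda>(s1,s2,v,u,x,y). (s1,s2,(),(v,u),x,y)) J"
    unfolding J_def map_aux_law unfolding aux_law_def by (simp add: map_pmf_def bind_assoc_pmf bind_return_pmf)
  then have "eRate (aux_law p ch (\<lambda>_ _. return_pmf ()) (\<lambda>s1 s2 _. bind_pmf (qv s1) (\<lambda>v. map_pmf (Pair v) (qu s1 v))) (\<lambda>w s1 _. qx (snd w) s1 (fst w))) =
    eRate (map_pmf (\<lambda>(s1,s2,v,u,x,y). (s1,s2,(),(v,u),x,y)) J)" by simp
  also have "\<dots> = ent J (\<lambda>\<omega>. (\<lambda>(s1,s2,v,u,x,y). (y,s2,v)) ((\<lambda>(s1,s2,v,u,x,y). (s1,s2,(),(v,u),x,y)) \<omega>))
     - ent J (\<lambda>\<omega>. (\<lambda>(s1,s2,v,u,x,y). (u,y,s2,v)) ((\<lambda>(s1,s2,v,u,x,y). (s1,s2,(),(v,u),x,y)) \<omega>))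
     - ent J (\<lambda>\<omega>. (\<lambda>(s1,s2,v,u,x,y). (s1,v)) ((\<lambda>(s1,s2,v,u,x,y). (s1,s2,(),(v,u),x,y)) \<omega>))
     + ent J (\<lambda>\<omega>. (\<lambda>(s1,s2,v,u,x,y). (u,s1,v)) ((\<lambda>(s1,s2,v,u,x,y). (s1,s2,(),(v,u),x,y)) \<omega>))"
    unfolding eRate_def ent_map ..
  also have "ent J (\<lambda>\<omega>. (\<lambda>(s1,s2,v,u,x,y). (y,s2,v)) ((\<lambda>(s1,s2,v,u,x,y). (s1,s2,(),(v,u),x,y)) \<omega>)) = ent J (\<lambda>(s1,s2,v,u,x,y). (y,s2))"
    by (rule ent_cong) auto
  also have "ent J (\<lambda>\<omega>. (\<lambda>(s1,s2,v,u,x,y). (u,y,s2,v)) ((\<lambda>(s1,s2,v,u,x,y). (s1,s2,(),(v,u),x,y)) \<omega>)) = ent J (\<lambda>(s1,s2,v,u,x,y). (u,y,s2,v))"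
    by (rule ent_cong) auto
  also have "ent J (\<lambda>\<omega>. (\<lambda>(s1,s2,v,u,x,y). (s1,v)) ((\<lambda>(s1,s2,v,u,x,y). (s1,s2,(),(v,u),x,y)) \<omega>)) = ent J (\<lambda>(s1,s2,v,u,x,y). s1)"
    by (rule ent_cong) auto
  also have "ent J (\<lambda>\<omega>. (\<lambda>(s1,s2,v,u,x,y). (u,s1,v)) ((\<lambda>(s1,s2,v,u,x,y). (s1,s2,(),(v,u),x,y)) \<omega>)) = ent J (\<lambda>(s1,s2,v,u,x,y). (u,s1,v))"
    by (rule ent_cong) auto
  finally show ?thesis unfolding J_def[symmetric] eRate_def eC1_def by linarith
qed

lemma achievable1_below:
  fixes p :: "('s1::finite \<times> 's2::finite) pmf" and ch :: "'x::finite \<Rightarrow> 's1 \<Rightarrow> 's2 \<Rightarrow> 'y::finite pmf"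
  assumes P: "P \<in> class_laws k (\<lambda>s t. fst s = fst t) (\<lambda>s t. fst s = fst t) p ch" and con: "eC1 P \<le> R'"
    and R: "0 \<le> R'" "0 \<le> R" "R < eRate P"
  shows "achievable1 p ch R R'"
proof -
  obtain qv qu' qx where P': "P = aux_law p ch qv qu' qx" and k: "kernel_class (\<lambda>s t. fst s = fst t) (\<lambda>s t. fst s = fst t) qv qu'"
    and v: "\<And>s1 s2. set_pmf (qv s1 s2) \<subseteq> {..<k}" and u': "\<And>s1 s2 v. set_pmf (qu' s1 s2 v) \<subseteq> {..<k}"
    using P unfolding class_laws_def by blast
  define qu where "qu s1 = qu' s1 undefined" for s1
  have qu: "qu' = (\<lambda>s1 s2. qu s1)" using k by (auto simp: kernel_class_def qu_def fun_eq_iff)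
  have u: "set_pmf (qu s1 v) \<subseteq> {..<k}" for s1 v using u' by (simp add: qu_def)
  have qv: "qv s1 s2 = qv s1 t2" for s1 s2 t2 using k by (simp add: kernel_class_def)
  show ?thesis
  proof (cases "0 < R'")
    case True
    obtain qv' :: "'s1 \<Rightarrow> 's2 \<Rightarrow> (bool \<times> nat) pmf" and VL and qu'' :: "'s1 \<Rightarrow> bool \<times> nat \<Rightarrow> nat pmf" and UL qx' where s: "finite VL" "\<And>s1 s2. set_pmf (qv' s1 s2) \<subseteq> VL" "finite UL" "\<And>s1 v. set_pmf (qu'' s1 v) \<subseteq> UL"
      "\<And>s1 s2 t1 t2. qv s1 s2 = qv t1 t2 \<Longrightarrow> qv' s1 s2 = qv' t1 t2" "\<And>s1 t1. qu s1 = qu t1 \<Longrightarrow> qu'' s1 = qu'' t1"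
      "R < eRate (aux_law p ch qv' (\<lambda>s1 s2. qu'' s1) qx')" "eC1 (aux_law p ch qv' (\<lambda>s1 s2. qu'' s1) qx') < R'"
      by (rule strict_constraint[where con=eC1 and con'=eC1, OF finite_lessThan v finite_lessThan u disjI1[OF conjI[OF refl refl]] True con[unfolded P' qu] R(2) R(3)[unfolded P' qu]]) (rule that)
    show ?thesis
      by (rule achievable1_strict[OF s(1-4) s(5)[OF qv] R(2,1) s(7) disjI1[OF s(8)]])
  next
    case False
    then have R0: "R' = 0" using R by simp
    define \<kappa> where "\<kappa> s1 = qv s1 undefined" for s1
    have \<kappa>: "qv = (\<lambda>s1 s2. \<kappa> s1)" by (intro ext) (simp add: \<kappa>_def, rule qv)
    \<comment> \<open>At rate zero the constraint says \<open>eC1 P \<le> 0\<close>, so absorbing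
      \<open>V\<close> into \<open>U\<close> changes the rate by \<open>- eC1 P\<close> and does not
      lower it. The description is then constant.\<close>
    have r: "R < eRate (aux_law p ch (\<lambda>_ _. return_pmf ()) (\<lambda>s1 s2 _. bind_pmf (\<kappa> s1) (\<lambda>v. map_pmf (Pair v) (qu s1 v))) (\<lambda>w s1 _. qx (snd w) s1 (fst w)))"
      unfolding eRate_absorb using R con unfolding P' qu \<kappa> R0 by simp
    have w: "set_pmf (bind_pmf (\<kappa> s1) (\<lambda>v. map_pmf (Pair v) (qu s1 v))) \<subseteq> {..<k} \<times> {..<k}" for s1
      using v u unfolding \<kappa> by fastforce
    show ?thesis
      by (rule achievable1_strict[of "{()}" "\<lambda>_ _. return_pmf ()" "{..<k} \<times> {..<k}" "\<lambda>s1 _. bind_pmf (\<kappa> s1) (\<lambda>v. map_pmf (Pair v) (qu s1 v))", OF _ _ _ w _ R(2,1) r])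
        auto
  qed
qed

lemma achievable2_below:
  fixes p :: "('s1::finite \<times> 's2::finite) pmf" and ch :: "'x::finite \<Rightarrow> 's1 \<Rightarrow> 's2 \<Rightarrow> 'y::finite pmf"
  assumes P: "P \<in> class_laws k (\<lambda>s t. snd s = snd t) (\<lambda>s t. fst s = fst t) p ch" and con: "eC2 P \<le> R'"
    and R: "0 \<le> R'" "0 \<le> R" "R < eRate P"
  shows "achievable2 p ch R R'"
proof -
  obtain qv qu' qx where P': "P = aux_law p ch qv qu' qx" and k: "kernel_class (\<lambda>s t. snd s = snd t) (\<lambda>s t. fst s = fst t) qv qu'"
    and v: "\<And>s1 s2. set_pmf (qv s1 s2) \<subseteq> {..<k}" and u': "\<And>s1 s2 v. set_pmf (qu' s1 s2 v) \<subseteq> {..<k}"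
    using P unfolding class_laws_def by blast
  define qu where "qu s1 = qu' s1 undefined" for s1
  have qu: "qu' = (\<lambda>s1 s2. qu s1)" using k by (auto simp: kernel_class_def qu_def fun_eq_iff)
  have u: "set_pmf (qu s1 v) \<subseteq> {..<k}" for s1 v using u' by (simp add: qu_def)
  have qv: "qv s1 s2 = qv t1 s2" for s1 s2 t1 using k by (simp add: kernel_class_def)
  show ?thesis
  proof (cases "0 < R'")
    case True
    obtain qv' :: "'s1 \<Rightarrow> 's2 \<Rightarrow> (bool \<times> nat) pmf" and VL and qu'' :: "'s1 \<Rightarrow> bool \<times> nat \<Rightarrow> nat pmf" and UL qx' where s: "finite VL" "\<And>s1 s2. set_pmf (qv' s1 s2) \<subseteq> VL" "finite UL" "\<And>s1 v. set_pmf (qu'' s1 v) \<subseteq> UL"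
      "\<And>s1 s2 t1 t2. qv s1 s2 = qv t1 t2 \<Longrightarrow> qv' s1 s2 = qv' t1 t2" "\<And>s1 t1. qu s1 = qu t1 \<Longrightarrow> qu'' s1 = qu'' t1"
      "R < eRate (aux_law p ch qv' (\<lambda>s1 s2. qu'' s1) qx')" "eC2 (aux_law p ch qv' (\<lambda>s1 s2. qu'' s1) qx') < R'"
      by (rule strict_constraint[where con=eC2 and con'=eC2, OF finite_lessThan v finite_lessThan u disjI2[OF disjI1[OF conjI[OF refl refl]]] True con[unfolded P' qu] R(2) R(3)[unfolded P' qu]]) (rule that)
    show ?thesis
      by (rule achievable2_strict[OF s(1-4) s(5)[OF qv] R(2,1) s(7) disjI1[OF s(8)]])
  next
    case False
    show ?thesis
      by (rule achievable2_strict[of "{..<k}" qv "{..<k}" qu, OF _ v _ u qv]) (use R con False in \<open>auto simp: P' qu\<close>)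
  qed
qed

lemma achievable2C_below:
  fixes p :: "('s1::finite \<times> 's2::finite) pmf" and ch :: "'x::finite \<Rightarrow> 's1 \<Rightarrow> 's2 \<Rightarrow> 'y::finite pmf"
  assumes P: "P \<in> class_laws k (\<lambda>s t. snd s = snd t) (\<lambda>s t. True) p ch" and con: "eC2C P \<le> R'"
    and R: "0 \<le> R'" "0 \<le> R" "R < eRate P"
  shows "achievable2C p ch R R'"
proof -
  obtain qv qu' qx where P': "P = aux_law p ch qv qu' qx" and k: "kernel_class (\<lambda>s t. snd s = snd t) (\<lambda>s t. True) qv qu'"
    and v: "\<And>s1 s2. set_pmf (qv s1 s2) \<subseteq> {..<k}" and u': "\<And>s1 s2 v. set_pmf (qu' s1 s2 v) \<subseteq> {..<k}"
    using P unfolding class_laws_def by blast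
  define qu where "qu s1 = qu' s1 undefined" for s1
  have k2: "qu' s1 s2 v = qu' t1 t2 v" for s1 s2 t1 t2 v using k unfolding kernel_class_def by blast
  have qu: "qu' = (\<lambda>s1 s2. qu s1)" unfolding qu_def by (intro ext) (rule k2)
  have quc: "qu s1 = qu t1" for s1 t1 unfolding qu_def by (rule ext) (rule k2)
  have u: "set_pmf (qu s1 v) \<subseteq> {..<k}" for s1 v using u' by (simp add: qu_def)
  have qv: "qv s1 s2 = qv t1 s2" for s1 s2 t1 using k by (simp add: kernel_class_def)
  show ?thesis
  proof (cases "0 < R'")
    case True
    obtain qv' :: "'s1 \<Rightarrow> 's2 \<Rightarrow> (bool \<times> nat) pmf" and VL and qu'' :: "'s1 \<Rightarrow> bool \<times> nat \<Rightarrow> nat pmf" and UL qx' where s: "finite VL" "\<And>s1 s2. set_pmf (qv' s1 s2) \<subseteq> VL" "finite UL" "\<And>s1 v. set_pmf (qu'' s1 v) \<subseteq> UL"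
      "\<And>s1 s2 t1 t2. qv s1 s2 = qv t1 t2 \<Longrightarrow> qv' s1 s2 = qv' t1 t2" "\<And>s1 t1. qu s1 = qu t1 \<Longrightarrow> qu'' s1 = qu'' t1"
      "R < eRate (aux_law p ch qv' (\<lambda>s1 s2. qu'' s1) qx')" "eC2C (aux_law p ch qv' (\<lambda>s1 s2. qu'' s1) qx') < R'"
      by (rule strict_constraint[where con=eC2C and con'=eC2C, OF finite_lessThan v finite_lessThan u disjI2[OF disjI2[OF conjI[OF refl refl]]] True con[unfolded P' qu] R(2) R(3)[unfolded P' qu]]) (rule that)
    show ?thesis
      by (rule achievable2C_strict[OF s(1-4) s(5)[OF qv] s(6)[OF quc] R(2,1) s(7) disjI1[OF s(8)]])
  next
    case False
    show ?thesis
      by (rule achievable2C_strict[of "{..<k}" qv "{..<k}" qu, OF _ v _ u qv quc]) (use R con False in \<open>auto simp: P' qu\<close>)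
  qed
qed

section \<open>Capacities\<close>

lemma error_prob_one_message:
  fixes p :: "('s1 \<times> 's2) pmf" and ch :: "'x \<Rightarrow> 's1 \<Rightarrow> 's2 \<Rightarrow> 'y pmf"
  shows "error_prob n (index_set n 0) p ch d f (\<lambda>_ _ _. 1) = 0"
proof -
  have i: "index_set n 0 = {1}" by (auto simp: index_set_def)
  have e: "{\<omega> \<in> space M. (case \<omega> of (w', s1, s2, y) \<Rightarrow> (1::nat) \<noteq> w') \<and> fst \<omega> = 1} = {}"
    for M :: "(nat \<times> (nat \<Rightarrow> 's1) \<times> (nat \<Rightarrow> 's2) \<times> (nat \<Rightarrow> 'y)) measure" by auto
  show ?thesis unfolding error_prob_def cond_prob_def i by (simp only: sum.insert sum.empty finite.emptyI empty_iff e measure_empty div_0 add_0_right simp_thms)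
qed

lemma zero_achievable:
  assumes "0 \<le> R'"
  shows "achievable1 p ch 0 R'" "achievable2 p ch 0 R'" "achievable2C p ch 0 R'"
  unfolding achievable1_def achievable2_def achievable2C_def
  by (intro conjI exI[of _ "\<lambda>_ _. 1"] exI[of _ "\<lambda>_ _ _ _. 1"] exI[of _ "undefined"]; simp only: error_prob_one_message index_set_nonempty[OF assms] index_set_nonempty[OF order_refl] tendsto_const order_refl simp_thms)+

lemma le_Sup_of_dense:
  fixes S :: "real set"
  assumes "0 \<in> S" "bdd_above S" "\<And>R. 0 \<le> R \<Longrightarrow> R < m \<Longrightarrow> R \<in> S"
  shows "m \<le> Sup S"
proof (cases "m \<le> 0")
  case True
  then show ?thesis using cSup_upper[OF assms(1,2)] by simp
next
  case False
  then show ?thesis using cSup_upper[OF _ assms(2)] assms(3) by (intro dense_le_bounded[of 0 m]) auto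
qed

lemma Sup_eq_threshold:
  fixes S :: "real set"
  assumes "0 \<in> S" "\<And>R. R \<in> S \<Longrightarrow> R \<le> m" "\<And>R. 0 \<le> R \<Longrightarrow> R < m \<Longrightarrow> R \<in> S"
  shows "Sup S = m"
proof (rule antisym)
  show "Sup S \<le> m" using assms(1,2) by (intro cSup_least) auto
  show "m \<le> Sup S" using assms by (intro le_Sup_of_dense) (auto simp: bdd_above_def)
qed

section \<open>Agreement with the stated families and functionals\<close>

lemma glawsI:
  assumes "kernel_class Ev Eu qv qu" "\<And>s1 s2. set_pmf (qv s1 s2) \<subseteq> {..<k}" "\<And>s1 s2 v. set_pmf (qu s1 s2 v) \<subseteq> {..<k}"
  shows "aux_law p ch qv qu qx \<in> class_laws k Ev Eu p ch"
  unfolding class_laws_def using assms by blast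

lemma laws_class_laws:
  "laws1 k p ch = class_laws k (\<lambda>s t. fst s = fst t) (\<lambda>s t. fst s = fst t) p ch"
  "laws2_lb k p ch = class_laws k (\<lambda>s t. snd s = snd t) (\<lambda>s t. fst s = fst t) p ch"
  "laws2_ub1 k p ch = class_laws k (\<lambda>s t. s = t) (\<lambda>s t. fst s = fst t) p ch"
  "laws2_ub2 k p ch = class_laws k (\<lambda>s t. snd s = snd t) (\<lambda>s t. s = t) p ch"
  "laws2C k p ch = class_laws k (\<lambda>s t. snd s = snd t) (\<lambda>s t. True) p ch"
proof -
  show "laws1 k p ch = class_laws k (\<lambda>s t. fst s = fst t) (\<lambda>s t. fst s = fst t) p ch"
  proof (intro set_eqI iffI)
    fix P assume "P \<in> laws1 k p ch"
    then show "P \<in> class_laws k (\<lambda>s t. fst s = fst t) (\<lambda>s t. fst s = fst t) p ch" unfolding laws1_def joint_law_aux_law by clarify (rule glawsI, simp add: kernel_class_def, blast, blast)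
  next
    fix P assume "P \<in> class_laws k (\<lambda>s t. fst s = fst t) (\<lambda>s t. fst s = fst t) p ch"
    then obtain qv qu qx where P: "P = aux_law p ch qv qu qx" and k: "kernel_class (\<lambda>s t. fst s = fst t) (\<lambda>s t. fst s = fst t) qv qu"
      and s: "\<And>s1 s2. set_pmf (qv s1 s2) \<subseteq> {..<k}" "\<And>s1 s2 v. set_pmf (qu s1 s2 v) \<subseteq> {..<k}" unfolding class_laws_def by blast
    have "qv = (\<lambda>s1 s2. qv s1 undefined)" using k by (intro ext) (simp add: kernel_class_def)
    moreover have "qu = (\<lambda>s1 s2. qu s1 undefined)" using k by (intro ext) (simp add: kernel_class_def)
    ultimately have "P = aux_law p ch (\<lambda>s1 s2. qv s1 undefined) (\<lambda>s1 s2. qu s1 undefined) qx" using P by simp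
    then show "P \<in> laws1 k p ch" unfolding laws1_def joint_law_aux_law
      by (intro CollectI exI[of _ "\<lambda>s1. qv s1 undefined"] exI[of _ "\<lambda>s1. qu s1 undefined"] exI[of _ qx] conjI allI s)
  qed
  show "laws2_lb k p ch = class_laws k (\<lambda>s t. snd s = snd t) (\<lambda>s t. fst s = fst t) p ch"
  proof (intro set_eqI iffI)
    fix P assume "P \<in> laws2_lb k p ch"
    then show "P \<in> class_laws k (\<lambda>s t. snd s = snd t) (\<lambda>s t. fst s = fst t) p ch" unfolding laws2_lb_def joint_law_aux_law by clarify (rule glawsI, simp add: kernel_class_def, blast, blast)
  next
    fix P assume "P \<in> class_laws k (\<lambda>s t. snd s = snd t) (\<lambda>s t. fst s = fst t) p ch"
    then obtain qv qu qx where P: "P = aux_law p ch qv qu qx" and k: "kernel_class (\<lambda>s t. snd s = snd t) (\<lambda>s t. fst s = fst t) qv qu"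
      and s: "\<And>s1 s2. set_pmf (qv s1 s2) \<subseteq> {..<k}" "\<And>s1 s2 v. set_pmf (qu s1 s2 v) \<subseteq> {..<k}" unfolding class_laws_def by blast
    have "qv = (\<lambda>s1. qv undefined)" using k by (intro ext) (simp add: kernel_class_def)
    moreover have "qu = (\<lambda>s1 s2. qu s1 undefined)" using k by (intro ext) (simp add: kernel_class_def)
    ultimately have "P = aux_law p ch (\<lambda>s1. qv undefined) (\<lambda>s1 s2. qu s1 undefined) qx" using P by simp
    then show "P \<in> laws2_lb k p ch" unfolding laws2_lb_def joint_law_aux_law
      by (intro CollectI exI[of _ "qv undefined"] exI[of _ "\<lambda>s1. qu s1 undefined"] exI[of _ qx] conjI allI s)
  qed
  show "laws2_ub1 k p ch = class_laws k (\<lambda>s t. s = t) (\<lambda>s t. fst s = fst t) p ch"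
  proof (intro set_eqI iffI)
    fix P assume "P \<in> laws2_ub1 k p ch"
    then show "P \<in> class_laws k (\<lambda>s t. s = t) (\<lambda>s t. fst s = fst t) p ch" unfolding laws2_ub1_def joint_law_aux_law by clarify (rule glawsI, simp add: kernel_class_def, blast, blast)
  next
    fix P assume "P \<in> class_laws k (\<lambda>s t. s = t) (\<lambda>s t. fst s = fst t) p ch"
    then obtain qv qu qx where P: "P = aux_law p ch qv qu qx" and k: "kernel_class (\<lambda>s t. s = t) (\<lambda>s t. fst s = fst t) qv qu"
      and s: "\<And>s1 s2. set_pmf (qv s1 s2) \<subseteq> {..<k}" "\<And>s1 s2 v. set_pmf (qu s1 s2 v) \<subseteq> {..<k}" unfolding class_laws_def by blast
    have "qv = qv" ..
    moreover have "qu = (\<lambda>s1 s2. qu s1 undefined)" using k by (intro ext) (simp add: kernel_class_def)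
    ultimately have "P = aux_law p ch (qv) (\<lambda>s1 s2. qu s1 undefined) qx" using P by simp
    then show "P \<in> laws2_ub1 k p ch" unfolding laws2_ub1_def joint_law_aux_law
      by (intro CollectI exI[of _ qv] exI[of _ "\<lambda>s1. qu s1 undefined"] exI[of _ qx] conjI allI s)
  qed
  show "laws2_ub2 k p ch = class_laws k (\<lambda>s t. snd s = snd t) (\<lambda>s t. s = t) p ch"
  proof (intro set_eqI iffI)
    fix P assume "P \<in> laws2_ub2 k p ch"
    then show "P \<in> class_laws k (\<lambda>s t. snd s = snd t) (\<lambda>s t. s = t) p ch" unfolding laws2_ub2_def joint_law_aux_law by clarify (rule glawsI, simp add: kernel_class_def, blast, blast)
  next
    fix P assume "P \<in> class_laws k (\<lambda>s t. snd s = snd t) (\<lambda>s t. s = t) p ch"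
    then obtain qv qu qx where P: "P = aux_law p ch qv qu qx" and k: "kernel_class (\<lambda>s t. snd s = snd t) (\<lambda>s t. s = t) qv qu"
      and s: "\<And>s1 s2. set_pmf (qv s1 s2) \<subseteq> {..<k}" "\<And>s1 s2 v. set_pmf (qu s1 s2 v) \<subseteq> {..<k}" unfolding class_laws_def by blast
    have "qv = (\<lambda>s1. qv undefined)" using k by (intro ext) (simp add: kernel_class_def)
    moreover have "qu = qu" ..
    ultimately have "P = aux_law p ch (\<lambda>s1. qv undefined) (qu) qx" using P by simp
    then show "P \<in> laws2_ub2 k p ch" unfolding laws2_ub2_def joint_law_aux_law
      by (intro CollectI exI[of _ "qv undefined"] exI[of _ qu] exI[of _ qx] conjI allI s)
  qed
  show "laws2C k p ch = class_laws k (\<lambda>s t. snd s = snd t) (\<lambda>s t. True) p ch"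
  proof (intro set_eqI iffI)
    fix P assume "P \<in> laws2C k p ch"
    then show "P \<in> class_laws k (\<lambda>s t. snd s = snd t) (\<lambda>s t. True) p ch" unfolding laws2C_def joint_law_aux_law by clarify (rule glawsI, simp add: kernel_class_def, blast, blast)
  next
    fix P assume "P \<in> class_laws k (\<lambda>s t. snd s = snd t) (\<lambda>s t. True) p ch"
    then obtain qv qu qx where P: "P = aux_law p ch qv qu qx" and k: "kernel_class (\<lambda>s t. snd s = snd t) (\<lambda>s t. True) qv qu"
      and s: "\<And>s1 s2. set_pmf (qv s1 s2) \<subseteq> {..<k}" "\<And>s1 s2 v. set_pmf (qu s1 s2 v) \<subseteq> {..<k}" unfolding class_laws_def by blast
    have "qv = (\<lambda>s1. qv undefined)" using k by (intro ext) (simp add: kernel_class_def)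
    moreover have "qu = (\<lambda>s1 s2. qu undefined undefined)" using k unfolding kernel_class_def by (intro ext) blast
    ultimately have "P = aux_law p ch (\<lambda>s1. qv undefined) (\<lambda>s1 s2. qu undefined undefined) qx" using P by simp
    then show "P \<in> laws2C k p ch" unfolding laws2C_def joint_law_aux_law
      by (intro CollectI exI[of _ "qv undefined"] exI[of _ "qu undefined undefined"] exI[of _ qx] conjI allI s)
  qed
qed

text \<open>The last equation splits I(U;Y,S2|V) into \<open>eRate\<close> and I(U;S1|V), so that
  the objective of the causal case can be compared with the others.\<close>

lemma single_letter_entropies:
  fixes P :: "('s1::finite, 's2::finite, 'x::finite, 'y::finite) outcome pmf"
  assumes fin: "finite (set_pmf P)"
  shows "rate P = eRate P"
    and "mi P rv_V rv_S1 - mi P rv_V rv_YS2 = eC1 P"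
    and "cmi P rv_V rv_S2 rv_S1 = eC2 P"
    and "mi P rv_V rv_S2 = eC2C P"
    and "cmi P rv_U rv_YS2 rv_V = eRate P + (ent P (\<lambda>(s1,s2,v,u,x,y). (v,u)) + ent P (\<lambda>(s1,s2,v,u,x,y). (s1,v)) -
      ent P (\<lambda>(s1,s2,v,u,x,y). (u,s1,v)) - ent P (\<lambda>(s1,s2,v,u,x,y). v))"
proof -
  note d = rv_V_def rv_U_def rv_S1_def rv_S2_def rv_YS2_def
  have e: "ent P (\<lambda>\<omega>. (rv_U \<omega>, rv_V \<omega>)) = ent P (\<lambda>(s1,s2,v,u,x,y). (v,u))"
    "ent P (\<lambda>\<omega>. (rv_YS2 \<omega>, rv_V \<omega>)) = ent P (\<lambda>(s1,s2,v,u,x,y). (y,s2,v))"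
    "ent P (\<lambda>\<omega>. (rv_U \<omega>, rv_YS2 \<omega>, rv_V \<omega>)) = ent P (\<lambda>(s1,s2,v,u,x,y). (u,y,s2,v))"
    "ent P (\<lambda>\<omega>. (rv_S1 \<omega>, rv_V \<omega>)) = ent P (\<lambda>(s1,s2,v,u,x,y). (s1,v))"
    "ent P (\<lambda>\<omega>. (rv_U \<omega>, rv_S1 \<omega>, rv_V \<omega>)) = ent P (\<lambda>(s1,s2,v,u,x,y). (u,s1,v))"
    "ent P rv_V = ent P (\<lambda>(s1,s2,v,u,x,y). v)" "ent P rv_S1 = ent P (\<lambda>(s1,s2,v,u,x,y). s1)" "ent P rv_S2 = ent P (\<lambda>(s1,s2,v,u,x,y). s2)"
    "ent P rv_YS2 = ent P (\<lambda>(s1,s2,v,u,x,y). (y,s2))"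
    "ent P (\<lambda>\<omega>. (rv_V \<omega>, rv_S1 \<omega>)) = ent P (\<lambda>(s1,s2,v,u,x,y). (s1,v))"
    "ent P (\<lambda>\<omega>. (rv_V \<omega>, rv_S2 \<omega>)) = ent P (\<lambda>(s1,s2,v,u,x,y). (s2,v))"
    "ent P (\<lambda>\<omega>. (rv_V \<omega>, rv_YS2 \<omega>)) = ent P (\<lambda>(s1,s2,v,u,x,y). (y,s2,v))"
    "ent P (\<lambda>\<omega>. (rv_S2 \<omega>, rv_S1 \<omega>)) = ent P (\<lambda>(s1,s2,v,u,x,y). (s1,s2))"
    "ent P (\<lambda>\<omega>. (rv_V \<omega>, rv_S2 \<omega>, rv_S1 \<omega>)) = ent P (\<lambda>(s1,s2,v,u,x,y). (s1,s2,v))"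
    by (rule ent_cong, auto simp: d)+
  show "rate P = eRate P" unfolding rate_def cmi_ent[OF fin] e eRate_def by linarith
  show "mi P rv_V rv_S1 - mi P rv_V rv_YS2 = eC1 P" unfolding mutual_information_ent[OF fin] e eC1_def by linarith
  show "cmi P rv_V rv_S2 rv_S1 = eC2 P" unfolding cmi_ent[OF fin] e eC2_def by linarith
  show "mi P rv_V rv_S2 = eC2C P" unfolding mutual_information_ent[OF fin] e eC2C_def by linarith
  show "cmi P rv_U rv_YS2 rv_V = eRate P + (ent P (\<lambda>(s1,s2,v,u,x,y). (v,u)) + ent P (\<lambda>(s1,s2,v,u,x,y). (s1,v)) -
      ent P (\<lambda>(s1,s2,v,u,x,y). (u,s1,v)) - ent P (\<lambda>(s1,s2,v,u,x,y). v))"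
    unfolding cmi_ent[OF fin] e eRate_def by linarith
qed

text \<open>Here \<open>U\<close> is drawn from \<open>V\<close> alone. The mean logarithm of this
  one kernel is minus the entropy of \<open>U\<close> given \<open>V\<close>, and also minus its
  entropy given \<open>S1\<close> and \<open>V\<close>, so I(U;S1|V) is zero.\<close>

lemma cmi_laws2C:
  fixes p :: "('s1::finite \<times> 's2::finite) pmf" and ch :: "'x::finite \<Rightarrow> 's1 \<Rightarrow> 's2 \<Rightarrow> 'y::finite pmf"
  assumes "P \<in> laws2C k p ch"
  shows "cmi P rv_U rv_YS2 rv_V = eRate P"
proof -
  obtain qv qu qx where P: "P = aux_law p ch (\<lambda>s1. qv) (\<lambda>s1 s2. qu) qx"
    using assms unfolding laws2C_def joint_law_aux_law by auto
  have fin: "finite (set_pmf P)" using assms finite_class_laws unfolding laws_class_laws by blast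
  let ?C = "\<lambda>(s1,s2,v,u,x,y). (s1,v)" and ?V = "\<lambda>(s1,s2,v,u,x,y). v" and ?U = "\<lambda>(s1,s2,v,u,x,y). u"
  have c: "map_pmf (\<lambda>\<omega>. (?V \<omega>, ?U \<omega>)) P = bind_pmf (map_pmf ?V P) (\<lambda>c. map_pmf (Pair c) (qu c))"
    unfolding P aux_law_def by (simp add: map_pmf_def bind_assoc_pmf bind_return_pmf split_def bind_pmf_const)
  have "ent P ?C - ent P (\<lambda>\<omega>. (?C \<omega>, ?U \<omega>)) =
     measure_pmf.expectation P (\<lambda>\<omega>. log 2 (pmf ((\<lambda>(s1,v). qu v) (?C \<omega>)) (?U \<omega>)))"
    by (rule kernel_ratio(1)[OF fin aux_law_kernel_u[where qu="\<lambda>s1. qu" and p=p and ch=ch and qv="\<lambda>s1. qv" and qx=qx, folded P], symmetric])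
  also have "\<dots> = measure_pmf.expectation P (\<lambda>\<omega>. log 2 (pmf (qu (?V \<omega>)) (?U \<omega>)))"
    by (rule expectation_cong_pmf) auto
  also have "\<dots> = ent P ?V - ent P (\<lambda>\<omega>. (?V \<omega>, ?U \<omega>))" by (rule kernel_ratio(1)[OF fin c])
  also have "ent P (\<lambda>\<omega>. (?V \<omega>, ?U \<omega>)) = ent P (\<lambda>(s1,s2,v,u,x,y). (v,u))" by (rule ent_cong) auto
  finally have 1: "ent P ?C - ent P (\<lambda>\<omega>. (?C \<omega>, ?U \<omega>)) = ent P ?V - ent P (\<lambda>(s1,s2,v,u,x,y). (v,u))" .
  have 2: "ent P (\<lambda>\<omega>. (?C \<omega>, ?U \<omega>)) = ent P (\<lambda>(s1,s2,v,u,x,y). (u,s1,v))" by (rule ent_cong) auto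
  show ?thesis using 1 unfolding single_letter_entropies(5)[OF fin] 2 by linarith
qed

lemma values_class_laws:
  fixes p :: "('s1::finite \<times> 's2::finite) pmf" and ch :: "'x::finite \<Rightarrow> 's1 \<Rightarrow> 's2 \<Rightarrow> 'y::finite pmf"
  shows "values1 k p ch R' = eRate ` {P \<in> class_laws k (\<lambda>s t. fst s = fst t) (\<lambda>s t. fst s = fst t) p ch. eC1 P \<le> R'}"
    and "values2 (laws2_lb k p ch) R' = eRate ` {P \<in> class_laws k (\<lambda>s t. snd s = snd t) (\<lambda>s t. fst s = fst t) p ch. eC2 P \<le> R'}"
    and "values2 (laws2_ub1 k p ch) R' = eRate ` {P \<in> class_laws k (\<lambda>s t. s = t) (\<lambda>s t. fst s = fst t) p ch. eC2 P \<le> R'}"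
    and "values2 (laws2_ub2 k p ch) R' = eRate ` {P \<in> class_laws k (\<lambda>s t. snd s = snd t) (\<lambda>s t. s = t) p ch. eC2 P \<le> R'}"
    and "values2C k p ch R' = eRate ` {P \<in> class_laws k (\<lambda>s t. snd s = snd t) (\<lambda>s t. True) p ch. eC2C P \<le> R'}"
proof -
  have f: "finite (set_pmf P)" if "P \<in> class_laws k Ev Eu p ch" for P Ev Eu using that by (rule finite_class_laws)
  have i: "F ` {P \<in> class_laws k Ev Eu p ch. con P \<le> R'} = eRate ` {P \<in> class_laws k Ev Eu p ch. con' P \<le> R'}"
    if "\<And>P. P \<in> class_laws k Ev Eu p ch \<Longrightarrow> con P = con' P" "\<And>P. P \<in> class_laws k Ev Eu p ch \<Longrightarrow> F P = eRate P"
    for Ev Eu F and con con' :: "_ \<Rightarrow> real"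
    using that by (intro image_cong Collect_cong) auto
  show "values1 k p ch R' = eRate ` {P \<in> class_laws k (\<lambda>s t. fst s = fst t) (\<lambda>s t. fst s = fst t) p ch. eC1 P \<le> R'}"
    unfolding values1_def laws_class_laws by (rule i) (rule single_letter_entropies, erule f)+
  show "values2 (laws2_lb k p ch) R' = eRate ` {P \<in> class_laws k (\<lambda>s t. snd s = snd t) (\<lambda>s t. fst s = fst t) p ch. eC2 P \<le> R'}"
    unfolding values2_def laws_class_laws by (rule i) (rule single_letter_entropies, erule f)+
  show "values2 (laws2_ub1 k p ch) R' = eRate ` {P \<in> class_laws k (\<lambda>s t. s = t) (\<lambda>s t. fst s = fst t) p ch. eC2 P \<le> R'}"
    unfolding values2_def laws_class_laws by (rule i) (rule single_letter_entropies, erule f)+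
  show "values2 (laws2_ub2 k p ch) R' = eRate ` {P \<in> class_laws k (\<lambda>s t. snd s = snd t) (\<lambda>s t. s = t) p ch. eC2 P \<le> R'}"
    unfolding values2_def laws_class_laws by (rule i) (rule single_letter_entropies, erule f)+
  show "values2C k p ch R' = eRate ` {P \<in> class_laws k (\<lambda>s t. snd s = snd t) (\<lambda>s t. True) p ch. eC2C P \<le> R'}"
    unfolding values2C_def laws_class_laws
  proof (rule i)
    fix P assume P: "P \<in> class_laws k (\<lambda>s t. snd s = snd t) (\<lambda>s t. True) p ch"
    show "mi P rv_V rv_S2 = eC2C P" by (rule single_letter_entropies) (rule f[OF P])
    show "cmi P rv_U rv_YS2 rv_V = eRate P" using P unfolding laws_class_laws(5)[symmetric] by (rule cmi_laws2C)
  qed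
qed

text \<open>A law with larger alphabets reduces to alphabets of size \<open>K\<close> without
  changing any functional, and smaller alphabets are contained in larger ones. The maximum is
  therefore the same for all \<open>k \<ge> K\<close>.\<close>

lemma stable_maximum:
  fixes p :: "('s1::finite \<times> 's2::finite) pmf" and ch :: "'x::finite \<Rightarrow> 's1 \<Rightarrow> 's2 \<Rightarrow> 'y::finite pmf"
  assumes K: "suffices K TYPE('s1 \<times> 's2 \<times> nat \<times> nat \<times> 'x \<times> 'y)" "0 < K" and R': "0 \<le> R'"
    and con: "con = eC1 \<or> con = eC2 \<or> con = eC2C"
  obtains P where "P \<in> class_laws K Ev Eu p ch" "con P \<le> R'" "\<And>Q. Q \<in> class_laws K Ev Eu p ch \<Longrightarrow> con Q \<le> R' \<Longrightarrow> eRate Q \<le> eRate P"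
    "\<And>k. K \<le> k \<Longrightarrow> is_maximum (eRate P) (eRate ` {P \<in> class_laws k Ev Eu p ch. con P \<le> R'})"
proof -
  let ?P = "aux_law p ch (\<lambda>_ _. return_pmf (0::nat)) (\<lambda>_ _ _. return_pmf (0::nat)) undefined"
  have P0: "?P \<in> class_laws K Ev Eu p ch" using K(2) by (intro glawsI) (auto simp: kernel_class_def)
  have "con ?P \<le> R'" using con R' trivial_law(2-4)[of p ch "0::nat" "0::nat"] by auto
  from class_laws_maximum[OF P0 this con] obtain P where P: "P \<in> class_laws K Ev Eu p ch" "con P \<le> R'"
    "\<And>Q. Q \<in> class_laws K Ev Eu p ch \<Longrightarrow> con Q \<le> R' \<Longrightarrow> eRate Q \<le> eRate P" by blast
  have "is_maximum (eRate P) (eRate ` {P \<in> class_laws k Ev Eu p ch. con P \<le> R'})" if k: "K \<le> k" for k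
    unfolding is_maximum_def
  proof
    show "eRate P \<in> eRate ` {P \<in> class_laws k Ev Eu p ch. con P \<le> R'}" using P(1,2) class_laws_mono[OF k] by blast
    show "\<forall>a\<in>eRate ` {P \<in> class_laws k Ev Eu p ch. con P \<le> R'}. a \<le> eRate P"
    proof clarify
      fix Q assume Q: "Q \<in> class_laws k Ev Eu p ch" "con Q \<le> R'"
      have "finite_law Ev Eu p ch Q"
      proof -
        obtain qv qu qx where q: "Q = aux_law p ch qv qu qx" "kernel_class Ev Eu qv qu" "\<forall>s1 s2. set_pmf (qv s1 s2) \<subseteq> {..<k}" "\<forall>s1 s2 v. set_pmf (qu s1 s2 v) \<subseteq> {..<k}"
          using Q(1) unfolding class_laws_def by blast
        have "finite (set_pmf (qv s1 s2))" "finite (set_pmf (qu s1 s2 v))" for s1 s2 v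
          by (rule finite_subset[OF q(3)[rule_format] finite_lessThan], rule finite_subset[OF q(4)[rule_format] finite_lessThan])
        then show ?thesis using q(1,2) unfolding finite_law_def by blast
      qed
      then obtain Q' where Q': "Q' \<in> class_laws K Ev Eu p ch" "eRate Q' = eRate Q" "eC1 Q' = eC1 Q" "eC2 Q' = eC2 Q" "eC2C Q' = eC2C Q"
        using K(1) unfolding suffices_def by blast
      have "con Q' = con Q" using con Q' by auto
      then show "eRate Q \<le> eRate P" using P(3)[OF Q'(1)] Q' Q(2) by simp
    qed
  qed
  with P show ?thesis by (rule that)
qed

theorem theorem1:
  shows "\<exists>K :: nat. \<forall>(p :: ('s1 :: finite \<times> 's2 :: finite) pmf)
           (ch :: 'x :: finite \<Rightarrow> 's1 \<Rightarrow> 's2 \<Rightarrow> 'y :: finite pmf) (R' :: real). R' \<ge> 0 \<longrightarrow>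
    (\<forall>k\<ge>K. is_maximum (capacity1 p ch R') (values1 k p ch R')) \<and>
    (\<exists>C2_lb C2_ub1 C2_ub2.
       (\<forall>k\<ge>K. is_maximum C2_lb (values2 (laws2_lb k p ch) R') \<and>
               is_maximum C2_ub1 (values2 (laws2_ub1 k p ch) R') \<and>
               is_maximum C2_ub2 (values2 (laws2_ub2 k p ch) R')) \<and>
       C2_lb \<le> capacity2 p ch R' \<and>
       capacity2 p ch R' \<le> C2_ub1 \<and> capacity2 p ch R' \<le> C2_ub2) \<and>
    (\<forall>k\<ge>K. is_maximum (capacity2C p ch R') (values2C k p ch R'))"
proof -
  obtain K0 where K0: "suffices K0 TYPE('s1 \<times> 's2 \<times> nat \<times> nat \<times> 'x \<times> 'y)" using ex_suffices by blast
  obtain Ka where Ka: "suffices Ka TYPE('s1 \<times> 's2 \<times> (nat \<times> nat \<times> (nat \<Rightarrow> 'y) \<times> (nat \<Rightarrow> 's2) \<times> (nat \<Rightarrow> 's1)) \<times> nat \<times> 'x \<times> 'y)" using ex_suffices by blast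
  obtain Kb where Kb: "suffices Kb TYPE('s1 \<times> 's2 \<times> (nat \<times> nat \<times> (nat \<Rightarrow> 's2)) \<times> (nat \<times> (nat \<Rightarrow> 'y) \<times> (nat \<Rightarrow> 's1)) \<times> 'x \<times> 'y)" using ex_suffices by blast
  obtain Kc where Kc: "suffices Kc TYPE('s1 \<times> 's2 \<times> (nat \<times> nat \<times> (nat \<Rightarrow> 's2)) \<times> (nat \<times> (nat \<Rightarrow> 's1) \<times> (nat \<Rightarrow> 'y)) \<times> 'x \<times> 'y)" using ex_suffices by blast
  \<comment> \<open>The sum dominates the four bounds, and the successor makes \<open>{..<K}\<close>
    nonempty, so that the constant auxiliary variables have a value.\<close>
  define K where "K = Suc (K0 + Ka + Kb + Kc)"
  have le: "K0 \<le> K" "Ka \<le> K" "Kb \<le> K" "Kc \<le> K" and pos: "0 < K" by (auto simp: K_def)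
  note s0 = suffices_mono[OF K0 le(1)] and sa = suffices_mono[OF Ka le(2)] and sb = suffices_mono[OF Kb le(3)] and sc = suffices_mono[OF Kc le(4)]
  show ?thesis
  proof (intro exI[of _ K] allI impI)
    fix p :: "('s1 \<times> 's2) pmf" and ch :: "'x \<Rightarrow> 's1 \<Rightarrow> 's2 \<Rightarrow> 'y pmf" and R' :: real
    assume R': "R' \<ge> 0"
    obtain P1 where P1: "P1 \<in> class_laws K (\<lambda>s t. fst s = fst t) (\<lambda>s t. fst s = fst t) p ch" "eC1 P1 \<le> R'"
      "\<And>Q. Q \<in> class_laws K (\<lambda>s t. fst s = fst t) (\<lambda>s t. fst s = fst t) p ch \<Longrightarrow> eC1 Q \<le> R' \<Longrightarrow> eRate Q \<le> eRate P1"
      "\<And>k. K \<le> k \<Longrightarrow> is_maximum (eRate P1) (eRate ` {P \<in> class_laws k (\<lambda>s t. fst s = fst t) (\<lambda>s t. fst s = fst t) p ch. eC1 P \<le> R'})"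
      by (rule stable_maximum[OF s0 pos R', where con=eC1 and Ev="\<lambda>s t. fst s = fst t" and Eu="\<lambda>s t. fst s = fst t" and p=p and ch=ch]) (simp, rule that)
    obtain Pl where Pl: "Pl \<in> class_laws K (\<lambda>s t. snd s = snd t) (\<lambda>s t. fst s = fst t) p ch" "eC2 Pl \<le> R'"
      "\<And>k. K \<le> k \<Longrightarrow> is_maximum (eRate Pl) (eRate ` {P \<in> class_laws k (\<lambda>s t. snd s = snd t) (\<lambda>s t. fst s = fst t) p ch. eC2 P \<le> R'})"
      by (rule stable_maximum[OF s0 pos R', where con=eC2 and Ev="\<lambda>s t. snd s = snd t" and Eu="\<lambda>s t. fst s = fst t" and p=p and ch=ch]) (simp, rule that)
    obtain Pa where Pa: "Pa \<in> class_laws K (\<lambda>s t. s = t) (\<lambda>s t. fst s = fst t) p ch" "\<And>Q. Q \<in> class_laws K (\<lambda>s t. s = t) (\<lambda>s t. fst s = fst t) p ch \<Longrightarrow> eC2 Q \<le> R' \<Longrightarrow> eRate Q \<le> eRate Pa"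
      "\<And>k. K \<le> k \<Longrightarrow> is_maximum (eRate Pa) (eRate ` {P \<in> class_laws k (\<lambda>s t. s = t) (\<lambda>s t. fst s = fst t) p ch. eC2 P \<le> R'})"
      by (rule stable_maximum[OF s0 pos R', where con=eC2 and Ev="\<lambda>s t. s = t" and Eu="\<lambda>s t. fst s = fst t" and p=p and ch=ch]) (simp, rule that)
    obtain Pb where Pb: "Pb \<in> class_laws K (\<lambda>s t. snd s = snd t) (\<lambda>s t. s = t) p ch" "\<And>Q. Q \<in> class_laws K (\<lambda>s t. snd s = snd t) (\<lambda>s t. s = t) p ch \<Longrightarrow> eC2 Q \<le> R' \<Longrightarrow> eRate Q \<le> eRate Pb"
      "\<And>k. K \<le> k \<Longrightarrow> is_maximum (eRate Pb) (eRate ` {P \<in> class_laws k (\<lambda>s t. snd s = snd t) (\<lambda>s t. s = t) p ch. eC2 P \<le> R'})"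
      by (rule stable_maximum[OF s0 pos R', where con=eC2 and Ev="\<lambda>s t. snd s = snd t" and Eu="\<lambda>s t. s = t" and p=p and ch=ch]) (simp, rule that)
    obtain Pc where Pc: "Pc \<in> class_laws K (\<lambda>s t. snd s = snd t) (\<lambda>s t. True) p ch" "eC2C Pc \<le> R'"
      "\<And>Q. Q \<in> class_laws K (\<lambda>s t. snd s = snd t) (\<lambda>s t. True) p ch \<Longrightarrow> eC2C Q \<le> R' \<Longrightarrow> eRate Q \<le> eRate Pc"
      "\<And>k. K \<le> k \<Longrightarrow> is_maximum (eRate Pc) (eRate ` {P \<in> class_laws k (\<lambda>s t. snd s = snd t) (\<lambda>s t. True) p ch. eC2C P \<le> R'})"
      by (rule stable_maximum[OF s0 pos R', where con=eC2C and Ev="\<lambda>s t. snd s = snd t" and Eu="\<lambda>s t. True" and p=p and ch=ch]) (simp, rule that)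
    have c1: "capacity1 p ch R' = eRate P1" unfolding capacity1_def
    proof (rule Sup_eq_threshold)
      show "0 \<in> {R. achievable1 p ch R R'}" using zero_achievable(1)[OF R'] by simp
      show "R \<le> eRate P1" if "R \<in> {R. achievable1 p ch R R'}" for R using that converse_1[OF _ R' sa P1(3)] by simp
      show "R \<in> {R. achievable1 p ch R R'}" if "0 \<le> R" "R < eRate P1" for R
        using achievable1_below[OF P1(1,2) R' that] by simp
    qed
    have c2C: "capacity2C p ch R' = eRate Pc" unfolding capacity2C_def
    proof (rule Sup_eq_threshold)
      show "0 \<in> {R. achievable2C p ch R R'}" using zero_achievable(3)[OF R'] by simp
      show "R \<le> eRate Pc" if "R \<in> {R. achievable2C p ch R R'}" for R using that converse_2C[OF _ R' sc Pc(3)] by simp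
      show "R \<in> {R. achievable2C p ch R R'}" if "0 \<le> R" "R < eRate Pc" for R
        using achievable2C_below[OF Pc(1,2) R' that] by simp
    qed
    have z2: "0 \<in> {R. achievable2 p ch R R'}" using zero_achievable(2)[OF R'] by simp
    have ub2: "R \<le> min (eRate Pa) (eRate Pb)" if "R \<in> {R. achievable2 p ch R R'}" for R
      using that converse_2[OF _ R' sa sb Pa(2) Pb(2)] by simp
    have "capacity2 p ch R' \<le> min (eRate Pa) (eRate Pb)"
      unfolding capacity2_def using z2 ub2 by (intro cSup_least) blast+
    moreover have "eRate Pl \<le> capacity2 p ch R'" unfolding capacity2_def
    proof (rule le_Sup_of_dense[OF z2])
      show "bdd_above {R. achievable2 p ch R R'}" using ub2 by (intro bdd_aboveI)
      show "R \<in> {R. achievable2 p ch R R'}" if "0 \<le> R" "R < eRate Pl" for R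
        using achievable2_below[OF Pl(1,2) R' that] by simp
    qed
    ultimately show "(\<forall>k\<ge>K. is_maximum (capacity1 p ch R') (values1 k p ch R')) \<and>
      (\<exists>C2_lb C2_ub1 C2_ub2.
         (\<forall>k\<ge>K. is_maximum C2_lb (values2 (laws2_lb k p ch) R') \<and>
                 is_maximum C2_ub1 (values2 (laws2_ub1 k p ch) R') \<and>
                 is_maximum C2_ub2 (values2 (laws2_ub2 k p ch) R')) \<and>
         C2_lb \<le> capacity2 p ch R' \<and>
         capacity2 p ch R' \<le> C2_ub1 \<and> capacity2 p ch R' \<le> C2_ub2) \<and>
      (\<forall>k\<ge>K. is_maximum (capacity2C p ch R') (values2C k p ch R'))"
      unfolding values_class_laws c1 c2C
      by (intro conjI allI impI exI[of _ "eRate Pl"] exI[of _ "eRate Pa"] exI[of _ "eRate Pb"] P1(4) Pl(3) Pa(3) Pb(3) Pc(4)) auto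
  qed
qed

end
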